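(* Let $k$ be an arbitrary field, $M\supseteq k$ an infinite field, and $f^{D_5}_{s,t}(X)=X^5+(t-3)X^4+(s-t+3)X^3+(t^2-t-2s-1)X^2+sX+t$. For $\mathbf{a}\in M^2$ write $L_{\mathbf{a}}=\mathrm{Spl}_Mf^{D_5}_{\mathbf{a}}(X)$ and $G_{\mathbf{a}}=\mathrm{Gal}(f^{D_5}_{\mathbf{a}}/M)$. Let $\mathbf{a}=(a_1,a_2)$, $\mathbf{a}'=(a_1',a_2')\in M^2$ with $G_{\mathbf{a}}\ge G_{\mathbf{a}'}\ge C_5$, and let $F^1_{\mathbf{a},\mathbf{a}'}(X)$, $F^2_{\mathbf{a},\mathbf{a}'}(X)$ be the specializations of the polynomials $F^1,F^2$ of the context at $(s,t,s',t')=(a_1,a_2,a_1',a_2')$. Then exactly one of the following holds (listed as: $G_{\mathbf{a}}$; $G_{\mathbf{a}'}$; GAP ID and structure of $G_{\mathbf{a},\mathbf{a}'}=\mathrm{Gal}(f^{D_5}_{\mathbf{a}}f^{D_5}_{\mathbf{a}'}/M)$; intersection; $\mathrm{DT}(F^1_{\mathbf{a},\mathbf{a}'})$; $\mathrm{DT}(F^2_{\mathbf{a},\mathbf{a}'})$): (II-1) $D_5$; $D_5$; $[100,13]$, $D_5\times D_5$; $L_{\mathbf{a}}\cap L_{\mathbf{a}'}=M$; $10$; $10$. (II-2) $D_5$; $D_5$; $[50,4]$, $(C_5\times C_5)\rtimes C_2$; $[L_{\mathbf{a}}\cap L_{\mathbf{a}'}:M]=2$; $5^2$; $5^2$. (II-3)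 $D_5$; $D_5$; $[10,1]$, $D_5$; $L_{\mathbf{a}}=L_{\mathbf{a}'}$; and either $(\mathrm{DT}(F^1),\mathrm{DT}(F^2))=(5,2^2,1;\ 5^2)$ or $=(5^2;\ 5,2^2,1)$. (II-4) $D_5$; $C_5$; $[50,3]$, $D_5\times C_5$; $L_{\mathbf{a}}\cap L_{\mathbf{a}'}=M$; $10$; $10$. (III-1) $C_5$; $C_5$; $[25,2]$, $C_5\times C_5$; $L_{\mathbf{a}}\ne L_{\mathbf{a}'}$; $5^2$; $5^2$. (III-2) $C_5$; $C_5$; $[5,1]$, $C_5$; $L_{\mathbf{a}}=L_{\mathbf{a}'}$; and either $(\mathrm{DT}(F^1),\mathrm{DT}(F^2))=(5,1^5;\ 5^2)$ or $=(5^2;\ 5,1^5)$.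
   Context: $D_5$, $C_5$ denote the dihedral group of order 10 and cyclic group of order 5 ($f^{D_5}_{s,t}$ is $k$-generic for $D_5$, so $G_{\mathbf{a}}$ is isomorphic to a subgroup of $D_5$); $G_{\mathbf{a}}\ge G_{\mathbf{a}'}\ge C_5$ means each is, up to conjugation, contained in the former. Let $x,y,x',y'$ be independent indeterminates over $k$. Let $\sigma,\tau$ be the $k$-automorphisms of $k(x,y)$ with $\sigma: x\mapsto y,\ y\mapsto -(y-1)/x$ and $\tau: x\mapsto x,\ y\mapsto -(x-1)/y$, and $\sigma',\tau'$ the analogous automorphisms of $k(x',y')$ (with $x',y'$ in place of $x,y$), all extended to $k(x,y,x',y')$ trivially on the other variables. Put $t=-\frac{(x-1)(y-1)(x+y-1)}{xy}$, $s=\sum_{i=0}^4\sigma^i\bigl((x-1)(y-1)\bigr)$, and $s',t'$ the same expressions in $x',y'$; then $k(x,y)^{\langle\sigma,\tau\rangle}=k(s,t)$, and $x$ is a root of $f^{D_5}_{s,t}$. Let $P=\sum_{i=0}^4\sigma^i(x)\,\sigma'^i(x')=xx'+yy'+\frac{(y-1)(y'-1)}{xx'}+\frac{(x+y-1)(x'+y'-1)}{xx'yy'}+\frac{(x-1)(x'-1)}{yy'}$. Define $F^1_{s,t,s',t'}(X)=\prod_{h\in\langle\sigma',\tau'\rangle}(X-h(P))$, a degree-10 polynomial with coefficients in $k(s,t,s',t')$, and $F^2_{s,t,s',t'}(X)=F^1_{(s+5t)/t^2,\,-1/t,\,s',\,t'}(X)$. The decomposition type $\mathrm{DT}$ over $M$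 of a specialized polynomial is the multiset of degrees of its irreducible factors over $M$ (exponents denote multiplicity), with the paper's convention that if the specialized resolvent has repeated factors, one first replaces the data by a Tschirnhausen transformation over $M$ making the resolvent squarefree (equivalently, DT is the multiset of orbit lengths of the Galois group $G_{\mathbf{a},\mathbf{a}'}$ on the 10 cosets indexing the factors). GAP IDs refer to the SmallGroups library. *)

theory Defs
  imports
    "HOL-Combinatorics.Permutations"
    "HOL-Algebra.Bij"
    "HOL-Algebra.Elementary_Groups"
    "HOL-Algebra.Generated_Groups"
    "HOL-Algebra.Algebraic_Closure_Type"
    "HOL-Computational_Algebra.Computational_Algebra"
begin

subsection \<open>Splitting fields and Galois groups over the ground field \<open>'m\<close>\<close>

text \<open>
  The ground field \<open>M\<close> is a type \<open>'m\<close> of class \<open>field\<close>; all algebraic extensions of it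
  are subfields of the algebraic closure \<open>'m alg_closure\<close>, in which \<open>M\<close> is \<open>range to_ac\<close>.
\<close>

definition ac_roots :: "'m::field poly \<Rightarrow> 'm alg_closure set" where
  "ac_roots p = {z. poly (map_poly to_ac p) z = 0}"

definition is_subfield :: "'f::field set \<Rightarrow> bool" where
  "is_subfield L \<longleftrightarrow> 1 \<in> L \<and> (\<forall>u\<in>L. \<forall>v\<in>L. u - v \<in> L \<and> u * v \<in> L) \<and> (\<forall>u\<in>L. inverse u \<in> L)"

definition Spl :: "'m::field poly \<Rightarrow> 'm alg_closure set" where
  "Spl p = \<Inter>{L. is_subfield L \<and> range to_ac \<subseteq> L \<and> ac_roots p \<subseteq> L}"

definition ext_degree :: "'m::field alg_closure set \<Rightarrow> nat" where
  "ext_degree L = vector_space.dim (\<lambda>(c::'m) v. to_ac c * v) L"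

definition Gal :: "'m::field poly \<Rightarrow> ('m alg_closure \<Rightarrow> 'm alg_closure) monoid" where
  "Gal p = (BijGroup (Spl p))\<lparr>carrier :=
     {\<phi> \<in> Bij (Spl p). (\<forall>c. \<phi> (to_ac c) = to_ac c) \<and>
        (\<forall>u\<in>Spl p. \<forall>v\<in>Spl p. \<phi> (u + v) = \<phi> u + \<phi> v \<and> \<phi> (u * v) = \<phi> u * \<phi> v)}\<rparr>"

text \<open>
  The Galois group as a permutation group of degree 5, with respect to a numbering
  \<open>r\<close> of the five distinct roots. Changing the numbering conjugates the group in \<open>S\<^sub>5\<close>,
  so containment up to conjugation is containment for suitable numberings.
\<close>

definition gal_perms :: "(nat \<Rightarrow> 'm alg_closure) \<Rightarrow> 'm::field poly \<Rightarrow> (nat \<Rightarrow> nat) set" where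
  "gal_perms r p = {\<pi>. \<pi> permutes {..<5} \<and> (\<exists>\<phi>\<in>carrier (Gal p). \<forall>i<5. \<phi> (r i) = r (\<pi> i))}"

definition C5_perms :: "(nat \<Rightarrow> nat) set" where
  "C5_perms = {\<pi>. \<pi> permutes {..<5} \<and> (\<exists>j. \<forall>i<5. \<pi> i = (i + j) mod 5)}"

definition gal_ge :: "'m::field poly \<Rightarrow> 'm poly \<Rightarrow> bool" where
  "gal_ge p q \<longleftrightarrow> (\<exists>r r'. bij_betw r {..<5} (ac_roots p) \<and> bij_betw r' {..<5} (ac_roots q) \<and>
     gal_perms r' q \<subseteq> gal_perms r p)"

definition gal_ge_C5 :: "'m::field poly \<Rightarrow> bool" where
  "gal_ge_C5 p \<longleftrightarrow> (\<exists>r. bij_betw r {..<5} (ac_roots p) \<and> C5_perms \<subseteq> gal_perms r p)"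


subsection \<open>The groups of the table\<close>

text \<open>The semidirect product of an abelian group with \<open>C\<^sub>2\<close> acting by inversion.\<close>

definition gen_dihedral :: "('a, 'b) monoid_scheme \<Rightarrow> ('a \<times> bool) monoid" where
  "gen_dihedral A = \<lparr>carrier = carrier A \<times> UNIV,
     monoid.mult = (\<lambda>(u, d) (v, e). (u \<otimes>\<^bsub>A\<^esub> (if d then inv\<^bsub>A\<^esub> v else v), d \<noteq> e)),
     one = (\<one>\<^bsub>A\<^esub>, False)\<rparr>"

abbreviation C5 :: "int monoid" where
  "C5 \<equiv> integer_mod_group 5"

abbreviation D5 :: "(int \<times> bool) monoid" where
  "D5 \<equiv> gen_dihedral C5"

text \<open>
  Up to isomorphism there are two non-abelian groups \<open>(C\<^sub>5 \<times> C\<^sub>5) \<rtimes> C\<^sub>2\<close>: \<open>D\<^sub>5 \<times> C\<^sub>5\<close>, which is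
  SmallGroup(50,3), and the following one, in which \<open>C\<^sub>2\<close> inverts all of \<open>C\<^sub>5 \<times> C\<^sub>5\<close>; this is
  SmallGroup(50,4).
\<close>

abbreviation C5C5_C2 :: "((int \<times> int) \<times> bool) monoid" where
  "C5C5_C2 \<equiv> gen_dihedral (C5 \<times>\<times> C5)"


subsection \<open>Rational functions in four indeterminates\<close>

text \<open>
  \<open>'k ratfun4\<close> is the field of fractions of \<open>k[X\<^sub>1][X\<^sub>2][X\<^sub>3][X\<^sub>4]\<close>, the innermost polynomial
  variable being \<open>X\<^sub>1\<close>. It serves both as \<open>k(x,y,x',y')\<close> and as \<open>k(s,t,s',t')\<close>.
\<close>

type_synonym 'k ratfun4 = "'k poly poly poly poly fract"

definition X1 :: "'k::field ratfun4" where "X1 = Fract [:[:[:[:0, 1:]:]:]:] 1"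
definition X2 :: "'k::field ratfun4" where "X2 = Fract [:[:[:0, 1:]:]:] 1"
definition X3 :: "'k::field ratfun4" where "X3 = Fract [:[:0, 1:]:] 1"
definition X4 :: "'k::field ratfun4" where "X4 = Fract [:0, 1:] 1"

definition const4 :: "'k::field \<Rightarrow> 'k ratfun4" where
  "const4 c = Fract [:[:[:[:c:]:]:]:] 1"

definition eval_via :: "('a::zero \<Rightarrow> 'b::comm_semiring_0) \<Rightarrow> 'b \<Rightarrow> 'a poly \<Rightarrow> 'b" where
  "eval_via \<phi> u p = poly (map_poly \<phi> p) u"

definition eval4 ::
  "('k::field \<Rightarrow> 'f::field) \<Rightarrow> 'f \<Rightarrow> 'f \<Rightarrow> 'f \<Rightarrow> 'f \<Rightarrow> 'k poly poly poly poly \<Rightarrow> 'f" where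
  "eval4 \<phi> u1 u2 u3 u4 = eval_via (eval_via (eval_via (eval_via \<phi> u1) u2) u3) u4"

text \<open>
  The value of a rational function at a point of a field \<open>F\<close> containing \<open>k\<close> via \<open>\<phi>\<close>. It is
  computed from any representation as a fraction whose denominator does not vanish at the point;
  it is unspecified if there is no such representation.
\<close>

definition ratfun_eval ::
  "('k::field \<Rightarrow> 'f::field) \<Rightarrow> 'f \<Rightarrow> 'f \<Rightarrow> 'f \<Rightarrow> 'f \<Rightarrow> 'k ratfun4 \<Rightarrow> 'f" where
  "ratfun_eval \<phi> u1 u2 u3 u4 q = (THE v. \<exists>n d. q = Fract n d \<and> d \<noteq> 0 \<and>
     eval4 \<phi> u1 u2 u3 u4 d \<noteq> 0 \<and> v = eval4 \<phi> u1 u2 u3 u4 n / eval4 \<phi> u1 u2 u3 u4 d)"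


subsection \<open>The action on \<open>k(x,y,x',y')\<close> and the invariants\<close>

text \<open>Here \<open>x = X1\<close>, \<open>y = X2\<close>, \<open>x' = X3\<close>, \<open>y' = X4\<close>.\<close>

definition sig :: "'k::field ratfun4 \<Rightarrow> 'k ratfun4" where
  "sig = ratfun_eval const4 X2 (- (X2 - 1) / X1) X3 X4"

definition sig' :: "'k::field ratfun4 \<Rightarrow> 'k ratfun4" where
  "sig' = ratfun_eval const4 X1 X2 X4 (- (X4 - 1) / X3)"

definition tau' :: "'k::field ratfun4 \<Rightarrow> 'k ratfun4" where
  "tau' = ratfun_eval const4 X1 X2 X3 (- (X3 - 1) / X4)"

definition inv_s :: "'k::field ratfun4" where
  "inv_s = (\<Sum>i<5. (sig ^^ i) ((X1 - 1) * (X2 - 1)))"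

definition inv_t :: "'k::field ratfun4" where
  "inv_t = - ((X1 - 1) * (X2 - 1) * (X1 + X2 - 1)) / (X1 * X2)"

definition inv_s' :: "'k::field ratfun4" where
  "inv_s' = (\<Sum>i<5. (sig' ^^ i) ((X3 - 1) * (X4 - 1)))"

definition inv_t' :: "'k::field ratfun4" where
  "inv_t' = - ((X3 - 1) * (X4 - 1) * (X3 + X4 - 1)) / (X3 * X4)"


subsection \<open>The resolvent polynomials\<close>

text \<open>
  For polynomials \<open>g, g'\<close> over \<open>k\<close> the roots \<open>x\<close>, \<open>x'\<close> are replaced by their Tschirnhausen
  transforms \<open>g(x)\<close>, \<open>g'(x')\<close>. The resolvents \<open>F\<^sup>1\<close>, \<open>F\<^sup>2\<close> themselves are the case \<open>g = g' = X\<close>.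
\<close>

definition P_tr :: "'k::field poly \<Rightarrow> 'k poly \<Rightarrow> 'k ratfun4" where
  "P_tr g g' = (\<Sum>i<5. (sig ^^ i) (poly (map_poly const4 g) X1) *
                       (sig' ^^ i) (poly (map_poly const4 g') X3))"

definition resolvent_xy :: "'k::field poly \<Rightarrow> 'k poly \<Rightarrow> 'k ratfun4 poly" where
  "resolvent_xy g g' = (\<Prod>h\<in>generate (BijGroup UNIV) {sig', tau'}. [:- h (P_tr g g'), 1:])"

text \<open>
  The coefficients of the product above lie in the subfield generated over \<open>k\<close> by the invariants
  \<open>s, t, s', t'\<close>, which are algebraically independent. From here on \<open>X1, X2, X3, X4\<close> stand for
  \<open>s, t, s', t'\<close>.
\<close>

definition F1_tr :: "'k::field poly \<Rightarrow> 'k poly \<Rightarrow> 'k ratfun4 poly" where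
  "F1_tr g g' = (THE F. map_poly (ratfun_eval const4 inv_s inv_t inv_s' inv_t') F = resolvent_xy g g')"

definition F2_tr :: "'k::field poly \<Rightarrow> 'k poly \<Rightarrow> 'k ratfun4 poly" where
  "F2_tr g g' = map_poly (ratfun_eval const4 ((X1 + 5 * X2) / X2\<^sup>2) (- 1 / X2) X3 X4) (F1_tr g g')"

definition F1 :: "'k::field ratfun4 poly" where
  "F1 = F1_tr [:0, 1:] [:0, 1:]"

definition F2 :: "'k::field ratfun4 poly" where
  "F2 = F2_tr [:0, 1:] [:0, 1:]"

definition specialize ::
  "('k::field \<Rightarrow> 'm::field) \<Rightarrow> 'm \<Rightarrow> 'm \<Rightarrow> 'm \<Rightarrow> 'm \<Rightarrow> 'k ratfun4 poly \<Rightarrow> 'm poly" where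
  "specialize \<iota> a1 a2 a1' a2' F = map_poly (ratfun_eval \<iota> a1 a2 a1' a2') F"

definition fD5 :: "'m::field \<Rightarrow> 'm \<Rightarrow> 'm poly" where
  "fD5 s t = [:t, s, t\<^sup>2 - t - 2 * s - 1, s - t + 3, t - 3, 1:]"


subsection \<open>Decomposition types\<close>

definition irr_degrees :: "'m::field poly \<Rightarrow> nat multiset" where
  "irr_degrees F = (THE m. \<exists>c A. c \<noteq> 0 \<and> (\<forall>q\<in>#A. Factorial_Ring.irreducible q) \<and>
     F = smult c (prod_mset A) \<and> m = image_mset Polynomial.degree A)"

text \<open>
  \<open>g\<close> transforms the separable polynomial \<open>p\<close>, with roots \<open>\<alpha>\<close>, into the polynomial with roots
  \<open>g(\<alpha>)\<close>; the latter is required to be separable, so that it has the same splitting field.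
\<close>

definition tschirnhausen :: "'m::field poly \<Rightarrow> 'm poly \<Rightarrow> bool" where
  "tschirnhausen p g \<longleftrightarrow> Polynomial.degree g < Polynomial.degree p \<and>
     inj_on (poly (map_poly to_ac g)) (ac_roots p)"

text \<open>
  The decomposition type of a specialized resolvent \<open>F\<close> of \<open>p\<close> and \<open>p'\<close>. If \<open>F\<close> has repeated
  factors, then \<open>p\<close> and \<open>p'\<close> are first replaced by Tschirnhausen transforms for which the resolvent
  \<open>R g g'\<close> is squarefree. The description operator makes an equation for the decomposition type
  include the existence of such transforms and the independence of their choice.
\<close>

definition decomp_type ::
  "'m::field poly \<Rightarrow> 'm poly \<Rightarrow> 'm poly \<Rightarrow> ('m poly \<Rightarrow> 'm poly \<Rightarrow> 'm poly) \<Rightarrow> nat multiset" where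
  "decomp_type F p p' R =
     (if squarefree F then irr_degrees F
      else (THE m. \<exists>g g'. tschirnhausen p g \<and> tschirnhausen p' g' \<and>
              squarefree (R g g') \<and> m = irr_degrees (R g g')))"

definition DT_F1 :: "('k::field \<Rightarrow> 'm::field) \<Rightarrow> 'm \<Rightarrow> 'm \<Rightarrow> 'm \<Rightarrow> 'm \<Rightarrow> nat multiset" where
  "DT_F1 \<iota> a1 a2 a1' a2' =
     decomp_type (specialize \<iota> a1 a2 a1' a2' F1) (fD5 a1 a2) (fD5 a1' a2')
       (\<lambda>g g'. specialize id a1 a2 a1' a2' (F1_tr g g'))"

definition DT_F2 :: "('k::field \<Rightarrow> 'm::field) \<Rightarrow> 'm \<Rightarrow> 'm \<Rightarrow> 'm \<Rightarrow> 'm \<Rightarrow> nat multiset" where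
  "DT_F2 \<iota> a1 a2 a1' a2' =
     decomp_type (specialize \<iota> a1 a2 a1' a2' F2)
       (fD5 ((a1 + 5 * a2) / a2\<^sup>2) (- 1 / a2)) (fD5 a1' a2')
       (\<lambda>g g'. specialize id a1 a2 a1' a2' (F2_tr g g'))"

end

theory Submission
  imports Defs
begin

text \<open>
  For \<open>t \<noteq> 0\<close> the roots of \<open>f\<^sup>D\<^sup>5\<close> form a pentagon, that is a sequence of period 5 with
  \<open>x\<^sub>i\<^sub>-\<^sub>1 x\<^sub>i\<^sub>+\<^sub>1 = 1 - x\<^sub>i\<close>, and the roots of the resolvent \<open>F\<^sup>1\<close> are the sums \<open>\<Sum>\<^sub>i x\<^sub>i x'\<^sub>h\<^sub>(\<^sub>i\<^sub>)\<close> for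
  \<open>h \<in> D\<^sub>5\<close>. The Galois group of the product is a subgroup \<open>\<Gamma>\<close> of \<open>D\<^sub>5 \<times> D\<^sub>5\<close>; an element \<open>(a, b)\<close> permutes
  the roots of \<open>F\<^sup>1\<close> by \<open>h \<mapsto> b h a\<^sup>-\<^sup>1\<close>, and a Tschirnhausen transformation makes these roots
  distinct, so that the decomposition type lists the orbit lengths. The substitution that defines
  \<open>F\<^sup>2\<close> replaces \<open>x\<^sub>i\<close> by the pentagon \<open>x\<^sub>2\<^sub>i / (x\<^sub>2\<^sub>i - 1)\<close>, hence twists \<open>a\<close> by an automorphism of
  \<open>D\<^sub>5\<close> that multiplies rotations by \<open>3 = 2\<^sup>-\<^sup>1\<close>. Under the hypotheses, \<open>\<Gamma>\<close> either
  contains \<open>C\<^sub>5 \<times> C\<^sub>5\<close>, and there are four possibilities, or it is the graph of an isomorphism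
  that multiplies rotations by some \<open>k\<close>. In the latter case \<open>F\<^sup>1\<close> has the small orbits for
  \<open>k = \<plusminus>1\<close> and \<open>F\<^sup>2\<close> for \<open>k = \<plusminus>3\<close>, which are all units modulo 5.
\<close>

section \<open>Polynomials under field morphisms\<close>

text \<open>Invariants are handled by one explicit descent instead: an expression in the entries of
  a pentagon that does not depend on the dihedral index is a polynomial in \<open>s\<close>,
  \<open>t\<close>, \<open>1/t\<close> over the base. With base \<open>M\<close> it says that
  functions constant on \<open>D5 \<times> D5\<close> have values in \<open>M\<close>, the one input
  of the Galois theory below. With base \<open>k[s, t, s', t', 1/t, 1/t']\<close> it says that the
  coefficients of the resolvents have only powers of \<open>t t'\<close> as denominators, so they
  can be specialized wherever \<open>t t' \<noteq> 0\<close>. This condition follows from the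
  hypotheses: some automorphism moves every root, but for \<open>t = 0\<close> the element 0 is a
  fixed root. The hypotheses refer to arbitrary numberings of the roots; what is carried over to the
  pentagons is only whether an automorphism fixes, or moves, some root, which tells the identity,
  rotations and reflections apart. The cases exclude each other because the orders of the three
  Galois groups differ.\<close>

locale ring_morphism =
  fixes \<phi> :: "'a::comm_ring_1 \<Rightarrow> 'b::comm_ring_1"
  assumes hom_one [simp]: "\<phi> 1 = 1"
    and hom_add [simp]: "\<phi> (c + d) = \<phi> c + \<phi> d"
    and hom_mult [simp]: "\<phi> (c * d) = \<phi> c * \<phi> d"
begin

lemma hom_zero [simp]: "\<phi> 0 = 0"
  using hom_add[of 0 0] by simp

lemma hom_minus [simp]: "\<phi> (- c) = - \<phi> c"
  using hom_add[of c "- c"] by (simp add: eq_neg_iff_add_eq_0 add.commute)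

lemma hom_diff [simp]: "\<phi> (c - d) = \<phi> c - \<phi> d"
  using hom_add[of c "- d"] by simp

lemma hom_power [simp]: "\<phi> (c ^ n) = \<phi> c ^ n"
  by (induction n) auto

lemma hom_sum: "\<phi> (sum f A) = (\<Sum>a\<in>A. \<phi> (f a))"
  by (induction A rule: infinite_finite_induct) auto

lemma coeff_map_hom [simp]: "Polynomial.coeff (map_poly \<phi> p) n = \<phi> (Polynomial.coeff p n)"
  by (simp add: coeff_map_poly)

lemma map_poly_add: "map_poly \<phi> (p + q) = map_poly \<phi> p + map_poly \<phi> q"
  by (rule poly_eqI) simp

lemma map_poly_diff: "map_poly \<phi> (p - q) = map_poly \<phi> p - map_poly \<phi> q"
  by (rule poly_eqI) simp

lemma map_poly_mult: "map_poly \<phi> (p * q) = map_poly \<phi> p * map_poly \<phi> q"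
  by (rule poly_eqI) (simp add: coeff_mult hom_sum)

lemma map_poly_prod: "map_poly \<phi> (prod f A) = (\<Prod>a\<in>A. map_poly \<phi> (f a))"
  by (induction A rule: infinite_finite_induct) (auto simp: map_poly_mult)

lemma map_poly_pCons_hom [simp]: "map_poly \<phi> (pCons c p) = pCons (\<phi> c) (map_poly \<phi> p)"
  by (simp add: map_poly_pCons)

lemma poly_map_hom: "poly (map_poly \<phi> p) (\<phi> z) = \<phi> (poly p z)"
  by (induction p) auto

lemma ring_morphism_eval_via: "ring_morphism (eval_via \<phi> z)"
  by unfold_locales (simp_all add: eval_via_def map_poly_add map_poly_mult)

end

locale field_morphism = ring_morphism \<phi> for \<phi> :: "'a::field \<Rightarrow> 'b::field"
begin

lemma hom_eq_0_iff [simp]: "\<phi> c = 0 \<longleftrightarrow> c = 0"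
proof
  assume "\<phi> c = 0"
  then have "\<phi> (c * inverse c) = 0" by (simp only: hom_mult mult_zero_left)
  then show "c = 0" by (cases "c = 0") auto
qed simp

lemma hom_eq_iff [simp]: "\<phi> c = \<phi> d \<longleftrightarrow> c = d"
  using hom_eq_0_iff[of "c - d"] by (simp del: hom_eq_0_iff)

lemma hom_inverse [simp]: "\<phi> (inverse c) = inverse (\<phi> c)"
proof (cases "c = 0")
  case False
  then have "\<phi> c * \<phi> (inverse c) = 1" by (simp flip: hom_mult)
  then show ?thesis by (metis inverse_unique)
qed simp

lemma hom_divide [simp]: "\<phi> (c / d) = \<phi> c / \<phi> d"
  by (simp add: divide_inverse)

lemma degree_map_hom [simp]: "Polynomial.degree (map_poly \<phi> p) = Polynomial.degree p"
  by (rule degree_map_poly) auto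

lemma map_poly_hom_eq_0_iff [simp]: "map_poly \<phi> p = 0 \<longleftrightarrow> p = 0"
  by (simp add: poly_eq_iff)

lemma map_poly_hom_eq_iff [simp]: "map_poly \<phi> p = map_poly \<phi> q \<longleftrightarrow> p = q"
  by (simp add: poly_eq_iff)

text \<open>Division with remainder commutes with the embedding, so the remainder over the larger
  field is the image of the remainder over the smaller one. Divisibility over \<open>M\<close> can
  thus be tested in the algebraic closure.\<close>

lemma map_poly_dvd_iff: "map_poly \<phi> q dvd map_poly \<phi> p \<longleftrightarrow> q dvd p"
proof
  assume dvd: "map_poly \<phi> q dvd map_poly \<phi> p"
  show "q dvd p"
  proof (cases "q = 0")
    case False
    have "map_poly \<phi> p = map_poly \<phi> q * map_poly \<phi> (p div q) + map_poly \<phi> (p mod q)"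
      by (simp flip: map_poly_mult map_poly_add)
    with dvd have "map_poly \<phi> q dvd map_poly \<phi> (p mod q)"
      by (simp add: dvd_add_right_iff)
    moreover have "p mod q = 0 \<or> Polynomial.degree (p mod q) < Polynomial.degree q"
      using False by (rule degree_mod_less)
    ultimately have "p mod q = 0"
      by (metis degree_map_hom dvd_imp_degree_le leD map_poly_hom_eq_0_iff)
    then show ?thesis by auto
  qed (use dvd in auto)
qed (auto simp: map_poly_mult elim!: dvdE)

end

lemma field_morphism_compose:
  assumes "field_morphism \<phi>" "field_morphism \<psi>"
  shows "field_morphism (\<lambda>c. \<psi> (\<phi> c))"
proof -
  interpret a: field_morphism \<phi> by fact
  interpret b: field_morphism \<psi> by fact
  show ?thesis by unfold_locales auto
qed

interpretation to_ac: field_morphism to_ac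
  by unfold_locales simp_all

section \<open>Counting roots and comparing factorizations\<close>

lemma degree_prod_linear:
  "Polynomial.degree (\<Prod>c\<in>A. [:- (v c :: 'a::idom), 1:]) = card A"
  by (subst degree_prod_sum_eq) auto

lemma prod_linear_dvd:
  fixes p :: "'a::idom poly"
  assumes "finite Z" "\<And>z. z \<in> Z \<Longrightarrow> poly p z = 0"
  shows "(\<Prod>z\<in>Z. [:- z, 1:]) dvd p"
  using assms
proof (induction Z arbitrary: p)
  case (insert z Z)
  from insert.prems have "[:- z, 1:] dvd p" by (simp add: poly_eq_0_iff_dvd)
  then obtain q where p: "p = [:- z, 1:] * q" by (elim dvdE)
  have "poly q y = 0" if "y \<in> Z" for y
  proof -
    have "poly p y = 0" "y \<noteq> z" using insert that by auto
    then show ?thesis by (simp add: p)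
  qed
  then have "(\<Prod>z\<in>Z. [:- z, 1:]) dvd q" by (rule insert.IH)
  then have "[:- z, 1:] * (\<Prod>z\<in>Z. [:- z, 1:]) dvd [:- z, 1:] * q" by (rule mult_dvd_mono[OF dvd_refl])
  with insert.hyps show ?case by (metis p prod.insert)
qed auto

text \<open>The two cofactors share out the distinct points \<open>v c\<close>: at most as many as
  its degree are roots of \<open>q\<close>, and the others fall to \<open>p\<close>.\<close>

lemma degree_le_card_roots_of_split:
  fixes p :: "'a::field poly"
  assumes "finite A" "inj_on v A" and dvd: "p dvd (\<Prod>c\<in>A. [:- v c, 1:])"
  shows "Polynomial.degree p \<le> card {c\<in>A. poly p (v c) = 0}"
proof -
  from dvd obtain q where q: "(\<Prod>c\<in>A. [:- v c, 1:]) = p * q" by (elim dvdE)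
  have nz: "p * q \<noteq> 0" using assms(1) unfolding q[symmetric] by (simp add: prod_zero_iff)
  have deg: "card A = Polynomial.degree p + Polynomial.degree q"
  proof -
    have "Polynomial.degree (p * q) = Polynomial.degree p + Polynomial.degree q"
      using nz by (intro degree_mult_eq) auto
    then show ?thesis by (simp flip: q add: degree_prod_linear)
  qed
  have root: "poly p (v c) = 0 \<or> poly q (v c) = 0" if "c \<in> A" for c
  proof -
    have "poly (p * q) (v c) = 0"
      unfolding q[symmetric] using assms(1) that by (auto simp: poly_prod intro!: prod_zero)
    then show ?thesis by simp
  qed
  have "card {c\<in>A. poly q (v c) = 0} = card (v ` {c\<in>A. poly q (v c) = 0})"
    by (rule card_image[symmetric]) (use assms(2) in \<open>auto simp: inj_on_def\<close>)
  also have "\<dots> \<le> card {z. poly q z = 0}"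
    by (rule card_mono) (use nz in \<open>auto simp: poly_roots_finite\<close>)
  also have "\<dots> \<le> Polynomial.degree q"
    using nz by (intro card_poly_roots_bound) auto
  finally have q_le: "card {c\<in>A. poly q (v c) = 0} \<le> Polynomial.degree q" .
  have "A = {c\<in>A. poly p (v c) = 0} \<union> {c\<in>A. poly q (v c) = 0}" using root by auto
  then have "card A \<le> card {c\<in>A. poly p (v c) = 0} + card {c\<in>A. poly q (v c) = 0}"
    by (metis card_Un_le)
  with deg q_le show ?thesis by linarith
qed

lemma poly_eq_const_of_roots:
  fixes p :: "'a::field poly"
  assumes "finite A" "inj_on v A" "\<And>c. c \<in> A \<Longrightarrow> poly p (v c) = z" "Polynomial.degree p < card A"
  shows "p = [:z:]"
proof (rule ccontr)
  assume "p \<noteq> [:z:]"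
  then have nz: "p - [:z:] \<noteq> 0" by simp
  have "card A = card (v ` A)" using assms(2) by (simp add: card_image)
  also have "\<dots> \<le> card {y. poly (p - [:z:]) y = 0}"
    by (rule card_mono) (use poly_roots_finite[OF nz] assms(3) in auto)
  also have "\<dots> \<le> Polynomial.degree (p - [:z:])" using nz by (rule card_poly_roots_bound)
  also have "\<dots> \<le> Polynomial.degree p"
    using degree_diff_le_max[of p "[:z:]"] by simp
  finally show False using assms(4) by simp
qed

text \<open>In a relation with nonzero constant term all other terms are divisible by
  \<open>z\<close>, so \<open>z\<close> times a polynomial in \<open>z\<close> is a nonzero
  constant. The induction removes factors \<open>X\<close> until such a term appears. It makes rings
  of algebraic elements closed under inverses.\<close>

lemma inverse_as_poly:
  fixes z :: "'m::field alg_closure"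
  assumes "p \<noteq> 0" "poly (map_poly to_ac p) z = 0" "z \<noteq> 0"
  shows "\<exists>q. inverse z = poly (map_poly to_ac q) z"
  using assms
proof (induction p)
  case (pCons c p)
  show ?case
  proof (cases "c = 0")
    case True
    with pCons show ?thesis by auto
  next
    case False
    have "to_ac c + z * poly (map_poly to_ac p) z = 0" using pCons.prems by simp
    then have "z * (- to_ac (inverse c) * poly (map_poly to_ac p) z) = 1"
      using False by (simp add: add_eq_0_iff field_simps)
    then have "z * poly (map_poly to_ac (Polynomial.smult (- inverse c) p)) z = 1"
      by (simp add: map_poly_smult del: smult_minus_left)
    then show ?thesis by (metis inverse_unique)
  qed
qed simp

text \<open>Factorizations over a field agree up to units. The scalars \<open>c\<close> and
  \<open>d\<close> absorb the units, so that cancelling \<open>q\<close> against an associate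
  \<open>b\<close> keeps the shape of the equation. The description operator in
  \<open>irr_degrees\<close> is well defined by this.\<close>

lemma irreducible_degrees_unique:
  fixes A B :: "'m::field poly multiset"
  assumes "\<And>q. q \<in># A \<Longrightarrow> Factorial_Ring.irreducible q" "\<And>q. q \<in># B \<Longrightarrow> Factorial_Ring.irreducible q"
    and "Polynomial.smult c (prod_mset A) = Polynomial.smult d (prod_mset B)" "c \<noteq> 0" "d \<noteq> 0"
  shows "image_mset Polynomial.degree A = image_mset Polynomial.degree B"
  using assms
proof (induction A arbitrary: B c d)
  case empty
  have "B = {#}"
  proof (rule ccontr)
    assume "B \<noteq> {#}"
    then obtain b B' where B: "B = add_mset b B'" by (meson multiset_cases)
    then have irr: "Factorial_Ring.irreducible b" using empty by simp
    have eq: "[:c:] = b * Polynomial.smult d (prod_mset B')"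
      using empty.prems(3) by (simp add: B one_pCons mult_smult_right)
    have "b * Polynomial.smult d (prod_mset B') \<noteq> 0"
      unfolding eq[symmetric] using \<open>c \<noteq> 0\<close> by simp
    then have nz: "b \<noteq> 0" "prod_mset B' \<noteq> 0" "d \<noteq> 0" by force+
    have "Polynomial.degree [:c:] = Polynomial.degree b + Polynomial.degree (Polynomial.smult d (prod_mset B'))"
      unfolding eq using nz by (intro degree_mult_eq) auto
    then have "is_unit b" using nz by (simp add: is_unit_iff_degree)
    with irr show False by (simp add: irreducible_not_unit)
  qed
  then show ?case by simp
next
  case (add q A)
  have irr: "Factorial_Ring.irreducible q" using add.prems by simp
  then have prime: "prime_elem q" by (rule field_poly_irreducible_imp_prime)
  have "q dvd Polynomial.smult d (prod_mset B)"
    by (simp flip: add.prems(3) add: dvd_smult)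
  then have "q dvd prod_mset B" using \<open>d \<noteq> 0\<close> by (simp add: dvd_smult_iff)
  then obtain b where b: "b \<in># B" "q dvd b"
    using prime by (elim prime_elem_dvd_prod_msetE) auto
  then obtain B' where B: "B = add_mset b B'" by (meson mset_add)
  obtain u where u: "b = q * u" using b by (elim dvdE)
  have irrb: "Factorial_Ring.irreducible b" using add.prems b by simp
  then have "is_unit u" using irr u by (metis irreducible_not_unit irreducible_def)
  then obtain e where e: "u = [:e:]" "e \<noteq> 0" by (metis is_unit_polyE unit_dvdE is_unit_pCons_iff)
  have deg: "Polynomial.degree b = Polynomial.degree q" using e by (simp add: u)
  have "q * Polynomial.smult c (prod_mset A) = q * Polynomial.smult (d * e) (prod_mset B')"
    using add.prems(3) by (simp add: B u e mult_ac mult_smult_right)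
  then have "Polynomial.smult c (prod_mset A) = Polynomial.smult (d * e) (prod_mset B')"
    using prime_elem_not_zeroI[OF prime] mult_left_cancel by blast
  with add.IH[of B' c "d * e"] add.prems e have "image_mset Polynomial.degree A = image_mset Polynomial.degree B'"
    by (auto simp: B)
  then show ?case by (simp add: B deg)
qed

lemma irr_degrees_eqI:
  assumes "c \<noteq> 0" "\<And>q. q \<in># A \<Longrightarrow> Factorial_Ring.irreducible q"
    "F = Polynomial.smult c (prod_mset A)"
  shows "irr_degrees F = image_mset Polynomial.degree A"
  unfolding irr_degrees_def
proof (rule the_equality)
  show "\<exists>c Aa. c \<noteq> 0 \<and> (\<forall>q\<in>#Aa. Factorial_Ring.irreducible q) \<and>
     F = Polynomial.smult c (prod_mset Aa) \<and> image_mset Polynomial.degree A = image_mset Polynomial.degree Aa"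
    using assms by blast
qed (use irreducible_degrees_unique assms in metis)


section \<open>Galois groups from algebras of functions on a group\<close>

text \<open>
  If \<open>g\<close> runs through a group of permutations of the roots of a polynomial, then a polynomial
  expression in the roots becomes a function of \<open>g\<close>. The fixed field theorem of Galois theory
  follows from the single fact that the constants among these functions lie in the ground field.
\<close>

locale galois_algebra = group I for I :: "('i, 'b) monoid_scheme" (structure) +
  fixes W :: "('i \<Rightarrow> 'm::field alg_closure) set" and \<theta> :: "'i \<Rightarrow> 'm alg_closure"
  assumes finite_carrier: "finite (carrier I)"
    and const_mem: "(\<lambda>_. to_ac c) \<in> W"
    and add_mem: "u \<in> W \<Longrightarrow> v \<in> W \<Longrightarrow> (\<lambda>g. u g + v g) \<in> W"
    and mult_mem: "u \<in> W \<Longrightarrow> v \<in> W \<Longrightarrow> (\<lambda>g. u g * v g) \<in> W"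
    and shift_mem: "u \<in> W \<Longrightarrow> h \<in> carrier I \<Longrightarrow> (\<lambda>g. u (g \<otimes> h)) \<in> W"
    and constant_rational: "u \<in> W \<Longrightarrow> (\<And>g. g \<in> carrier I \<Longrightarrow> u g = u \<one>) \<Longrightarrow> u \<one> \<in> range to_ac"
    and theta_mem: "\<theta> \<in> W" and theta_inj: "inj_on \<theta> (carrier I)"
begin

lemma zero_mem: "(\<lambda>_. 0) \<in> W" and one_mem: "(\<lambda>_. 1) \<in> W"
  using const_mem[of 0] const_mem[of 1] by simp_all

lemma minus_mem: "u \<in> W \<Longrightarrow> (\<lambda>g. - u g) \<in> W"
  using mult_mem[OF const_mem[of "- 1"]] by force

lemma diff_mem: "u \<in> W \<Longrightarrow> v \<in> W \<Longrightarrow> (\<lambda>g. u g - v g) \<in> W"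
  using add_mem[OF _ minus_mem] by force

lemma sum_mem: "(\<And>a. a \<in> A \<Longrightarrow> u a \<in> W) \<Longrightarrow> (\<lambda>g. \<Sum>a\<in>A. u a g) \<in> W"
  by (induction A rule: infinite_finite_induct) (auto simp: zero_mem add_mem)

lemma prod_mem: "(\<And>a. a \<in> A \<Longrightarrow> u a \<in> W) \<Longrightarrow> (\<lambda>g. \<Prod>a\<in>A. u a g) \<in> W"
  by (induction A rule: infinite_finite_induct) (auto simp: one_mem mult_mem)

lemma poly_mem: "u \<in> W \<Longrightarrow> (\<lambda>g. poly (map_poly to_ac q) (u g)) \<in> W"
  by (induction q) (auto simp: zero_mem const_mem intro!: add_mem mult_mem)

definition Wpoly :: "('i \<Rightarrow> 'm alg_closure poly) set" where
  "Wpoly = {p. \<forall>n. (\<lambda>g. Polynomial.coeff (p g) n) \<in> W}"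

lemma Wpoly_mult: "p \<in> Wpoly \<Longrightarrow> q \<in> Wpoly \<Longrightarrow> (\<lambda>g. p g * q g) \<in> Wpoly"
  by (auto simp: Wpoly_def coeff_mult intro!: sum_mem mult_mem)

lemma Wpoly_const: "u \<in> W \<Longrightarrow> (\<lambda>g. [:u g:]) \<in> Wpoly"
  unfolding Wpoly_def
proof (intro CollectI allI)
  show "(\<lambda>g. Polynomial.coeff [:u g:] n) \<in> W" if "u \<in> W" for n
    using that zero_mem by (cases n) simp_all
qed

lemma Wpoly_linear: "u \<in> W \<Longrightarrow> (\<lambda>g. [:- u g, 1:]) \<in> Wpoly"
  unfolding Wpoly_def
proof (intro CollectI allI)
  show "(\<lambda>g. Polynomial.coeff [:- u g, 1:] n) \<in> W" if "u \<in> W" for n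
  proof (cases n)
    case (Suc k)
    then show ?thesis using zero_mem one_mem by (cases k) simp_all
  qed (use that in \<open>simp add: minus_mem\<close>)
qed

lemma Wpoly_sum: "(\<And>a. a \<in> A \<Longrightarrow> p a \<in> Wpoly) \<Longrightarrow> (\<lambda>g. \<Sum>a\<in>A. p a g) \<in> Wpoly"
  by (auto simp: Wpoly_def coeff_sum intro!: sum_mem)

lemma Wpoly_prod: "(\<And>a. a \<in> A \<Longrightarrow> p a \<in> Wpoly) \<Longrightarrow> (\<lambda>g. \<Prod>a\<in>A. p a g) \<in> Wpoly"
proof (induction A rule: infinite_finite_induct)
  have "(\<lambda>g. 1) \<in> Wpoly" using Wpoly_const[OF one_mem] by (simp add: one_pCons)
  then show "(\<lambda>g. \<Prod>a\<in>A. p a g) \<in> Wpoly" if "infinite A" for A using that by simp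
  from \<open>(\<lambda>g. 1) \<in> Wpoly\<close> show "(\<lambda>g. \<Prod>a\<in>{}. p a g) \<in> Wpoly" by simp
qed (auto intro!: Wpoly_mult)

text \<open>For a group \<open>K\<close> of automorphisms this says that its fixed field is
  \<open>M\<close>. For the whole carrier it is a locale assumption; it will be proved for
  \<open>\<Gamma>\<close>, and the lemmas in between are applied to both.\<close>

definition rational_on :: "'i set \<Rightarrow> bool" where
  "rational_on K \<longleftrightarrow> (\<forall>u\<in>W. (\<forall>g\<in>K. u g = u \<one>) \<longrightarrow> u \<one> \<in> range to_ac)"

lemma rational_on_carrier: "rational_on (carrier I)"
  unfolding rational_on_def using constant_rational by blast

lemma rational_poly:
  assumes "rational_on K" "p \<in> Wpoly" "\<And>g. g \<in> K \<Longrightarrow> p g = p \<one>"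
  shows "\<exists>q. map_poly to_ac q = p \<one>"
proof
  have "Polynomial.coeff (p \<one>) n \<in> range to_ac" for n
  proof -
    have "(\<lambda>g. Polynomial.coeff (p g) n) \<in> W" using assms(2) by (simp add: Wpoly_def)
    then show ?thesis using assms(1,3) unfolding rational_on_def by fastforce
  qed
  then show "map_poly to_ac (map_poly of_ac (p \<one>)) = p \<one>"
    by (intro poly_eqI) (simp add: coeff_map_poly to_ac_of_ac)
qed

section \<open>Norms and Lagrange interpolation on a subgroup\<close>

lemma subgroup_shift:
  assumes K: "subgroup K I" and g: "g \<in> K"
  shows "bij_betw (\<lambda>k. g \<otimes> k) K K" and "k \<in> K \<Longrightarrow> bij_betw (\<lambda>l. g \<otimes> l) (K - {k}) (K - {g \<otimes> k})"
proof -
  note mem = subgroup.mem_carrier[OF K] and cl = subgroup.m_closed[OF K] subgroup.m_inv_closed[OF K]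
  have inj: "inj_on (\<lambda>k. g \<otimes> k) K" using g mem by (auto simp: inj_on_def)
  moreover have "(\<lambda>k. g \<otimes> k) ` K = K"
  proof
    show "K \<subseteq> (\<lambda>k. g \<otimes> k) ` K"
    proof
      fix k assume k: "k \<in> K"
      have "k = g \<otimes> (inv g \<otimes> k)" using g k mem by (simp flip: m_assoc)
      then show "k \<in> (\<lambda>k. g \<otimes> k) ` K" using g k cl by blast
    qed
  qed (use g cl in auto)
  ultimately show bij: "bij_betw (\<lambda>k. g \<otimes> k) K K" by (simp add: bij_betw_def)
  show "bij_betw (\<lambda>l. g \<otimes> l) (K - {k}) (K - {g \<otimes> k})" if "k \<in> K"
    using bij that g mem by (intro bij_betw_DiffI) (auto simp: bij_betw_def)
qed

text \<open>The norm, the product of all translates of \<open>u\<close> by \<open>K\<close>, is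
  constant on \<open>K\<close> and hence a nonzero element of \<open>M\<close>. The product of the
  other translates, divided by the norm, is the inverse.\<close>

lemma inverse_mem:
  assumes K: "subgroup K I" "rational_on K" and u: "u \<in> W" "\<And>g. g \<in> K \<Longrightarrow> u g \<noteq> 0"
  shows "\<exists>v\<in>W. \<forall>g\<in>K. v g * u g = 1"
proof -
  note mem = subgroup.mem_carrier[OF K(1)] and one = subgroup.one_closed[OF K(1)]
  have fin: "finite K" using finite_carrier subgroup.subset[OF K(1)] finite_subset by blast
  define N where "N = (\<lambda>g. \<Prod>k\<in>K. u (g \<otimes> k))"
  have N: "N g = prod u K" if "g \<in> K" for g
    unfolding N_def using prod.reindex_bij_betw[OF subgroup_shift(1)[OF K(1) that], of u] by simp
  have "N \<in> W" unfolding N_def using u mem by (intro prod_mem shift_mem)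
  moreover have "\<forall>g\<in>K. N g = N \<one>" using N one by simp
  ultimately obtain c where c: "N \<one> = to_ac c" using K(2) unfolding rational_on_def by blast
  have cN: "prod u K = to_ac c" using N[OF one] c by simp
  then have "c \<noteq> 0" using u fin by (metis prod_zero_iff to_ac_0)
  define v where "v = (\<lambda>g. to_ac (inverse c) * (\<Prod>k\<in>K - {\<one>}. u (g \<otimes> k)))"
  have "v \<in> W" unfolding v_def using u mem by (intro mult_mem const_mem prod_mem shift_mem) auto
  moreover have "v g * u g = 1" if "g \<in> K" for g
  proof -
    have "v g * u g = to_ac (inverse c) * N g"
      using fin one mem[OF that] by (simp add: v_def N_def prod.remove[of K "\<one>"] mult_ac)
    then show ?thesis using \<open>c \<noteq> 0\<close> by (simp add: N[OF that] cN)
  qed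
  ultimately show ?thesis by blast
qed

text \<open>Lagrange interpolation at the nodes \<open>v k\<close>: translation by an element of
  \<open>K\<close> only permutes the summands, so the interpolating polynomial is constant on
  \<open>K\<close> and its coefficients lie in \<open>M\<close>.\<close>

lemma interpolation:
  assumes K: "subgroup K I" "rational_on K" and v: "v \<in> W" "inj_on v K" and u: "u \<in> W"
  shows "\<exists>q. \<forall>h\<in>K. poly (map_poly to_ac q) (v h) = u h"
proof -
  note mem = subgroup.mem_carrier[OF K(1)] and one = subgroup.one_closed[OF K(1)]
  have fin: "finite K" using finite_carrier subgroup.subset[OF K(1)] finite_subset by blast
  \<comment> \<open>The denominator of the Lagrange basis polynomial at the node \<open>v g\<close>,
    written through translates so that it is a function in \<open>W\<close>.\<close>
  define D where "D = (\<lambda>g. \<Prod>k\<in>K - {\<one>}. v g - v (g \<otimes> k))"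
  have "D \<in> W" unfolding D_def using v mem by (intro prod_mem diff_mem shift_mem) auto
  have D: "D g = (\<Prod>l\<in>K - {g}. v g - v l)" if "g \<in> K" for g
    unfolding D_def
    using prod.reindex_bij_betw[OF subgroup_shift(2)[OF K(1) that one], of "\<lambda>l. v g - v l"] mem[OF that]
    by simp
  have "D g \<noteq> 0" if "g \<in> K" for g
    using that v(2) fin by (auto simp: D prod_zero_iff inj_on_def)
  then obtain E where E: "E \<in> W" "\<And>g. g \<in> K \<Longrightarrow> E g * D g = 1"
    using inverse_mem[OF K \<open>D \<in> W\<close>] by blast
  define \<Lambda> where "\<Lambda> = (\<lambda>g. \<Sum>k\<in>K. [:u (g \<otimes> k) * E (g \<otimes> k):] * (\<Prod>l\<in>K - {k}. [:- v (g \<otimes> l), 1:]))"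
  define \<Lambda>0 where "\<Lambda>0 = (\<Sum>k\<in>K. [:u k * E k:] * (\<Prod>l\<in>K - {k}. [:- v l, 1:]))"
  have \<Lambda>: "\<Lambda> g = \<Lambda>0" if g: "g \<in> K" for g
  proof -
    have "\<Lambda> g = (\<Sum>k\<in>K. [:u (g \<otimes> k) * E (g \<otimes> k):] * (\<Prod>l\<in>K - {g \<otimes> k}. [:- v l, 1:]))"
      unfolding \<Lambda>_def
    proof (rule sum.cong[OF refl])
      fix k assume "k \<in> K"
      then show "[:u (g \<otimes> k) * E (g \<otimes> k):] * (\<Prod>l\<in>K - {k}. [:- v (g \<otimes> l), 1:]) =
        [:u (g \<otimes> k) * E (g \<otimes> k):] * (\<Prod>l\<in>K - {g \<otimes> k}. [:- v l, 1:])"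
        using prod.reindex_bij_betw[OF subgroup_shift(2)[OF K(1) g], of k "\<lambda>l. [:- v l, 1:]"] by simp
    qed
    also have "\<dots> = \<Lambda>0"
      unfolding \<Lambda>0_def
      using sum.reindex_bij_betw[OF subgroup_shift(1)[OF K(1) g],
          of "\<lambda>k. [:u k * E k:] * (\<Prod>l\<in>K - {k}. [:- v l, 1:])"] by simp
    finally show ?thesis .
  qed
  have "\<Lambda> \<in> Wpoly" unfolding \<Lambda>_def
    using u E(1) v(1) mem
    by (intro Wpoly_sum Wpoly_mult Wpoly_const Wpoly_prod Wpoly_linear mult_mem shift_mem) auto
  then obtain q where q: "map_poly to_ac q = \<Lambda>0"
    using rational_poly[OF K(2), of \<Lambda>] \<Lambda> one by auto
  have "poly (map_poly to_ac q) (v h) = u h" if h: "h \<in> K" for h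
  proof -
    have "poly \<Lambda>0 (v h) = (\<Sum>k\<in>K. u k * E k * (\<Prod>l\<in>K - {k}. v h - v l))"
      by (simp add: \<Lambda>0_def poly_sum poly_prod)
    also have "\<dots> = u h * E h * (\<Prod>l\<in>K - {h}. v h - v l)"
      using fin h by (subst sum.remove[of K h]) (auto intro!: sum.neutral)
    also have "\<dots> = u h" using E(2)[OF h] by (simp add: D[OF h] mult.assoc)
    finally show ?thesis by (simp add: q)
  qed
  then show ?thesis by blast
qed

text \<open>The kernel of the evaluation \<open>u \<mapsto> u \<one>\<close> consists of the
  algebraic relations between the roots. \<open>\<Gamma>\<close> is the set of \<open>h\<close> that
  respect all of them, that is, for which \<open>u \<one> \<mapsto> u h\<close> is well defined: the
  Galois group as a group of permutations.\<close>

definition \<Gamma> :: "'i set" where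
  "\<Gamma> = {h \<in> carrier I. \<forall>u\<in>W. u \<one> = 0 \<longrightarrow> u h = 0}"

lemma Gamma_carrier: "h \<in> \<Gamma> \<Longrightarrow> h \<in> carrier I"
  by (simp add: \<Gamma>_def)

lemma finite_Gamma: "finite \<Gamma>"
  by (simp add: \<Gamma>_def finite_carrier)

lemma Gamma_eq:
  assumes "h \<in> \<Gamma>" "u \<in> W" "v \<in> W" "u \<one> = v \<one>"
  shows "u h = v h"
  using assms diff_mem[of u v] by (auto simp: \<Gamma>_def)

text \<open>Translation gives closure under products. Inverses come from finiteness: right
  multiplication by \<open>h\<close> is injective on \<open>\<Gamma>\<close>, hence reaches
  \<open>\<one>\<close>.\<close>

lemma subgroup_Gamma: "subgroup \<Gamma> I"
proof (rule subgroupI)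
  have one: "\<one> \<in> \<Gamma>" by (simp add: \<Gamma>_def)
  show "\<Gamma> \<subseteq> carrier I" by (auto simp: \<Gamma>_def)
  show "\<Gamma> \<noteq> {}" using one by auto
  have mult: "g \<otimes> h \<in> \<Gamma>" if g: "g \<in> \<Gamma>" and h: "h \<in> \<Gamma>" for g h
    unfolding \<Gamma>_def
  proof (intro CollectI conjI ballI impI)
    show "g \<otimes> h \<in> carrier I" using g h by (simp add: \<Gamma>_def)
    fix u assume u: "u \<in> W" "u \<one> = 0"
    have "(\<lambda>k. u (k \<otimes> h)) \<in> W" using u h by (simp add: shift_mem Gamma_carrier)
    moreover have "u (\<one> \<otimes> h) = 0" using u h by (simp add: \<Gamma>_def)
    ultimately show "u (g \<otimes> h) = 0" using g by (auto simp: \<Gamma>_def)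
  qed
  then show "g \<otimes> h \<in> \<Gamma>" if "g \<in> \<Gamma>" "h \<in> \<Gamma>" for g h using that by blast
  fix h assume h: "h \<in> \<Gamma>"
  have "inj_on (\<lambda>g. g \<otimes> h) \<Gamma>" using h by (auto simp: inj_on_def \<Gamma>_def)
  moreover have "(\<lambda>g. g \<otimes> h) ` \<Gamma> \<subseteq> \<Gamma>" using mult h by auto
  ultimately have "(\<lambda>g. g \<otimes> h) ` \<Gamma> = \<Gamma>" using finite_Gamma by (metis endo_inj_surj)
  then obtain g where "g \<in> \<Gamma>" "g \<otimes> h = \<one>" using one by (metis imageE)
  then show "inv h \<in> \<Gamma>" using h by (metis Gamma_carrier inv_equality)
qed

lemma one_Gamma: "\<one> \<in> \<Gamma>"
  by (rule subgroup.one_closed[OF subgroup_Gamma])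

lemma theta_poly: "\<exists>P. map_poly to_ac P = (\<Prod>h\<in>carrier I. [:- \<theta> h, 1:])"
proof -
  define \<Phi> where "\<Phi> = (\<lambda>g. \<Prod>h\<in>carrier I. [:- \<theta> (g \<otimes> h), 1:])"
  have "\<Phi> \<in> Wpoly"
    unfolding \<Phi>_def using theta_mem by (intro Wpoly_prod Wpoly_linear shift_mem)
  moreover have \<Phi>: "\<Phi> g = (\<Prod>h\<in>carrier I. [:- \<theta> h, 1:])" if "g \<in> carrier I" for g
    unfolding \<Phi>_def
    using prod.reindex_bij_betw[OF subgroup_shift(1)[OF subgroup_self that], of "\<lambda>h. [:- \<theta> h, 1:]"]
    by simp
  ultimately show ?thesis
    using rational_poly[OF rational_on_carrier, of \<Phi>] by (metis one_closed)
qed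

text \<open>The minimal polynomial \<open>m\<close> of \<open>\<theta> \<one>\<close> vanishes at
  \<open>\<theta> h\<close> exactly for \<open>h\<close> in \<open>\<Gamma>\<close>, and it divides
  a product of distinct linear factors, so its degree is at most the order of
  \<open>\<Gamma>\<close>. An element fixed by \<open>\<Gamma>\<close>, written as a polynomial in
  \<open>\<theta>\<close> and reduced modulo \<open>m\<close>, takes one value at more points than
  its degree, so it is constant. This is the fixed field theorem.\<close>

lemma rational_on_Gamma: "rational_on \<Gamma>"
proof -
  define \<Phi> where "\<Phi> = (\<Prod>h\<in>carrier I. [:- \<theta> h, 1:])"
  obtain P where P: "map_poly to_ac P = \<Phi>" using theta_poly by (auto simp: \<Phi>_def)
  define S where "S = {p :: 'm poly. p \<noteq> 0 \<and> poly (map_poly to_ac p) (\<theta> \<one>) = 0}"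
  have "\<Phi> \<noteq> 0" using finite_carrier by (simp add: \<Phi>_def prod_zero_iff)
  then have "P \<noteq> 0" using P by auto
  moreover have "poly \<Phi> (\<theta> \<one>) = 0"
    using finite_carrier by (auto simp: \<Phi>_def poly_prod intro!: prod_zero)
  ultimately have PS: "P \<in> S" using P by (simp add: S_def)
  then obtain m where m: "m \<in> S" and min: "\<And>p. p \<in> S \<Longrightarrow> Polynomial.degree m \<le> Polynomial.degree p"
    by (metis arg_min_nat_lemma[of "\<lambda>p. p \<in> S" _ Polynomial.degree])
  have m_nz: "m \<noteq> 0" and m_root: "poly (map_poly to_ac m) (\<theta> \<one>) = 0" using m by (auto simp: S_def)
  have m_dvd: "m dvd p" if "poly (map_poly to_ac p) (\<theta> \<one>) = 0" for p
  proof (rule ccontr)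
    assume "\<not> m dvd p"
    then have nz: "p mod m \<noteq> 0" by (simp add: mod_eq_0_iff_dvd)
    have "p mod m = p - m * (p div m)" by (simp add: minus_mult_div_eq_mod)
    then have "map_poly to_ac (p mod m) = map_poly to_ac p - map_poly to_ac m * map_poly to_ac (p div m)"
      by (simp add: to_ac.map_poly_diff to_ac.map_poly_mult)
    then have "p mod m \<in> S" using that m_root nz by (simp add: S_def)
    then show False using min degree_mod_less[OF m_nz, of p] nz by fastforce
  qed
  have roots: "\<Gamma> = {h \<in> carrier I. poly (map_poly to_ac m) (\<theta> h) = 0}"
  proof (intro equalityI subsetI)
    fix h assume h: "h \<in> \<Gamma>"
    then show "h \<in> {h \<in> carrier I. poly (map_poly to_ac m) (\<theta> h) = 0}"
      using poly_mem[OF theta_mem, of m] m_root by (auto simp: \<Gamma>_def)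
  next
    fix h assume h: "h \<in> {h \<in> carrier I. poly (map_poly to_ac m) (\<theta> h) = 0}"
    show "h \<in> \<Gamma>" unfolding \<Gamma>_def
    proof (intro CollectI conjI ballI impI)
      fix u assume u: "u \<in> W" "u \<one> = 0"
      obtain q where q: "\<And>g. g \<in> carrier I \<Longrightarrow> poly (map_poly to_ac q) (\<theta> g) = u g"
        using interpolation[OF subgroup_self rational_on_carrier theta_mem theta_inj u(1)] by blast
      then have "m dvd q" using u by (intro m_dvd) simp
      then have "poly (map_poly to_ac q) (\<theta> h) = 0" using h by (auto simp: to_ac.map_poly_mult elim!: dvdE)
      then show "u h = 0" using q h by simp
    qed (use h in auto)
  qed
  have "map_poly to_ac m dvd \<Phi>"
    using m_dvd[of P] PS by (simp add: S_def to_ac.map_poly_dvd_iff flip: P)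
  then have deg: "Polynomial.degree m \<le> card \<Gamma>"
    using degree_le_card_roots_of_split[OF finite_carrier theta_inj, of "map_poly to_ac m"]
    by (simp add: \<Phi>_def roots)
  show ?thesis unfolding rational_on_def
  proof (intro ballI impI)
    fix u assume u: "u \<in> W" "\<forall>g\<in>\<Gamma>. u g = u \<one>"
    obtain q where q: "\<And>g. g \<in> carrier I \<Longrightarrow> poly (map_poly to_ac q) (\<theta> g) = u g"
      using interpolation[OF subgroup_self rational_on_carrier theta_mem theta_inj u(1)] by blast
    define r where "r = q mod m"
    have q_eq: "map_poly to_ac q = map_poly to_ac m * map_poly to_ac (q div m) + map_poly to_ac r"
      by (simp add: r_def flip: to_ac.map_poly_mult to_ac.map_poly_add)
    have "poly (map_poly to_ac r) (\<theta> h) = u \<one>" if "h \<in> \<Gamma>" for h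
      using q[of h] u(2) that roots by (auto simp: q_eq)
    moreover have "inj_on \<theta> \<Gamma>"
      using theta_inj roots by (auto simp: inj_on_def)
    moreover have "Polynomial.degree (map_poly to_ac r) < card \<Gamma>"
    proof (cases "Polynomial.degree r = 0")
      case True
      then show ?thesis using one_Gamma finite_Gamma by (auto simp: card_gt_0_iff)
    next
      case False
      then have "Polynomial.degree r < Polynomial.degree m"
        using degree_mod_less[OF m_nz, of q] by (auto simp: r_def)
      with deg show ?thesis by simp
    qed
    ultimately have "map_poly to_ac r = [:u \<one>:]"
      using poly_eq_const_of_roots[OF finite_Gamma] by blast
    then have "to_ac (Polynomial.coeff r 0) = u \<one>" by (metis coeff_pCons_0 to_ac.coeff_map_hom)
    then show "u \<one> \<in> range to_ac" by (metis rangeI)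
  qed
qed

lemma is_subfield_values: "is_subfield ((\<lambda>u. u \<one>) ` W)"
  unfolding is_subfield_def
proof (intro conjI ballI)
  show "1 \<in> (\<lambda>u. u \<one>) ` W" using one_mem by force
  fix y assume "y \<in> (\<lambda>u. u \<one>) ` W"
  then obtain u where u: "u \<in> W" "y = u \<one>" by blast
  show "inverse y \<in> (\<lambda>u. u \<one>) ` W"
  proof (cases "y = 0")
    case True
    then show ?thesis using zero_mem by force
  next
    case False
    obtain p :: "'m poly" where "p \<noteq> 0" "poly (map_poly to_ac p) y = 0"
      by (rule alg_closure_algebraic)
    then obtain q where "inverse y = poly (map_poly to_ac q) y"
      using inverse_as_poly False by blast
    then show ?thesis using poly_mem[OF u(1), of q] u(2) by force
  qed
  fix z assume "z \<in> (\<lambda>u. u \<one>) ` W"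
  then obtain v where v: "v \<in> W" "z = v \<one>" by blast
  show "y - z \<in> (\<lambda>u. u \<one>) ` W" using diff_mem[OF u(1) v(1)] u v by force
  show "y * z \<in> (\<lambda>u. u \<one>) ` W" using mult_mem[OF u(1) v(1)] u v by force
qed


text \<open>By the choice of \<open>\<Gamma>\<close> the value \<open>u h\<close> depends only on
  the number \<open>u \<one>\<close>, and this defines an automorphism for each \<open>h\<close>.
  Conversely, an automorphism sends \<open>\<theta> \<one>\<close> to some conjugate
  \<open>\<theta> h\<close>, and this determines it everywhere because all of \<open>W\<close> is
  interpolated by polynomials in \<open>\<theta>\<close>.\<close>

lemma Gal_iso:
  assumes Spl: "Spl q = (\<lambda>u. u \<one>) ` W"
  shows "\<exists>\<Phi>\<in>iso (I\<lparr>carrier := \<Gamma>\<rparr>) (Gal q). \<forall>h\<in>\<Gamma>. \<forall>u\<in>W. \<Phi> h (u \<one>) = u h"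
proof -
  define \<phi> where "\<phi> h = (\<lambda>z\<in>Spl q. (SOME u. u \<in> W \<and> u \<one> = z) h)" for h
  have \<phi>: "\<phi> h (u \<one>) = u h" if h: "h \<in> \<Gamma>" and u: "u \<in> W" for h u
  proof -
    have "(SOME v. v \<in> W \<and> v \<one> = u \<one>) \<in> W \<and> (SOME v. v \<in> W \<and> v \<one> = u \<one>) \<one> = u \<one>"
      by (rule someI[of _ u]) (use u in auto)
    then show ?thesis using Gamma_eq[OF h] u by (simp add: \<phi>_def Spl)
  qed
  have val: "u h \<in> Spl q" if "h \<in> \<Gamma>" "u \<in> W" for h u
    unfolding Spl using shift_mem[OF that(2) Gamma_carrier[OF that(1)]] that(1)
    by (intro image_eqI[where x = "\<lambda>g. u (g \<otimes> h)"]) (auto simp: Gamma_carrier)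
  note inv_Gamma = subgroup.m_inv_closed[OF subgroup_Gamma] and mult_Gamma = subgroup.m_closed[OF subgroup_Gamma]
  have bij: "bij_betw (\<phi> h) (Spl q) (Spl q)" if h: "h \<in> \<Gamma>" for h
  proof (rule bij_betw_imageI)
    show "inj_on (\<phi> h) (Spl q)"
    proof (rule inj_onI)
      fix y z assume "y \<in> Spl q" "z \<in> Spl q" and eq: "\<phi> h y = \<phi> h z"
      then obtain u v where u: "u \<in> W" "y = u \<one>" and v: "v \<in> W" "z = v \<one>" unfolding Spl by blast
      have "u (inv h \<otimes> h) = v (inv h \<otimes> h)"
        by (rule Gamma_eq[OF inv_Gamma[OF h], of "\<lambda>g. u (g \<otimes> h)" "\<lambda>g. v (g \<otimes> h)"])
          (use u v h eq in \<open>auto simp: \<phi> shift_mem Gamma_carrier\<close>)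
      then show "y = z" using u v h by (simp add: Gamma_carrier)
    qed
    show "\<phi> h ` Spl q = Spl q"
    proof
      show "\<phi> h ` Spl q \<subseteq> Spl q" using val[OF h] \<phi>[OF h] by (subst (1) Spl) auto
      show "Spl q \<subseteq> \<phi> h ` Spl q"
      proof
        fix y assume "y \<in> Spl q"
        then obtain u where u: "u \<in> W" "y = u \<one>" unfolding Spl by blast
        define v where "v = (\<lambda>g. u (g \<otimes> inv h))"
        have v: "v \<in> W" unfolding v_def using u h by (simp add: shift_mem Gamma_carrier)
        have "\<phi> h (v \<one>) = y" using h u by (simp add: \<phi>[OF h v]) (simp add: v_def Gamma_carrier)
        moreover have "v \<one> \<in> Spl q" using val[OF one_Gamma v] .
        ultimately show "y \<in> \<phi> h ` Spl q" by blast
      qed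
    qed
  qed
  have mem: "\<phi> h \<in> carrier (Gal q)" if h: "h \<in> \<Gamma>" for h
  proof -
    have "\<phi> h (y + z) = \<phi> h y + \<phi> h z \<and> \<phi> h (y * z) = \<phi> h y * \<phi> h z" if "y \<in> Spl q" "z \<in> Spl q" for y z
    proof -
      obtain u v where "u \<in> W" "y = u \<one>" "v \<in> W" "z = v \<one>" using \<open>y \<in> Spl q\<close> \<open>z \<in> Spl q\<close> unfolding Spl by blast
      then show ?thesis
        using \<phi>[OF h add_mem[of u v]] \<phi>[OF h mult_mem[of u v]] \<phi>[OF h] by simp
    qed
    moreover have "\<phi> h (to_ac c) = to_ac c" for c using \<phi>[OF h const_mem[of c]] .
    ultimately show ?thesis using bij[OF h] by (simp add: Gal_def Bij_def \<phi>_def)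
  qed
  have bijs: "\<phi> h \<in> Bij (Spl q)" if "h \<in> \<Gamma>" for h using mem[OF that] by (simp add: Gal_def)
  have "\<phi> \<in> iso (I\<lparr>carrier := \<Gamma>\<rparr>) (Gal q)"
    unfolding iso_iff
  proof (intro conjI)
    show "\<phi> \<in> hom (I\<lparr>carrier := \<Gamma>\<rparr>) (Gal q)"
    proof (rule homI)
      fix h k assume "h \<in> carrier (I\<lparr>carrier := \<Gamma>\<rparr>)" "k \<in> carrier (I\<lparr>carrier := \<Gamma>\<rparr>)"
      then have h: "h \<in> \<Gamma>" and k: "k \<in> \<Gamma>" by auto
      have "\<phi> (h \<otimes> k) = compose (Spl q) (\<phi> h) (\<phi> k)"
      proof (rule extensionalityI[of _ "Spl q"])
        show "\<phi> (h \<otimes> k) \<in> extensional (Spl q)" by (simp add: \<phi>_def)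
        fix y assume y: "y \<in> Spl q"
        then obtain u where u: "u \<in> W" "y = u \<one>" unfolding Spl by blast
        have "\<phi> h (u k) = u (h \<otimes> k)"
          using \<phi>[OF h shift_mem[OF u(1) Gamma_carrier[OF k]]] k by (simp add: Gamma_carrier)
        then show "\<phi> (h \<otimes> k) y = compose (Spl q) (\<phi> h) (\<phi> k) y"
          using y u \<phi>[OF mult_Gamma[OF h k] u(1)] by (simp add: compose_def \<phi>[OF k])
      qed auto
      then show "\<phi> (h \<otimes>\<^bsub>I\<lparr>carrier := \<Gamma>\<rparr>\<^esub> k) = \<phi> h \<otimes>\<^bsub>Gal q\<^esub> \<phi> k"
        using bijs h k by (simp add: Gal_def BijGroup_def)
    qed (use mem in auto)
    show "inj_on \<phi> (carrier (I\<lparr>carrier := \<Gamma>\<rparr>))"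
    proof (rule inj_onI)
      fix h k assume hk: "h \<in> carrier (I\<lparr>carrier := \<Gamma>\<rparr>)" "k \<in> carrier (I\<lparr>carrier := \<Gamma>\<rparr>)" "\<phi> h = \<phi> k"
      then have "\<theta> h = \<theta> k" using \<phi>[OF _ theta_mem, of h] \<phi>[OF _ theta_mem, of k] by simp
      then show "h = k" using theta_inj hk by (auto simp: inj_on_def Gamma_carrier)
    qed
    have "\<psi> \<in> \<phi> ` \<Gamma>" if \<psi>: "\<psi> \<in> carrier (Gal q)" for \<psi>
    proof -
      have \<psi>c: "\<psi> (to_ac c) = to_ac c" for c using \<psi> by (simp add: Gal_def)
      have \<psi>h: "\<psi> (y + z) = \<psi> y + \<psi> z" "\<psi> (y * z) = \<psi> y * \<psi> z" if "y \<in> Spl q" "z \<in> Spl q" for y z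
        using \<psi> that by (auto simp: Gal_def)
      have \<psi>p: "\<psi> (poly (map_poly to_ac p) z) = poly (map_poly to_ac p) (\<psi> z)" if z: "z \<in> Spl q" for p z
      proof -
        obtain u where u: "u \<in> W" "z = u \<one>" using z unfolding Spl by blast
        show ?thesis
        proof (induction p)
          case (pCons c p)
          have "poly (map_poly to_ac p) z \<in> Spl q" "to_ac c \<in> Spl q"
            using val[OF one_Gamma poly_mem[OF u(1), of p]] val[OF one_Gamma const_mem] by (auto simp: u)
          moreover have "z * poly (map_poly to_ac p) z \<in> Spl q"
            using val[OF one_Gamma mult_mem[OF u(1) poly_mem[OF u(1), of p]]] by (simp add: u)
          ultimately show ?case using pCons z by (simp add: \<psi>h \<psi>c)
        qed (use \<psi>c[of 0] in simp)
      qed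
      have \<theta>1: "\<theta> \<one> \<in> Spl q" using val[OF one_Gamma theta_mem] .
      obtain P where P: "map_poly to_ac P = (\<Prod>h\<in>carrier I. [:- \<theta> h, 1:])" using theta_poly by blast
      have "poly (map_poly to_ac P) (\<theta> \<one>) = 0"
        using finite_carrier unfolding P by (auto simp: poly_prod intro!: prod_zero)
      then have "poly (map_poly to_ac P) (\<psi> (\<theta> \<one>)) = 0" using \<psi>p[OF \<theta>1, of P] \<psi>c[of 0] by simp
      then obtain h where h: "h \<in> carrier I" "\<psi> (\<theta> \<one>) = \<theta> h"
        using finite_carrier unfolding P by (auto simp: poly_prod prod_zero_iff)
      have \<psi>u: "\<psi> (u \<one>) = u h" if u: "u \<in> W" for u
      proof -
        obtain p where "\<And>g. g \<in> carrier I \<Longrightarrow> poly (map_poly to_ac p) (\<theta> g) = u g"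
          using interpolation[OF subgroup_self rational_on_carrier theta_mem theta_inj u] by blast
        then show ?thesis using \<psi>p[OF \<theta>1, of p] h by (metis one_closed)
      qed
      have "u h = 0" if "u \<in> W" "u \<one> = 0" for u using \<psi>u[OF that(1)] \<psi>c[of 0] that(2) by simp
      then have "h \<in> \<Gamma>" using h by (simp add: \<Gamma>_def)
      moreover have "\<psi> = \<phi> h"
      proof (rule extensionalityI[of _ "Spl q"])
        show "\<psi> \<in> extensional (Spl q)" using \<psi> by (simp add: Gal_def Bij_def)
        show "\<psi> y = \<phi> h y" if "y \<in> Spl q" for y
          using that \<psi>u \<phi>[OF \<open>h \<in> \<Gamma>\<close>] unfolding Spl by auto
      qed (simp add: \<phi>_def)
      ultimately show ?thesis by blast
    qed
    then show "\<phi> ` carrier (I\<lparr>carrier := \<Gamma>\<rparr>) = carrier (Gal q)" using mem by auto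
  qed
  then show ?thesis using \<phi> by blast
qed

text \<open>The polynomial with the roots \<open>\<theta> (g \<otimes> r)\<close>, for
  \<open>r\<close> in \<open>N\<close>, depends only on the coset of \<open>g\<close>. It has the
  root \<open>\<theta> \<one>\<close> for \<open>g = \<one>\<close> but not for
  \<open>g = t\<close>, so one of its coefficients tells the two cosets apart. In every
  characteristic it serves in place of a square root of a discriminant.\<close>

lemma coset_separating:
  assumes N: "subgroup N I" and t: "t \<in> carrier I" "t \<notin> N"
  shows "\<exists>v\<in>W. (\<forall>g\<in>carrier I. \<forall>r\<in>N. v (g \<otimes> r) = v g) \<and> v t \<noteq> v \<one>"
proof -
  note mem = subgroup.mem_carrier[OF N]
  have fin: "finite N" using finite_carrier subgroup.subset[OF N] finite_subset by blast
  define p where "p = (\<lambda>g. \<Prod>r\<in>N. [:- \<theta> (g \<otimes> r), 1:])"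
  have "p \<in> Wpoly" unfolding p_def using theta_mem mem by (intro Wpoly_prod Wpoly_linear shift_mem)
  have inv: "p (g \<otimes> r) = p g" if "g \<in> carrier I" "r \<in> N" for g r
    unfolding p_def
    using prod.reindex_bij_betw[OF subgroup_shift(1)[OF N \<open>r \<in> N\<close>], of "\<lambda>l. [:- \<theta> (g \<otimes> l), 1:]"] that mem
    by (simp add: m_assoc)
  have "poly (p \<one>) (\<theta> \<one>) = 0"
    using fin subgroup.one_closed[OF N] by (auto simp: p_def poly_prod intro!: prod_zero bexI[of _ "\<one>"])
  moreover have "poly (p t) (\<theta> \<one>) \<noteq> 0"
  proof
    assume "poly (p t) (\<theta> \<one>) = 0"
    then obtain r where r: "r \<in> N" "\<theta> \<one> = \<theta> (t \<otimes> r)" using fin by (auto simp: p_def poly_prod prod_zero_iff)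
    then have "t \<otimes> r = \<one>" using theta_inj t mem by (auto simp: inj_on_def)
    then have "t = inv r" using r t mem by (metis inv_equality)
    then show False using t r subgroup.m_inv_closed[OF N] by blast
  qed
  ultimately have "p t \<noteq> p \<one>" by metis
  then obtain n where "Polynomial.coeff (p t) n \<noteq> Polynomial.coeff (p \<one>) n" by (meson poly_eqI)
  with inv \<open>p \<in> Wpoly\<close> show ?thesis by (auto simp: Wpoly_def intro!: bexI[of _ "\<lambda>g. Polynomial.coeff (p g) n"])
qed

text \<open>Here \<open>\<epsilon>\<close> is the sign character of a quadratic extension. The
  quotient of the differences of \<open>u\<close> and of \<open>v\<close> under translation by
  \<open>t\<close> is constant on \<open>\<Gamma>\<close> and gives \<open>c1\<close>; then
  \<open>u - c1 v\<close> is constant and gives \<open>c0\<close>. No division by 2 occurs.\<close>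

lemma quadratic_values:
  assumes v: "v \<in> W" "\<And>g. g \<in> \<Gamma> \<Longrightarrow> v g = (if \<epsilon> g then d' else d)" "d \<noteq> d'"
    and \<epsilon>: "t \<in> \<Gamma>" "\<epsilon> t" "\<not> \<epsilon> \<one>" "\<And>g. g \<in> \<Gamma> \<Longrightarrow> \<epsilon> (g \<otimes> t) \<longleftrightarrow> \<not> \<epsilon> g"
    and u: "u \<in> W" "\<And>g. g \<in> \<Gamma> \<Longrightarrow> u g = (if \<epsilon> g then u t else u \<one>)"
  shows "\<exists>c0 c1. u \<one> = to_ac c0 + to_ac c1 * d"
proof -
  note mult_Gamma = subgroup.m_closed[OF subgroup_Gamma]
  have e: "(\<lambda>g. v g - v (g \<otimes> t)) \<in> W" using v \<epsilon> by (intro diff_mem shift_mem) (auto simp: Gamma_carrier)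
  have "v g - v (g \<otimes> t) \<noteq> 0" if "g \<in> \<Gamma>" for g using v \<epsilon> that mult_Gamma by auto
  then obtain E where E: "E \<in> W" "\<And>g. g \<in> \<Gamma> \<Longrightarrow> E g * (v g - v (g \<otimes> t)) = 1"
    using inverse_mem[OF subgroup_Gamma rational_on_Gamma e] by blast
  define w where "w = (\<lambda>g. (u g - u (g \<otimes> t)) * E g)"
  have "w \<in> W" unfolding w_def using u E \<epsilon> by (intro mult_mem diff_mem shift_mem) (auto simp: Gamma_carrier)
  have w: "w g * (d - d') = u \<one> - u t" if g: "g \<in> \<Gamma>" for g
  proof (cases "\<epsilon> g")
    case True
    then have "E g * (d' - d) = 1" "w g = (u t - u \<one>) * E g"
      using E(2)[OF g] v(2) u(2)[of g] u(2)[of "g \<otimes> t"] \<epsilon> g mult_Gamma by (simp_all add: w_def)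
    moreover have "(u t - u \<one>) * E g * (d - d') = (u \<one> - u t) * (E g * (d' - d))"
      by (simp add: algebra_simps)
    ultimately show ?thesis using \<open>E g * (d' - d) = 1\<close> by simp
  next
    case False
    then have "E g * (d - d') = 1" "w g = (u \<one> - u t) * E g"
      using E(2)[OF g] v(2) u(2)[of g] u(2)[of "g \<otimes> t"] \<epsilon> g mult_Gamma by (simp_all add: w_def)
    then show ?thesis by (simp add: mult.assoc)
  qed
  then have "\<forall>g\<in>\<Gamma>. w g = w \<one>" using v(3) one_Gamma by (metis eq_iff_diff_eq_0 mult_right_cancel)
  then obtain c1 where c1: "w \<one> = to_ac c1"
    using rational_on_Gamma \<open>w \<in> W\<close> unfolding rational_on_def by blast
  have c1': "to_ac c1 * (d - d') = u \<one> - u t" using w[OF one_Gamma] c1 by simp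
  define z where "z = (\<lambda>g. u g - to_ac c1 * v g)"
  have "z \<in> W" unfolding z_def using u v by (intro diff_mem mult_mem const_mem)
  moreover have "\<forall>g\<in>\<Gamma>. z g = z \<one>"
  proof
    fix g assume g: "g \<in> \<Gamma>"
    show "z g = z \<one>"
      using u(2)[OF g] v(2)[OF g] v(2)[OF one_Gamma] \<epsilon>(3) c1' by (auto simp: z_def algebra_simps)
  qed
  ultimately obtain c0 where "z \<one> = to_ac c0" using rational_on_Gamma unfolding rational_on_def by blast
  then have "u \<one> = to_ac c0 + to_ac c1 * d" using v(2)[OF one_Gamma] \<epsilon>(3) by (simp add: z_def algebra_simps)
  then show ?thesis by blast
qed

end

section \<open>Conjugate elements: orbits and irreducible factors\<close>

locale conjugate_family = galois_algebra I W \<theta>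
  for I :: "('i, 'b) monoid_scheme" (structure) and W :: "('i \<Rightarrow> 'm::field alg_closure) set" and \<theta> +
  fixes J :: "'j set" and act :: "'i \<Rightarrow> 'j \<Rightarrow> 'j" and V :: "'j \<Rightarrow> 'i \<Rightarrow> 'm alg_closure"
  assumes finite_J: "finite J"
    and act_closed: "h \<in> \<Gamma> \<Longrightarrow> c \<in> J \<Longrightarrow> act h c \<in> J"
    and act_one: "c \<in> J \<Longrightarrow> act \<one> c = c"
    and act_mult: "h \<in> \<Gamma> \<Longrightarrow> k \<in> \<Gamma> \<Longrightarrow> c \<in> J \<Longrightarrow> act (h \<otimes> k) c = act h (act k c)"
    and V_mem: "c \<in> J \<Longrightarrow> V c \<in> W"
    and V_act: "h \<in> \<Gamma> \<Longrightarrow> c \<in> J \<Longrightarrow> V c h = V (act h c) \<one>"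
begin

definition orb :: "'j \<Rightarrow> 'j set" where "orb c = (\<lambda>h. act h c) ` \<Gamma>"

lemma orb_subset: "c \<in> J \<Longrightarrow> orb c \<subseteq> J"
  by (auto simp: orb_def act_closed)

lemma mem_orb: "c \<in> J \<Longrightarrow> c \<in> orb c"
  unfolding orb_def using act_one one_Gamma by force

lemma orb_eq:
  assumes "c \<in> J" "d \<in> orb c"
  shows "orb d = orb c"
proof -
  note inv_Gamma = subgroup.m_inv_closed[OF subgroup_Gamma] and mult_Gamma = subgroup.m_closed[OF subgroup_Gamma]
  obtain h where h: "h \<in> \<Gamma>" "d = act h c" using assms by (auto simp: orb_def)
  have "orb d \<subseteq> orb c"
    using h assms(1) mult_Gamma by (auto simp: orb_def simp flip: act_mult)
  moreover have "orb c \<subseteq> orb d"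
  proof
    fix e assume "e \<in> orb c"
    then obtain k where k: "k \<in> \<Gamma>" "e = act k c" by (auto simp: orb_def)
    have "act (k \<otimes> inv h) d = e"
      using h k assms(1) inv_Gamma mult_Gamma by (simp flip: act_mult add: m_assoc Gamma_carrier)
    then show "e \<in> orb d" using h k inv_Gamma mult_Gamma by (force simp: orb_def)
  qed
  ultimately show ?thesis by blast
qed

text \<open>An element of \<open>\<Gamma>\<close> permutes the distinct values, so the product over
  them is constant on \<open>\<Gamma>\<close>. The index set \<open>J0\<close> contains one index
  for each value and thereby discards multiplicities.\<close>

lemma values_poly:
  assumes J': "J' \<subseteq> J" and stable: "\<And>h c. h \<in> \<Gamma> \<Longrightarrow> c \<in> J' \<Longrightarrow> act h c \<in> J'"
  shows "\<exists>q. map_poly to_ac q = (\<Prod>z\<in>(\<lambda>c. V c \<one>) ` J'. [:- z, 1:])"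
proof -
  define Z where "Z = (\<lambda>c. V c \<one>) ` J'"
  obtain J0 where J0: "J0 \<subseteq> J'" "inj_on (\<lambda>c. V c \<one>) J0" "Z = (\<lambda>c. V c \<one>) ` J0"
    unfolding Z_def by (metis subset_image_inj subset_refl)
  have fin: "finite Z" using J' finite_J by (auto simp: Z_def intro: finite_subset)
  define p where "p = (\<lambda>g. \<Prod>c\<in>J0. [:- V c g, 1:])"
  have "p \<in> Wpoly" unfolding p_def using J' J0 V_mem by (intro Wpoly_prod Wpoly_linear) auto
  moreover have p: "p g = (\<Prod>z\<in>Z. [:- z, 1:])" if g: "g \<in> \<Gamma>" for g
  proof -
    have inj: "inj_on (\<lambda>c. V c g) J0"
    proof (rule inj_onI)
      fix c d assume cd: "c \<in> J0" "d \<in> J0" "V c g = V d g"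
      note inv_Gamma = subgroup.m_inv_closed[OF subgroup_Gamma g]
      \<comment> \<open>Elements that agree after applying \<open>g\<close> agree before: translate
        back by the inverse of \<open>g\<close>.\<close>
      have "V c (inv g \<otimes> g) = V d (inv g \<otimes> g)"
        by (rule Gamma_eq[OF inv_Gamma, of "\<lambda>k. V c (k \<otimes> g)" "\<lambda>k. V d (k \<otimes> g)"])
          (use cd J0 J' g V_mem in \<open>auto intro!: shift_mem simp: Gamma_carrier\<close>)
      then show "c = d" using cd J0 g by (auto simp: inj_on_def Gamma_carrier)
    qed
    have "(\<lambda>c. V c g) ` J0 \<subseteq> Z"
    proof
      fix z assume "z \<in> (\<lambda>c. V c g) ` J0"
      then obtain c where c: "c \<in> J0" "z = V c g" by blast
      then have "z = V (act g c) \<one>" "act g c \<in> J'" using V_act[OF g] stable[OF g] J0(1) J' by auto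
      then show "z \<in> Z" by (simp add: Z_def)
    qed
    moreover have "card ((\<lambda>c. V c g) ` J0) = card Z"
      using inj J0 by (simp add: card_image)
    ultimately have "(\<lambda>c. V c g) ` J0 = Z" using fin by (simp add: card_subset_eq)
    then have "bij_betw (\<lambda>c. V c g) J0 Z" using inj by (simp add: bij_betw_def)
    from prod.reindex_bij_betw[OF this, of "\<lambda>z. [:- z, 1:]"] show ?thesis by (simp add: p_def)
  qed
  ultimately show ?thesis
    using rational_poly[OF rational_on_Gamma, of p] p[OF one_Gamma] by (simp add: Z_def)
qed

lemma conjugate_roots:
  assumes "c \<in> J" "poly (map_poly to_ac q) (V c \<one>) = 0"
  shows "(\<Prod>z\<in>(\<lambda>c. V c \<one>) ` orb c. [:- z, 1:]) dvd map_poly to_ac q"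
proof (rule prod_linear_dvd)
  show "finite ((\<lambda>c. V c \<one>) ` orb c)" by (simp add: orb_def finite_Gamma)
  fix z assume "z \<in> (\<lambda>c. V c \<one>) ` orb c"
  then obtain h where h: "h \<in> \<Gamma>" "z = V c h" using assms(1) V_act by (auto simp: orb_def)
  then show "poly (map_poly to_ac q) z = 0"
    using poly_mem[OF V_mem[OF assms(1)], of q] assms(2) by (auto simp: \<Gamma>_def)
qed

lemma orbit_poly:
  assumes c: "c \<in> J"
  shows "\<exists>q. map_poly to_ac q = (\<Prod>z\<in>(\<lambda>c. V c \<one>) ` orb c. [:- z, 1:])"
proof (rule values_poly)
  show "act h d \<in> orb c" if "h \<in> \<Gamma>" "d \<in> orb c" for h d
  proof -
    have "act h d \<in> orb d" using that by (auto simp: orb_def)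
    then show ?thesis using orb_eq[OF c that(2)] by simp
  qed
qed (rule orb_subset[OF c])

text \<open>If two indices gave the same root, the product \<open>F0\<close> over the distinct roots
  would be a proper divisor of \<open>F\<close>. A root of the cofactor is also a root of
  \<open>F0\<close>, and the polynomial of its orbit, which has coefficients in \<open>M\<close>,
  would divide both factors; so its square would divide \<open>F\<close>.\<close>

lemma inj_if_squarefree:
  assumes F: "map_poly to_ac F = (\<Prod>c\<in>J. [:- V c \<one>, 1:])" and sf: "squarefree F"
  shows "inj_on (\<lambda>c. V c \<one>) J"
proof (rule ccontr)
  assume not_inj: "\<not> inj_on (\<lambda>c. V c \<one>) J"
  define Z where "Z = (\<lambda>c. V c \<one>) ` J"
  obtain F0 where F0: "map_poly to_ac F0 = (\<Prod>z\<in>Z. [:- z, 1:])"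
    using values_poly[of J] act_closed by (auto simp: Z_def)
  obtain J0 where J0: "J0 \<subseteq> J" "inj_on (\<lambda>c. V c \<one>) J0" "Z = (\<lambda>c. V c \<one>) ` J0"
    unfolding Z_def by (metis subset_image_inj subset_refl)
  have finZ: "finite Z" using finite_J by (simp add: Z_def)
  have "map_poly to_ac F0 = (\<Prod>c\<in>J0. [:- V c \<one>, 1:])"
    using J0 by (simp add: F0 prod.reindex)
  then have "map_poly to_ac F0 dvd map_poly to_ac F"
    using J0 finite_J by (simp add: F prod_dvd_prod_subset)
  then obtain F1 where F1: "F = F0 * F1" by (auto simp: to_ac.map_poly_dvd_iff)
  have "F \<noteq> 0" using sf by auto
  have "card Z < card J"
    using not_inj card_image_le[OF finite_J, of "\<lambda>c. V c \<one>"] eq_card_imp_inj_on[OF finite_J, of "\<lambda>c. V c \<one>"]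
    unfolding Z_def by linarith
  moreover have "Polynomial.degree F = card J" "Polynomial.degree F0 = card Z"
    using degree_prod_linear[of "\<lambda>c. V c \<one>" J] degree_prod_linear[of "\<lambda>z. z" Z]
    by (simp_all flip: F F0)
  ultimately have "Polynomial.degree F1 > 0"
    using \<open>F \<noteq> 0\<close> by (auto simp: F1 degree_mult_eq)
  then obtain z where z: "poly (map_poly to_ac F1) z = 0"
    using alg_closed_imp_poly_has_root[of "map_poly to_ac F1"] by auto
  then have "poly (map_poly to_ac F) z = 0" by (simp add: F1 to_ac.map_poly_mult)
  then obtain c where c: "c \<in> J" "z = V c \<one>" using finite_J by (auto simp: F poly_prod prod_zero_iff)
  obtain q where q: "map_poly to_ac q = (\<Prod>z\<in>(\<lambda>c. V c \<one>) ` orb c. [:- z, 1:])"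
    using orbit_poly[OF c(1)] by blast
  have "q dvd F1"
    using conjugate_roots[OF c(1), of F1] z c by (simp add: to_ac.map_poly_dvd_iff flip: q)
  moreover have "poly (map_poly to_ac F0) (V c \<one>) = 0"
    using finZ c by (auto simp: F0 Z_def poly_prod intro!: prod_zero)
  then have "q dvd F0"
    using conjugate_roots[OF c(1), of F0] by (simp add: to_ac.map_poly_dvd_iff flip: q)
  ultimately have "q\<^sup>2 dvd F" by (simp add: F1 power2_eq_square mult_dvd_mono)
  then have "is_unit q" using sf by (simp add: squarefree_def)
  then have "Polynomial.degree (map_poly to_ac q) = 0" by (metis is_unit_iff_degree not_is_unit_0 to_ac.degree_map_hom)
  moreover have "Polynomial.degree (map_poly to_ac q) = card ((\<lambda>c. V c \<one>) ` orb c)"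
    unfolding q by (rule degree_prod_linear)
  moreover have "card ((\<lambda>c. V c \<one>) ` orb c) > 0"
    using mem_orb[OF c(1)] finite_Gamma by (auto simp: card_gt_0_iff orb_def)
  ultimately show False by simp
qed

text \<open>If \<open>F = q\<^sup>2 * p\<close>, then \<open>q * p\<close> already vanishes at all
  \<open>card J\<close> distinct roots, so \<open>q\<close> has degree 0.\<close>

lemma squarefree_if_inj:
  assumes F: "map_poly to_ac F = (\<Prod>c\<in>J. [:- V c \<one>, 1:])" and inj: "inj_on (\<lambda>c. V c \<one>) J"
  shows "squarefree F"
proof (rule squarefreeI)
  fix q assume dvd: "q\<^sup>2 dvd F"
  have "map_poly to_ac F \<noteq> 0" using finite_J by (simp add: F prod_zero_iff)
  then have "F \<noteq> 0" by auto
  with dvd have "q \<noteq> 0" by auto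
  have "Polynomial.degree q = 0"
  proof (rule ccontr)
    assume "Polynomial.degree q \<noteq> 0"
    obtain p where p: "F = q\<^sup>2 * p" using dvd by (elim dvdE)
    have nz: "p \<noteq> 0" using \<open>F \<noteq> 0\<close> p by auto
    have "Polynomial.degree F \<le> card {c\<in>J. poly (map_poly to_ac (q * p)) (V c \<one>) = 0}"
    proof -
      have "{c\<in>J. poly (map_poly to_ac (q * p)) (V c \<one>) = 0} = J"
      proof -
        have "poly (map_poly to_ac (q * p)) (V c \<one>) = 0" if "c \<in> J" for c
        proof -
          have "poly (map_poly to_ac F) (V c \<one>) = 0"
            using finite_J that by (auto simp: F poly_prod intro!: prod_zero)
          then show ?thesis by (simp add: p to_ac.map_poly_mult power2_eq_square)
        qed
        then show ?thesis by auto
      qed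
      then show ?thesis using degree_prod_linear[of "\<lambda>c. V c \<one>" J] by (simp flip: F)
    qed
    also have "\<dots> = card ((\<lambda>c. V c \<one>) ` {c\<in>J. poly (map_poly to_ac (q * p)) (V c \<one>) = 0})"
      using inj by (intro card_image[symmetric]) (auto simp: inj_on_def)
    also have "\<dots> \<le> card {z. poly (map_poly to_ac (q * p)) z = 0}"
      using nz \<open>q \<noteq> 0\<close> poly_roots_finite[of "map_poly to_ac (q * p)"] by (intro card_mono) auto
    also have "\<dots> \<le> Polynomial.degree (q * p)"
      using nz \<open>q \<noteq> 0\<close> card_poly_roots_bound[of "map_poly to_ac (q * p)"] by simp
    finally show False
      using nz \<open>q \<noteq> 0\<close> \<open>Polynomial.degree q \<noteq> 0\<close> by (simp add: p power2_eq_square degree_mult_eq)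
  qed
  then show "is_unit q" using \<open>q \<noteq> 0\<close> by (simp add: is_unit_iff_degree)
qed

text \<open>A factor over \<open>M\<close> that vanishes at one root vanishes at its whole orbit.
  Hence the polynomial of an orbit has no proper factor, and the orbits give the factorization of
  \<open>F\<close>.\<close>

lemma irr_degrees_orbits:
  assumes F: "map_poly to_ac F = (\<Prod>c\<in>J. [:- V c \<one>, 1:])" and inj: "inj_on (\<lambda>c. V c \<one>) J"
  shows "irr_degrees F = image_mset card (mset_set (orb ` J))"
proof -
  have injO: "inj_on (\<lambda>c. V c \<one>) (orb c)" if "c \<in> J" for c
    using inj orb_subset[OF that] by (rule inj_on_subset)
  have "\<forall>Q\<in>orb ` J. \<exists>q. map_poly to_ac q = (\<Prod>c\<in>Q. [:- V c \<one>, 1:])"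
    using orbit_poly injO by (auto simp: prod.reindex)
  then obtain q where q: "\<And>Q. Q \<in> orb ` J \<Longrightarrow> map_poly to_ac (q Q) = (\<Prod>c\<in>Q. [:- V c \<one>, 1:])"
    by metis
  have deg: "Polynomial.degree (q Q) = card Q" if "Q \<in> orb ` J" for Q
    using degree_prod_linear[of "\<lambda>c. V c \<one>" Q] by (simp flip: q[OF that])
  have irr: "Factorial_Ring.irreducible (q Q)" if "Q \<in> orb ` J" for Q
  proof -
    from that obtain c where c: "c \<in> J" "Q = orb c" by blast
    have pos: "card Q > 0" using mem_orb[OF c(1)] finite_Gamma by (auto simp: card_gt_0_iff orb_def c)
    have nz: "q Q \<noteq> 0" using deg[OF that] pos by auto
    have factor: "is_unit b" if ab: "q Q = a * b" and root: "poly (map_poly to_ac a) (V c \<one>) = 0" for a b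
    proof -
      have "map_poly to_ac (q Q) dvd map_poly to_ac a"
        using conjugate_roots[OF c(1) root] injO[OF c(1)] q[OF \<open>Q \<in> orb ` J\<close>] c by (simp add: prod.reindex)
      then have "a * b dvd a * 1" by (simp add: to_ac.map_poly_dvd_iff ab)
      moreover have "a \<noteq> 0" using nz ab by auto
      ultimately show ?thesis using dvd_mult_cancel_left by blast
    qed
    show ?thesis
    proof (rule irreducibleI[OF nz])
      show "\<not> is_unit (q Q)" using deg[OF that] pos by (auto simp: is_unit_iff_degree[OF nz])
      fix a b assume ab: "q Q = a * b"
      have "poly (map_poly to_ac (q Q)) (V c \<one>) = 0"
      proof -
        have "finite Q" "c \<in> Q" using mem_orb[OF c(1)] finite_Gamma by (auto simp: c orb_def)
        then show ?thesis unfolding q[OF that] by (auto simp: poly_prod intro!: prod_zero)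
      qed
      then have "poly (map_poly to_ac a) (V c \<one>) = 0 \<or> poly (map_poly to_ac b) (V c \<one>) = 0"
        by (simp add: ab to_ac.map_poly_mult)
      then show "is_unit a \<or> is_unit b" using factor[OF ab] factor[of b a] ab by (auto simp: mult.commute)
    qed
  qed
  have fin: "finite (orb ` J)" using finite_J by simp
  have "F = (\<Prod>Q\<in>orb ` J. q Q)"
  proof -
    have "map_poly to_ac (\<Prod>Q\<in>orb ` J. q Q) = (\<Prod>Q\<in>orb ` J. \<Prod>c\<in>Q. [:- V c \<one>, 1:])"
      unfolding to_ac.map_poly_prod by (rule prod.cong) (simp_all add: q)
    also have "\<dots> = (\<Prod>c\<in>\<Union>(orb ` J). [:- V c \<one>, 1:])"
    proof (rule prod.Union_disjoint[unfolded comp_def, symmetric])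
      show "\<forall>A\<in>orb ` J. finite A" by (auto simp: orb_def finite_Gamma)
      show "\<forall>A\<in>orb ` J. \<forall>B\<in>orb ` J. A \<noteq> B \<longrightarrow> A \<inter> B = {}"
        using orb_eq by blast
    qed
    also have "\<Union>(orb ` J) = J" using orb_subset mem_orb by blast
    finally show ?thesis using F by (metis to_ac.map_poly_hom_eq_iff)
  qed
  then have "F = Polynomial.smult 1 (prod_mset (image_mset q (mset_set (orb ` J))))"
    by (simp add: prod_unfold_prod_mset)
  then have "irr_degrees F = image_mset Polynomial.degree (image_mset q (mset_set (orb ` J)))"
    by (intro irr_degrees_eqI[of 1]) (use irr fin in auto)
  also have "\<dots> = image_mset card (mset_set (orb ` J))"
    using deg fin by (auto simp: multiset.map_comp intro!: image_mset_cong)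
  finally show ?thesis .
qed

end

section \<open>The dihedral group and pentagon sequences\<close>

lemma group_gen_dihedral:
  assumes "comm_group A"
  shows "group (gen_dihedral A)"
proof -
  interpret comm_group A by fact
  show ?thesis
  proof (rule groupI)
    show "\<one>\<^bsub>gen_dihedral A\<^esub> \<in> carrier (gen_dihedral A)" by (simp add: gen_dihedral_def)
  next
    fix g h assume "g \<in> carrier (gen_dihedral A)" "h \<in> carrier (gen_dihedral A)"
    then show "g \<otimes>\<^bsub>gen_dihedral A\<^esub> h \<in> carrier (gen_dihedral A)"
      by (auto simp: gen_dihedral_def)
  next
    fix g h k assume "g \<in> carrier (gen_dihedral A)" "h \<in> carrier (gen_dihedral A)" "k \<in> carrier (gen_dihedral A)"
    then show "g \<otimes>\<^bsub>gen_dihedral A\<^esub> h \<otimes>\<^bsub>gen_dihedral A\<^esub> k = g \<otimes>\<^bsub>gen_dihedral A\<^esub> (h \<otimes>\<^bsub>gen_dihedral A\<^esub> k)"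
      by (auto simp: gen_dihedral_def m_assoc inv_mult)
  next
    fix g assume "g \<in> carrier (gen_dihedral A)"
    then show "\<one>\<^bsub>gen_dihedral A\<^esub> \<otimes>\<^bsub>gen_dihedral A\<^esub> g = g" by (auto simp: gen_dihedral_def)
  next
    fix g assume g: "g \<in> carrier (gen_dihedral A)"
    then obtain u d where ud: "g = (u, d)" "u \<in> carrier A" by (auto simp: gen_dihedral_def)
    show "\<exists>h\<in>carrier (gen_dihedral A). h \<otimes>\<^bsub>gen_dihedral A\<^esub> g = \<one>\<^bsub>gen_dihedral A\<^esub>"
      using ud by (intro bexI[of _ "(if d then u else inv\<^bsub>A\<^esub> u, d)"]) (auto simp: gen_dihedral_def)
  qed
qed

interpretation D5: group D5
  by (rule group_gen_dihedral) simp

lemma carrier_D5: "carrier D5 = {0..<5} \<times> UNIV"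
  by (simp add: gen_dihedral_def carrier_integer_mod_group)

lemma one_D5: "\<one>\<^bsub>D5\<^esub> = (0, False)"
  by (simp add: gen_dihedral_def)

lemma mult_D5:
  "v \<in> {0..<5} \<Longrightarrow> (u, d) \<otimes>\<^bsub>D5\<^esub> (v, e) = ((if d then u - v else u + v) mod 5, d \<noteq> e)"
  by (simp add: gen_dihedral_def carrier_integer_mod_group mod_add_right_eq)

lemma finite_D5: "finite (carrier D5)"
  by (simp add: carrier_D5)

text \<open>The action of \<open>(u, d)\<close> on the indices of a pentagon, as a rotation or a
  reflection. The result is not reduced, so composition agrees with the product of \<open>D5\<close>
  only modulo 5, which is enough for sequences of period 5.\<close>

definition aff :: "int \<times> bool \<Rightarrow> int \<Rightarrow> int" where
  "aff a i = (if snd a then fst a - i else fst a + i)"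

lemma aff_simps [simp]: "aff (u, False) i = u + i" "aff (u, True) i = u - i"
  by (simp_all add: aff_def)

text \<open>
  The relations say that consecutive values are \<open>x, \<sigma>(x), \<sigma>\<^sup>2(x), \<dots>\<close>; they are invariant under the
  dihedral group acting on the indices.
\<close>

locale pentagon =
  fixes x :: "int \<Rightarrow> 'f::field"
  assumes period [simp]: "x (i + 5) = x i"
    and rel: "x (i - 1) * x (i + 1) = 1 - x i"
    and nz [simp]: "x i \<noteq> 0"

definition pent_t :: "(int \<Rightarrow> 'f::field) \<Rightarrow> 'f" where
  "pent_t x = - (x 0 * x 1 * x 2 * x 3 * x 4)"

definition pent_s :: "(int \<Rightarrow> 'f::field) \<Rightarrow> 'f" where
  "pent_s x = (x 0 - 1) * (x 1 - 1) + (x 1 - 1) * (x 2 - 1) + (x 2 - 1) * (x 3 - 1) +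
     (x 3 - 1) * (x 4 - 1) + (x 4 - 1) * (x 0 - 1)"

lemma mod5_cases:
  fixes i :: int
  obtains "i mod 5 = 0" | "i mod 5 = 1" | "i mod 5 = 2" | "i mod 5 = 3" | "i mod 5 = 4"
  using pos_mod_bound[of 5 i] pos_mod_sign[of 5 i] by linarith

lemma mod5_shift:
  fixes i :: int
  shows "i mod 5 = r \<Longrightarrow> (i + 1) mod 5 = (r + 1) mod 5" "i mod 5 = r \<Longrightarrow> (i - 1) mod 5 = (r - 1) mod 5"
  by (metis mod_add_left_eq) (metis mod_diff_left_eq)

lemma atLeastLessThan5: "{0..<5} = {0, 1, 2, 3, 4 :: int}"
  by auto


section \<open>Elementary symmetric functions of a pentagon\<close>

lemma pentagon_e1:
  fixes a b c d e :: "'f::field"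
  assumes h1: "a * c = 1 - b" and h2: "b * d = 1 - c" and h3: "c * e = 1 - d"
    and h4: "d * a = 1 - e" and h5: "e * b = 1 - a"
  shows "a + b + c + d + e = 3 + a * b * c * d * e"
proof -
  have "a * b * c * d * e = (a * c) * (e * b) * d" by (simp add: mult_ac)
  also have "\<dots> = d - d * a - b * d + a * (b * d)" unfolding h1 h5 by (simp add: algebra_simps)
  also have "\<dots> = d - (1 - e) - (1 - c) + a - a * c" unfolding h4 h2 by (simp add: algebra_simps)
  also have "\<dots> = a + b + c + d + e - 3" unfolding h1 by simp
  finally show ?thesis by simp
qed

text \<open>The relations make products of two non-adjacent entries linear. What remains are the sum
  \<open>E\<close>, the adjacent products \<open>q\<close> and the squares \<open>p\<close>, and
  \<open>p\<close> is eliminated by expanding the square of \<open>E\<close>. All identities have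
  integer coefficients, so they hold in every characteristic.\<close>

lemma pentagon_e234:
  fixes a b c d e s t :: "'f::field"
  assumes h1: "a * c = 1 - b" and h2: "b * d = 1 - c" and h3: "c * e = 1 - d"
    and h4: "d * a = 1 - e" and h5: "e * b = 1 - a"
    and t: "t = 3 - (a + b + c + d + e)"
    and s: "s = (a - 1) * (b - 1) + (b - 1) * (c - 1) + (c - 1) * (d - 1) + (d - 1) * (e - 1) + (e - 1) * (a - 1)"
  shows "a * b + a * c + a * d + a * e + b * c + b * d + b * e + c * d + c * e + d * e = s - t + 3"
    and "a * b * c + a * b * d + a * b * e + a * c * d + a * c * e + a * d * e + b * c * d + b * c * e
      + b * d * e + c * d * e = - (t\<^sup>2 - t - 2 * s - 1)"
    and "a * b * c * d + a * b * c * e + a * b * d * e + a * c * d * e + b * c * d * e = s"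
proof -
  define E where "E = a + b + c + d + e"
  define q where "q = a * b + b * c + c * d + d * e + e * a"
  define p where "p = a * a + b * b + c * c + d * d + e * e"
  have r: "a * c + b * d + c * e + d * a + e * b = 5 - E" unfolding h1 h2 h3 h4 h5 by (simp add: E_def)
  have s': "s = q - 2 * E + 5" by (simp add: s q_def E_def algebra_simps)
  have "E * E = p + 2 * q + 2 * (a * c + b * d + c * e + d * a + e * b)"
    by (simp add: E_def p_def q_def algebra_simps)
  then have E2: "E * E = p + 2 * q + 2 * (5 - E)" unfolding r .
  have "a * b + a * c + a * d + a * e + b * c + b * d + b * e + c * d + c * e + d * e
      = q + (a * c + b * d + c * e + d * a + e * b)" by (simp add: q_def algebra_simps)
  then show "a * b + a * c + a * d + a * e + b * c + b * d + b * e + c * d + c * e + d * e = s - t + 3"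
    unfolding r s' by (simp add: t E_def)
  have "a * b * c + a * b * d + a * b * e + a * c * d + a * c * e + a * d * e + b * c * d + b * c * e
      + b * d * e + c * d * e
    = b * (a * c) + c * (b * d) + d * (c * e) + e * (d * a) + a * (e * b)
      + (a * (b * d) + b * (c * e) + c * (d * a) + d * (e * b) + e * (a * c))" by (simp add: algebra_simps)
  also have "\<dots> = b * (1 - b) + c * (1 - c) + d * (1 - d) + e * (1 - e) + a * (1 - a)
      + (a * (1 - c) + b * (1 - d) + c * (1 - e) + d * (1 - a) + e * (1 - b))"
    by (simp only: h1 h2 h3 h4 h5)
  also have "\<dots> = 2 * E - p - (a * c + b * d + c * e + d * a + e * b)"
    by (simp add: E_def p_def algebra_simps)
  finally have "a * b * c + a * b * d + a * b * e + a * c * d + a * c * e + a * d * e + b * c * d + b * c * e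
      + b * d * e + c * d * e = 2 * E - p - (a * c + b * d + c * e + d * a + e * b)" .
  note T3 = this
  show "a * b * c + a * b * d + a * b * e + a * c * d + a * c * e + a * d * e + b * c * d + b * c * e
      + b * d * e + c * d * e = - (t\<^sup>2 - t - 2 * s - 1)"
  proof -
    have t': "t = 3 - E" by (simp add: t E_def)
    have t2: "t\<^sup>2 = 9 - 6 * E + (p + 2 * q + 2 * (5 - E))"
      unfolding E2[symmetric] by (simp add: t' power2_eq_square algebra_simps)
    show ?thesis unfolding T3 r t2 unfolding s' t' by (simp add: algebra_simps)
  qed
  have "a * b * c * d + a * b * c * e + a * b * d * e + a * c * d * e + b * c * d * e
    = (a * c) * (b * d) + (a * c) * (e * b) + (d * a) * (e * b) + (d * a) * (c * e) + (b * d) * (c * e)"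
    by (simp add: algebra_simps)
  also have "\<dots> = s" unfolding h1 h2 h3 h4 h5 by (simp add: s algebra_simps)
  finally show "a * b * c * d + a * b * c * e + a * b * d * e + a * c * d * e + b * c * d * e = s" .
qed

lemma prod_linear_5:
  fixes a b c d e :: "'f::field"
  shows "[:- a, 1:] * ([:- b, 1:] * ([:- c, 1:] * ([:- d, 1:] * [:- e, 1:]))) =
    [: - (a * b * c * d * e),
     a * b * c * d + a * b * c * e + a * b * d * e + a * c * d * e + b * c * d * e,
     - (a * b * c + a * b * d + a * b * e + a * c * d + a * c * e + a * d * e + b * c * d + b * c * e
      + b * d * e + c * d * e),
     a * b + a * c + a * d + a * e + b * c + b * d + b * e + c * d + c * e + d * e,
     - (a + b + c + d + e), 1:]"
proof -
  have 1: "[:- d, 1:] * [:- e, 1:] = [:d * e, - (d + e), 1:]" by simp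
  have 2: "[:- c, 1:] * [:d * e, - (d + e), 1:] = [:- (c * d * e), c * d + c * e + d * e, - (c + d + e), 1:]"
    by (simp add: algebra_simps)
  have 3: "[:- b, 1:] * [:- (c * d * e), c * d + c * e + d * e, - (c + d + e), 1:] =
    [:b * c * d * e, - (b * c * d + b * c * e + b * d * e + c * d * e),
      b * c + b * d + b * e + c * d + c * e + d * e, - (b + c + d + e), 1:]"
    by (simp add: algebra_simps)
  show ?thesis unfolding 1 2 3 by (simp add: algebra_simps)
qed

context pentagon
begin

lemma period_mult: "x (i + 5 * k) = x i"
proof (induction k rule: int_induct[where k = 0])
  case (step1 k)
  have "i + 5 * (k + 1) = (i + 5 * k) + 5" by simp
  then show ?case using step1 period[of "i + 5 * k"] by (simp only:)
next
  case (step2 k)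
  have "i + 5 * k = (i + 5 * (k - 1)) + 5" by simp
  then show ?case using step2 period[of "i + 5 * (k - 1)"] by (simp only:)
qed simp

lemma x_mod: "x (i mod 5) = x i"
  using period_mult[of "i mod 5" "i div 5"] by simp

lemma x_cong: "i mod 5 = j mod 5 \<Longrightarrow> x i = x j"
  by (metis x_mod)

lemma pentagon_aff: "pentagon (\<lambda>i. x (aff a i))"
proof (cases a)
  case (Pair u d)
  have 1: "x (u - (i + 5)) = x (u - i)" for i
    using period[of "u - i - 5"] by (simp add: algebra_simps)
  have 2: "x (u - (i - 1)) * x (u - (i + 1)) = 1 - x (u - i)" for i
    using rel[of "u - i"] by (simp add: algebra_simps)
  have 3: "x (u + (i - 1)) * x (u + (i + 1)) = 1 - x (u + i)" for i
    using rel[of "u + i"] by (simp add: algebra_simps)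
  have 4: "x (u + (i + 5)) = x (u + i)" for i
    using period[of "u + i"] by (simp add: algebra_simps)
  show ?thesis by (cases d; unfold_locales) (auto simp: Pair 1 2 3 4)
qed

lemma rels:
  "x 0 * x 2 = 1 - x 1" "x 1 * x 3 = 1 - x 2" "x 2 * x 4 = 1 - x 3"
  "x 3 * x 0 = 1 - x 4" "x 4 * x 1 = 1 - x 0"
proof -
  have "x 5 = x 0" "x (-1) = x 4" by (rule x_cong; simp)+
  then show "x 0 * x 2 = 1 - x 1" "x 1 * x 3 = 1 - x 2" "x 2 * x 4 = 1 - x 3"
    "x 3 * x 0 = 1 - x 4" "x 4 * x 1 = 1 - x 0"
    using rel[of 1] rel[of 2] rel[of 3] rel[of 4] rel[of 0] by simp_all
qed

lemma e1: "x 0 + x 1 + x 2 + x 3 + x 4 = 3 - pent_t x"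
  using pentagon_e1[OF rels] by (simp add: pent_t_def)

lemma pent_rotate: "pent_t (\<lambda>i. x (i + 1)) = pent_t x" "pent_s (\<lambda>i. x (i + 1)) = pent_s x"
proof -
  have "x 5 = x 0" by (rule x_cong) simp
  then show "pent_t (\<lambda>i. x (i + 1)) = pent_t x" "pent_s (\<lambda>i. x (i + 1)) = pent_s x"
    by (simp_all add: pent_t_def pent_s_def mult_ac add_ac)
qed

lemma pent_reflect: "pent_t (\<lambda>i. x (- i)) = pent_t x" "pent_s (\<lambda>i. x (- i)) = pent_s x"
proof -
  have "x (- 1) = x 4" "x (- 2) = x 3" "x (- 3) = x 2" "x (- 4) = x 1" by (rule x_cong; simp)+
  then show "pent_t (\<lambda>i. x (- i)) = pent_t x" "pent_s (\<lambda>i. x (- i)) = pent_s x"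
    by (simp_all add: pent_t_def pent_s_def mult_ac add_ac)
qed

end

text \<open>All index maps are composed of rotations by one step and the reflection, and each of
  these only rearranges the defining expressions.\<close>

lemma (in pentagon) pent_invariant:
  "pent_t (\<lambda>i. x (aff a i)) = pent_t x" "pent_s (\<lambda>i. x (aff a i)) = pent_s x"
proof -
  define f where "f u = (pent_t (\<lambda>i. x (u + i)), pent_s (\<lambda>i. x (u + i)))" for u
  have step: "f (u + 1) = f u" for u
  proof -
    interpret u: pentagon "\<lambda>i. x (u + i)" using pentagon_aff[of "(u, False)"] by simp
    show ?thesis using u.pent_rotate by (simp add: f_def add_ac)
  qed
  have f: "f u = f 0" for u
  proof (induction u rule: int_induct[where k = 0])
    case (step2 i)
    then show ?case using step[of "i - 1"] by simp
  qed (simp_all add: step)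
  obtain u d where a: "a = (u, d)" by (cases a)
  interpret u: pentagon "\<lambda>i. x (u + i)" using pentagon_aff[of "(u, False)"] by simp
  have "pent_t (\<lambda>i. x (aff a i)) = pent_t (\<lambda>i. x (u + i)) \<and> pent_s (\<lambda>i. x (aff a i)) = pent_s (\<lambda>i. x (u + i))"
    using u.pent_reflect by (cases d) (simp_all add: a)
  then show "pent_t (\<lambda>i. x (aff a i)) = pent_t x" "pent_s (\<lambda>i. x (aff a i)) = pent_s x"
    using f[of u] by (simp_all add: f_def)
qed

context pentagon
begin

lemma t_nz [simp]: "pent_t x \<noteq> 0"
  by (simp add: pent_t_def)

lemma elementary_symmetric:
  defines "s \<equiv> pent_s x" and "t \<equiv> pent_t x"
  shows "x 0 * x 1 + x 0 * x 2 + x 0 * x 3 + x 0 * x 4 + x 1 * x 2 + x 1 * x 3 + x 1 * x 4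
      + x 2 * x 3 + x 2 * x 4 + x 3 * x 4 = s - t + 3"
    and "x 0 * x 1 * x 2 + x 0 * x 1 * x 3 + x 0 * x 1 * x 4 + x 0 * x 2 * x 3 + x 0 * x 2 * x 4
      + x 0 * x 3 * x 4 + x 1 * x 2 * x 3 + x 1 * x 2 * x 4 + x 1 * x 3 * x 4 + x 2 * x 3 * x 4
      = - (t\<^sup>2 - t - 2 * s - 1)"
    and "x 0 * x 1 * x 2 * x 3 + x 0 * x 1 * x 2 * x 4 + x 0 * x 1 * x 3 * x 4 + x 0 * x 2 * x 3 * x 4
      + x 1 * x 2 * x 3 * x 4 = s"
proof -
  have t: "t = 3 - (x 0 + x 1 + x 2 + x 3 + x 4)" using e1 by (simp add: t_def algebra_simps)
  have s: "s = (x 0 - 1) * (x 1 - 1) + (x 1 - 1) * (x 2 - 1) + (x 2 - 1) * (x 3 - 1) +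
     (x 3 - 1) * (x 4 - 1) + (x 4 - 1) * (x 0 - 1)" by (simp add: s_def pent_s_def)
  note E = pentagon_e234[OF rels t s]
  show "x 0 * x 1 + x 0 * x 2 + x 0 * x 3 + x 0 * x 4 + x 1 * x 2 + x 1 * x 3 + x 1 * x 4
      + x 2 * x 3 + x 2 * x 4 + x 3 * x 4 = s - t + 3" by (rule E)
  show "x 0 * x 1 * x 2 + x 0 * x 1 * x 3 + x 0 * x 1 * x 4 + x 0 * x 2 * x 3 + x 0 * x 2 * x 4
      + x 0 * x 3 * x 4 + x 1 * x 2 * x 3 + x 1 * x 2 * x 4 + x 1 * x 3 * x 4 + x 2 * x 3 * x 4
      = - (t\<^sup>2 - t - 2 * s - 1)" by (rule E)
  show "x 0 * x 1 * x 2 * x 3 + x 0 * x 1 * x 2 * x 4 + x 0 * x 1 * x 3 * x 4 + x 0 * x 2 * x 3 * x 4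
      + x 1 * x 2 * x 3 * x 4 = s" by (rule E)
qed

lemma fD5_eq_prod: "fD5 (pent_s x) (pent_t x) = (\<Prod>i\<in>{0..<5}. [:- x i, 1:])"
proof -
  have 1: "(\<Prod>i\<in>{0..<5}. [:- x i, 1:]) = [:- x 0, 1:] * ([:- x 1, 1:] * ([:- x 2, 1:] * ([:- x 3, 1:] * [:- x 4, 1:])))"
    by (simp only: atLeastLessThan5) (simp del: mult_pCons_left mult_pCons_right)
  show ?thesis
    unfolding 1 prod_linear_5 elementary_symmetric e1 by (simp add: fD5_def pent_t_def)
qed

lemma fD5_root: "poly (fD5 (pent_s x) (pent_t x)) (x i) = 0"
proof -
  have "i mod 5 \<in> {0..<5}" by simp
  then have "poly (fD5 (pent_s x) (pent_t x)) (x (i mod 5)) = 0"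
    unfolding fD5_eq_prod by (auto simp: poly_prod intro!: prod_zero)
  then show ?thesis by (simp add: x_mod)
qed

text \<open>Hence 1 is not a root when \<open>t \<noteq> 0\<close>, and the factors
  \<open>x i - 1\<close> that become denominators below are invertible.\<close>

lemma fD5_at_1: "poly (fD5 s t) 1 = (t :: 'f)\<^sup>2"
  by (simp add: fD5_def algebra_simps)

lemma x_ne_1 [simp]: "x i \<noteq> 1"
proof
  assume "x i = 1"
  then show False using fD5_root[of i] fD5_at_1 by simp
qed

text \<open>So the neighbours of an entry are the roots of a quadratic whose coefficients involve
  only that entry and \<open>t\<close>. The existence of pentagons and the normal form used in the
  descent both rest on it.\<close>

lemma neighbours:
  "x 4 + x 1 = - (x 0 - 2) - pent_t x * x 0 / (x 0 - 1)"
  "x 4 * x 1 = 1 - x 0"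
proof -
  have "(x 4 + x 1) * (x 0 - 1) = - (x 0 - 2) * (x 0 - 1) - pent_t x * x 0"
  proof -
    have t: "pent_t x = 3 - (x 0 + x 1 + x 2 + x 3 + x 4)" using e1 by simp
    have "pent_t x * x 0 = 3 * x 0 - x 0 * x 0 - x 1 * x 0 - x 0 * x 2 - x 3 * x 0 - x 4 * x 0"
      unfolding t by (simp add: algebra_simps)
    then show ?thesis unfolding rels by (simp add: algebra_simps)
  qed
  then show "x 4 + x 1 = - (x 0 - 2) - pent_t x * x 0 / (x 0 - 1)"
    by (simp add: field_simps)
qed (rule rels)

end


section \<open>Pentagons determined by two consecutive entries\<close>

definition pent :: "'f::field \<Rightarrow> 'f \<Rightarrow> int \<Rightarrow> 'f" where
  "pent x y i = (let r = i mod 5 in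
     if r = 0 then x else if r = 1 then y else if r = 2 then (1 - y) / x
     else if r = 3 then (x + y - 1) / (x * y) else (1 - x) / y)"

lemma pent_simps [simp]:
  "pent x y 0 = x" "pent x y 1 = y" "pent x y 2 = (1 - y) / x" "pent x y 3 = (x + y - 1) / (x * y)"
  "pent x y 4 = (1 - x) / y"
  by (simp_all add: pent_def)

lemma pentagon_pent:
  assumes "x \<noteq> 0" "y \<noteq> 0" "y \<noteq> 1" "x + y \<noteq> 1" "x \<noteq> (1 :: 'f::field)"
  shows "pentagon (pent x y)"
proof
  have per: "pent x y i = pent x y (i mod 5)" for i by (simp add: pent_def)
  show "pent x y (i + 5) = pent x y i" for i by (simp add: pent_def)
  have nz: "x + y - 1 \<noteq> 0" "1 - x \<noteq> 0" "1 - y \<noteq> 0" using assms by (auto simp: algebra_simps)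
  show "pent x y i \<noteq> 0" for i using assms nz by (simp add: pent_def Let_def)
  show "pent x y (i - 1) * pent x y (i + 1) = 1 - pent x y i" for i
  proof (cases rule: mod5_cases[of i])
    case 1
    then have "pent x y i = pent x y 0" "pent x y (i - 1) = pent x y 4" "pent x y (i + 1) = pent x y 1"
      by (simp_all add: per[of i] per[of "i - 1"] per[of "i + 1"] mod5_shift)
    then show ?thesis using assms by simp
  next
    case 2
    then have "pent x y i = pent x y 1" "pent x y (i - 1) = pent x y 0" "pent x y (i + 1) = pent x y 2"
      by (simp_all add: per[of i] per[of "i - 1"] per[of "i + 1"] mod5_shift)
    then show ?thesis using assms by simp
  next
    case 3
    then have "pent x y i = pent x y 2" "pent x y (i - 1) = pent x y 1" "pent x y (i + 1) = pent x y 3"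
      by (simp_all add: per[of i] per[of "i - 1"] per[of "i + 1"] mod5_shift)
    note e = this
    show ?thesis unfolding e pent_simps using assms(1,2) by (simp add: field_simps)
  next
    case 4
    then have "pent x y i = pent x y 3" "pent x y (i - 1) = pent x y 2" "pent x y (i + 1) = pent x y 4"
      by (simp_all add: per[of i] per[of "i - 1"] per[of "i + 1"] mod5_shift)
    note e = this
    show ?thesis unfolding e pent_simps using assms(1,2) by (simp add: field_simps)
  next
    case 5
    then have "pent x y i = pent x y 4" "pent x y (i - 1) = pent x y 3" "pent x y (i + 1) = pent x y 0"
      by (simp_all add: per[of i] per[of "i - 1"] per[of "i + 1"] mod5_shift)
    note e = this
    show ?thesis unfolding e pent_simps using assms(1,2) by (simp add: field_simps)
  qed
qed

lemma (in pentagon) eq_pent: "x i = pent (x 0) (x 1) i"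
proof -
  have 2: "x 2 = (1 - x 1) / x 0" and 4: "x 4 = (1 - x 0) / x 1"
    using rels by (simp_all add: field_simps)
  have "x 0 * x 1 * x 3 = x 0 * (1 - x 2)" using rels(2) by simp
  also have "\<dots> = x 0 + x 1 - 1" using rels(1) by (simp add: algebra_simps)
  finally have 3: "x 3 = (x 0 + x 1 - 1) / (x 0 * x 1)" by (simp add: field_simps)
  have "x i = x (i mod 5)" by (simp add: x_mod)
  also have "\<dots> = pent (x 0) (x 1) (i mod 5)"
    by (cases rule: mod5_cases[of i]) (simp_all only: pent_simps 2[symmetric] 3[symmetric] 4[symmetric])
  also have "\<dots> = pent (x 0) (x 1) i" by (simp add: pent_def)
  finally show ?thesis .
qed

lemma pent_t_pent: "x \<noteq> 0 \<Longrightarrow> y \<noteq> 0 \<Longrightarrow> pent_t (pent x y) = - ((x - 1) * (y - 1) * (x + y - 1)) / (x * y)"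
  by (simp add: pent_t_def field_simps)

text \<open>Take a root \<open>x\<close> of the quintic and a root \<open>y\<close> of the quadratic
  for its neighbours. The quadratic yields the right \<open>t\<close>. Then \<open>s\<close> is
  right as well, because the quintic is linear in \<open>s\<close> with the coefficient
  \<open>x * (x - 1)\<^sup>2\<close>, which is nonzero.\<close>

lemma pentagon_exists:
  fixes s t :: "'f::alg_closed_field"
  assumes t: "t \<noteq> 0"
  shows "\<exists>x. pentagon x \<and> pent_s x = s \<and> pent_t x = t"
proof -
  have "Polynomial.degree (fD5 s t) = 5" by (simp add: fD5_def)
  then obtain x where x: "poly (fD5 s t) x = 0"
    using alg_closed_imp_poly_has_root[of "fD5 s t"] by auto
  have x0: "x \<noteq> 0" using x t by (auto simp: fD5_def)
  have "poly (fD5 s t) 1 = t\<^sup>2" by (simp add: fD5_def algebra_simps)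
  then have x1: "x \<noteq> 1" using x t by auto
  \<comment> \<open>The quadratic with the sum and the product of roots from
    \<open>neighbours\<close>, multiplied by \<open>x - 1\<close>.\<close>
  have "Polynomial.degree [:- ((x - 1)\<^sup>2), (x - 1) * (x - 2) + t * x, x - 1:] = 2" using x1 by simp
  then obtain y where "poly [:- ((x - 1)\<^sup>2), (x - 1) * (x - 2) + t * x, x - 1:] y = 0"
    using alg_closed_imp_poly_has_root[of "[:- ((x - 1)\<^sup>2), (x - 1) * (x - 2) + t * x, x - 1:]"] by auto
  then have y: "(x - 1) * y\<^sup>2 + ((x - 1) * (x - 2) + t * x) * y = (x - 1)\<^sup>2"
    by (simp add: algebra_simps power2_eq_square)
  have y0: "y \<noteq> 0" using y x1 by auto
  have txy: "t * (x * y) = - ((x - 1) * (y - 1) * (x + y - 1))"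
    using y by (simp add: algebra_simps power2_eq_square)
  have "t * (x * y) \<noteq> 0" using t x0 y0 by simp
  then have nz: "y \<noteq> 1" "x + y \<noteq> 1" unfolding txy by auto
  interpret pentagon "pent x y" using pentagon_pent[OF x0 y0 nz x1] .
  have T: "pent_t (pent x y) = t" using txy x0 y0 by (simp add: pent_t_pent field_simps)
  have "poly (fD5 (pent_s (pent x y)) t) x = 0" using fD5_root[of 0] T by simp
  moreover have "poly (fD5 u t) x - poly (fD5 s t) x = (u - s) * (x * (x - 1)\<^sup>2)" for u
    by (simp add: fD5_def algebra_simps power2_eq_square)
  ultimately have "(pent_s (pent x y) - s) * (x * (x - 1)\<^sup>2) = 0" using x by (metis diff_self)
  then have "pent_s (pent x y) = s" using x0 x1 by simp
  with T show ?thesis using pentagon_axioms by blast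
qed

section \<open>Dihedral symmetric functions of pentagons\<close>

text \<open>Closure under sums and products only; constants enter as generators. Substitution and
  invariance statements are then proved generator by generator.\<close>

inductive_set fun_alg :: "('i \<Rightarrow> 'f::field) set \<Rightarrow> ('i \<Rightarrow> 'f) set" for K where
  gen: "u \<in> K \<Longrightarrow> u \<in> fun_alg K"
| add: "u \<in> fun_alg K \<Longrightarrow> v \<in> fun_alg K \<Longrightarrow> (\<lambda>g. u g + v g) \<in> fun_alg K"
| mult: "u \<in> fun_alg K \<Longrightarrow> v \<in> fun_alg K \<Longrightarrow> (\<lambda>g. u g * v g) \<in> fun_alg K"

lemma fun_alg_subst:
  assumes "u \<in> fun_alg K" "\<And>v. v \<in> K \<Longrightarrow> (\<lambda>g. v (f g)) \<in> fun_alg K'"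
  shows "(\<lambda>g. u (f g)) \<in> fun_alg K'"
  using assms(1) by induction (auto intro: assms(2) fun_alg.intros)

lemma fun_alg_invariant:
  assumes "u \<in> fun_alg K" "\<And>v. v \<in> K \<Longrightarrow> v g = v h"
  shows "u g = u h"
  using assms(1) by induction (auto simp: assms(2))

text \<open>
  Every polynomial expression in \<open>X = x(a0)\<close> and its neighbours can be written as
  \<open>\<alpha>(X) + \<beta>(X)Y\<close> with \<open>Y = x(a1)\<close> and \<open>\<alpha>\<close>, \<open>\<beta>\<close> of degree less than 5; if it does not depend on \<open>a\<close>,
  then it is the constant coefficient of \<open>\<alpha>\<close>.
\<close>

locale symmetric_descent = pentagon x for x :: "int \<Rightarrow> 'f::field" +
  fixes R :: "('b \<Rightarrow> 'f) set" and B :: "'f set"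
  assumes inj: "inj_on x {0..<5}"
    and R_add: "u \<in> R \<Longrightarrow> v \<in> R \<Longrightarrow> (\<lambda>b. u b + v b) \<in> R"
    and R_mult: "u \<in> R \<Longrightarrow> v \<in> R \<Longrightarrow> (\<lambda>b. u b * v b) \<in> R"
    and R_const: "c \<in> B \<Longrightarrow> (\<lambda>_. c) \<in> R"
    and B_add: "c \<in> B \<Longrightarrow> d \<in> B \<Longrightarrow> c + d \<in> B" and B_mult: "c \<in> B \<Longrightarrow> d \<in> B \<Longrightarrow> c * d \<in> B"
    and B_minus: "c \<in> B \<Longrightarrow> - c \<in> B"
    and B_one: "1 \<in> B" and B_s: "pent_s x \<in> B" and B_t: "pent_t x \<in> B" and B_t': "inverse (pent_t x) \<in> B"
begin

lemma B_diff: "c \<in> B \<Longrightarrow> d \<in> B \<Longrightarrow> c - d \<in> B"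
  using B_add[OF _ B_minus, of c d] by simp

lemma B_zero: "0 \<in> B" using B_diff[OF B_one B_one] by simp

lemma B_numeral: "numeral n \<in> B"
proof -
  have "of_nat k \<in> B" for k by (induction k) (auto simp: B_zero B_add B_one)
  from this[of "numeral n"] show ?thesis by simp
qed

lemmas B_intros = B_add B_mult B_minus B_diff B_one B_s B_t B_t' B_zero B_numeral

definition over_B :: "'f poly \<Rightarrow> bool" where "over_B p \<longleftrightarrow> (\<forall>n. Polynomial.coeff p n \<in> B)"

lemma over_B_pCons [simp]: "over_B (pCons c p) \<longleftrightarrow> c \<in> B \<and> over_B p"
  unfolding over_B_def coeff_pCons
  by (metis (no_types, lifting) nat.case(1,2) not0_implies_Suc)

lemma over_B_0 [simp]: "over_B 0" by (simp add: over_B_def B_zero)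

lemma over_B_diff: "over_B p \<Longrightarrow> over_B q \<Longrightarrow> over_B (p - q)"
  by (simp add: over_B_def B_diff)

lemma over_B_smult: "c \<in> B \<Longrightarrow> over_B p \<Longrightarrow> over_B (Polynomial.smult c p)"
  by (simp add: over_B_def B_mult)

lemma over_B_fD5: "over_B (fD5 (pent_s x) (pent_t x))"
  by (simp add: fD5_def power2_eq_square B_intros)

definition U :: "((int \<times> bool) \<times> 'b \<Rightarrow> 'f) set" where
  "U = {w. \<exists>r. (\<forall>i<5. r i \<in> R) \<and> (\<forall>a b. w (a, b) = (\<Sum>i<5. r i b * x (aff a 0) ^ i))}"

lemma U_add: "u \<in> U \<Longrightarrow> v \<in> U \<Longrightarrow> (\<lambda>g. u g + v g) \<in> U"
proof -
  assume "u \<in> U" "v \<in> U"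
  then obtain r q where r: "\<forall>i<5. r i \<in> R" "\<forall>a b. u (a, b) = (\<Sum>i<5. r i b * x (aff a 0) ^ i)"
    and q: "\<forall>i<5. q i \<in> R" "\<forall>a b. v (a, b) = (\<Sum>i<5. q i b * x (aff a 0) ^ i)"
    unfolding U_def by blast
  then show ?thesis unfolding U_def
    by (intro CollectI exI[of _ "\<lambda>i b. r i b + q i b"]) (auto simp: R_add distrib_right sum.distrib)
qed

lemma U_scale: "u \<in> U \<Longrightarrow> c \<in> R \<Longrightarrow> (\<lambda>g. c (snd g) * u g) \<in> U"
proof -
  assume "u \<in> U" and c: "c \<in> R"
  then obtain r where r: "\<forall>i<5. r i \<in> R" "\<forall>a b. u (a, b) = (\<Sum>i<5. r i b * x (aff a 0) ^ i)"
    unfolding U_def by blast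
  then show ?thesis unfolding U_def
    by (intro CollectI exI[of _ "\<lambda>i b. c b * r i b"]) (auto simp: R_mult c sum_distrib_left mult.assoc)
qed

lemma R_U: "c \<in> R \<Longrightarrow> (\<lambda>g. c (snd g)) \<in> U"
proof -
  assume c: "c \<in> R"
  have "(\<lambda>b. if i = 0 then c b else 0) \<in> R" for i :: nat
    by (cases "i = 0") (simp_all add: c R_const[OF B_zero])
  then show ?thesis unfolding U_def
    by (intro CollectI exI[of _ "\<lambda>i b. if i = 0 then c b else 0"]) (auto simp: eval_nat_numeral)
qed

lemma aff_root:
  "x (aff a 0) ^ 5 = - (\<Sum>i<5. Polynomial.coeff (fD5 (pent_s x) (pent_t x)) i * x (aff a 0) ^ i)"
proof -
  have "Polynomial.degree (fD5 (pent_s x) (pent_t x)) = 5" "Polynomial.coeff (fD5 (pent_s x) (pent_t x)) 5 = 1"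
    by (simp_all add: fD5_def eval_nat_numeral)
  moreover have "{..5::nat} = insert 5 {..<5}" by auto
  ultimately show ?thesis
    using fD5_root[of "aff a 0"] by (simp add: poly_altdef add_eq_0_iff)
qed

lemma U_X: "u \<in> U \<Longrightarrow> (\<lambda>g. x (aff (fst g) 0) * u g) \<in> U"
proof -
  assume "u \<in> U"
  then obtain r where r: "\<forall>i<5. r i \<in> R" "\<forall>a b. u (a, b) = (\<Sum>i<5. r i b * x (aff a 0) ^ i)"
    unfolding U_def by blast
  define f where "f = Polynomial.coeff (fD5 (pent_s x) (pent_t x))"
  have f: "f i \<in> B" for i using over_B_fD5 by (simp add: f_def over_B_def)
  define q where "q = (\<lambda>i b. (if i = 0 then 0 else r (i - 1) b) + (- f i) * r 4 b)"
  have "q i \<in> R" if "i < 5" for i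
  proof -
    have "(\<lambda>b. if i = 0 then 0 else r (i - 1) b) \<in> R"
      using that r(1) by (cases i) (auto simp: R_const[OF B_zero])
    moreover have "(\<lambda>b. (- f i) * r 4 b) \<in> R"
      using R_mult[OF R_const[OF B_minus[OF f]]] r(1) by simp
    ultimately show ?thesis unfolding q_def by (rule R_add)
  qed
  moreover have "x (aff a 0) * u (a, b) = (\<Sum>i<5. q i b * x (aff a 0) ^ i)" for a b
  proof -
    define y where "y = x (aff a 0)"
    have y5: "y ^ 5 = - (\<Sum>i<5. f i * y ^ i)" using aff_root[of a] by (simp add: y_def f_def)
    have "y * u (a, b) = y * (\<Sum>i<5. r i b * y ^ i)" using r(2)[rule_format, of a b] by (simp add: y_def)
    also have "\<dots> = r 0 b * y + r 1 b * y ^ 2 + r 2 b * y ^ 3 + r 3 b * y ^ 4 + r 4 b * y ^ 5"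
      by (simp add: eval_nat_numeral algebra_simps)
    also have "\<dots> = (\<Sum>i<5. q i b * y ^ i)"
      unfolding y5 by (simp add: q_def eval_nat_numeral algebra_simps)
    finally show ?thesis by (simp add: y_def)
  qed
  ultimately show ?thesis unfolding U_def by (intro CollectI exI[of _ q]) auto
qed

lemma U_poly:
  assumes "over_B p" "u \<in> U"
  shows "(\<lambda>g. poly p (x (aff (fst g) 0)) * u g) \<in> U"
  using assms(1)
proof (induction p)
  case 0
  show ?case using R_U[OF R_const[OF B_zero]] by simp
next
  case (pCons c p)
  have "(\<lambda>g. c * u g) \<in> U" using U_scale[OF assms(2) R_const] pCons.prems by simp
  moreover have "(\<lambda>g. x (aff (fst g) 0) * (poly p (x (aff (fst g) 0)) * u g)) \<in> U"
    using pCons by (intro U_X) simp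
  ultimately have "(\<lambda>g. c * u g + x (aff (fst g) 0) * (poly p (x (aff (fst g) 0)) * u g)) \<in> U"
    by (rule U_add)
  then show ?case by (simp add: algebra_simps)
qed

definition V :: "((int \<times> bool) \<times> 'b \<Rightarrow> 'f) set" where
  "V = {\<lambda>g. u g + v g * x (aff (fst g) 1) | u v. u \<in> U \<and> v \<in> U}"

lemma V_I: "u \<in> U \<Longrightarrow> v \<in> U \<Longrightarrow> (\<And>g. w g = u g + v g * x (aff (fst g) 1)) \<Longrightarrow> w \<in> V"
  unfolding V_def by blast

lemma V_E:
  assumes "w \<in> V"
  obtains u v where "u \<in> U" "v \<in> U" "w = (\<lambda>g. u g + v g * x (aff (fst g) 1))"
  using assms unfolding V_def by blast

lemma U_V: "u \<in> U \<Longrightarrow> u \<in> V"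
  using R_U[OF R_const[OF B_zero]] by (intro V_I[of u "\<lambda>_. 0"]) auto

lemma V_add:
  assumes "u \<in> V" "v \<in> V"
  shows "(\<lambda>g. u g + v g) \<in> V"
proof -
  obtain u1 u2 where u: "u1 \<in> U" "u2 \<in> U" "u = (\<lambda>g. u1 g + u2 g * x (aff (fst g) 1))"
    by (rule V_E[OF assms(1)])
  obtain v1 v2 where v: "v1 \<in> U" "v2 \<in> U" "v = (\<lambda>g. v1 g + v2 g * x (aff (fst g) 1))"
    by (rule V_E[OF assms(2)])
  show ?thesis by (rule V_I[OF U_add[OF u(1) v(1)] U_add[OF u(2) v(2)]]) (simp add: u v algebra_simps)
qed

lemma V_poly:
  assumes p: "over_B p" and "u \<in> V"
  shows "(\<lambda>g. poly p (x (aff (fst g) 0)) * u g) \<in> V"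
proof -
  obtain u1 u2 where u: "u1 \<in> U" "u2 \<in> U" "u = (\<lambda>g. u1 g + u2 g * x (aff (fst g) 1))"
    by (rule V_E[OF assms(2)])
  show ?thesis by (rule V_I[OF U_poly[OF p u(1)] U_poly[OF p u(2)]]) (simp add: u algebra_simps)
qed

text \<open>The constant coefficient of the quintic is \<open>t\<close>, whose inverse lies in
  \<open>B\<close>.\<close>

lemma inverse_X: "\<exists>p. over_B p \<and> (\<forall>a. inverse (x (aff a 0)) = poly p (x (aff a 0)))"
proof -
  obtain f where f: "fD5 (pent_s x) (pent_t x) = pCons (pent_t x) f" "over_B f"
    using over_B_fD5 unfolding fD5_def by (metis over_B_pCons)
  define p where "p = Polynomial.smult (- inverse (pent_t x)) f"
  have "over_B p" using f(2) unfolding over_B_def p_def by (simp add: B_intros)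
  moreover have "inverse (x (aff a 0)) = poly p (x (aff a 0))" for a
  proof (rule inverse_unique)
    have "pent_t x + x (aff a 0) * poly f (x (aff a 0)) = 0" using fD5_root[of "aff a 0"] f(1) by simp
    then have "x (aff a 0) * poly f (x (aff a 0)) = - pent_t x" by (simp add: add_eq_0_iff)
    then show "x (aff a 0) * poly p (x (aff a 0)) = 1" by (simp add: p_def mult.left_commute)
  qed
  ultimately show ?thesis by blast
qed

text \<open>By \<open>neighbours\<close> this requires the inverse of \<open>X - 1\<close>. Division
  of the quintic by \<open>X - 1\<close> leaves the remainder \<open>t\<^sup>2\<close>, so the
  inverse is \<open>- G / t\<^sup>2\<close> at \<open>X\<close>, where \<open>G\<close> is the
  quotient.\<close>

lemma neighbour_sum: "\<exists>p. over_B p \<and> (\<forall>a. x (aff a 4) + x (aff a 1) = poly p (x (aff a 0)))"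
proof -
  define s t where "s = pent_s x" and "t = pent_t x"
  define G where "G = [:t\<^sup>2 - t, t\<^sup>2 - s - t, s + 1, t - 2, 1:]"
  have h: "poly (fD5 s t) z = (z - 1) * poly G z + t\<^sup>2" for z
    by (simp add: G_def fD5_def algebra_simps power2_eq_square)
  define g where "g = Polynomial.smult (- (inverse t * inverse t)) G"
  have g: "inverse (x (aff a 0) - 1) = poly g (x (aff a 0))" for a
  proof (rule inverse_unique)
    have "t \<noteq> 0" by (simp add: t_def)
    have "(x (aff a 0) - 1) * poly G (x (aff a 0)) = - t\<^sup>2"
      using fD5_root[of "aff a 0"] unfolding s_def[symmetric] t_def[symmetric] h
      by (simp only: eq_neg_iff_add_eq_0)
    then have "- (inverse t * inverse t) * ((x (aff a 0) - 1) * poly G (x (aff a 0))) = 1"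
      using \<open>t \<noteq> 0\<close> by (simp add: power2_eq_square field_simps)
    then show "(x (aff a 0) - 1) * poly g (x (aff a 0)) = 1"
      unfolding g_def poly_smult by (simp only: mult.left_commute)
  qed
  define p where "p = [:2, - 1:] - Polynomial.smult t (pCons 0 g)"
  have "over_B G"
    by (simp add: G_def power2_eq_square B_intros s_def t_def)
  then have "over_B g" unfolding g_def by (intro over_B_smult) (simp_all add: B_intros t_def)
  then have "over_B (pCons 0 g)" "over_B [:2, - 1:]" by (simp_all add: B_intros)
  then have "over_B p" unfolding p_def by (intro over_B_diff over_B_smult) (simp_all add: B_intros t_def)
  moreover have "x (aff a 4) + x (aff a 1) = poly p (x (aff a 0))" for a
  proof -
    interpret a: pentagon "\<lambda>i. x (aff a i)" by (rule pentagon_aff)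
    show ?thesis
      using a.neighbours(1) g[of a] by (simp add: pent_invariant p_def divide_inverse t_def algebra_simps)
  qed
  ultimately show ?thesis by blast
qed

text \<open>That \<open>V\<close> is closed under products is not visible from its form. The
  functions whose multiples stay in \<open>V\<close> are closed under sums and products, so only
  generators have to be checked.\<close>

definition multipliers :: "((int \<times> bool) \<times> 'b \<Rightarrow> 'f) set" where
  "multipliers = {w. \<forall>v\<in>V. (\<lambda>g. w g * v g) \<in> V}"

lemma multipliers_add: "u \<in> multipliers \<Longrightarrow> v \<in> multipliers \<Longrightarrow> (\<lambda>g. u g + v g) \<in> multipliers"
  by (auto simp: multipliers_def distrib_right intro!: V_add)

lemma multipliers_mult: "u \<in> multipliers \<Longrightarrow> v \<in> multipliers \<Longrightarrow> (\<lambda>g. u g * v g) \<in> multipliers"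
  by (auto simp: multipliers_def mult.assoc)

lemma multipliers_poly: "over_B p \<Longrightarrow> (\<lambda>g. poly p (x (aff (fst g) 0))) \<in> multipliers"
  by (simp add: multipliers_def V_poly)

lemma multipliers_R: "c \<in> R \<Longrightarrow> (\<lambda>g. c (snd g)) \<in> multipliers"
proof -
  assume c: "c \<in> R"
  have "(\<lambda>g. c (snd g) * v g) \<in> V" if v: "v \<in> V" for v
  proof -
    obtain u1 u2 where u: "u1 \<in> U" "u2 \<in> U" "v = (\<lambda>g. u1 g + u2 g * x (aff (fst g) 1))"
      by (rule V_E[OF v])
    show ?thesis by (rule V_I[OF U_scale[OF u(1) c] U_scale[OF u(2) c]]) (simp add: u algebra_simps)
  qed
  then show ?thesis by (simp add: multipliers_def)
qed

text \<open>\<open>Y\<close> is a root of a monic quadratic over the polynomials in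
  \<open>X\<close>, whose roots have the sum given by \<open>neighbour_sum\<close> and the product
  \<open>1 - X\<close>. This reduces \<open>Y\<^sup>2\<close>.\<close>

lemma multipliers_Y: "(\<lambda>g. x (aff (fst g) 1)) \<in> multipliers"
proof -
  obtain p where p: "over_B p" "\<And>a. x (aff a 4) + x (aff a 1) = poly p (x (aff a 0))"
    using neighbour_sum by blast
  have Y2: "x (aff a 1) * x (aff a 1) = poly p (x (aff a 0)) * x (aff a 1) + poly [:- 1, 1:] (x (aff a 0))" for a
  proof -
    interpret a: pentagon "\<lambda>i. x (aff a i)" by (rule pentagon_aff)
    have "x (aff a 1) * x (aff a 1) = (x (aff a 4) + x (aff a 1)) * x (aff a 1) - x (aff a 4) * x (aff a 1)"
      by (simp add: algebra_simps)
    then show ?thesis by (simp add: p(2) a.neighbours(2))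
  qed
  have over: "over_B [:- 1, 1:]" by (simp add: B_intros)
  have "(\<lambda>g. x (aff (fst g) 1) * v g) \<in> V" if v: "v \<in> V" for v
  proof -
    obtain u1 u2 where u: "u1 \<in> U" "u2 \<in> U" "v = (\<lambda>g. u1 g + u2 g * x (aff (fst g) 1))"
      by (rule V_E[OF v])
    have "x (aff (fst g) 1) * v g = poly [:- 1, 1:] (x (aff (fst g) 0)) * u2 g +
        (u1 g + poly p (x (aff (fst g) 0)) * u2 g) * x (aff (fst g) 1)" for g
    proof -
      have "x (aff (fst g) 1) * v g = x (aff (fst g) 1) * u1 g + u2 g * (x (aff (fst g) 1) * x (aff (fst g) 1))"
        using u(3) by (simp add: algebra_simps)
      then show ?thesis unfolding Y2 by (simp add: algebra_simps)
    qed
    moreover have "(\<lambda>g. poly [:- 1, 1:] (x (aff (fst g) 0)) * u2 g) \<in> U"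
      "(\<lambda>g. u1 g + poly p (x (aff (fst g) 0)) * u2 g) \<in> U"
      by (intro U_poly U_add u p over)+
    ultimately show ?thesis by (intro V_I)
  qed
  then show ?thesis by (simp add: multipliers_def)
qed

text \<open>All entries come from \<open>X\<close> and \<open>Y\<close>: the other neighbour of
  \<open>X\<close> is the sum minus \<open>Y\<close>, and the relations give the remaining two after
  division by \<open>X\<close>, which \<open>inverse_X\<close> turns into multiplication by a
  polynomial.\<close>

lemma multipliers_x: "(\<lambda>g. x (aff (fst g) j)) \<in> multipliers"
proof -
  obtain p where p: "over_B p" "\<And>a. x (aff a 4) + x (aff a 1) = poly p (x (aff a 0))"
    using neighbour_sum by blast
  obtain q where q: "over_B q" "\<And>a. inverse (x (aff a 0)) = poly q (x (aff a 0))"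
    using inverse_X by blast
  have const: "(\<lambda>g. c) \<in> multipliers" if "c \<in> B" for c using multipliers_R[OF R_const[OF that]] .
  have neg: "(\<lambda>g. - u g) \<in> multipliers" if "u \<in> multipliers" for u
    using multipliers_mult[OF const[OF B_minus[OF B_one]] that] by simp
  have diff: "(\<lambda>g. u g - v g) \<in> multipliers" if "u \<in> multipliers" "v \<in> multipliers" for u v
    using multipliers_add[OF that(1) neg[OF that(2)]] by simp
  have X: "(\<lambda>g. x (aff (fst g) 0)) \<in> multipliers"
    using multipliers_poly[of "[:0, 1:]"] by (simp add: B_intros)
  have "(\<lambda>g. poly p (x (aff (fst g) 0)) - x (aff (fst g) 1)) \<in> multipliers"
    using p by (intro diff multipliers_poly multipliers_Y)
  then have x4: "(\<lambda>g. x (aff (fst g) 4)) \<in> multipliers" by (simp flip: p(2))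
  have x23: "x (aff a 2) = (1 - x (aff a 1)) * poly q (x (aff a 0))"
    "x (aff a 3) = (1 - x (aff a 4)) * poly q (x (aff a 0))" for a
  proof -
    interpret a: pentagon "\<lambda>i. x (aff a i)" by (rule pentagon_aff)
    show "x (aff a 2) = (1 - x (aff a 1)) * poly q (x (aff a 0))"
      "x (aff a 3) = (1 - x (aff a 4)) * poly q (x (aff a 0))"
      using a.rels(1,4) by (simp_all add: field_simps flip: q(2))
  qed
  have x2: "(\<lambda>g. x (aff (fst g) 2)) \<in> multipliers"
    unfolding x23 by (intro multipliers_mult diff const B_one multipliers_Y multipliers_poly q)
  have x3: "(\<lambda>g. x (aff (fst g) 3)) \<in> multipliers"
    unfolding x23 by (intro multipliers_mult diff const B_one x4 multipliers_poly q)
  have "x (aff a j) = x (aff a (j mod 5))" for a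
    by (rule x_cong) (auto simp: aff_def mod_simps)
  then have eq: "(\<lambda>g::(int \<times> bool) \<times> 'b. x (aff (fst g) j)) = (\<lambda>g. x (aff (fst g) (j mod 5)))" by auto
  show ?thesis unfolding eq
    by (cases rule: mod5_cases[of j]) (simp_all only: X multipliers_Y x2 x3 x4)
qed

lemma fun_alg_V:
  assumes "w \<in> fun_alg ({\<lambda>g. c (snd g) | c. c \<in> R} \<union> {\<lambda>g. x (aff (fst g) j) | j. True})"
  shows "w \<in> V"
proof -
  have "w \<in> multipliers" using assms
    by induction (auto simp: multipliers_R multipliers_x multipliers_add multipliers_mult)
  moreover have "(\<lambda>g. 1) \<in> V" using U_V[OF R_U[OF R_const[OF B_one]]] by simp
  ultimately show ?thesis unfolding multipliers_def by fastforce
qed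

text \<open>For each \<open>i\<close> the indices \<open>(i, False)\<close> and
  \<open>(i, True)\<close> give the same \<open>X = x i\<close> but distinct neighbours
  \<open>x (i + 1)\<close> and \<open>x (i - 1)\<close> as \<open>Y\<close>. Equality of the two
  values makes \<open>\<beta>\<close> vanish at \<open>x i\<close>. Then \<open>\<alpha>\<close>
  takes one value at five points and has degree below 5, so it equals its constant coefficient,
  whose dependence on \<open>b\<close> is a function in \<open>R\<close>.\<close>

theorem descent:
  assumes w: "w \<in> fun_alg ({\<lambda>g. c (snd g) | c. c \<in> R} \<union> {\<lambda>g. x (aff (fst g) j) | j. True})"
    and indep: "\<And>a b. w (a, b) = w ((0, False), b)"
  shows "(\<lambda>b. w ((0, False), b)) \<in> R"
proof -
  obtain u v where "u \<in> U" "v \<in> U" and uv: "w = (\<lambda>g. u g + v g * x (aff (fst g) 1))"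
    by (rule V_E[OF fun_alg_V[OF w]])
  then obtain r q where r: "\<forall>i<5. r i \<in> R" "\<And>a b. u (a, b) = (\<Sum>i<5. r i b * x (aff a 0) ^ i)"
    and q: "\<forall>i<5. q i \<in> R" "\<And>a b. v (a, b) = (\<Sum>i<5. q i b * x (aff a 0) ^ i)"
    unfolding U_def by blast
  have "w ((0, False), b) = r 0 b" for b
  proof -
    define \<alpha> where "\<alpha> = (\<Sum>i<5. Polynomial.monom (r i b) i)"
    define \<beta> where "\<beta> = (\<Sum>i<5. Polynomial.monom (q i b) i)"
    have W: "w (a, b) = poly \<alpha> (x (aff a 0)) + poly \<beta> (x (aff a 0)) * x (aff a 1)" for a
      by (simp add: uv r q \<alpha>_def \<beta>_def poly_sum poly_monom)
    have "poly \<alpha> (x i) = w ((0, False), b)" if i: "i \<in> {0..<5}" for i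
    proof -
      have 1: "w ((0, False), b) = poly \<alpha> (x i) + poly \<beta> (x i) * x (i + 1)"
        using W[of "(i, False)"] indep[of "(i, False)" b] by simp
      have 2: "w ((0, False), b) = poly \<alpha> (x i) + poly \<beta> (x i) * x (i - 1)"
        using W[of "(i, True)"] indep[of "(i, True)" b] by simp
      have "x (i + 1) \<noteq> x (i - 1)"
      proof
        assume "x (i + 1) = x (i - 1)"
        then have "x ((i + 1) mod 5) = x ((i - 1) mod 5)" by (simp add: x_mod)
        then have "(i + 1) mod 5 = (i - 1) mod 5" using inj by (auto simp: inj_on_def)
        then show False by presburger
      qed
      with 1 2 have "poly \<beta> (x i) = 0" by (metis add_left_cancel mult_cancel_left)
      with 1 show ?thesis by simp
    qed
    moreover have "Polynomial.degree \<alpha> < card {0..<5::int}"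
    proof -
      have "Polynomial.degree \<alpha> \<le> 4" unfolding \<alpha>_def
        by (rule degree_sum_le) (auto intro: order.trans[OF degree_monom_le])
      then show ?thesis by simp
    qed
    ultimately have "\<alpha> = [:w ((0, False), b):]"
      using poly_eq_const_of_roots[OF _ inj] by blast
    then have "Polynomial.coeff \<alpha> 0 = w ((0, False), b)" by simp
    then show ?thesis by (simp add: \<alpha>_def coeff_sum)
  qed
  then show ?thesis using r(1) by simp
qed

end


section \<open>Descent for one and for two pentagons\<close>

definition base_for :: "'f::field set \<Rightarrow> (int \<Rightarrow> 'f) \<Rightarrow> bool" where
  "base_for B x \<longleftrightarrow> pentagon x \<and> inj_on x {0..<5} \<and> 1 \<in> B \<and> (\<forall>c\<in>B. - c \<in> B) \<and>
     (\<forall>c\<in>B. \<forall>d\<in>B. c + d \<in> B \<and> c * d \<in> B) \<and> pent_s x \<in> B \<and> pent_t x \<in> B \<and> inverse (pent_t x) \<in> B"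

definition gens1 :: "'f::field set \<Rightarrow> (int \<Rightarrow> 'f) \<Rightarrow> (int \<times> bool \<Rightarrow> 'f) set" where
  "gens1 B x = {\<lambda>_. c | c. c \<in> B} \<union> {\<lambda>a. x (aff a j) | j. True}"

definition gens2 :: "'f::field set \<Rightarrow> (int \<Rightarrow> 'f) \<Rightarrow> (int \<Rightarrow> 'f) \<Rightarrow> ((int \<times> bool) \<times> (int \<times> bool) \<Rightarrow> 'f) set" where
  "gens2 B x x' = {\<lambda>_. c | c. c \<in> B} \<union> {\<lambda>g. x (aff (fst g) j) | j. True} \<union> {\<lambda>g. x' (aff (snd g) j) | j. True}"

lemma (in pentagon) x_aff_mod: "x (aff (fst a mod 5, snd a) j) = x (aff a j)"
  by (rule x_cong) (auto simp: aff_def mod_simps)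

lemma base_for_descent:
  assumes "base_for B x" "\<And>u v. u \<in> R \<Longrightarrow> v \<in> R \<Longrightarrow> (\<lambda>b. u b + v b) \<in> R"
    "\<And>u v. u \<in> R \<Longrightarrow> v \<in> R \<Longrightarrow> (\<lambda>b. u b * v b) \<in> R" "\<And>c. c \<in> B \<Longrightarrow> (\<lambda>_. c) \<in> R"
  shows "symmetric_descent x R B"
  using assms unfolding base_for_def symmetric_descent_def symmetric_descent_axioms_def by blast

text \<open>With a single pentagon there is no second argument: \<open>R\<close> consists of
  constant functions on a one-point type.\<close>

lemma symmetric1:
  assumes B: "base_for B x" and w: "w \<in> fun_alg (gens1 B x)"
    and const: "\<And>a. a \<in> carrier D5 \<Longrightarrow> w a = w (0, False)"
  shows "w (0, False) \<in> B"
proof -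
  interpret pentagon x using B by (simp add: base_for_def)
  define R where "R = {\<lambda>_::unit. c | c. c \<in> B}"
  have "symmetric_descent x R B"
  proof (rule base_for_descent[OF B])
    fix u v assume "u \<in> R" "v \<in> R"
    then obtain c d where "c \<in> B" "u = (\<lambda>_. c)" "d \<in> B" "v = (\<lambda>_. d)" by (auto simp: R_def)
    moreover from this have "c + d \<in> B" "c * d \<in> B" using B by (simp_all add: base_for_def)
    ultimately show "(\<lambda>b. u b + v b) \<in> R" "(\<lambda>b. u b * v b) \<in> R" unfolding R_def by blast+
  qed (auto simp: R_def)
  moreover have "(\<lambda>g. w (fst g)) \<in> fun_alg ({\<lambda>g. c (snd g) | c. c \<in> R} \<union> {\<lambda>g. x (aff (fst g) j) | j. True})"
  proof (rule fun_alg_subst[OF w])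
    fix v assume "v \<in> gens1 B x"
    then have "(\<lambda>g. v (fst g)) \<in> {\<lambda>g. c (snd g) | c. c \<in> R} \<union> {\<lambda>g. x (aff (fst g) j) | j. True}"
      unfolding gens1_def R_def by force
    then show "(\<lambda>g::(int \<times> bool) \<times> unit. v (fst g)) \<in> fun_alg ({\<lambda>g. c (snd g) | c. c \<in> R} \<union> {\<lambda>g. x (aff (fst g) j) | j. True})"
      by (rule fun_alg.gen)
  qed
  moreover have "w a = w (0, False)" for a
  proof -
    \<comment> \<open>The hypothesis covers only reduced indices, but the generators, and hence
      \<open>w\<close>, have period 5 in the rotation part.\<close>
    have "w a = w (fst a mod 5, snd a)"
      by (rule fun_alg_invariant[OF w]) (auto simp: gens1_def x_aff_mod)
    then show ?thesis using const[of "(fst a mod 5, snd a)"] by (simp add: carrier_D5)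
  qed
  ultimately have "(\<lambda>b. w (0, False)) \<in> R"
    using symmetric_descent.descent[of x R B "\<lambda>g. w (fst g)"] by simp
  then show ?thesis by (auto simp: R_def fun_eq_iff)
qed

text \<open>The descent is applied to \<open>x\<close> first, with the functions of the index of
  \<open>x'\<close> as the ring \<open>R\<close>, and then to \<open>x'\<close>. For this the
  descent allows coefficients that are functions of a second argument.\<close>

lemma symmetric2:
  assumes B: "base_for B x" "base_for B x'" and w: "w \<in> fun_alg (gens2 B x x')"
    and const: "\<And>g. g \<in> carrier (D5 \<times>\<times> D5) \<Longrightarrow> w g = w ((0, False), (0, False))"
  shows "w ((0, False), (0, False)) \<in> B"
proof -
  interpret x: pentagon x using B by (simp add: base_for_def)
  interpret x': pentagon x' using B by (simp add: base_for_def)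
  define R where "R = fun_alg (gens1 B x')"
  have "symmetric_descent x R B"
  proof (rule base_for_descent[OF B(1)])
    show "(\<lambda>_. c) \<in> R" if "c \<in> B" for c
      unfolding R_def using that by (intro fun_alg.gen) (auto simp: gens1_def)
  qed (auto simp: R_def intro: fun_alg.add fun_alg.mult)
  moreover have "w \<in> fun_alg ({\<lambda>g. c (snd g) | c. c \<in> R} \<union> {\<lambda>g. x (aff (fst g) j) | j. True})"
  proof (rule fun_alg_subst[OF w, of "\<lambda>g. g", simplified])
    fix v assume v: "v \<in> gens2 B x x'"
    have "(\<lambda>_. c) \<in> R" if "c \<in> B" for c
      unfolding R_def using that by (intro fun_alg.gen) (auto simp: gens1_def)
    moreover have "(\<lambda>b. x' (aff b j)) \<in> R" for j
      unfolding R_def by (intro fun_alg.gen) (auto simp: gens1_def)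
    ultimately have "v \<in> {\<lambda>g. c (snd g) | c. c \<in> R} \<union> {\<lambda>g. x (aff (fst g) j) | j. True}"
      using v unfolding gens2_def by force
    then show "v \<in> fun_alg ({\<lambda>g. c (snd g) | c. c \<in> R} \<union> {\<lambda>g. x (aff (fst g) j) | j. True})"
      by (rule fun_alg.gen)
  qed
  moreover have all: "w (a, b) = w ((0, False), (0, False))" for a b
  proof -
    have "w (a, b) = w ((fst a mod 5, snd a), (fst b mod 5, snd b))"
      by (rule fun_alg_invariant[OF w]) (auto simp: gens2_def x.x_aff_mod x'.x_aff_mod)
    then show ?thesis using const[of "((fst a mod 5, snd a), (fst b mod 5, snd b))"] by (simp add: carrier_D5)
  qed
  ultimately have "(\<lambda>b. w ((0, False), b)) \<in> R"
    using symmetric_descent.descent[of x R B w] by (metis (no_types, lifting))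
  then show ?thesis using symmetric1[OF B(2), of "\<lambda>b. w ((0, False), b)"] all by (simp add: R_def)
qed

section \<open>Values of rational functions\<close>

lemma eval_via_0 [simp]: "f 0 = 0 \<Longrightarrow> eval_via f u 0 = 0"
  by (simp add: eval_via_def)

lemma eval_via_pCons [simp]: "f 0 = 0 \<Longrightarrow> eval_via f u (pCons c p) = f c + u * eval_via f u p"
  by (simp add: eval_via_def map_poly_pCons)

lemma eval_via_rel:
  assumes "f 0 = 0" "g 0 = 0" "R 0 0" "\<And>a b c d. R a b \<Longrightarrow> R c d \<Longrightarrow> R (a + c) (b + d)"
    "\<And>a b c d. R a b \<Longrightarrow> R c d \<Longrightarrow> R (a * c) (b * d)" "\<And>c. R (f c) (g c)" "R u v"
  shows "R (eval_via f u p) (eval_via g v p)"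
  using assms by (induction p) auto

definition ev :: "('k::field \<Rightarrow> 'f::field) \<Rightarrow> 'f \<times> 'f \<times> 'f \<times> 'f \<Rightarrow> 'k poly poly poly poly \<Rightarrow> 'f" where
  "ev \<phi> p = (case p of (u1, u2, u3, u4) \<Rightarrow> eval4 \<phi> u1 u2 u3 u4)"

lemma (in field_morphism) ring_morphism_ev: "ring_morphism (ev \<phi> p)"
  unfolding ev_def eval4_def
  by (cases p) (auto intro!: ring_morphism.ring_morphism_eval_via ring_morphism_axioms)

text \<open>Evaluation respects every relation that is compatible with sums, products and
  coefficients. It is applied to the graph of a field morphism and to the relation
  \<open>has_val\<close>.\<close>

lemma ev_rel:
  assumes "f 0 = 0" "g 0 = 0" "R 0 0" "\<And>a b c d. R a b \<Longrightarrow> R c d \<Longrightarrow> R (a + c) (b + d)"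
    "\<And>a b c d. R a b \<Longrightarrow> R c d \<Longrightarrow> R (a * c) (b * d)" "\<And>c. R (f c) (g c)"
    "R u1 v1" "R u2 v2" "R u3 v3" "R u4 v4"
  shows "R (ev f (u1, u2, u3, u4) n) (ev g (v1, v2, v3, v4) n)"
proof -
  have 0: "eval_via f u 0 = 0" "eval_via g v 0 = 0" for u v using assms(1,2) by simp_all
  have 1: "R (eval_via f u1 p) (eval_via g v1 p)" for p
    by (rule eval_via_rel[where R = R]) (fact assms)+
  have 2: "R (eval_via (eval_via f u1) u2 p) (eval_via (eval_via g v1) v2 p)" for p
    by (rule eval_via_rel[where R = R]) (fact assms 0 1)+
  have 0: "eval_via (eval_via f u1) u2 0 = 0" "eval_via (eval_via g v1) v2 0 = 0" using 0 by simp_all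
  have 3: "R (eval_via (eval_via (eval_via f u1) u2) u3 p) (eval_via (eval_via (eval_via g v1) v2) v3 p)" for p
    by (rule eval_via_rel[where R = R]) (fact assms 0 2)+
  have 0: "eval_via (eval_via (eval_via f u1) u2) u3 0 = 0" "eval_via (eval_via (eval_via g v1) v2) v3 0 = 0"
    using 0 by simp_all
  show ?thesis unfolding ev_def eval4_def prod.case
    by (rule eval_via_rel[where R = R]) (fact assms 0 3)+
qed

text \<open>The graph of \<open>ratfun_eval\<close>. Unlike the description operator it records that
  the value is defined, so that rules for sums, products and composition can be chained.\<close>

definition has_val :: "('k::field \<Rightarrow> 'f::field) \<Rightarrow> 'f \<times> 'f \<times> 'f \<times> 'f \<Rightarrow> 'k ratfun4 \<Rightarrow> 'f \<Rightarrow> bool" where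
  "has_val \<phi> p q v \<longleftrightarrow> (\<exists>n d. q = Fract n d \<and> d \<noteq> 0 \<and> ev \<phi> p d \<noteq> 0 \<and> v = ev \<phi> p n / ev \<phi> p d)"

context field_morphism
begin

interpretation ev: ring_morphism "ev \<phi> p" for p by (rule ring_morphism_ev)

lemma has_val_unique: "has_val \<phi> p q v \<Longrightarrow> has_val \<phi> p q w \<Longrightarrow> v = w"
proof -
  assume "has_val \<phi> p q v" "has_val \<phi> p q w"
  then obtain n d n' d' where "q = Fract n d" "d \<noteq> 0" "ev \<phi> p d \<noteq> 0" "v = ev \<phi> p n / ev \<phi> p d"
    "q = Fract n' d'" "d' \<noteq> 0" "ev \<phi> p d' \<noteq> 0" "w = ev \<phi> p n' / ev \<phi> p d'"
    unfolding has_val_def by blast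
  moreover from this have "n * d' = n' * d" by (simp add: eq_fract)
  then have "ev \<phi> p n * ev \<phi> p d' = ev \<phi> p n' * ev \<phi> p d" by (metis ev.hom_mult)
  ultimately show ?thesis by (metis frac_eq_eq)
qed

lemma ratfun_eval_eq: "has_val \<phi> (u1, u2, u3, u4) q v \<Longrightarrow> ratfun_eval \<phi> u1 u2 u3 u4 q = v"
  unfolding ratfun_eval_def
proof (rule the_equality)
  assume h: "has_val \<phi> (u1, u2, u3, u4) q v"
  then show "\<exists>n d. q = Fract n d \<and> d \<noteq> 0 \<and> eval4 \<phi> u1 u2 u3 u4 d \<noteq> 0 \<and>
      v = eval4 \<phi> u1 u2 u3 u4 n / eval4 \<phi> u1 u2 u3 u4 d" by (simp add: has_val_def ev_def)
  fix w assume "\<exists>n d. q = Fract n d \<and> d \<noteq> 0 \<and> eval4 \<phi> u1 u2 u3 u4 d \<noteq> 0 \<and>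
      w = eval4 \<phi> u1 u2 u3 u4 n / eval4 \<phi> u1 u2 u3 u4 d"
  then have "has_val \<phi> (u1, u2, u3, u4) q w" by (simp add: has_val_def ev_def)
  then show "w = v" using h has_val_unique by blast
qed

lemma has_val_Fract: "ev \<phi> p d \<noteq> 0 \<Longrightarrow> has_val \<phi> p (Fract n d) (ev \<phi> p n / ev \<phi> p d)"
  unfolding has_val_def using ev.hom_zero by blast

lemma has_val_Fract_1: "has_val \<phi> p (Fract n 1) (ev \<phi> p n)"
  using has_val_Fract[of p 1 n] by simp

lemma has_val_add: "has_val \<phi> p q v \<Longrightarrow> has_val \<phi> p r w \<Longrightarrow> has_val \<phi> p (q + r) (v + w)"
proof -
  assume "has_val \<phi> p q v" "has_val \<phi> p r w"
  then obtain n d n' d' where "q = Fract n d" "d \<noteq> 0" "ev \<phi> p d \<noteq> 0" "v = ev \<phi> p n / ev \<phi> p d"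
    "r = Fract n' d'" "d' \<noteq> 0" "ev \<phi> p d' \<noteq> 0" "w = ev \<phi> p n' / ev \<phi> p d'"
    unfolding has_val_def by blast
  then show ?thesis using has_val_Fract[of p "d * d'" "n * d' + n' * d"] by (simp add: add_frac_eq)
qed

lemma has_val_mult: "has_val \<phi> p q v \<Longrightarrow> has_val \<phi> p r w \<Longrightarrow> has_val \<phi> p (q * r) (v * w)"
proof -
  assume "has_val \<phi> p q v" "has_val \<phi> p r w"
  then obtain n d n' d' where "q = Fract n d" "d \<noteq> 0" "ev \<phi> p d \<noteq> 0" "v = ev \<phi> p n / ev \<phi> p d"
    "r = Fract n' d'" "d' \<noteq> 0" "ev \<phi> p d' \<noteq> 0" "w = ev \<phi> p n' / ev \<phi> p d'"
    unfolding has_val_def by blast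
  then show ?thesis using has_val_Fract[of p "d * d'" "n * n'"] by simp
qed

lemma has_val_const: "has_val \<phi> p (const4 c) (\<phi> c)"
proof -
  have "ev \<phi> p [:[:[:[:c:]:]:]:] = \<phi> c" by (cases p) (simp add: ev_def eval4_def)
  then show ?thesis using has_val_Fract_1[of p "[:[:[:[:c:]:]:]:]"] by (simp add: const4_def)
qed

lemma has_val_X:
  "has_val \<phi> (u1, u2, u3, u4) X1 u1" "has_val \<phi> (u1, u2, u3, u4) X2 u2"
  "has_val \<phi> (u1, u2, u3, u4) X3 u3" "has_val \<phi> (u1, u2, u3, u4) X4 u4"
proof -
  let ?p = "(u1, u2, u3, u4)"
  have "ev \<phi> ?p [:[:[:[:0, 1:]:]:]:] = u1" "ev \<phi> ?p [:[:[:0, 1:]:]:] = u2"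
    "ev \<phi> ?p [:[:0, 1:]:] = u3" "ev \<phi> ?p [:0, 1:] = u4"
    by (simp_all add: ev_def eval4_def one_pCons)
  then show "has_val \<phi> ?p X1 u1" "has_val \<phi> ?p X2 u2" "has_val \<phi> ?p X3 u3" "has_val \<phi> ?p X4 u4"
    using has_val_Fract_1[of ?p] by (metis X1_def, metis X2_def, metis X3_def, metis X4_def)
qed

lemma has_val_0: "has_val \<phi> p 0 0" and has_val_1: "has_val \<phi> p 1 1"
  using has_val_Fract_1[of p 0] has_val_Fract_1[of p 1] by (simp_all add: Zero_fract_def One_fract_def)

lemma has_val_minus: "has_val \<phi> p q v \<Longrightarrow> has_val \<phi> p (- q) (- v)"
proof -
  assume "has_val \<phi> p q v"
  moreover have "has_val \<phi> p (Fract (- 1) 1) (- 1)" using has_val_Fract_1[of p "- 1"] by simp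
  ultimately have "has_val \<phi> p (Fract (- 1) 1 * q) (- 1 * v)" by (rule has_val_mult[rotated])
  moreover have "Fract (- 1) 1 = (- 1 :: 'a ratfun4)" by (simp add: One_fract_def)
  ultimately show ?thesis by simp
qed

lemma has_val_diff: "has_val \<phi> p q v \<Longrightarrow> has_val \<phi> p r w \<Longrightarrow> has_val \<phi> p (q - r) (v - w)"
  using has_val_add[OF _ has_val_minus, of p q v r w] by simp

lemma has_val_inverse: "has_val \<phi> p q v \<Longrightarrow> v \<noteq> 0 \<Longrightarrow> has_val \<phi> p (inverse q) (inverse v)"
proof -
  assume "has_val \<phi> p q v" "v \<noteq> 0"
  then obtain n d where "q = Fract n d" "d \<noteq> 0" "ev \<phi> p d \<noteq> 0" "v = ev \<phi> p n / ev \<phi> p d" "ev \<phi> p n \<noteq> 0"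
    unfolding has_val_def by auto
  then show ?thesis using has_val_Fract[of p n d] by simp
qed

lemma has_val_divide: "has_val \<phi> p q v \<Longrightarrow> has_val \<phi> p r w \<Longrightarrow> w \<noteq> 0 \<Longrightarrow> has_val \<phi> p (q / r) (v / w)"
  using has_val_mult[OF _ has_val_inverse, of p q v r w] by (simp add: divide_inverse)

lemma has_val_power: "has_val \<phi> p q v \<Longrightarrow> has_val \<phi> p (q ^ n) (v ^ n)"
  by (induction n) (auto intro: has_val_1 has_val_mult)

lemma has_val_numeral: "has_val \<phi> p (numeral n) (numeral n)"
proof -
  have "has_val \<phi> p (of_nat k) (of_nat k)" for k
    by (induction k) (auto intro: has_val_0 has_val_1 has_val_add)
  from this[of "numeral n"] show ?thesis by simp
qed

lemma has_val_sum: "(\<And>a. a \<in> A \<Longrightarrow> has_val \<phi> p (f a) (g a)) \<Longrightarrow> has_val \<phi> p (sum f A) (sum g A)"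
  by (induction A rule: infinite_finite_induct) (auto intro: has_val_0 has_val_add)

lemma has_val_poly:
  "has_val \<phi> p q v \<Longrightarrow> has_val \<phi> p (poly (map_poly const4 g) q) (poly (map_poly \<phi> g) v)"
proof (induction g)
  case (pCons c g)
  have "const4 0 = (0 :: 'a ratfun4)" by (simp add: const4_def Zero_fract_def)
  with pCons show ?case by (simp add: map_poly_pCons has_val_add has_val_mult has_val_const)
qed (simp add: has_val_0)

lemma has_val_nz: "has_val \<phi> p q v \<Longrightarrow> v \<noteq> 0 \<Longrightarrow> q \<noteq> 0"
  using has_val_unique[OF _ has_val_0] by blast

lemma has_val_coeff_prod_linear:
  assumes "\<And>a. a \<in> A \<Longrightarrow> has_val \<phi> p (f a) (g a)"
  shows "has_val \<phi> p (Polynomial.coeff (\<Prod>a\<in>A. [:- f a, 1:]) n) (Polynomial.coeff (\<Prod>a\<in>A. [:- g a, 1:]) n)"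
  using assms
proof (induction A arbitrary: n rule: infinite_finite_induct)
  case (insert a A)
  have "has_val \<phi> p (Polynomial.coeff [:- f a, 1:] k) (Polynomial.coeff [:- g a, 1:] k)" for k
  proof (cases k)
    case (Suc j)
    then show ?thesis by (cases j) (auto intro: has_val_0 has_val_1)
  qed (use insert.prems in \<open>auto intro: has_val_minus\<close>)
  then show ?case
    unfolding prod.insert[OF insert.hyps] coeff_mult
    by (intro has_val_sum has_val_mult) (use insert in auto)
qed (auto simp: coeff_1 has_val_0 has_val_1)

end

interpretation const4: field_morphism const4
  by unfold_locales (simp_all add: const4_def One_fract_def one_pCons)

lemma const4_ev_X: "ev const4 (X1, X2, X3, X4) n = Fract n 1"
proof -
  have c0: "const4 0 = (0 :: 'a ratfun4)" by simp
  have 1: "eval_via const4 X1 p = Fract [:[:[:p:]:]:] 1" for p :: "'a poly"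
    by (induction p) (simp_all add: c0 X1_def const4_def Zero_fract_def)
  have 2: "eval_via (eval_via const4 X1) X2 p = Fract [:[:p:]:] 1" for p :: "'a poly poly"
    by (induction p) (simp_all add: 1 X2_def Zero_fract_def)
  have 3: "eval_via (eval_via (eval_via const4 X1) X2) X3 p = Fract [:p:] 1" for p :: "'a poly poly poly"
    by (induction p) (simp_all add: 2 X3_def Zero_fract_def)
  have "eval_via (eval_via (eval_via (eval_via const4 X1) X2) X3) X4 n = Fract n 1"
    by (induction n) (simp_all add: 3 X4_def Zero_fract_def)
  then show ?thesis by (simp add: ev_def eval4_def)
qed

lemma ratfun4_cases:
  fixes q :: "'k::field ratfun4"
  obtains n d where "q = Fract n d" "d \<noteq> 0" "q = ev const4 (X1, X2, X3, X4) n / ev const4 (X1, X2, X3, X4) d"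
proof -
  obtain n d where "q = Fract n d" "d \<noteq> 0" by (cases q) auto
  then show ?thesis using that by (simp add: const4_ev_X)
qed

lemma has_val_ev:
  assumes "field_morphism \<phi>"
    and "has_val \<phi> p u1 v1" "has_val \<phi> p u2 v2" "has_val \<phi> p u3 v3" "has_val \<phi> p u4 v4"
  shows "has_val \<phi> p (ev const4 (u1, u2, u3, u4) n) (ev \<phi> (v1, v2, v3, v4) n)"
proof -
  interpret field_morphism \<phi> by fact
  show ?thesis
    by (rule ev_rel) (use assms in \<open>auto intro: has_val_0 has_val_add has_val_mult has_val_const\<close>)
qed

text \<open>The denominator of \<open>q\<close> is nonzero at the values \<open>v1, ..., v4\<close>;
  since these are values of \<open>u1, ..., u4\<close>, it is nonzero after substituting the latter.
  So the substitution is defined, and evaluating its result at \<open>p\<close> is evaluating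
  \<open>q\<close> at the values.\<close>

lemma has_val_comp:
  assumes \<phi>: "field_morphism \<phi>"
    and u: "has_val \<phi> p u1 v1" "has_val \<phi> p u2 v2" "has_val \<phi> p u3 v3" "has_val \<phi> p u4 v4"
    and q: "has_val \<phi> (v1, v2, v3, v4) q b"
  shows "\<exists>r. has_val const4 (u1, u2, u3, u4) q r \<and> has_val \<phi> p r b"
proof -
  interpret field_morphism \<phi> by fact
  obtain n d where nd: "q = Fract n d" "d \<noteq> 0" "ev \<phi> (v1, v2, v3, v4) d \<noteq> 0"
    "b = ev \<phi> (v1, v2, v3, v4) n / ev \<phi> (v1, v2, v3, v4) d"
    using q unfolding has_val_def by blast
  note ev = has_val_ev[OF \<phi> u]
  have "ev const4 (u1, u2, u3, u4) d \<noteq> 0" using has_val_nz[OF ev nd(3)] .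
  then have "has_val const4 (u1, u2, u3, u4) q (ev const4 (u1, u2, u3, u4) n / ev const4 (u1, u2, u3, u4) d)"
    unfolding nd(1) by (rule const4.has_val_Fract)
  moreover have "has_val \<phi> p (ev const4 (u1, u2, u3, u4) n / ev const4 (u1, u2, u3, u4) d) b"
    unfolding nd(4) by (rule has_val_divide[OF ev ev nd(3)])
  ultimately show ?thesis by blast
qed

lemma ev_morphism:
  assumes "field_morphism \<phi>" "field_morphism \<psi>"
  shows "ev (\<lambda>c. \<psi> (\<phi> c)) (\<psi> u1, \<psi> u2, \<psi> u3, \<psi> u4) n = \<psi> (ev \<phi> (u1, u2, u3, u4) n)"
proof -
  interpret a: field_morphism \<phi> by fact
  interpret b: field_morphism \<psi> by fact
  show ?thesis by (rule ev_rel[of _ _ "\<lambda>a b. a = \<psi> b"]) auto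
qed

lemma has_val_morphism:
  assumes "field_morphism \<phi>" "field_morphism \<psi>" "has_val \<phi> (u1, u2, u3, u4) q v"
  shows "has_val (\<lambda>c. \<psi> (\<phi> c)) (\<psi> u1, \<psi> u2, \<psi> u3, \<psi> u4) q (\<psi> v)"
proof -
  interpret b: field_morphism \<psi> by fact
  show ?thesis
    using assms(3) unfolding has_val_def by (force simp: ev_morphism[OF assms(1,2)])
qed

text \<open>A substitution is defined everywhere if no nonzero polynomial vanishes at the
  substituted functions. For this it suffices that their values at a single point \<open>p\<close>
  are algebraically independent.\<close>

lemma substitution_morphism:
  assumes \<phi>: "field_morphism \<phi>"
    and u: "has_val \<phi> p u1 v1" "has_val \<phi> p u2 v2" "has_val \<phi> p u3 v3" "has_val \<phi> p u4 v4"
    and v: "\<And>d. d \<noteq> 0 \<Longrightarrow> ev \<phi> (v1, v2, v3, v4) d \<noteq> 0"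
  shows "has_val const4 (u1, u2, u3, u4) q (ratfun_eval const4 u1 u2 u3 u4 q)"
    and "field_morphism (ratfun_eval const4 u1 u2 u3 u4)"
proof -
  interpret field_morphism \<phi> by fact
  have val: "has_val const4 (u1, u2, u3, u4) q (ratfun_eval const4 u1 u2 u3 u4 q)" for q
  proof -
    obtain n d where q: "q = Fract n d" "d \<noteq> 0" by (cases q) auto
    have "has_val \<phi> (v1, v2, v3, v4) q (ev \<phi> (v1, v2, v3, v4) n / ev \<phi> (v1, v2, v3, v4) d)"
      unfolding q(1) by (rule has_val_Fract[OF v[OF q(2)]])
    then obtain r where "has_val const4 (u1, u2, u3, u4) q r" using has_val_comp[OF \<phi> u] by blast
    moreover from this have "ratfun_eval const4 u1 u2 u3 u4 q = r" by (rule const4.ratfun_eval_eq)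
    ultimately show ?thesis by simp
  qed
  show "has_val const4 (u1, u2, u3, u4) q (ratfun_eval const4 u1 u2 u3 u4 q)" by (rule val)
  show "field_morphism (ratfun_eval const4 u1 u2 u3 u4)"
    by unfold_locales
      (rule const4.ratfun_eval_eq, rule const4.has_val_1,
       rule const4.ratfun_eval_eq, rule const4.has_val_add[OF val val],
       rule const4.ratfun_eval_eq, rule const4.has_val_mult[OF val val])
qed

lemma morphism_ext:
  fixes f g :: "'k::field ratfun4 \<Rightarrow> 'f::field"
  assumes "field_morphism f" "field_morphism g" "\<And>c. f (const4 c) = g (const4 c)"
    "f X1 = g X1" "f X2 = g X2" "f X3 = g X3" "f X4 = g X4"
  shows "f q = g q"
proof -
  interpret f: field_morphism f by fact
  interpret g: field_morphism g by fact
  have "f (ev const4 (X1, X2, X3, X4) n) = g (ev const4 (X1, X2, X3, X4) n)" for n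
    unfolding ev_morphism[OF const4.field_morphism_axioms assms(1), symmetric]
      ev_morphism[OF const4.field_morphism_axioms assms(2), symmetric]
    by (simp add: assms)
  moreover obtain n d where "q = ev const4 (X1, X2, X3, X4) n / ev const4 (X1, X2, X3, X4) d"
    by (rule ratfun4_cases)
  ultimately show ?thesis by simp
qed


section \<open>The generic pentagons and the resolvents\<close>

lemma has_val_pent:
  assumes "field_morphism \<phi>" "has_val \<phi> p a a'" "has_val \<phi> p b b'" "a' \<noteq> 0" "b' \<noteq> 0"
  shows "has_val \<phi> p (pent a b j) (pent a' b' j)"
proof -
  interpret field_morphism \<phi> by fact
  have "has_val \<phi> p ((1 - b) / a) ((1 - b') / a')"
    by (intro has_val_divide has_val_diff has_val_1 assms)
  moreover have "has_val \<phi> p ((a + b - 1) / (a * b)) ((a' + b' - 1) / (a' * b'))"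
    by (intro has_val_divide has_val_diff has_val_add has_val_mult has_val_1 assms) (use assms in simp)
  moreover have "has_val \<phi> p ((1 - a) / b) ((1 - a') / b')"
    by (intro has_val_divide has_val_diff has_val_1 assms)
  ultimately show ?thesis using assms(2,3) by (simp add: pent_def Let_def)
qed

lemma X_nz [simp]: "X1 \<noteq> 0" "X2 \<noteq> 0" "X3 \<noteq> 0" "X4 \<noteq> 0"
  by (simp_all add: X1_def X2_def X3_def X4_def Zero_fract_def eq_fract)

lemma one_ratfun4: "(1 :: 'k::field ratfun4) = Fract [:[:[:[:1:]:]:]:] 1"
  by (simp add: One_fract_def one_pCons)

definition gx :: "int \<Rightarrow> 'k::field ratfun4" where "gx = pent X1 X2"
definition gx' :: "int \<Rightarrow> 'k::field ratfun4" where "gx' = pent X3 X4"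

lemma pentagon_gx: "pentagon gx" and pentagon_gx': "pentagon gx'"
  unfolding gx_def gx'_def
  by (rule pentagon_pent; simp add: X1_def X2_def X3_def X4_def one_ratfun4 Zero_fract_def eq_fract)+

interpretation gx: pentagon gx by (rule pentagon_gx)
interpretation gx': pentagon gx' by (rule pentagon_gx')

text \<open>The last ten conditions are the inequalities between the five entries, cleared of
  denominators, so that for indeterminates they reduce to comparing polynomials.\<close>

lemma inj_pentI:
  fixes x y :: "'f::field"
  assumes "x \<noteq> 0" "y \<noteq> 0"
    and "x \<noteq> y" "x * x \<noteq> 1 - y" "x * x * y \<noteq> x + y - 1" "x * y \<noteq> 1 - x" "y * x \<noteq> 1 - y"
    "y * x * y \<noteq> x + y - 1" "y * y \<noteq> 1 - x" "(1 - y) * y \<noteq> x + y - 1" "(1 - y) * y \<noteq> (1 - x) * x"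
    "x + y - 1 \<noteq> (1 - x) * x"
  shows "inj_on (pent x y) {0..<5}"
proof -
  have *: "pent x y 0 \<noteq> pent x y 1" "pent x y 0 \<noteq> pent x y 2" "pent x y 0 \<noteq> pent x y 3" "pent x y 0 \<noteq> pent x y 4"
    "pent x y 1 \<noteq> pent x y 2" "pent x y 1 \<noteq> pent x y 3" "pent x y 1 \<noteq> pent x y 4"
    using assms by (simp_all add: nonzero_eq_divide_eq mult.assoc)
  have "pent x y 2 \<noteq> pent x y 4" unfolding pent_simps frac_eq_eq[OF assms(1,2)] by (rule assms)
  moreover have "pent x y 2 \<noteq> pent x y 3"
  proof
    assume "pent x y 2 = pent x y 3"
    then have "(1 - y) * (x * y) = (x + y - 1) * x" using assms(1,2) by (simp add: frac_eq_eq)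
    then have "x * ((1 - y) * y) = x * (x + y - 1)" by (simp add: mult_ac)
    then show False using assms by simp
  qed
  moreover have "pent x y 3 \<noteq> pent x y 4"
  proof
    assume "pent x y 3 = pent x y 4"
    then have "(x + y - 1) * y = (1 - x) * (x * y)" using assms(1,2) by (simp add: frac_eq_eq)
    then have "y * (x + y - 1) = y * ((1 - x) * x)" by (simp add: mult_ac)
    then show False using assms by simp
  qed
  ultimately have "pent x y 2 \<noteq> pent x y 3" "pent x y 3 \<noteq> pent x y 4" "pent x y 2 \<noteq> pent x y 4" by auto
  with * show ?thesis unfolding atLeastLessThan5 inj_on_def by (metis insert_iff singletonD)
qed

lemma inj_gx: "inj_on gx {0..<5}" and inj_gx': "inj_on gx' {0..<5}"
  unfolding gx_def gx'_def
  by (rule inj_pentI; simp add: X1_def X2_def X3_def X4_def one_ratfun4 Zero_fract_def eq_fract)+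

lemma has_val_gx:
  assumes "field_morphism \<phi>" "u1 \<noteq> 0" "u2 \<noteq> 0"
  shows "has_val \<phi> (u1, u2, u3, u4) (gx j) (pent u1 u2 j)"
  unfolding gx_def using assms by (intro has_val_pent field_morphism.has_val_X) auto

lemma has_val_gx':
  assumes "field_morphism \<phi>" "u3 \<noteq> 0" "u4 \<noteq> 0"
  shows "has_val \<phi> (u1, u2, u3, u4) (gx' j) (pent u3 u4 j)"
  unfolding gx'_def using assms by (intro has_val_pent field_morphism.has_val_X) auto

lemma (in pentagon) pent_aff: "pent (x (aff a 0)) (x (aff a 1)) j = x (aff a j)"
proof -
  interpret a: pentagon "\<lambda>i. x (aff a i)" by (rule pentagon_aff)
  show ?thesis using a.eq_pent[of j] by simp
qed

lemma pent_gx_Suc: "pent (gx 1) (gx 2) j = gx (j + 1)"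
  using gx.pent_aff[of "(1, False)" j] by (simp add: add.commute)

lemma gx_0_1: "gx 0 = X1" "gx 1 = X2" "gx' 0 = X3" "gx' 1 = X4"
  by (simp_all add: gx_def gx'_def)

lemma sig_eq: "sig = ratfun_eval const4 (gx 1) (gx 2) X3 X4"
  by (simp add: sig_def gx_def)

lemma sig_poly: "sig (poly (map_poly const4 g) (gx i)) = poly (map_poly const4 g) (gx (i + 1))"
proof -
  have "has_val const4 (gx 1, gx 2, X3, X4) (gx i) (gx (i + 1))"
    using has_val_gx[OF const4.field_morphism_axioms, of "gx 1" "gx 2" X3 X4 i] by (simp add: pent_gx_Suc)
  then show ?thesis unfolding sig_eq by (intro const4.ratfun_eval_eq const4.has_val_poly)
qed

lemma sig_pow_poly: "(sig ^^ n) (poly (map_poly const4 g) X1) = poly (map_poly const4 g) (gx (int n))"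
proof (induction n)
  case (Suc n)
  then show ?case using sig_poly[of g "int n"] by (simp add: add.commute)
qed (simp add: gx_0_1)

lemma lessThan5: "{..<5::nat} = {0, 1, 2, 3, 4}"
  by auto

lemma inv_s_eq: "inv_s = pent_s gx"
proof -
  have step: "sig ((gx i - 1) * (gx (i + 1) - 1)) = (gx (i + 1) - 1) * (gx (i + 1 + 1) - 1)" for i :: int
  proof -
    have "has_val const4 (gx 1, gx 2, X3, X4) (gx i) (gx (i + 1))" for i
      using has_val_gx[OF const4.field_morphism_axioms, of "gx 1" "gx 2" X3 X4 i] by (simp add: pent_gx_Suc)
    then show ?thesis unfolding sig_eq
      by (intro const4.ratfun_eval_eq const4.has_val_mult const4.has_val_diff const4.has_val_1)
  qed
  have pow: "(sig ^^ n) ((X1 - 1) * (X2 - 1)) = (gx (int n) - 1) * (gx (int n + 1) - 1)" for n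
  proof (induction n)
    case (Suc n)
    then show ?case using step[of "int n"] by (simp add: add.commute)
  qed (simp add: gx_0_1)
  have "gx 5 = gx 0" by (rule gx.x_cong) simp
  then show ?thesis unfolding inv_s_def lessThan5 by (simp add: pow pent_s_def add_ac del: funpow.simps)
qed

lemma inv_t_eq: "inv_t = pent_t gx"
  by (simp add: inv_t_def gx_def pent_t_pent)

lemma inv_t'_eq: "inv_t' = pent_t gx'"
  by (simp add: inv_t'_def gx'_def pent_t_pent)

section \<open>The dihedral group acting on the second pair of indeterminates\<close>

definition rho :: "int \<times> bool \<Rightarrow> 'k::field ratfun4 \<Rightarrow> 'k ratfun4" where
  "rho h = ratfun_eval const4 X1 X2 (gx' (aff h 0)) (gx' (aff h 1))"

lemma has_val_gx'_aff: "has_val const4 (X1, X2, gx' (aff h 0), gx' (aff h 1)) (gx' j) (gx' (aff h j))"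
  using has_val_gx'[OF const4.field_morphism_axioms, of "gx' (aff h 0)" "gx' (aff h 1)" X1 X2 j]
  by (simp add: gx'.pent_aff)

lemma rho_gx': "rho h (gx' j) = gx' (aff h j)"
  unfolding rho_def by (rule const4.ratfun_eval_eq[OF has_val_gx'_aff])

lemma rho_X: "rho h X1 = X1" "rho h X2 = X2" "rho h (const4 c) = const4 c"
  unfolding rho_def by (rule const4.ratfun_eval_eq const4.has_val_X const4.has_val_const)+

definition aff_inv :: "int \<times> bool \<Rightarrow> int \<times> bool" where
  "aff_inv h = (if snd h then fst h else - fst h, snd h)"

lemma aff_inv [simp]: "aff (aff_inv h) (aff h j) = j" "aff h (aff (aff_inv h) j) = j"
  by (auto simp: aff_def aff_inv_def)

text \<open>Evaluated at the point that belongs to the inverse index map, the substituted functions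
  become \<open>X3\<close> and \<open>X4\<close> again, so they are algebraically
  independent.\<close>

lemma morphism_rho: "field_morphism (rho h)"
  unfolding rho_def
proof (rule substitution_morphism(2)[OF const4.field_morphism_axioms, of "(X1, X2, gx' (aff (aff_inv h) 0), gx' (aff (aff_inv h) 1))" X1 X1 X2 X2 _ X3 _ X4])
  let ?p = "(X1, X2, gx' (aff (aff_inv h) 0), gx' (aff (aff_inv h) 1))"
  show "has_val const4 ?p (gx' (aff h 0)) X3" "has_val const4 ?p (gx' (aff h 1)) X4"
    using has_val_gx'_aff[of "aff_inv h" "aff h 0"] has_val_gx'_aff[of "aff_inv h" "aff h 1"]
    by (simp_all add: gx_0_1)
  show "ev const4 (X1, X2, X3, X4) d \<noteq> 0" if "d \<noteq> 0" for d :: "'a poly poly poly poly"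
    using that by (simp add: const4_ev_X Zero_fract_def eq_fract)
qed (rule const4.has_val_X)+

lemma rho_X34: "rho h X3 = gx' (aff h 0)" "rho h X4 = gx' (aff h 1)"
  using rho_gx'[of h 0] rho_gx'[of h 1] by (simp_all add: gx_0_1)

lemma rho_comp:
  fixes q :: "'k::field ratfun4"
  assumes "\<And>j. gx' (aff k j) = (gx' (aff h (aff h' j)) :: 'k ratfun4)"
  shows "rho h (rho h' q) = rho k q"
proof (rule morphism_ext[OF field_morphism_compose[OF morphism_rho morphism_rho] morphism_rho])
  show "rho h (rho h' X3) = rho k (X3 :: 'k ratfun4)" "rho h (rho h' X4) = rho k (X4 :: 'k ratfun4)"
    using assms[of 0] assms[of 1] by (simp_all add: rho_X34 rho_gx')
qed (simp_all add: rho_X)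

lemma rho_one: "rho (0, False) q = q"
proof (rule morphism_ext[OF morphism_rho])
  show "field_morphism (\<lambda>q :: 'a ratfun4. q)" by unfold_locales auto
  show "rho (0, False) X3 = X3" "rho (0, False) X4 = X4"
    by (simp_all add: rho_X34 gx_0_1)
qed (simp_all add: rho_X)

lemma (in pentagon) x_aff_mult:
  assumes "h \<in> carrier D5"
  shows "x (aff (g \<otimes>\<^bsub>D5\<^esub> h) j) = x (aff g (aff h j))"
proof -
  obtain u d v e where gh: "g = (u, d)" "h = (v, e)" "v \<in> {0..<5}" using assms by (cases g, cases h) (auto simp: carrier_D5)
  show ?thesis unfolding gh(1,2) mult_D5[OF gh(3)]
    by (rule x_cong) (auto simp: aff_def mod_simps algebra_simps)
qed

lemma rho_mult: "h \<in> carrier D5 \<Longrightarrow> rho g (rho h q) = rho (g \<otimes>\<^bsub>D5\<^esub> h) q"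
  by (rule rho_comp) (simp add: gx'.x_aff_mult)

lemma rho_Bij: "rho h \<in> Bij UNIV"
proof -
  have "rho h (rho (aff_inv h) q) = q" "rho (aff_inv h) (rho h q) = q" for q :: "'a ratfun4"
    using rho_comp[of "(0, False)" h "aff_inv h" q] rho_comp[of "(0, False)" "aff_inv h" h q] by (simp_all add: rho_one)
  then have "bij (rho h :: 'a ratfun4 \<Rightarrow> _)" by (metis bijI')
  then show ?thesis by (simp add: Bij_def)
qed

lemma rho_hom: "rho \<in> hom D5 (BijGroup UNIV)"
  by (rule homI) (auto simp: BijGroup_def rho_Bij compose_def rho_mult)

lemma rho_inj: "inj_on rho (carrier D5)"
proof (rule inj_onI)
  fix g h assume g: "g \<in> carrier D5" and h: "h \<in> carrier D5" and eq: "rho g = (rho h :: 'a ratfun4 \<Rightarrow> _)"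
  have *: "gx' (aff g j) = (gx' (aff h j) :: 'a ratfun4)" for j using rho_gx'[of g j] rho_gx'[of h j] eq by metis
  have "aff g j mod 5 = aff h j mod 5" for j
  proof (rule inj_onD[OF inj_gx'])
    show "gx' (aff g j mod 5) = (gx' (aff h j mod 5) :: 'a ratfun4)" unfolding gx'.x_mod by (rule *)
  qed auto
  from this[of 0] this[of 1] show "g = h"
    using g h by (cases g; cases h) (auto simp: aff_def carrier_D5 split: if_splits; presburger)
qed

lemma sig'_eq: "sig' = rho (1, False)"
  by (simp add: sig'_def rho_def gx'_def)

lemma gx'_neg: "gx' (- 1) = (1 - X3) / X4"
proof -
  have "gx' (- 1) = (gx' 4 :: 'a ratfun4)" by (rule gx'.x_cong) simp
  then show ?thesis by (simp add: gx'_def)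
qed

lemma tau'_eq: "tau' = rho (0, True)"
  by (simp add: tau'_def rho_def gx_0_1 gx'_neg)

text \<open>\<open>sig'\<close> and \<open>tau'\<close> are the images of a rotation and a
  reflection that generate \<open>D5\<close>. Together with the injectivity of \<open>rho\<close>
  this lets the product defining the resolvent run over \<open>D5\<close>.\<close>

lemma generate_eq:
  "generate (BijGroup UNIV) {sig', tau'} = (rho ` carrier D5 :: ('a::field ratfun4 \<Rightarrow> 'a ratfun4) set)"
proof -
  interpret B: group "BijGroup (UNIV :: 'a ratfun4 set)" by (rule group_BijGroup)
  interpret h: group_hom D5 "BijGroup (UNIV :: 'a ratfun4 set)" rho
    by unfold_locales (rule rho_hom)
  have gens: "(1, False) \<in> carrier D5" "(0, True) \<in> carrier D5" by (auto simp: carrier_D5)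
  have gen_D5: "generate D5 {(1, False), (0, True)} = carrier D5"
  proof
    show "generate D5 {(1, False), (0, True)} \<subseteq> carrier D5"
      using gens by (intro D5.generate_incl) auto
    have rot: "(int n mod 5, False) \<in> generate D5 {(1, False), (0, True)}" for n
    proof (induction n)
      case 0
      show ?case using generate.one[of D5 "{(1, False), (0, True)}"] by (simp add: one_D5)
    next
      case (Suc n)
      have "(int n mod 5, False) \<otimes>\<^bsub>D5\<^esub> (1, False) \<in> generate D5 {(1, False), (0, True)}"
        by (intro generate.eng Suc generate.incl) simp
      then show ?case by (simp add: mult_D5 mod_simps add.commute)
    qed
    show "carrier D5 \<subseteq> generate D5 {(1, False), (0, True)}"
    proof
      fix g assume "g \<in> carrier D5"
      then obtain u d where g: "g = (u, d)" "0 \<le> u" "u < 5" by (cases g) (auto simp: carrier_D5)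
      have r: "(u, False) \<in> generate D5 {(1, False), (0, True)}" using rot[of "nat u"] g by simp
      have "(u, False) \<otimes>\<^bsub>D5\<^esub> (0, True) \<in> generate D5 {(1, False), (0, True)}"
        by (intro generate.eng r generate.incl) simp
      with r g show "g \<in> generate D5 {(1, False), (0, True)}" by (cases d) (simp_all add: mult_D5)
    qed
  qed
  have "generate (BijGroup UNIV) (rho ` {(1, False), (0, True)}) =
      (rho :: _ \<Rightarrow> 'a ratfun4 \<Rightarrow> _) ` generate D5 {(1, False), (0, True)}"
    by (rule h.generate_img) (use gens in auto)
  then show ?thesis unfolding gen_D5 by (simp add: sig'_eq tau'_eq)
qed

text \<open>Separate index maps for the two pentagons make the Galois action on the roots of the
  resolvent visible; \<open>G\<close> and \<open>G'\<close> are Tschirnhausen transformations. On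
  the generic pentagons, with trivial index maps and without transformations, this is
  \<open>P\<close>.\<close>

definition rsum :: "('f::field \<Rightarrow> 'g::field) \<Rightarrow> ('f \<Rightarrow> 'g) \<Rightarrow> (int \<Rightarrow> 'f) \<Rightarrow> (int \<Rightarrow> 'f) \<Rightarrow> int \<times> bool \<Rightarrow> int \<times> bool \<Rightarrow> 'g" where
  "rsum G G' x x' a b = (\<Sum>i\<in>{0..<5}. G (x (aff a i)) * G' (x' (aff b i)))"

lemma sig'_pow_poly: "(sig' ^^ n) (poly (map_poly const4 g) X3) = poly (map_poly const4 g) (gx' (int n))"
proof (induction n)
  case (Suc n)
  have "field_morphism (rho (1, False))" by (rule morphism_rho)
  then interpret r: field_morphism "rho (1, False) :: 'a ratfun4 \<Rightarrow> _" .
  have "rho (1, False) (poly (map_poly const4 g) (gx' (int n))) = poly (map_poly const4 g) (gx' (int n + 1))"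
    unfolding r.poly_map_hom[symmetric] by (simp add: map_poly_map_poly rho_X rho_gx' comp_def add.commute)
  with Suc show ?case by (simp add: sig'_eq add.commute)
qed (simp add: gx_0_1)

abbreviation gpoly :: "'k::field poly \<Rightarrow> 'k ratfun4 \<Rightarrow> 'k ratfun4" where
  "gpoly g \<equiv> poly (map_poly const4 g)"

lemma P_tr_eq: "P_tr g g' = rsum (gpoly g) (gpoly g') gx gx' (0, False) (0, False)"
proof -
  have "P_tr g g' = (\<Sum>i<5. gpoly g (gx (int i)) * gpoly g' (gx' (int i)))"
    unfolding P_tr_def sig_pow_poly sig'_pow_poly ..
  also have "\<dots> = rsum (gpoly g) (gpoly g') gx gx' (0, False) (0, False)"
    unfolding rsum_def lessThan5 atLeastLessThan5 by simp
  finally show ?thesis .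
qed

lemma rho_rsum:
  fixes g g' :: "'a::field poly"
  shows "rho h (rsum (gpoly g) (gpoly g') gx gx' (0, False) (0, False)) = rsum (gpoly g) (gpoly g') gx gx' (0, False) h"
proof -
  have "field_morphism (rho h)" by (rule morphism_rho)
  then interpret r: field_morphism "rho h :: 'a ratfun4 \<Rightarrow> _" .
  have "rho h (gpoly f z) = gpoly f (rho h z)" for f and z :: "'a ratfun4"
    unfolding r.poly_map_hom[symmetric] by (simp add: map_poly_map_poly rho_X comp_def)
  moreover have "rho h (gx j) = (gx j :: 'a ratfun4)" for j
    unfolding rho_def using has_val_gx[OF const4.field_morphism_axioms, of X1 X2 _ _ j]
    by (intro const4.ratfun_eval_eq) (simp add: gx_def)
  ultimately show ?thesis by (simp add: rsum_def r.hom_sum rho_gx')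
qed

lemma resolvent_eq:
  "resolvent_xy g g' = (\<Prod>h\<in>carrier D5. [:- rsum (gpoly g) (gpoly g') gx gx' (0, False) h, 1:])"
  unfolding resolvent_xy_def generate_eq P_tr_eq
  by (subst prod.reindex[OF rho_inj]) (simp add: rho_rsum)

lemma inv_s'_eq: "inv_s' = pent_s gx'"
proof -
  have "field_morphism (rho (1, False))" by (rule morphism_rho)
  then interpret r: field_morphism "rho (1, False) :: 'a ratfun4 \<Rightarrow> _" .
  have pow: "(sig' ^^ n) ((X3 - 1) * (X4 - 1)) = (gx' (int n) - 1) * (gx' (int n + 1) - (1 :: 'a ratfun4))" for n
  proof (induction n)
    case (Suc n)
    then show ?case by (simp add: sig'_eq rho_gx' add.commute add.left_commute)
  qed (simp add: gx_0_1)
  have "gx' 5 = (gx' 0 :: 'a ratfun4)" by (rule gx'.x_cong) simp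
  then show ?thesis unfolding inv_s'_def lessThan5 by (simp add: pow pent_s_def add_ac del: funpow.simps)
qed

abbreviation INV :: "'k::field ratfun4 \<times> 'k ratfun4 \<times> 'k ratfun4 \<times> 'k ratfun4" where
  "INV \<equiv> (inv_s, inv_t, inv_s', inv_t')"

lemma inv_t_nz [simp]: "inv_t \<noteq> 0" "inv_t' \<noteq> 0"
  by (simp_all add: inv_t_eq inv_t'_eq)

interpretation evI: ring_morphism "ev const4 INV"
  by (rule const4.ring_morphism_ev)

lemma evI_X:
  "ev const4 INV [:[:[:[:0, 1:]:]:]:] = inv_s" "ev const4 INV [:[:[:0, 1:]:]:] = inv_t"
  "ev const4 INV [:[:0, 1:]:] = inv_s'" "ev const4 INV [:0, 1:] = inv_t'"
  "ev const4 INV [:[:[:[:c:]:]:]:] = const4 c"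
  by (simp_all add: ev_def eval4_def one_pCons)

text \<open>The ring \<open>k[s, t, s', t', 1/t, 1/t']\<close>.\<close>

definition Bgen :: "'k::field ratfun4 set" where
  "Bgen = {q. \<exists>n e. q * (inv_t * inv_t') ^ e = ev const4 INV n}"

lemma Bgen_ev: "ev const4 INV n \<in> Bgen"
  unfolding Bgen_def by (intro CollectI exI[of _ n] exI[of _ 0]) simp

lemma Bgen_closed:
  assumes "p \<in> Bgen" "q \<in> Bgen"
  shows "p + q \<in> Bgen" "p * q \<in> Bgen" "- p \<in> Bgen"
proof -
  obtain n e where p: "p * (inv_t * inv_t') ^ e = ev const4 INV n" using assms(1) by (auto simp: Bgen_def)
  obtain m f where q: "q * (inv_t * inv_t') ^ f = ev const4 INV m" using assms(2) by (auto simp: Bgen_def)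
  define T where "T = [:[:[:0, 1:]:]:] * [:0, 1 :: 'a poly poly poly:]"
  have T: "ev const4 INV T = inv_t * inv_t'" unfolding T_def evI.hom_mult evI_X ..
  have "(p + q) * (inv_t * inv_t') ^ (e + f) =
      (p * (inv_t * inv_t') ^ e) * (inv_t * inv_t') ^ f + (q * (inv_t * inv_t') ^ f) * (inv_t * inv_t') ^ e"
    by (simp add: power_add algebra_simps)
  also have "\<dots> = ev const4 INV (n * T ^ f + m * T ^ e)" unfolding p q by (simp add: T)
  finally show "p + q \<in> Bgen" unfolding Bgen_def by blast
  have "(p * q) * (inv_t * inv_t') ^ (e + f) = (p * (inv_t * inv_t') ^ e) * (q * (inv_t * inv_t') ^ f)"
    by (simp add: power_add algebra_simps)
  also have "\<dots> = ev const4 INV (n * m)" unfolding p q by simp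
  finally show "p * q \<in> Bgen" unfolding Bgen_def by blast
  have "(- p) * (inv_t * inv_t') ^ e = ev const4 INV (- n)" using p by simp
  then show "- p \<in> Bgen" unfolding Bgen_def by blast
qed

lemma Bgen_const: "const4 c \<in> Bgen"
  using Bgen_ev[of "[:[:[:[:c:]:]:]:]"] by (simp only: evI_X)

lemma Bgen_inverse: "inverse inv_t \<in> Bgen" "inverse inv_t' \<in> Bgen"
proof -
  have "inverse inv_t * (inv_t * inv_t') ^ 1 = ev const4 INV [:0, 1:]"
    "inverse inv_t' * (inv_t * inv_t') ^ 1 = ev const4 INV [:[:[:0, 1:]:]:]"
    unfolding evI_X by simp_all
  then show "inverse inv_t \<in> Bgen" "inverse inv_t' \<in> Bgen" unfolding Bgen_def by blast+
qed

lemma base_for_gx: "base_for (Bgen :: 'a::field ratfun4 set) gx" "base_for (Bgen :: 'a ratfun4 set) gx'"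
proof -
  have "(1 :: 'a ratfun4) \<in> Bgen" using Bgen_const[of 1] by simp
  moreover have "inv_s \<in> (Bgen :: 'a ratfun4 set)" "inv_t \<in> (Bgen :: 'a ratfun4 set)"
    "inv_s' \<in> (Bgen :: 'a ratfun4 set)" "inv_t' \<in> (Bgen :: 'a ratfun4 set)"
    using Bgen_ev by (metis evI_X)+
  ultimately show "base_for (Bgen :: 'a ratfun4 set) gx" "base_for (Bgen :: 'a ratfun4 set) gx'"
    unfolding base_for_def
    by (simp_all add: pentagon_gx pentagon_gx' inj_gx inj_gx' Bgen_closed Bgen_inverse
      flip: inv_s_eq inv_s'_eq inv_t_eq inv_t'_eq)
qed

section \<open>Resolvents of pentagons\<close>

lemma sum_periodic:
  assumes "\<And>i. f (i mod 5) = f i"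
  shows "(\<Sum>i\<in>{0..<5}. f (aff c i)) = (\<Sum>i\<in>{0..<5}. f i)"
proof -
  have "inj_on (\<lambda>i. aff c i mod 5) {0..<5}"
  proof (rule inj_onI)
    fix i j :: int assume ij: "i \<in> {0..<5}" "j \<in> {0..<5}" and eq: "aff c i mod 5 = aff c j mod 5"
    have "5 dvd aff c i - aff c j" using eq by (simp add: mod_eq_dvd_iff)
    then have "5 dvd i - j" by (cases "snd c") (auto simp: aff_def dvd_diff_commute)
    then have "i mod 5 = j mod 5" by (simp add: mod_eq_dvd_iff)
    then show "i = j" using ij by simp
  qed
  moreover have "(\<lambda>i. aff c i mod 5) ` {0..<5} \<subseteq> {0..<5}" by auto
  ultimately have bij: "bij_betw (\<lambda>i. aff c i mod 5) {0..<5} {0..<5}"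
    by (simp add: bij_betw_def endo_inj_surj)
  have "(\<Sum>i\<in>{0..<5}. f (aff c i)) = (\<Sum>i\<in>{0..<5}. f (aff c i mod 5))" by (simp add: assms)
  also have "\<dots> = (\<Sum>i\<in>{0..<5}. f i)" using sum.reindex_bij_betw[OF bij, of f] .
  finally show ?thesis .
qed

text \<open>The cyclic sum is reindexed by the inverse of \<open>a\<close>. This is the source of
  the action \<open>h \<mapsto> b h a\<^sup>-\<^sup>1\<close>.\<close>

lemma rsum_act:
  assumes "pentagon x" "pentagon x'" and a: "a \<in> carrier D5"
  shows "rsum G G' x x' a b = rsum G G' x x' (0, False) (b \<otimes>\<^bsub>D5\<^esub> inv\<^bsub>D5\<^esub> a)"
proof -
  interpret x: pentagon x by fact
  interpret x': pentagon x' by fact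
  define f where "f i = G (x (aff a i)) * G' (x' (aff b i))" for i
  have inv: "inv\<^bsub>D5\<^esub> a \<in> carrier D5" using a by simp
  have per: "f (i mod 5) = f i" for i
  proof -
    have "x (aff a (i mod 5)) = x (aff a i)" "x' (aff b (i mod 5)) = x' (aff b i)"
      by (rule x.x_cong x'.x_cong, simp add: aff_def mod_simps)+
    then show ?thesis by (simp add: f_def)
  qed
  have "rsum G G' x x' a b = (\<Sum>i\<in>{0..<5}. f i)" by (simp add: rsum_def f_def)
  also have "\<dots> = (\<Sum>i\<in>{0..<5}. f (aff (inv\<^bsub>D5\<^esub> a) i))" using sum_periodic[of f "inv\<^bsub>D5\<^esub> a"] per by simp
  also have "\<dots> = rsum G G' x x' (a \<otimes>\<^bsub>D5\<^esub> inv\<^bsub>D5\<^esub> a) (b \<otimes>\<^bsub>D5\<^esub> inv\<^bsub>D5\<^esub> a)"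
    by (simp add: rsum_def f_def x.x_aff_mult[OF inv] x'.x_aff_mult[OF inv])
  finally show ?thesis using a by (simp add: one_D5)
qed

lemma bij_two_sided:
  assumes "a \<in> carrier D5" "b \<in> carrier D5"
  shows "bij_betw (\<lambda>h. b \<otimes>\<^bsub>D5\<^esub> h \<otimes>\<^bsub>D5\<^esub> a) (carrier D5) (carrier D5)"
proof -
  have "inj_on (\<lambda>h. b \<otimes>\<^bsub>D5\<^esub> h \<otimes>\<^bsub>D5\<^esub> a) (carrier D5)" using assms by (auto simp: inj_on_def)
  moreover have "(\<lambda>h. b \<otimes>\<^bsub>D5\<^esub> h \<otimes>\<^bsub>D5\<^esub> a) ` carrier D5 \<subseteq> carrier D5" using assms by auto
  ultimately show ?thesis using finite_D5 by (simp add: bij_betw_def endo_inj_surj)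
qed

text \<open>Index maps on both pentagons only permute the ten factors, since
  \<open>h \<mapsto> b h a\<^sup>-\<^sup>1\<close> is a bijection of \<open>D5\<close>.\<close>

lemma prod_rsum_const:
  assumes "pentagon x" "pentagon x'" and ab: "a \<in> carrier D5" "b \<in> carrier D5"
  shows "(\<Prod>h\<in>carrier D5. [:- rsum G G' x x' a (b \<otimes>\<^bsub>D5\<^esub> h), 1:]) =
    (\<Prod>h\<in>carrier D5. [:- rsum G G' x x' (0, False) h, 1:])"
proof -
  have inv: "inv\<^bsub>D5\<^esub> a \<in> carrier D5" using ab by simp
  have "(\<Prod>h\<in>carrier D5. [:- rsum G G' x x' a (b \<otimes>\<^bsub>D5\<^esub> h), 1:]) =
    (\<Prod>h\<in>carrier D5. [:- rsum G G' x x' (0, False) (b \<otimes>\<^bsub>D5\<^esub> h \<otimes>\<^bsub>D5\<^esub> inv\<^bsub>D5\<^esub> a), 1:])"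
    by (simp add: rsum_act[OF assms(1,2) ab(1), of G G' "b \<otimes>\<^bsub>D5\<^esub> _"])
  also have "\<dots> = (\<Prod>h\<in>carrier D5. [:- rsum G G' x x' (0, False) h, 1:])"
    using prod.reindex_bij_betw[OF bij_two_sided[OF inv ab(2)], of "\<lambda>h. [:- rsum G G' x x' (0, False) h, 1:]"] .
  finally show ?thesis .
qed

lemma fun_alg_sum:
  assumes "(\<lambda>_. 0) \<in> K" "\<And>a. a \<in> A \<Longrightarrow> u a \<in> fun_alg K"
  shows "(\<lambda>g. \<Sum>a\<in>A. u a g) \<in> fun_alg K"
  using assms(2) by (induction A rule: infinite_finite_induct) (auto intro: fun_alg.intros assms(1))

lemma fun_alg_poly:
  assumes "\<And>n. (\<lambda>_. Polynomial.coeff p n) \<in> K" "u \<in> fun_alg K"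
  shows "(\<lambda>g. poly p (u g)) \<in> fun_alg K"
  using assms(1)
proof (induction p)
  case 0
  then show ?case by (auto intro: fun_alg.gen)
next
  case (pCons c p)
  have "(\<lambda>_. Polynomial.coeff p n) \<in> K" for n using pCons.prems[of "Suc n"] by simp
  then have "(\<lambda>g. poly p (u g)) \<in> fun_alg K" by (rule pCons.IH)
  moreover have "(\<lambda>_. c) \<in> fun_alg K" using pCons.prems[of 0] by (auto intro: fun_alg.gen)
  ultimately show ?case by (auto intro!: fun_alg.add fun_alg.mult assms(2))
qed

lemma fun_alg_coeff_prod:
  assumes K: "(\<lambda>_. 0) \<in> K" "(\<lambda>_. 1) \<in> K" "(\<lambda>_. - 1) \<in> K" and u: "\<And>a. a \<in> A \<Longrightarrow> u a \<in> fun_alg K"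
  shows "(\<lambda>g. Polynomial.coeff (\<Prod>a\<in>A. [:- u a g, 1:]) n) \<in> fun_alg K"
  using u
proof (induction A arbitrary: n rule: infinite_finite_induct)
  case (insert a A)
  have "(\<lambda>g. - u a g) \<in> fun_alg K"
    using fun_alg.mult[OF fun_alg.gen[OF K(3)], of "u a"] insert.prems by simp
  then have "(\<lambda>g. Polynomial.coeff [:- u a g, 1:] k) \<in> fun_alg K" for k
  proof (cases k)
    case (Suc j)
    then show ?thesis using K by (cases j) (auto intro: fun_alg.gen)
  qed simp
  then show ?case
    unfolding prod.insert[OF insert.hyps] coeff_mult
    by (intro fun_alg_sum fun_alg.mult K) (use insert in auto)
qed (use K in \<open>auto simp: coeff_1 intro: fun_alg.gen\<close>)

lemma gens2_const: "c \<in> B \<Longrightarrow> (\<lambda>_. c) \<in> gens2 B x x'"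
  by (auto simp: gens2_def)

lemma rsum_mem:
  assumes "\<And>n. Polynomial.coeff p n \<in> B" "\<And>n. Polynomial.coeff p' n \<in> B" "0 \<in> B" "pentagon x'" "h \<in> carrier D5"
  shows "(\<lambda>g. rsum (poly p) (poly p') x x' (fst g) (snd g \<otimes>\<^bsub>D5\<^esub> h)) \<in> fun_alg (gens2 B x x')"
proof -
  interpret pentagon x' by fact
  show ?thesis unfolding rsum_def x_aff_mult[OF assms(5)]
    by (intro fun_alg_sum fun_alg.mult fun_alg_poly gens2_const fun_alg.gen assms) (auto simp: gens2_def)
qed

text \<open>As functions of the two index maps the coefficients are constant by
  \<open>prod_rsum_const\<close>, so the descent for two pentagons puts them into the base
  ring.\<close>

lemma resolvent_coeff_mem:
  assumes B: "base_for B x" "base_for B x'"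
    and p: "\<And>n. Polynomial.coeff p n \<in> B" "\<And>n. Polynomial.coeff p' n \<in> B"
  shows "Polynomial.coeff (\<Prod>h\<in>carrier D5. [:- rsum (poly p) (poly p') x x' (0, False) h, 1:]) n \<in> B"
proof -
  have pent: "pentagon x" "pentagon x'" using B by (simp_all add: base_for_def)
  have one: "1 \<in> B" "- 1 \<in> B" using B by (simp_all add: base_for_def)
  then have zero: "0 \<in> B" using B by (metis add.right_inverse base_for_def)
  define w where "w = (\<lambda>g. Polynomial.coeff (\<Prod>h\<in>carrier D5. [:- rsum (poly p) (poly p') x x' (fst g) (snd g \<otimes>\<^bsub>D5\<^esub> h), 1:]) n)"
  have "w \<in> fun_alg (gens2 B x x')" unfolding w_def
    by (intro fun_alg_coeff_prod rsum_mem gens2_const p zero one pent)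
  moreover have w: "w g = Polynomial.coeff (\<Prod>h\<in>carrier D5. [:- rsum (poly p) (poly p') x x' (0, False) h, 1:]) n"
    if "g \<in> carrier (D5 \<times>\<times> D5)" for g
    using that unfolding w_def by (subst prod_rsum_const[OF pent]) auto
  moreover have "((0, False), (0, False)) \<in> carrier (D5 \<times>\<times> D5)" by (simp add: carrier_D5)
  ultimately show ?thesis using symmetric2[OF B, of w] by metis
qed

lemma resolvent_xy_Bgen: "Polynomial.coeff (resolvent_xy g g') n \<in> Bgen"
  unfolding resolvent_eq
  by (rule resolvent_coeff_mem[OF base_for_gx]) (simp_all add: Bgen_const)

section \<open>Specialization of the resolvents\<close>

lemma ev_to_ac_X:
  "ev (\<lambda>c. to_ac (const4 c)) (to_ac X1, to_ac X2, to_ac X3, to_ac X4) d = to_ac (Fract d 1)"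
  by (simp only: ev_morphism[OF const4.field_morphism_axioms to_ac.field_morphism_axioms] const4_ev_X)

lemma has_val_inv:
  assumes \<phi>: "field_morphism \<phi>" and x: "pentagon x" "pentagon x'"
  shows "has_val \<phi> (x 0, x 1, x' 0, x' 1) inv_s (pent_s x)" "has_val \<phi> (x 0, x 1, x' 0, x' 1) inv_t (pent_t x)"
    "has_val \<phi> (x 0, x 1, x' 0, x' 1) inv_s' (pent_s x')" "has_val \<phi> (x 0, x 1, x' 0, x' 1) inv_t' (pent_t x')"
proof -
  interpret field_morphism \<phi> by fact
  interpret x: pentagon x by fact
  interpret x': pentagon x' by fact
  let ?p = "(x 0, x 1, x' 0, x' 1)"
  have v: "has_val \<phi> ?p (gx j) (x j)" "has_val \<phi> ?p (gx' j) (x' j)" for j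
    using has_val_gx[OF \<phi>, of "x 0" "x 1" "x' 0" "x' 1" j] has_val_gx'[OF \<phi>, of "x' 0" "x' 1" "x 0" "x 1" j]
    by (simp_all flip: x.eq_pent x'.eq_pent)
  show "has_val \<phi> ?p inv_s (pent_s x)" "has_val \<phi> ?p inv_t (pent_t x)"
    "has_val \<phi> ?p inv_s' (pent_s x')" "has_val \<phi> ?p inv_t' (pent_t x')"
    unfolding inv_s_eq inv_t_eq inv_s'_eq inv_t'_eq pent_s_def pent_t_def
    by (intro has_val_add has_val_mult has_val_diff has_val_1 has_val_minus v)+
qed

text \<open>Over the algebraic closure of \<open>k(X1, X2, X3, X4)\<close> there are pentagons with
  the invariants \<open>X1, X2\<close> and \<open>X3, X4\<close>. So \<open>s, t, s', t'\<close>
  satisfy no polynomial relation.\<close>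

lemma inv_morphism:
  fixes q :: "'k::field ratfun4"
  shows "has_val const4 INV q (ratfun_eval const4 inv_s inv_t inv_s' inv_t' q)"
    and "field_morphism (ratfun_eval const4 inv_s inv_t inv_s' inv_t' :: 'k ratfun4 \<Rightarrow> _)"
proof -
  have nz: "to_ac X2 \<noteq> (0 :: 'k ratfun4 alg_closure)" "to_ac X4 \<noteq> (0 :: 'k ratfun4 alg_closure)" by simp_all
  obtain x :: "int \<Rightarrow> 'k ratfun4 alg_closure" where x: "pentagon x" "pent_s x = to_ac X1" "pent_t x = to_ac X2"
    using pentagon_exists[OF nz(1), of "to_ac X1"] by blast
  obtain x' :: "int \<Rightarrow> 'k ratfun4 alg_closure" where x': "pentagon x'" "pent_s x' = to_ac X3" "pent_t x' = to_ac X4"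
    using pentagon_exists[OF nz(2), of "to_ac X3"] by blast
  have \<phi>: "field_morphism (\<lambda>c :: 'k. to_ac (const4 c))"
    by (rule field_morphism_compose[OF const4.field_morphism_axioms to_ac.field_morphism_axioms])
  note v = has_val_inv[OF \<phi> x(1) x'(1), unfolded x x']
  have d: "ev (\<lambda>c :: 'k. to_ac (const4 c)) (to_ac X1, to_ac X2, to_ac X3, to_ac X4) d \<noteq> 0" if "d \<noteq> 0" for d
    unfolding ev_to_ac_X using that by (simp add: Zero_fract_def eq_fract)
  show "has_val const4 INV q (ratfun_eval const4 inv_s inv_t inv_s' inv_t' q)"
    "field_morphism (ratfun_eval const4 inv_s inv_t inv_s' inv_t' :: 'k ratfun4 \<Rightarrow> _)"
    by (rule substitution_morphism[OF \<phi> v], rule d, assumption)+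
qed

text \<open>The substitution \<open>E\<close> of the invariants is injective, and each coefficient
  of the resolvent is in its image because it lies in \<open>Bgen\<close>. So the polynomial
  described in \<open>F1_tr\<close> exists and is unique, and its denominators are powers of
  \<open>t t'\<close>, which is \<open>T\<close> in the proof.\<close>

lemma F1_tr_coeff:
  "\<exists>n e. Polynomial.coeff (F1_tr g g') j = Fract n (([:[:[:0, 1:]:]:] * [:0, 1:]) ^ e) \<and>
     has_val const4 INV (Polynomial.coeff (F1_tr g g') j) (Polynomial.coeff (resolvent_xy g g') j)"
proof -
  define E where "E = (ratfun_eval const4 inv_s inv_t inv_s' inv_t' :: 'a ratfun4 \<Rightarrow> _)"
  interpret E: field_morphism E unfolding E_def by (rule inv_morphism)
  have val: "has_val const4 INV q (E q)" for q unfolding E_def by (rule inv_morphism)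
  define T where "T = [:[:[:0, 1:]:]:] * [:0, 1 :: 'a poly poly poly:]"
  have T: "ev const4 INV T = inv_t * inv_t'" unfolding T_def evI.hom_mult evI_X ..
  have coeff: "\<exists>n e. E (Fract n (T ^ e)) = Polynomial.coeff (resolvent_xy g g') j" for j
  proof -
    obtain n e where ne: "Polynomial.coeff (resolvent_xy g g') j * (inv_t * inv_t') ^ e = ev const4 INV n"
      using resolvent_xy_Bgen[of g g' j] by (auto simp: Bgen_def)
    have nz: "ev const4 INV (T ^ e) \<noteq> 0" by (simp add: T)
    have "has_val const4 INV (Fract n (T ^ e)) (ev const4 INV n / ev const4 INV (T ^ e))"
      by (rule const4.has_val_Fract[OF nz])
    moreover have "ev const4 INV n / ev const4 INV (T ^ e) = Polynomial.coeff (resolvent_xy g g') j"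
      using nz by (simp add: T flip: ne)
    ultimately show ?thesis using const4.has_val_unique[OF val] by metis
  qed
  define F where "F = map_poly (inv_into UNIV E) (resolvent_xy g g')"
  have E_inj: "inj E" by (simp add: inj_def)
  have "map_poly E F = resolvent_xy g g'"
  proof (rule poly_eqI)
    fix n
    have "inv_into UNIV E 0 = 0" using E_inj by (metis E.hom_zero inv_f_f)
    moreover have "Polynomial.coeff (resolvent_xy g g') n \<in> range E" using coeff[of n] by (metis rangeI)
    ultimately show "Polynomial.coeff (map_poly E F) n = Polynomial.coeff (resolvent_xy g g') n"
      by (simp add: F_def coeff_map_poly f_inv_into_f)
  qed
  then have "F1_tr g g' = F"
    unfolding F1_tr_def E_def[symmetric] by (intro the_equality) (metis E.map_poly_hom_eq_iff)+
  with \<open>map_poly E F = resolvent_xy g g'\<close> have eq: "E (Polynomial.coeff (F1_tr g g') j) = Polynomial.coeff (resolvent_xy g g') j"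
    by (metis E.coeff_map_hom)
  obtain n e where "E (Fract n (T ^ e)) = Polynomial.coeff (resolvent_xy g g') j" using coeff by blast
  with eq have "Polynomial.coeff (F1_tr g g') j = Fract n (T ^ e)" by (metis E.hom_eq_iff)
  then show ?thesis using val[of "Polynomial.coeff (F1_tr g g') j"] eq unfolding T_def by auto
qed

lemma F1_tr_regular:
  assumes "field_morphism \<iota>" "a2 \<noteq> 0" "a2' \<noteq> 0"
  shows "\<exists>b. has_val \<iota> (a1, a2, a1', a2') (Polynomial.coeff (F1_tr g g') j) b"
proof -
  interpret field_morphism \<iota> by fact
  interpret e: ring_morphism "ev \<iota> (a1, a2, a1', a2')" by (rule ring_morphism_ev)
  obtain n e where ne: "Polynomial.coeff (F1_tr g g') j = Fract n (([:[:[:0, 1:]:]:] * [:0, 1:]) ^ e)"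
    using F1_tr_coeff by blast
  have "ev \<iota> (a1, a2, a1', a2') [:[:[:0, 1:]:]:] = a2" "ev \<iota> (a1, a2, a1', a2') [:0, 1:] = a2'"
    by (simp_all add: ev_def eval4_def one_pCons)
  then have "ev \<iota> (a1, a2, a1', a2') (([:[:[:0, 1:]:]:] * [:0, 1:]) ^ e) \<noteq> 0"
    unfolding e.hom_power e.hom_mult using assms by simp
  from has_val_Fract[OF this] show ?thesis unfolding ne by blast
qed

lemma coeff_specialize:
  assumes "field_morphism \<iota>" "has_val \<iota> (a1, a2, a1', a2') (Polynomial.coeff F j) b"
  shows "Polynomial.coeff (specialize \<iota> a1 a2 a1' a2' F) j = b"
proof -
  interpret field_morphism \<iota> by fact
  have "ratfun_eval \<iota> a1 a2 a1' a2' 0 = 0" by (rule ratfun_eval_eq[OF has_val_0])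
  then show ?thesis
    unfolding specialize_def using ratfun_eval_eq[OF assms(2)] by (simp add: coeff_map_poly)
qed

text \<open>A coefficient of \<open>F1_tr\<close> is evaluated in two ways: directly at
  \<open>a1, a2, a1', a2'\<close>, and by substituting the invariants first and evaluating at the
  pentagons, where it becomes a coefficient of the product over \<open>D5\<close>. Values are
  unique, so both agree.\<close>

theorem specialize_F1_tr:
  fixes \<iota> :: "'k::field \<Rightarrow> 'm::field"
  assumes \<iota>: "field_morphism \<iota>" and x: "pentagon x" "pent_s x = to_ac a1" "pent_t x = to_ac a2"
    and x': "pentagon x'" "pent_s x' = to_ac a1'" "pent_t x' = to_ac a2'"
  shows "map_poly to_ac (specialize \<iota> a1 a2 a1' a2' (F1_tr g g')) =
    (\<Prod>h\<in>carrier D5. [:- rsum (poly (map_poly (\<lambda>c. to_ac (\<iota> c)) g)) (poly (map_poly (\<lambda>c. to_ac (\<iota> c)) g')) x x' (0, False) h, 1:])"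
proof (rule poly_eqI)
  fix j
  have \<phi>: "field_morphism (\<lambda>c. to_ac (\<iota> c))"
    by (rule field_morphism_compose[OF \<iota> to_ac.field_morphism_axioms])
  interpret \<phi>: field_morphism "\<lambda>c. to_ac (\<iota> c)" by (rule \<phi>)
  interpret x: pentagon x by fact
  interpret x': pentagon x' by fact
  have nz: "a2 \<noteq> 0" "a2' \<noteq> 0" using x.t_nz x'.t_nz x(3) x'(3) by auto
  let ?p = "(x 0, x 1, x' 0, x' 1)" and ?B = "Polynomial.coeff (F1_tr g g') j"
  obtain b where b: "has_val \<iota> (a1, a2, a1', a2') ?B b" using F1_tr_regular[OF \<iota> nz] by blast
  have "has_val (\<lambda>c. to_ac (\<iota> c)) (to_ac a1, to_ac a2, to_ac a1', to_ac a2') ?B (to_ac b)"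
    by (rule has_val_morphism[OF \<iota> to_ac.field_morphism_axioms b])
  then obtain q where q: "has_val const4 INV ?B q" "has_val (\<lambda>c. to_ac (\<iota> c)) ?p q (to_ac b)"
    using has_val_comp[OF \<phi> has_val_inv[OF \<phi> x(1) x'(1)]] unfolding x x' by blast
  have "q = Polynomial.coeff (resolvent_xy g g') j"
    using F1_tr_coeff[of g g' j] const4.has_val_unique[OF q(1)] by blast
  moreover have "has_val (\<lambda>c. to_ac (\<iota> c)) ?p (gx j) (x j)" "has_val (\<lambda>c. to_ac (\<iota> c)) ?p (gx' j) (x' j)" for j
    using has_val_gx[OF \<phi>, of "x 0" "x 1" "x' 0" "x' 1" j] has_val_gx'[OF \<phi>, of "x' 0" "x' 1" "x 0" "x 1" j]
    by (simp_all flip: x.eq_pent x'.eq_pent)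
  then have "has_val (\<lambda>c. to_ac (\<iota> c)) ?p (Polynomial.coeff (resolvent_xy g g') j)
    (Polynomial.coeff (\<Prod>h\<in>carrier D5. [:- rsum (poly (map_poly (\<lambda>c. to_ac (\<iota> c)) g)) (poly (map_poly (\<lambda>c. to_ac (\<iota> c)) g')) x x' (0, False) h, 1:]) j)"
    unfolding resolvent_eq rsum_def
    by (intro \<phi>.has_val_coeff_prod_linear \<phi>.has_val_sum \<phi>.has_val_mult \<phi>.has_val_poly)
  ultimately have "to_ac b = Polynomial.coeff (\<Prod>h\<in>carrier D5. [:- rsum (poly (map_poly (\<lambda>c. to_ac (\<iota> c)) g)) (poly (map_poly (\<lambda>c. to_ac (\<iota> c)) g')) x x' (0, False) h, 1:]) j"
    using \<phi>.has_val_unique[OF q(2)] by blast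
  then show "Polynomial.coeff (map_poly to_ac (specialize \<iota> a1 a2 a1' a2' (F1_tr g g'))) j =
    Polynomial.coeff (\<Prod>h\<in>carrier D5. [:- rsum (poly (map_poly (\<lambda>c. to_ac (\<iota> c)) g)) (poly (map_poly (\<lambda>c. to_ac (\<iota> c)) g')) x x' (0, False) h, 1:]) j"
    using coeff_specialize[OF \<iota> b] by simp
qed

text \<open>The substituted functions have values at the point, and \<open>- 1 / a2\<close> is
  nonzero, so \<open>F1_tr\<close> is regular at these values and the two evaluations
  compose.\<close>

lemma specialize_F2_tr:
  assumes \<iota>: "field_morphism \<iota>" and nz: "a2 \<noteq> 0" "a2' \<noteq> 0"
  shows "specialize \<iota> a1 a2 a1' a2' (F2_tr g g') = specialize \<iota> ((a1 + 5 * a2) / a2\<^sup>2) (- 1 / a2) a1' a2' (F1_tr g g')"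
proof (rule poly_eqI)
  fix j
  interpret field_morphism \<iota> by fact
  let ?p = "(a1, a2, a1', a2')"
  have "- 1 / a2 \<noteq> 0" using nz by simp
  then obtain b where b: "has_val \<iota> ((a1 + 5 * a2) / a2\<^sup>2, - 1 / a2, a1', a2') (Polynomial.coeff (F1_tr g g') j) b"
    using F1_tr_regular[OF \<iota> _ nz(2)] by blast
  have "has_val \<iota> ?p ((X1 + 5 * X2) / X2\<^sup>2) ((a1 + 5 * a2) / a2\<^sup>2)"
    by (intro has_val_divide has_val_add has_val_mult has_val_numeral has_val_power has_val_X) (use nz in simp)
  moreover have "has_val \<iota> ?p (- 1 / X2) (- 1 / a2)"
    by (intro has_val_divide has_val_minus has_val_1 has_val_X nz)
  ultimately obtain q where q: "has_val const4 ((X1 + 5 * X2) / X2\<^sup>2, - 1 / X2, X3, X4) (Polynomial.coeff (F1_tr g g') j) q"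
    "has_val \<iota> ?p q b"
    using has_val_comp[OF \<iota> _ _ has_val_X(3,4) b] by blast
  have "Polynomial.coeff (F2_tr g g') j = q"
    using coeff_specialize[OF const4.field_morphism_axioms q(1)] by (simp add: F2_tr_def specialize_def)
  then have "Polynomial.coeff (specialize \<iota> a1 a2 a1' a2' (F2_tr g g')) j = b"
    using coeff_specialize[OF \<iota>, of a1 a2 a1' a2' "F2_tr g g'" j b] q(2) by simp
  then show "Polynomial.coeff (specialize \<iota> a1 a2 a1' a2' (F2_tr g g')) j =
    Polynomial.coeff (specialize \<iota> ((a1 + 5 * a2) / a2\<^sup>2) (- 1 / a2) a1' a2' (F1_tr g g')) j"
    using coeff_specialize[OF \<iota> b] by simp
qed

section \<open>The Galois groups of two pentagons\<close>

lemma avoid_roots: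
  fixes S :: "'m::field alg_closure poly set"
  assumes "infinite (UNIV :: 'm set)" "finite S" "0 \<notin> S"
  shows "\<exists>e::'m. \<forall>p\<in>S. poly p (to_ac e) \<noteq> 0"
proof -
  have "finite (\<Union>p\<in>S. {z. poly p z = 0})" using assms(2,3) by (auto intro!: poly_roots_finite)
  moreover have "infinite (range (to_ac :: 'm \<Rightarrow> _))" using assms(1) inj_to_ac finite_imageD by blast
  ultimately obtain z where "z \<in> range (to_ac :: 'm \<Rightarrow> _)" "z \<notin> (\<Union>p\<in>S. {z. poly p z = 0})"
    by (meson finite_subset subsetI)
  then show ?thesis by blast
qed

text \<open>The difference of the combinations with coefficients \<open>1, z, z\<^sup>2, ...\<close>
  at \<open>g\<close> and at \<open>h\<close>, as a polynomial in \<open>z\<close>. Its roots are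
  the choices of \<open>z\<close> that fail to separate \<open>g\<close> from
  \<open>h\<close>.\<close>

definition pencil :: "nat \<Rightarrow> (nat \<Rightarrow> 'i \<Rightarrow> 'm::field alg_closure) \<Rightarrow> 'i \<Rightarrow> 'i \<Rightarrow> 'm alg_closure poly" where
  "pencil n f g h = (\<Sum>i<n. Polynomial.monom (f i g - f i h) i)"

lemma poly_pencil: "poly (pencil n f g h) z = (\<Sum>i<n. z ^ i * f i g) - (\<Sum>i<n. z ^ i * f i h)"
  by (simp add: pencil_def poly_sum poly_monom sum_subtractf algebra_simps)

lemma pencil_nz: "i < n \<Longrightarrow> f i g \<noteq> f i h \<Longrightarrow> pencil n f g h \<noteq> 0"
proof
  assume "i < n" "f i g \<noteq> f i h" "pencil n f g h = 0"
  then have "Polynomial.coeff (pencil n f g h) i = 0" by simp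
  moreover have "Polynomial.coeff (pencil n f g h) i = f i g - f i h"
    using \<open>i < n\<close> by (simp add: pencil_def coeff_sum)
  ultimately show False using \<open>f i g \<noteq> f i h\<close> by simp
qed

text \<open>Each pair \<open>g \<noteq> h\<close> excludes the finitely many roots of a nonzero
  polynomial, and \<open>M\<close> is infinite. The resulting combination plays the role of a
  primitive element.\<close>

lemma separating_element:
  fixes f :: "nat \<Rightarrow> 'i \<Rightarrow> 'm::field alg_closure"
  assumes "infinite (UNIV :: 'm set)" "finite A"
    and sep: "\<And>g h. g \<in> A \<Longrightarrow> h \<in> A \<Longrightarrow> g \<noteq> h \<Longrightarrow> \<exists>i<n. f i g \<noteq> f i h"
  shows "\<exists>e. inj_on (\<lambda>g. \<Sum>i<n. to_ac (e ^ i) * f i g) A"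
proof -
  define S where "S = (\<lambda>(g, h). pencil n f g h) ` {(g, h). g \<in> A \<and> h \<in> A \<and> g \<noteq> h}"
  have "finite {(g, h). g \<in> A \<and> h \<in> A \<and> g \<noteq> h}"
    by (rule finite_subset[of _ "A \<times> A"]) (use assms(2) in auto)
  then have fin: "finite S" by (simp add: S_def)
  have "0 \<notin> S"
  proof
    assume "0 \<in> S"
    then obtain g h where gh: "g \<in> A" "h \<in> A" "g \<noteq> h" "pencil n f g h = 0" by (auto simp: S_def)
    from sep[OF gh(1-3)] obtain i where "i < n" "f i g \<noteq> f i h" by blast
    with pencil_nz[of i n f g h] gh(4) show False by simp
  qed
  from avoid_roots[OF assms(1) fin this] obtain e :: 'm where e: "\<And>p. p \<in> S \<Longrightarrow> poly p (to_ac e) \<noteq> 0"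
    by blast
  have "inj_on (\<lambda>g. \<Sum>i<n. to_ac (e ^ i) * f i g) A"
  proof (rule inj_onI, rule ccontr)
    fix g h assume gh: "g \<in> A" "h \<in> A" "g \<noteq> h"
      and eq: "(\<Sum>i<n. to_ac (e ^ i) * f i g) = (\<Sum>i<n. to_ac (e ^ i) * f i h)"
    have "pencil n f g h \<in> S" using gh by (auto simp: S_def)
    from e[OF this] show False using eq by (simp add: poly_pencil)
  qed
  then show ?thesis by blast
qed

lemma aff_eqI:
  assumes "a \<in> carrier D5" "b \<in> carrier D5" "aff a 0 mod 5 = aff b 0 mod 5" "aff a 1 mod 5 = aff b 1 mod 5"
  shows "a = b"
proof -
  obtain u d v e where ab: "a = (u, d)" "b = (v, e)" by (cases a, cases b)
  have "u mod 5 = v mod 5" using assms(3) by (cases d; cases e) (simp_all add: ab)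
  then have uv: "u = v" using assms(1,2) by (simp add: ab carrier_D5)
  have "(u + 1) mod 5 \<noteq> (u - 1) mod 5" by (simp add: mod_eq_dvd_iff)
  then have "d = e" using assms(4) by (cases d; cases e) (simp_all add: ab uv)
  then show ?thesis using ab uv by simp
qed

locale distinct_pentagon = pentagon x for x :: "int \<Rightarrow> 'f::field" +
  assumes inj: "inj_on x {0..<5}"
begin

lemma x_eq_iff: "x i = x j \<longleftrightarrow> i mod 5 = j mod 5"
proof
  assume "x i = x j"
  then have "x (i mod 5) = x (j mod 5)" by (simp add: x_mod)
  then show "i mod 5 = j mod 5" using inj by (auto simp: inj_on_def)
qed (rule x_cong)

lemma separates:
  assumes "a \<in> carrier D5" "b \<in> carrier D5" "x (aff a 0) = x (aff b 0)" "x (aff a 1) = x (aff b 1)"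
  shows "a = b"
  using aff_eqI[OF assms(1,2)] assms(3,4) by (simp add: x_eq_iff)

end

locale root_pentagon = distinct_pentagon x for x :: "int \<Rightarrow> 'm::field alg_closure" +
  fixes a1 a2 :: 'm
  assumes s_eq: "pent_s x = to_ac a1" and t_eq: "pent_t x = to_ac a2"
begin

lemma base_for: "base_for (range to_ac) x"
proof -
  have range: "to_ac c \<in> range to_ac" for c :: 'm by (rule rangeI)
  have "inverse (to_ac a2) \<in> range to_ac" using range[of "inverse a2"] by simp
  moreover have "- c \<in> range to_ac" if "c \<in> range to_ac" for c :: "'m alg_closure"
    using that range by (elim rangeE) (simp only: to_ac_minus[symmetric])
  moreover have "c + d \<in> range to_ac \<and> c * d \<in> range to_ac"
    if "c \<in> range to_ac" "d \<in> range to_ac" for c d :: "'m alg_closure"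
    using that range by (elim rangeE) (simp only: to_ac_add[symmetric] to_ac_mult[symmetric])
  moreover have "(1 :: 'm alg_closure) \<in> range to_ac" using range[of 1] by simp
  ultimately show ?thesis
    unfolding base_for_def s_eq t_eq using pentagon_axioms inj range by simp
qed

lemma fD5_roots: "ac_roots (fD5 a1 a2) = range x"
proof -
  have "map_poly to_ac (fD5 a1 a2) = fD5 (pent_s x) (pent_t x)"
    by (simp add: s_eq t_eq fD5_def)
  then have "ac_roots (fD5 a1 a2) = {z. \<exists>i\<in>{0..<5}. z = x i}"
    unfolding ac_roots_def fD5_eq_prod by (simp add: poly_prod prod_zero_iff)
  also have "\<dots> = range x"
  proof (intro equalityI subsetI)
    fix z assume "z \<in> range x"
    then obtain i where "z = x (i mod 5)" by (auto simp: x_mod)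
    moreover have "i mod 5 \<in> {0..<5}" by simp
    ultimately show "z \<in> {z. \<exists>i\<in>{0..<5}. z = x i}" by blast
  qed auto
  finally show ?thesis .
qed

definition "W1 = fun_alg (gens1 (range to_ac) x)"

text \<open>Translation moves the generators of \<open>W1\<close> among themselves, and a constant
  function has its value in \<open>M\<close> by \<open>symmetric1\<close>. Two consecutive entries
  tell the elements of \<open>D5\<close> apart, which yields \<open>\<theta>\<close>.\<close>

lemma galois1:
  assumes "infinite (UNIV :: 'm set)"
  shows "\<exists>\<theta>. galois_algebra D5 W1 \<theta>"
proof -
  have gen: "(\<lambda>_. to_ac c) \<in> W1" "(\<lambda>a. x (aff a j)) \<in> W1" for c j
    unfolding W1_def by (auto intro!: fun_alg.gen simp: gens1_def)
  define f where "f = (\<lambda>(i::nat) a. x (aff a (int i)))"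
  have "\<exists>i<2. f i g \<noteq> f i h" if gh: "g \<in> carrier D5" "h \<in> carrier D5" "g \<noteq> h" for g h
  proof (rule ccontr)
    assume "\<not> ?thesis"
    then have "f 0 g = f 0 h" "f 1 g = f 1 h" by auto
    then show False using separates[OF gh(1,2)] gh(3) by (simp add: f_def)
  qed
  then obtain e where e: "inj_on (\<lambda>g. \<Sum>i<2. to_ac (e ^ i) * f i g) (carrier D5)"
    using separating_element[OF assms finite_D5, of 2 f] by blast
  have "galois_algebra D5 W1 (\<lambda>g. \<Sum>i<2. to_ac (e ^ i) * f i g)"
  proof (unfold_locales)
    show "finite (carrier D5)" by (rule finite_D5)
    show "(\<lambda>_. to_ac c) \<in> W1" for c by (rule gen)
    show "(\<lambda>g. u g + v g) \<in> W1" "(\<lambda>g. u g * v g) \<in> W1" if "u \<in> W1" "v \<in> W1" for u v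
      using that unfolding W1_def by (auto intro: fun_alg.intros)
    show "(\<lambda>g. u (g \<otimes>\<^bsub>D5\<^esub> h)) \<in> W1" if u: "u \<in> W1" and h: "h \<in> carrier D5" for u h
      unfolding W1_def
    proof (rule fun_alg_subst[OF u[unfolded W1_def]])
      fix v assume "v \<in> gens1 (range to_ac) x"
      then consider c where "v = (\<lambda>_. to_ac c)" | j where "v = (\<lambda>a. x (aff a j))"
        unfolding gens1_def by blast
      then show "(\<lambda>g. v (g \<otimes>\<^bsub>D5\<^esub> h)) \<in> fun_alg (gens1 (range to_ac) x)"
        unfolding W1_def[symmetric] by cases (simp_all only: gen x_aff_mult[OF h])
    qed
    show "u \<one>\<^bsub>D5\<^esub> \<in> range to_ac" if "u \<in> W1" "\<And>g. g \<in> carrier D5 \<Longrightarrow> u g = u \<one>\<^bsub>D5\<^esub>" for u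
      using symmetric1[OF base_for that(1)[unfolded W1_def]] that(2) by (simp add: one_D5)
    have "(\<lambda>_. 0) \<in> gens1 (range to_ac) x" unfolding gens1_def by (force intro: exI[of _ 0] range_eqI[of _ _ 0])
    then show "(\<lambda>g. \<Sum>i<2. to_ac (e ^ i) * f i g) \<in> W1"
      using gen unfolding W1_def f_def by (intro fun_alg_sum fun_alg.mult)
    show "inj_on (\<lambda>g. \<Sum>i<2. to_ac (e ^ i) * f i g) (carrier D5)" by (rule e)
  qed
  then show ?thesis by blast
qed

end

section \<open>Splitting fields as sets of values\<close>

lemma is_subfield_add:
  assumes "is_subfield L" "u \<in> L" "v \<in> L"
  shows "u + v \<in> L"
proof -
  have "0 \<in> L" using assms unfolding is_subfield_def by (metis diff_self)
  then have "0 - v \<in> L" using assms unfolding is_subfield_def by blast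
  then have "u - (0 - v) \<in> L" using assms unfolding is_subfield_def by blast
  then show ?thesis by simp
qed

lemma (in galois_algebra) Spl_eq:
  assumes W: "W = fun_alg K" and K: "\<And>v g. v \<in> K \<Longrightarrow> v g \<in> range to_ac \<union> ac_roots q"
    and roots: "ac_roots q \<subseteq> (\<lambda>u. u \<one>) ` W"
  shows "Spl q = (\<lambda>u. u \<one>) ` W"
proof
  have "range to_ac \<subseteq> (\<lambda>u. u \<one>) ` W" using const_mem by (force simp: image_iff)
  then show "Spl q \<subseteq> (\<lambda>u. u \<one>) ` W"
    unfolding Spl_def using is_subfield_values roots by blast
  have "u g \<in> L" if L: "is_subfield L" "range to_ac \<subseteq> L" "ac_roots q \<subseteq> L" and u: "u \<in> fun_alg K" for u g L
    using u
  proof induction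
    case (gen u)
    then show ?case using K L by blast
  next
    case (add u v)
    then show ?case using is_subfield_add[OF L(1)] by blast
  next
    case (mult u v)
    then show ?case using L(1) by (auto simp: is_subfield_def)
  qed
  then show "(\<lambda>u. u \<one>) ` W \<subseteq> Spl q" unfolding Spl_def W by blast
qed

lemma (in root_pentagon) Spl1:
  assumes "galois_algebra D5 W1 \<theta>"
  shows "Spl (fD5 a1 a2) = (\<lambda>u. u (0, False)) ` W1"
proof -
  interpret galois_algebra D5 W1 \<theta> by fact
  have "x i \<in> (\<lambda>u. u (0, False)) ` W1" for i
    unfolding W1_def by (rule image_eqI[of _ _ "\<lambda>a. x (aff a i)"]) (auto intro!: fun_alg.gen simp: gens1_def)
  then have "ac_roots (fD5 a1 a2) \<subseteq> (\<lambda>u. u \<one>\<^bsub>D5\<^esub>) ` W1" unfolding fD5_roots one_D5 by blast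
  then show ?thesis
    using Spl_eq[OF W1_def, of "fD5 a1 a2"] by (auto simp: gens1_def fD5_roots one_D5)
qed

locale two_pentagons = x: root_pentagon x a1 a2 + x': root_pentagon x' a1' a2'
  for x x' :: "int \<Rightarrow> 'm::field alg_closure" and a1 a2 a1' a2' +
  assumes infinite_M: "infinite (UNIV :: 'm set)"
begin

definition "W2 = fun_alg (gens2 (range to_ac) x x')"

lemma gen2:
  "(\<lambda>_. to_ac c) \<in> W2" "(\<lambda>g. x (aff (fst g) j)) \<in> W2" "(\<lambda>g. x' (aff (snd g) j)) \<in> W2"
  unfolding W2_def by (auto intro!: fun_alg.gen simp: gens2_def)

lemma W1_W2: "u \<in> x.W1 \<Longrightarrow> (\<lambda>g. u (fst g)) \<in> W2" "v \<in> x'.W1 \<Longrightarrow> (\<lambda>g. v (snd g)) \<in> W2"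
  unfolding x.W1_def x'.W1_def W2_def
  by (erule fun_alg_subst, force simp: gens1_def gens2_def intro: fun_alg.gen)+

lemma galois2: "\<exists>\<theta>. galois_algebra (D5 \<times>\<times> D5) W2 \<theta>"
proof -
  interpret I: group "D5 \<times>\<times> D5" by (rule DirProd_group) unfold_locales
  \<comment> \<open>Two consecutive entries of \<open>x\<close> for \<open>i = 0, 1\<close> and of
    \<open>x'\<close> for \<open>i = 2, 3\<close>; together they determine both index maps.\<close>
  define f where "f = (\<lambda>(i::nat) g. if i < 2 then x (aff (fst g) (int i)) else x' (aff (snd g) (int i - 2)))"
  have "\<exists>i<4. f i g \<noteq> f i h" if gh: "g \<in> carrier (D5 \<times>\<times> D5)" "h \<in> carrier (D5 \<times>\<times> D5)" "g \<noteq> h" for g h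
  proof (rule ccontr)
    assume "\<not> ?thesis"
    then have "f 0 g = f 0 h" "f 1 g = f 1 h" "f 2 g = f 2 h" "f 3 g = f 3 h" by auto
    then have "fst g = fst h" "snd g = snd h"
      using gh x.separates[of "fst g" "fst h"] x'.separates[of "snd g" "snd h"] by (auto simp: f_def)
    then show False using gh(3) by (simp add: prod_eq_iff)
  qed
  moreover have fin: "finite (carrier (D5 \<times>\<times> D5))" by (simp add: finite_D5)
  ultimately obtain e where e: "inj_on (\<lambda>g. \<Sum>i<4. to_ac (e ^ i) * f i g) (carrier (D5 \<times>\<times> D5))"
    using separating_element[OF infinite_M, of "carrier (D5 \<times>\<times> D5)" 4 f] by blast
  have "galois_algebra (D5 \<times>\<times> D5) W2 (\<lambda>g. \<Sum>i<4. to_ac (e ^ i) * f i g)"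
  proof (unfold_locales)
    show "finite (carrier (D5 \<times>\<times> D5))" by (rule fin)
    show "(\<lambda>_. to_ac c) \<in> W2" for c by (rule gen2)
    show "(\<lambda>g. u g + v g) \<in> W2" "(\<lambda>g. u g * v g) \<in> W2" if "u \<in> W2" "v \<in> W2" for u v
      using that unfolding W2_def by (auto intro: fun_alg.intros)
    show "(\<lambda>g. u (g \<otimes>\<^bsub>D5 \<times>\<times> D5\<^esub> h)) \<in> W2" if u: "u \<in> W2" and h: "h \<in> carrier (D5 \<times>\<times> D5)" for u h
      unfolding W2_def
    proof (rule fun_alg_subst[OF u[unfolded W2_def]])
      fix v assume v: "v \<in> gens2 (range to_ac) x x'"
      obtain h1 h2 where h12: "h = (h1, h2)" "h1 \<in> carrier D5" "h2 \<in> carrier D5" using h by auto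
      have "x (aff (fst (g \<otimes>\<^bsub>D5 \<times>\<times> D5\<^esub> h)) j) = x (aff (fst g) (aff h1 j))"
        "x' (aff (snd (g \<otimes>\<^bsub>D5 \<times>\<times> D5\<^esub> h)) j) = x' (aff (snd g) (aff h2 j))" for g j
        by (cases g, simp add: h12(1) x.x_aff_mult[OF h12(2)] x'.x_aff_mult[OF h12(3)])+
      note * = this
      show "(\<lambda>g. v (g \<otimes>\<^bsub>D5 \<times>\<times> D5\<^esub> h)) \<in> fun_alg (gens2 (range to_ac) x x')"
        unfolding W2_def[symmetric] using v
        unfolding gens2_def by (elim UnE CollectE exE conjE rangeE) (simp_all only: gen2 *)
    qed
    show "u \<one>\<^bsub>D5 \<times>\<times> D5\<^esub> \<in> range to_ac"
      if "u \<in> W2" "\<And>g. g \<in> carrier (D5 \<times>\<times> D5) \<Longrightarrow> u g = u \<one>\<^bsub>D5 \<times>\<times> D5\<^esub>" for u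
      using symmetric2[OF x.base_for x'.base_for that(1)[unfolded W2_def]] that(2) by (simp add: one_D5)
    have zero: "(\<lambda>_. 0) \<in> gens2 (range to_ac) x x'" by (rule gens2_const) (metis rangeI to_ac_0)
    have "f i \<in> W2" for i unfolding f_def using gen2 by (cases "i < 2") simp_all
    then show "(\<lambda>g. \<Sum>i<4. to_ac (e ^ i) * f i g) \<in> W2"
      using gen2(1) zero unfolding W2_def by (intro fun_alg_sum fun_alg.mult)
    show "inj_on (\<lambda>g. \<Sum>i<4. to_ac (e ^ i) * f i g) (carrier (D5 \<times>\<times> D5))" by (rule e)
  qed
  then show ?thesis by blast
qed

end

text \<open>For the image \<open>N\<close> of \<open>I.\<Gamma>\<close> the polynomial with the
  roots \<open>\<theta>' n\<close> is constant on \<open>I.\<Gamma>\<close>, hence has coefficients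
  in \<open>M\<close>. It vanishes at \<open>\<theta>' \<one>\<close>, so also at
  \<open>\<theta>' a\<close> for \<open>a\<close> in \<open>J.\<Gamma>\<close>, and this forces
  \<open>a\<close> into \<open>N\<close>. It says that restricting automorphisms to a smaller
  splitting field is surjective.\<close>

lemma galois_projection:
  assumes "galois_algebra I W \<theta>" "galois_algebra J W' \<theta>'" and \<pi>: "\<pi> \<in> hom I J"
    and lift: "\<And>u. u \<in> W' \<Longrightarrow> (\<lambda>g. u (\<pi> g)) \<in> W"
  shows "\<pi> ` galois_algebra.\<Gamma> I W = galois_algebra.\<Gamma> J W'"
proof -
  interpret I: galois_algebra I W \<theta> by fact
  interpret J: galois_algebra J W' \<theta>' by fact
  interpret \<pi>: group_hom I J \<pi> by unfold_locales (rule \<pi>)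
  define N where "N = \<pi> ` I.\<Gamma>"
  have N: "subgroup N J" unfolding N_def by (rule \<pi>.subgroup_img_is_subgroup[OF I.subgroup_Gamma])
  have finN: "finite N" by (simp add: N_def I.finite_Gamma)
  have "N \<subseteq> J.\<Gamma>"
  proof
    fix n assume "n \<in> N"
    then obtain h where h: "h \<in> I.\<Gamma>" "n = \<pi> h" by (auto simp: N_def)
    have "u n = 0" if "u \<in> W'" "u \<one>\<^bsub>J\<^esub> = 0" for u
      using I.Gamma_eq[OF h(1) lift[OF that(1)] I.zero_mem] that(2) h(2) \<pi>.hom_one by simp
    moreover have "\<pi> h \<in> carrier J" using I.Gamma_carrier[OF h(1)] by simp
    ultimately show "n \<in> J.\<Gamma>" unfolding J.\<Gamma>_def h(2) by blast
  qed
  moreover have "J.\<Gamma> \<subseteq> N"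
  proof
    fix a assume a: "a \<in> J.\<Gamma>"
    \<comment> \<open>A preimage of each \<open>n\<close> is chosen so that the roots can be written
      as translates of one function in \<open>W\<close>.\<close>
    have "\<forall>n\<in>N. \<exists>k. k \<in> I.\<Gamma> \<and> \<pi> k = n" by (auto simp: N_def)
    from bchoice[OF this] obtain f where "\<forall>n\<in>N. f n \<in> I.\<Gamma> \<and> \<pi> (f n) = n" by (elim exE)
    then have f: "\<And>n. n \<in> N \<Longrightarrow> f n \<in> I.\<Gamma> \<and> \<pi> (f n) = n" by blast
    define p0 where "p0 = (\<lambda>g. \<Prod>n\<in>N. [:- \<theta>' (\<pi> (g \<otimes>\<^bsub>I\<^esub> f n)), 1:])"
    have "p0 \<in> I.Wpoly" unfolding p0_def
    proof (intro I.Wpoly_prod I.Wpoly_linear)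
      fix n assume "n \<in> N"
      then have "f n \<in> carrier I" using f I.Gamma_carrier by blast
      from I.shift_mem[OF lift[OF J.theta_mem] this] show "(\<lambda>g. \<theta>' (\<pi> (g \<otimes>\<^bsub>I\<^esub> f n))) \<in> W" .
    qed
    moreover have p0: "p0 g = (\<Prod>n\<in>N. [:- \<theta>' n, 1:])" if g: "g \<in> I.\<Gamma>" for g
    proof -
      have "p0 g = (\<Prod>n\<in>N. [:- \<theta>' (\<pi> g \<otimes>\<^bsub>J\<^esub> n), 1:])"
        unfolding p0_def
      proof (rule prod.cong[OF refl])
        fix n assume "n \<in> N"
        then have "\<pi> (g \<otimes>\<^bsub>I\<^esub> f n) = \<pi> g \<otimes>\<^bsub>J\<^esub> n" using f I.Gamma_carrier g by (metis \<pi>.hom_mult)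
        then show "[:- \<theta>' (\<pi> (g \<otimes>\<^bsub>I\<^esub> f n)), 1:] = [:- \<theta>' (\<pi> g \<otimes>\<^bsub>J\<^esub> n), 1:]" by simp
      qed
      also have "\<dots> = (\<Prod>n\<in>N. [:- \<theta>' n, 1:])"
        using prod.reindex_bij_betw[OF J.subgroup_shift(1)[OF N, of "\<pi> g"], of "\<lambda>n. [:- \<theta>' n, 1:]"] g
        by (simp add: N_def)
      finally show ?thesis .
    qed
    ultimately obtain q where q: "map_poly to_ac q = (\<Prod>n\<in>N. [:- \<theta>' n, 1:])"
      using I.rational_poly[OF I.rational_on_Gamma, of p0] I.one_Gamma by auto
    have "poly (map_poly to_ac q) (\<theta>' \<one>\<^bsub>J\<^esub>) = 0"
      unfolding q using finN subgroup.one_closed[OF N] by (auto simp: poly_prod intro!: prod_zero)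
    then have "poly (map_poly to_ac q) (\<theta>' a) = 0"
      using a J.poly_mem[OF J.theta_mem, of q] by (auto simp: J.\<Gamma>_def)
    then obtain n where "n \<in> N" "\<theta>' a = \<theta>' n" unfolding q using finN by (auto simp: poly_prod prod_zero_iff)
    then show "a \<in> N" using J.theta_inj J.Gamma_carrier[OF a] subgroup.mem_carrier[OF N] by (metis inj_onD)
  qed
  ultimately show ?thesis by (simp add: N_def)
qed

lemma (in root_pentagon) Gal_action:
  assumes "galois_algebra D5 W1 \<theta>"
  shows "h \<in> galois_algebra.\<Gamma> D5 W1 \<Longrightarrow> \<exists>\<phi>\<in>carrier (Gal (fD5 a1 a2)). \<forall>j. \<phi> (x j) = x (aff h j)"
    and "\<phi> \<in> carrier (Gal (fD5 a1 a2)) \<Longrightarrow> \<exists>h\<in>galois_algebra.\<Gamma> D5 W1. \<forall>j. \<phi> (x j) = x (aff h j)"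
proof -
  interpret galois_algebra D5 W1 \<theta> by fact
  have "Spl (fD5 a1 a2) = (\<lambda>u. u \<one>\<^bsub>D5\<^esub>) ` W1" using Spl1[OF assms] by (simp add: one_D5)
  then obtain \<Phi> where \<Phi>: "\<Phi> \<in> iso (D5\<lparr>carrier := \<Gamma>\<rparr>) (Gal (fD5 a1 a2))"
    "\<And>h u. h \<in> \<Gamma> \<Longrightarrow> u \<in> W1 \<Longrightarrow> \<Phi> h (u \<one>\<^bsub>D5\<^esub>) = u h"
    using Gal_iso[of "fD5 a1 a2"] by blast
  have img: "\<Phi> ` \<Gamma> = carrier (Gal (fD5 a1 a2))" using \<Phi>(1) by (simp add: iso_iff)
  have act: "\<Phi> h (x j) = x (aff h j)" if "h \<in> \<Gamma>" for h j
  proof -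
    have "(\<lambda>a. x (aff a j)) \<in> W1" unfolding W1_def by (auto intro!: fun_alg.gen simp: gens1_def)
    from \<Phi>(2)[OF that this] show ?thesis by (simp add: one_D5)
  qed
  show "h \<in> \<Gamma> \<Longrightarrow> \<exists>\<phi>\<in>carrier (Gal (fD5 a1 a2)). \<forall>j. \<phi> (x j) = x (aff h j)" using img act by blast
  show "\<phi> \<in> carrier (Gal (fD5 a1 a2)) \<Longrightarrow> \<exists>h\<in>\<Gamma>. \<forall>j. \<phi> (x j) = x (aff h j)"
    using act by (auto simp flip: img)
qed

text \<open>A reflection fixes a vertex, because 2 is invertible modulo 5, and moves another; a
  nontrivial rotation fixes none. So the existence of fixed and of moved roots, which does not
  depend on a numbering, determines the type of an element.\<close>

lemma (in distinct_pentagon) fixed_points: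
  shows "(\<exists>j. x (aff h j) = x j) \<longleftrightarrow> snd h \<or> fst h mod 5 = 0"
    and "(\<exists>j. x (aff h j) \<noteq> x j) \<longleftrightarrow> snd h \<or> fst h mod 5 \<noteq> 0"
proof -
  obtain u d where h: "h = (u, d)" by (cases h)
  have refl: "(u - j) mod 5 = j mod 5 \<longleftrightarrow> 5 dvd u - 2 * j" for j
    by (simp add: mod_eq_dvd_iff algebra_simps)
  have rot: "(u + j) mod 5 = j mod 5 \<longleftrightarrow> u mod 5 = 0" for j
    by (simp add: mod_eq_dvd_iff mod_eq_0_iff_dvd)
  \<comment> \<open>The fixed vertex of the reflection is \<open>3 * u\<close>, as 3 is the inverse
    of 2 modulo 5.\<close>
  have "5 dvd u - 2 * (3 * u)" by simp
  then have 1: "\<exists>j. 5 dvd u - 2 * j" by blast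
  have 2: "\<exists>j. \<not> 5 dvd u - 2 * j"
  proof (cases "5 dvd u")
    case True
    then have "\<not> 5 dvd u - 2 * 1" using dvd_diff[of 5 u "u - 2 * 1"] by auto
    then show ?thesis by blast
  next
    case False
    then have "\<not> 5 dvd u - 2 * 0" by simp
    then show ?thesis by blast
  qed
  show "(\<exists>j. x (aff h j) = x j) \<longleftrightarrow> snd h \<or> fst h mod 5 = 0"
    using 1 by (cases d) (simp_all add: h x_eq_iff refl rot)
  show "(\<exists>j. x (aff h j) \<noteq> x j) \<longleftrightarrow> snd h \<or> fst h mod 5 \<noteq> 0"
    using 2 by (cases d) (simp_all add: h x_eq_iff refl rot)
qed

section \<open>Automorphisms as permutations of numbered roots\<close>

lemma Spl_closed:
  shows "to_ac c \<in> Spl q" "z \<in> ac_roots q \<Longrightarrow> z \<in> Spl q"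
    "u \<in> Spl q \<Longrightarrow> v \<in> Spl q \<Longrightarrow> u + v \<in> Spl q" "u \<in> Spl q \<Longrightarrow> v \<in> Spl q \<Longrightarrow> u * v \<in> Spl q"
proof -
  show "to_ac c \<in> Spl q" "z \<in> ac_roots q \<Longrightarrow> z \<in> Spl q" unfolding Spl_def by auto
  show "u \<in> Spl q \<Longrightarrow> v \<in> Spl q \<Longrightarrow> u + v \<in> Spl q" unfolding Spl_def using is_subfield_add by blast
  show "u \<in> Spl q \<Longrightarrow> v \<in> Spl q \<Longrightarrow> u * v \<in> Spl q" unfolding Spl_def is_subfield_def by blast
qed

lemma Gal_fixes: "\<phi> \<in> carrier (Gal q) \<Longrightarrow> \<phi> (to_ac c) = to_ac c"
  by (simp add: Gal_def)

lemma Gal_root: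
  assumes \<phi>: "\<phi> \<in> carrier (Gal q)" and z: "z \<in> ac_roots q"
  shows "\<phi> z \<in> ac_roots q"
proof -
  have Gal: "\<phi> (u + v) = \<phi> u + \<phi> v" "\<phi> (u * v) = \<phi> u * \<phi> v" if "u \<in> Spl q" "v \<in> Spl q" for u v
    using \<phi> that by (auto simp: Gal_def)
  have zero: "(0 :: 'a alg_closure) \<in> Spl q" "\<phi> 0 = 0" using Spl_closed(1)[of 0 q] Gal_fixes[OF \<phi>, of 0] by simp_all
  have "poly (map_poly to_ac p) z \<in> Spl q \<and> \<phi> (poly (map_poly to_ac p) z) = poly (map_poly to_ac p) (\<phi> z)" for p
  proof (induction p)
    case 0
    then show ?case using zero by simp
  next
    case (pCons c p)
    then show ?case using Spl_closed(1)[of c q] Spl_closed(2)[OF z]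
      by (simp add: map_poly_pCons Spl_closed Gal Gal_fixes[OF \<phi>])
  qed
  from this[of q] z zero show ?thesis by (simp add: ac_roots_def)
qed

lemma Gal_perm:
  assumes \<phi>: "\<phi> \<in> carrier (Gal q)" and r: "bij_betw r {..<5} (ac_roots q)"
  obtains \<pi> where "\<pi> \<in> gal_perms r q" "\<And>i. i < 5 \<Longrightarrow> \<phi> (r i) = r (\<pi> i)" "\<And>i. i < 5 \<Longrightarrow> \<pi> i < 5"
proof -
  have "inj_on \<phi> (Spl q)" using \<phi> by (auto simp: Gal_def Bij_def bij_betw_def)
  then have inj: "inj_on \<phi> (ac_roots q)" by (rule inj_on_subset) (auto intro: Spl_closed)
  define \<pi> where "\<pi> i = (if i < 5 then inv_into {..<5} r (\<phi> (r i)) else i)" for i :: nat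
  have r_mem: "r i \<in> ac_roots q" if "i < 5" for i using r that by (auto simp: bij_betw_def)
  have \<pi>: "r (\<pi> i) = \<phi> (r i)" "\<pi> i < 5" if "i < 5" for i
  proof -
    have "\<phi> (r i) \<in> r ` {..<5}" using Gal_root[OF \<phi> r_mem[OF that]] r by (simp add: bij_betw_def)
    then show "r (\<pi> i) = \<phi> (r i)" "\<pi> i < 5"
      using that inv_into_into[of "\<phi> (r i)" r "{..<5}"] by (simp_all add: \<pi>_def f_inv_into_f)
  qed
  have "inj_on \<pi> {..<5}"
  proof (rule inj_onI)
    fix i j assume ij: "i \<in> {..<5}" "j \<in> {..<5}" "\<pi> i = \<pi> j"
    then have "\<phi> (r i) = \<phi> (r j)" using \<pi>(1)[of i] \<pi>(1)[of j] by simp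
    then have "r i = r j" using inj_onD[OF inj _ r_mem r_mem] ij by simp
    then show "i = j" using r ij by (auto simp: bij_betw_def inj_on_def)
  qed
  moreover have "\<pi> ` {..<5} \<subseteq> {..<5}" using \<pi>(2) by auto
  ultimately have "bij_betw \<pi> {..<5} {..<5}" by (simp add: bij_betw_def endo_inj_surj)
  then have "\<pi> permutes {..<5}" by (rule bij_imp_permutes) (simp add: \<pi>_def)
  then have "\<pi> \<in> gal_perms r q" using \<phi> \<pi>(1) by (auto simp: gal_perms_def)
  then show thesis using that \<pi> by simp
qed

text \<open>The numberings in \<open>gal_ge\<close> need not follow the pentagons, so the common
  permutation is not matched with index maps. What is kept is whether it has a fixed point and
  whether it moves a point.\<close>

lemma gal_ge_fixed_roots:
  assumes ge: "gal_ge p q" and \<phi>': "\<phi>' \<in> carrier (Gal q)"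
  shows "\<exists>\<phi>\<in>carrier (Gal p). ((\<exists>z\<in>ac_roots p. \<phi> z = z) \<longleftrightarrow> (\<exists>z\<in>ac_roots q. \<phi>' z = z)) \<and>
    ((\<exists>z\<in>ac_roots p. \<phi> z \<noteq> z) \<longleftrightarrow> (\<exists>z\<in>ac_roots q. \<phi>' z \<noteq> z))"
proof -
  obtain r r' where r: "bij_betw r {..<5} (ac_roots p)" and r': "bij_betw r' {..<5} (ac_roots q)"
    and sub: "gal_perms r' q \<subseteq> gal_perms r p"
    using ge unfolding gal_ge_def by blast
  obtain \<pi> where \<pi>: "\<pi> \<in> gal_perms r' q" "\<And>i. i < 5 \<Longrightarrow> \<phi>' (r' i) = r' (\<pi> i)" "\<And>i. i < 5 \<Longrightarrow> \<pi> i < 5"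
    by (rule Gal_perm[OF \<phi>' r']) (rule that)
  then have "\<pi> \<in> gal_perms r p" using sub by blast
  then obtain \<phi> where \<phi>: "\<phi> \<in> carrier (Gal p)" "\<And>i. i < 5 \<Longrightarrow> \<phi> (r i) = r (\<pi> i)"
    by (auto simp: gal_perms_def)
  have inj_r: "r i = r j \<longleftrightarrow> i = j" "r' i = r' j \<longleftrightarrow> i = j" if "i < 5" "j < 5" for i j
    using r r' that by (auto simp: bij_betw_def inj_on_def)
  have fix_r: "\<phi> (r i) = r i \<longleftrightarrow> \<pi> i = i" "\<phi>' (r' i) = r' i \<longleftrightarrow> \<pi> i = i" if "i < 5" for i
    using \<phi>(2)[OF that] \<pi>(2)[OF that] inj_r[OF \<pi>(3)[OF that] that] by simp_all
  have roots: "ac_roots p = r ` {..<5}" "ac_roots q = r' ` {..<5}" using r r' by (auto simp: bij_betw_def)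
  show ?thesis
  proof (intro bexI[OF _ \<phi>(1)] conjI)
    show "(\<exists>z\<in>ac_roots p. \<phi> z = z) \<longleftrightarrow> (\<exists>z\<in>ac_roots q. \<phi>' z = z)"
      unfolding roots using fix_r by auto
    show "(\<exists>z\<in>ac_roots p. \<phi> z \<noteq> z) \<longleftrightarrow> (\<exists>z\<in>ac_roots q. \<phi>' z \<noteq> z)"
      unfolding roots using fix_r by auto
  qed
qed

lemma gal_ge_C5_moves:
  assumes "gal_ge_C5 q"
  shows "\<exists>\<phi>\<in>carrier (Gal q). \<forall>z\<in>ac_roots q. \<phi> z \<noteq> z"
proof -
  obtain r where r: "bij_betw r {..<5} (ac_roots q)" "C5_perms \<subseteq> gal_perms r q"
    using assms unfolding gal_ge_C5_def by blast
  define \<pi> where "\<pi> i = (if i < 5 then (i + 1) mod 5 else i)" for i :: nat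
  have "inj_on \<pi> {..<5}" "\<pi> ` {..<5} \<subseteq> {..<5}" unfolding \<pi>_def lessThan5 inj_on_def by simp_all
  then have "bij_betw \<pi> {..<5} {..<5}" by (simp add: bij_betw_def endo_inj_surj)
  then have "\<pi> permutes {..<5}" by (rule bij_imp_permutes) (simp add: \<pi>_def)
  then have "\<pi> \<in> C5_perms" unfolding C5_perms_def by (auto simp: \<pi>_def intro!: exI[of _ 1])
  then obtain \<phi> where \<phi>: "\<phi> \<in> carrier (Gal q)" "\<And>i. i < 5 \<Longrightarrow> \<phi> (r i) = r (\<pi> i)"
    using r(2) by (auto simp: gal_perms_def)
  have "\<phi> z \<noteq> z" if z: "z \<in> ac_roots q" for z
  proof -
    obtain i where i: "i < 5" "z = r i" using r(1) z by (auto simp: bij_betw_def)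
    have "\<pi> i \<noteq> i" "\<pi> i < 5" using i(1) by (auto simp: \<pi>_def mod_Suc split: if_splits)
    then have "r (\<pi> i) \<noteq> r i" using r(1) i(1) by (auto simp: bij_betw_def inj_on_def)
    then show ?thesis using \<phi>(2)[OF i(1)] i(2) by simp
  qed
  with \<phi>(1) show ?thesis by blast
qed

locale pentagon_pair = two_pentagons x x' a1 a2 a1' a2' +
    gx: galois_algebra D5 "root_pentagon.W1 x" \<theta>1 + gx': galois_algebra D5 "root_pentagon.W1 x'" \<theta>1' +
    galois_algebra "D5 \<times>\<times> D5" "two_pentagons.W2 x x'" \<theta>2
  for x x' :: "int \<Rightarrow> 'm::field alg_closure" and a1 a2 a1' a2' \<theta>1 \<theta>1' \<theta>2
begin

lemma Spl2: "Spl (fD5 a1 a2 * fD5 a1' a2') = (\<lambda>u. u ((0, False), (0, False))) ` W2"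
proof -
  have roots: "ac_roots (fD5 a1 a2 * fD5 a1' a2') = range x \<union> range x'"
    using x.fD5_roots x'.fD5_roots by (auto simp: ac_roots_def to_ac.map_poly_mult)
  have "x i \<in> (\<lambda>u. u ((0, False), (0, False))) ` W2" for i
    using gen2(2)[of i] by (rule image_eqI[rotated]) simp
  moreover have "x' i \<in> (\<lambda>u. u ((0, False), (0, False))) ` W2" for i
    using gen2(3)[of i] by (rule image_eqI[rotated]) simp
  ultimately have "ac_roots (fD5 a1 a2 * fD5 a1' a2') \<subseteq> (\<lambda>u. u \<one>\<^bsub>D5 \<times>\<times> D5\<^esub>) ` W2" unfolding roots by (auto simp: one_D5)
  then show ?thesis
    using Spl_eq[OF W2_def, of "fD5 a1 a2 * fD5 a1' a2'"] by (auto simp: gens2_def roots one_D5)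
qed

lemma Gamma_fst: "fst ` \<Gamma> = gx.\<Gamma>" and Gamma_snd: "snd ` \<Gamma> = gx'.\<Gamma>"
proof -
  show "fst ` \<Gamma> = gx.\<Gamma>"
    by (rule galois_projection[OF galois_algebra_axioms gx.galois_algebra_axioms])
      (auto simp: hom_def mult_DirProd' W1_W2)
  show "snd ` \<Gamma> = gx'.\<Gamma>"
    by (rule galois_projection[OF galois_algebra_axioms gx'.galois_algebra_axioms])
      (auto simp: hom_def mult_DirProd' W1_W2)
qed

lemma gal_ge_transfer:
  assumes ge: "gal_ge (fD5 a1 a2) (fD5 a1' a2')" and h': "h' \<in> gx'.\<Gamma>"
  shows "\<exists>h\<in>gx.\<Gamma>. ((\<exists>j. x (aff h j) = x j) \<longleftrightarrow> (\<exists>j. x' (aff h' j) = x' j)) \<and>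
    ((\<exists>j. x (aff h j) \<noteq> x j) \<longleftrightarrow> (\<exists>j. x' (aff h' j) \<noteq> x' j))"
proof -
  obtain \<phi>' where \<phi>': "\<phi>' \<in> carrier (Gal (fD5 a1' a2'))" "\<And>j. \<phi>' (x' j) = x' (aff h' j)"
    using x'.Gal_action(1)[OF gx'.galois_algebra_axioms h'] by blast
  obtain \<phi> where \<phi>: "\<phi> \<in> carrier (Gal (fD5 a1 a2))"
    "(\<exists>z\<in>range x. \<phi> z = z) \<longleftrightarrow> (\<exists>z\<in>range x'. \<phi>' z = z)" "(\<exists>z\<in>range x. \<phi> z \<noteq> z) \<longleftrightarrow> (\<exists>z\<in>range x'. \<phi>' z \<noteq> z)"
    using gal_ge_fixed_roots[OF ge \<phi>'(1)] unfolding x.fD5_roots x'.fD5_roots by blast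
  obtain h where h: "h \<in> gx.\<Gamma>" "\<And>j. \<phi> (x j) = x (aff h j)"
    using x.Gal_action(2)[OF gx.galois_algebra_axioms \<phi>(1)] by blast
  show ?thesis using h(1) \<phi>(2,3) by (intro bexI[OF _ h(1)]) (simp add: h(2) \<phi>'(2))
qed

lemma gal_ge_C5_rotation:
  assumes "gal_ge_C5 (fD5 a1' a2')"
  shows "\<exists>h\<in>gx'.\<Gamma>. \<forall>j. x' (aff h j) \<noteq> x' j"
proof -
  obtain \<phi> where \<phi>: "\<phi> \<in> carrier (Gal (fD5 a1' a2'))" "\<And>z. z \<in> range x' \<Longrightarrow> \<phi> z \<noteq> z"
    using gal_ge_C5_moves[OF assms] unfolding x'.fD5_roots by blast
  obtain h where h: "h \<in> gx'.\<Gamma>" "\<And>j. \<phi> (x' j) = x' (aff h j)"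
    using x'.Gal_action(2)[OF gx'.galois_algebra_axioms \<phi>(1)] by blast
  have "x' (aff h j) \<noteq> x' j" for j using \<phi>(2)[of "x' j"] h(2)[of j] by simp
  then show ?thesis using h(1) by blast
qed

end

section \<open>Subgroups of \<open>D\<^sub>5 \<times> D\<^sub>5\<close>\<close>

lemma inverse_mod5:
  fixes u :: int
  assumes "u mod 5 \<noteq> 0"
  shows "\<exists>c. (c * u) mod 5 = 1"
proof -
  have "u mod 5 = 1 \<or> u mod 5 = 2 \<or> u mod 5 = 3 \<or> u mod 5 = 4"
    using assms by (cases rule: mod5_cases[of u]) auto
  then have "(1 * u) mod 5 = 1 \<or> (3 * u) mod 5 = 1 \<or> (2 * u) mod 5 = 1 \<or> (4 * u) mod 5 = 1"
    by (elim disjE) (simp_all add: mod_mult_right_eq[of _ u 5, symmetric] del: mod_mult_right_eq)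
  then show ?thesis by blast
qed

lemma dvd5_mult: "5 dvd a * b \<longleftrightarrow> 5 dvd a \<or> 5 dvd (b :: int)"
proof -
  have "prime (5 :: int)" by simp
  then show ?thesis by (rule prime_dvd_mult_iff)
qed

text \<open>The form of the subgroups that contain all of \<open>C5 \<times> C5\<close>: rotation
  parts are free, and \<open>S\<close> restricts the two reflection flags.\<close>

definition C5_pairs :: "(bool \<Rightarrow> bool \<Rightarrow> bool) \<Rightarrow> ((int \<times> bool) \<times> (int \<times> bool)) set" where
  "C5_pairs S = {((u, d), (v, e)) | u d v e. u \<in> {0..<5} \<and> v \<in> {0..<5} \<and> S d e}"

text \<open>For \<open>k\<close> prime to 5, the graph of an isomorphism multiplying rotations by
  \<open>k\<close>. The offset of reflections is written \<open>2 * m\<close>, which covers every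
  residue, because the reflection \<open>w \<mapsto> 2m - w\<close> of the orbits then has the fixed
  point \<open>m\<close>.\<close>

definition C5_graph :: "int \<Rightarrow> int \<Rightarrow> (bool \<Rightarrow> bool) \<Rightarrow> ((int \<times> bool) \<times> (int \<times> bool)) set" where
  "C5_graph k m S = {((u, d), ((k * u + (if d then 2 * m else 0)) mod 5, d)) | u d. u \<in> {0..<5} \<and> S d}"

lemma mem_C5_pairs: "((u, d), (v, e)) \<in> C5_pairs S \<longleftrightarrow> u \<in> {0..<5} \<and> v \<in> {0..<5} \<and> S d e"
  unfolding C5_pairs_def by blast

lemma mem_C5_graph:
  "((u, d), (v, e)) \<in> C5_graph k m S \<longleftrightarrow>
    u \<in> {0..<5} \<and> v = (k * u + (if d then 2 * m else 0)) mod 5 \<and> d = e \<and> S d"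
  unfolding C5_graph_def by blast

lemma pair_pair_set_eqI: "(\<And>u d v e. ((u, d), (v, e)) \<in> A \<longleftrightarrow> ((u, d), (v, e)) \<in> B) \<Longrightarrow> A = (B :: (('a \<times> 'b) \<times> ('c \<times> 'd)) set)"
  by (auto simp: set_eq_iff)

text \<open>A form of Goursat's lemma. The hypotheses yield rotations \<open>(1, k)\<close> and
  \<open>(l, 1)\<close> in \<open>\<Gamma>\<close>. If \<open>(0, 1)\<close> belongs to it too, all
  rotations do and only the reflection flags remain. Otherwise the rotations form the line
  \<open>v = k u\<close>, and this forces the two flags to agree. The hypothesis \<open>refl\<close>
  rules out that reflections occur in the second component only.\<close>

lemma subgroup_classification:
  assumes sub: "subgroup \<Gamma> (D5 \<times>\<times> D5)"
    and rot1: "((u1, False), \<beta>) \<in> \<Gamma>" "u1 \<noteq> 0" and rot2: "(\<alpha>, (v2, False)) \<in> \<Gamma>" "v2 \<noteq> 0"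
    and refl: "\<And>\<alpha> v. (\<alpha>, (v, True)) \<in> \<Gamma> \<Longrightarrow> \<exists>u \<beta>. ((u, True), \<beta>) \<in> \<Gamma>"
  shows "\<Gamma> = C5_pairs (\<lambda>d e. True) \<or> \<Gamma> = C5_pairs (\<lambda>d e. d = e) \<or> \<Gamma> = C5_pairs (\<lambda>d e. \<not> e) \<or>
    \<Gamma> = C5_pairs (\<lambda>d e. \<not> d \<and> \<not> e) \<or>
    (\<exists>k m. k mod 5 \<noteq> 0 \<and> \<Gamma> = C5_graph k m (\<lambda>d. True)) \<or>
    (\<exists>k. k mod 5 \<noteq> 0 \<and> \<Gamma> = C5_graph k 0 (\<lambda>d. \<not> d))"
proof -
  \<comment> \<open>Membership for arbitrary integers in place of residues, so that the group law
    becomes plain arithmetic.\<close>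
  define P where "P u d v e \<longleftrightarrow> ((u mod 5, d), (v mod 5, e)) \<in> \<Gamma>" for u d v e
  have memP: "((u, d), (v, e)) \<in> \<Gamma> \<longleftrightarrow> u \<in> {0..<5} \<and> v \<in> {0..<5} \<and> P u d v e" for u d v e
    using subgroup.mem_carrier[OF sub, of "((u, d), (v, e))"] by (auto simp: P_def carrier_D5)
  have P_cong: "P u d v e \<longleftrightarrow> P u' d v' e" if "u mod 5 = u' mod 5" "v mod 5 = v' mod 5" for u u' v v' d e
    using that by (simp add: P_def)
  have P_mult: "P (if d then u - u' else u + u') (d \<noteq> d') (if e then v - v' else v + v') (e \<noteq> e')"
    if "P u d v e" "P u' d' v' e'" for u d v e u' d' v' e'
  proof -
    have "((u mod 5, d), (v mod 5, e)) \<otimes>\<^bsub>D5 \<times>\<times> D5\<^esub> ((u' mod 5, d'), (v' mod 5, e')) \<in> \<Gamma>"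
      by (rule subgroup.m_closed[OF sub that[unfolded P_def]])
    then show ?thesis
      by (cases d; cases e) (simp_all add: P_def mult_D5 mod_simps)
  qed
  have P_one: "P 0 False 0 False" using subgroup.one_closed[OF sub] by (simp add: P_def one_D5)
  have P_scale: "P (c * u) False (c * v) False" if "P u False v False" for c u v
  proof -
    have nat: "P (int n * u) False (int n * v) False" for n
    proof (induction n)
      case (Suc n)
      from P_mult[OF that Suc] show ?case by (simp add: algebra_simps)
    qed (simp add: P_one)
    have "int (nat (c mod 5)) = c mod 5" by simp
    then have "P ((c mod 5) * u) False ((c mod 5) * v) False" using nat[of "nat (c mod 5)"] by simp
    then show ?thesis using P_cong[of "(c mod 5) * u" "c * u" "(c mod 5) * v" "c * v"] by (simp add: mod_simps)
  qed
  have P_rot: "P (s + u) d (t + v) e" if "P s False t False" "P u d v e" for s t u d v e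
    using P_mult[OF that] by simp
  obtain k where k: "P 1 False k False"
  proof -
    obtain v e where \<beta>: "\<beta> = (v, e)" by (cases \<beta>)
    have u1: "u1 \<in> {0..<5}" "P u1 False v e" using rot1(1) memP \<beta> by auto
    then have "u1 mod 5 \<noteq> 0" using rot1(2) by simp
    then obtain c where c: "(c * (2 * u1)) mod 5 = 1" using inverse_mod5[of "2 * u1"] by (auto simp: mod_eq_0_iff_dvd dvd5_mult)
    \<comment> \<open>Squaring removes a possible reflection in the second component and leaves
      \<open>2 * u1\<close>, which is still a unit modulo 5.\<close>
    obtain w where "P (2 * u1) False w False" using P_mult[OF u1(2) u1(2)] by (cases e) (auto simp flip: mult_2)
    from P_scale[OF this, of c] have "P 1 False (c * w) False"
      using P_cong[of "c * (2 * u1)" 1 "c * w" "c * w"] c by simp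
    then show ?thesis using that by blast
  qed
  obtain l where l: "P l False 1 False"
  proof -
    obtain u d where \<alpha>: "\<alpha> = (u, d)" by (cases \<alpha>)
    have v2: "v2 \<in> {0..<5}" "P u d v2 False" using rot2(1) memP \<alpha> by auto
    then have "v2 mod 5 \<noteq> 0" using rot2(2) by simp
    then obtain c where c: "(c * (2 * v2)) mod 5 = 1" using inverse_mod5[of "2 * v2"] by (auto simp: mod_eq_0_iff_dvd dvd5_mult)
    obtain w where "P w False (2 * v2) False" using P_mult[OF v2(2) v2(2)] by (cases d) (auto simp flip: mult_2)
    from P_scale[OF this, of c] have "P (c * w) False 1 False"
      using P_cong[of "c * w" "c * w" "c * (2 * v2)" 1] c by simp
    then show ?thesis using that by blast
  qed
  define S where "S d e \<longleftrightarrow> (\<exists>u v. P u d v e)" for d e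
  have S_one: "S False False" using P_one by (auto simp: S_def)
  have S_xor: "S (d \<noteq> d') (e \<noteq> e')" if "S d e" "S d' e'" for d e d' e'
    using that P_mult unfolding S_def by meson
  have refl': "S True True \<or> S True False" if FT: "S False True"
  proof -
    obtain u v where "P u False v True" using FT by (auto simp: S_def)
    then have "((u mod 5, False), (v mod 5, True)) \<in> \<Gamma>" by (simp add: P_def)
    then obtain u' \<beta> where "((u', True), \<beta>) \<in> \<Gamma>" using refl by blast
    then have "S True (snd \<beta>)" using memP by (cases \<beta>) (auto simp: S_def)
    then show ?thesis by (cases "snd \<beta>") simp_all
  qed
  show ?thesis
  proof (cases "P 0 False 1 False")
    case True
    have full: "P u False v False" for u v
      using P_rot[OF P_scale[OF k, of u] P_scale[OF True, of "v - u * k"]] by (simp add: algebra_simps)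
    have "P u d v e \<longleftrightarrow> S d e" for u d v e
    proof
      assume "S d e"
      then obtain u0 v0 where "P u0 d v0 e" by (auto simp: S_def)
      from P_rot[OF full[of "u - u0" "v - v0"] this] show "P u d v e" by simp
    qed (auto simp: S_def)
    then have "((u, d), (v, e)) \<in> \<Gamma> \<longleftrightarrow> u \<in> {0..<5} \<and> v \<in> {0..<5} \<and> S d e" for u d v e
      by (simp add: memP)
    then have \<Gamma>: "\<Gamma> = C5_pairs S" by (intro pair_pair_set_eqI) (simp add: mem_C5_pairs)
    \<comment> \<open>The flags form a subgroup of \<open>C2 \<times> C2\<close>; of its five
      subgroups the one generated by \<open>(False, True)\<close> is excluded by
      \<open>refl'\<close>.\<close>
    have "S = (\<lambda>d e. True) \<or> S = (\<lambda>d e. d = e) \<or> S = (\<lambda>d e. \<not> e) \<or> S = (\<lambda>d e. \<not> d \<and> \<not> e)"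
    proof -
      have *: "S = T" if "S True True = T True True" "S True False = T True False" "S False True = T False True"
        "S False False = T False False" for T
        using that by (intro ext) (metis (full_types))
      have x1: "S False True" if "S True True" "S True False" using S_xor[OF that] by simp
      have x2: "S True False" if "S True True" "S False True" using S_xor[OF that] by simp
      have x3: "S True True" if "S True False" "S False True" using S_xor[OF that] by simp
      show ?thesis
        using x1 x2 x3 refl' S_one
        by (cases "S True True"; cases "S True False"; cases "S False True") (auto intro!: *)
    qed
    with \<Gamma> show ?thesis by metis
  next
    case False
    have zero: "w mod 5 = 0" if "P 0 False w False" for w
    proof (rule ccontr)
      assume "w mod 5 \<noteq> 0"
      then obtain c where "(c * w) mod 5 = 1" using inverse_mod5 by blast
      then have "P 0 False 1 False" using P_scale[OF that, of c] P_cong[of 0 0 "c * w" 1] by simp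
      then show False using False by contradiction
    qed
    have line: "P u False v False \<longleftrightarrow> v mod 5 = (k * u) mod 5" for u v
    proof
      assume "P u False v False"
      from P_rot[OF P_scale[OF k, of "- u"] this] have "P 0 False (v - k * u) False" by (simp add: algebra_simps)
      then show "v mod 5 = (k * u) mod 5" using zero by (simp add: mod_eq_dvd_iff mod_eq_0_iff_dvd)
    next
      assume "v mod 5 = (k * u) mod 5"
      then show "P u False v False" using P_scale[OF k, of u] P_cong[of u u v "k * u"] by (simp add: mult.commute)
    qed
    have k0: "k mod 5 \<noteq> 0"
    proof
      assume "k mod 5 = 0"
      then have "(k * l) mod 5 = 0" by (simp add: mod_eq_0_iff_dvd dvd5_mult)
      then show False using l line by simp
    qed
    have noTF: "\<not> S True False"
    proof
      assume "S True False"
      \<comment> \<open>The square of such an element is \<open>(0, 2v)\<close>, so \<open>v\<close>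
        is 0 modulo 5. The product of \<open>g\<close>, \<open>(1, k)\<close> and \<open>g\<close>
        then forces \<open>k = - k\<close>, which is impossible for a unit modulo 5.\<close>
      then obtain u v where g: "P u True v False" by (auto simp: S_def)
      have "P 0 False (2 * v) False" using P_mult[OF g g] by (simp flip: mult_2)
      then have "(2 * v) mod 5 = 0" by (rule zero)
      then have v0: "v mod 5 = 0" by (simp add: mod_eq_0_iff_dvd dvd5_mult)
      have "P (- 1) False (v + k + v) False" using P_mult[OF P_mult[OF g k] g] by simp
      then have "(v + k + v) mod 5 = (k * (- 1)) mod 5" by (simp add: line)
      then have "5 dvd 2 * v + 2 * k" by (simp add: mod_eq_dvd_iff algebra_simps)
      moreover have "5 dvd 2 * v" using v0 by (simp add: mod_eq_0_iff_dvd)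
      ultimately have "5 dvd 2 * k" by (simp add: dvd_add_right_iff)
      then have "(2 * k) mod 5 = 0" by simp
      then show False using k0 by (simp add: mod_eq_0_iff_dvd dvd5_mult)
    qed
    have noFT: "\<not> S False True"
    proof
      assume "S False True"
      then have "S True True" using refl' noTF by blast
      from S_xor[OF this \<open>S False True\<close>] show False using noTF by simp
    qed
    show ?thesis
    proof (cases "S True True")
      case True
      then obtain u0 v0 where g: "P u0 True v0 True" by (auto simp: S_def)
      \<comment> \<open>Since 3 is the inverse of 2 modulo 5, \<open>2 * m\<close> is the offset of
        the reflection found.\<close>
      define m where "m = 3 * (v0 - k * u0)"
      have m: "(v0 - k * u0) mod 5 = (2 * m) mod 5" by (simp add: m_def mod_eq_dvd_iff)
      have TT: "P u True v True \<longleftrightarrow> v mod 5 = (k * u + 2 * m) mod 5" for u v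
      proof
        assume "P u True v True"
        from P_mult[OF this g] have "P (u - u0) False (v - v0) False" by simp
        then have "(v - v0) mod 5 = (k * (u - u0)) mod 5" by (simp add: line)
        then have "5 dvd (v - v0 - k * (u - u0)) + (v0 - k * u0 - 2 * m)"
          using m by (intro dvd_add) (simp_all add: mod_eq_dvd_iff)
        then show "v mod 5 = (k * u + 2 * m) mod 5" by (simp add: mod_eq_dvd_iff algebra_simps)
      next
        assume "v mod 5 = (k * u + 2 * m) mod 5"
        then have "5 dvd v - (k * u + 2 * m)" "5 dvd v0 - k * u0 - 2 * m" using m by (simp_all add: mod_eq_dvd_iff)
        then have "5 dvd (v - (k * u + 2 * m)) - (v0 - k * u0 - 2 * m)" by (rule dvd_diff)
        then have "P (u - u0) False (v - v0) False" by (simp add: line mod_eq_dvd_iff algebra_simps)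
        from P_rot[OF this g] show "P u True v True" by simp
      qed
      have "((u, d), (v, e)) \<in> \<Gamma> \<longleftrightarrow> u \<in> {0..<5} \<and> v = (k * u + (if d then 2 * m else 0)) mod 5 \<and> d = e" for u d v e
        using noTF noFT unfolding memP
        by (cases d; cases e) (auto simp: S_def TT line)
      then have "\<Gamma> = C5_graph k m (\<lambda>d. True)" by (intro pair_pair_set_eqI) (simp add: mem_C5_graph)
      with k0 show ?thesis by blast
    next
      case False
      have "((u, d), (v, e)) \<in> \<Gamma> \<longleftrightarrow> u \<in> {0..<5} \<and> v = (k * u) mod 5 \<and> \<not> d \<and> \<not> e" for u d v e
        using noTF noFT False unfolding memP
        by (cases d; cases e) (auto simp: S_def line)
      then have "\<Gamma> = C5_graph k 0 (\<lambda>d. \<not> d)" by (intro pair_pair_set_eqI) (auto simp: mem_C5_graph)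
      with k0 show ?thesis by blast
    qed
  qed
qed

section \<open>Isomorphism types and projections of the subgroups\<close>

lemma update_carrier_mult: "x \<otimes>\<^bsub>G\<lparr>carrier := H\<rparr>\<^esub> y = x \<otimes>\<^bsub>G\<^esub> y"
  by simp

lemma isoI:
  assumes "\<And>g h. g \<in> carrier G \<Longrightarrow> h \<in> carrier G \<Longrightarrow> f (g \<otimes>\<^bsub>G\<^esub> h) = f g \<otimes>\<^bsub>H\<^esub> f h"
    and "bij_betw f (carrier G) (carrier H)"
  shows "G \<cong> H"
proof -
  have "f \<in> iso G H" unfolding iso_def hom_def using assms by (auto simp: bij_betw_def)
  then show ?thesis unfolding is_iso_def by blast
qed

lemma D5_rotations_iso: "D5\<lparr>carrier := {0..<5} \<times> {False}\<rparr> \<cong> C5"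
proof (rule isoI[of _ fst])
  show "bij_betw fst (carrier (D5\<lparr>carrier := {0..<5} \<times> {False}\<rparr>)) (carrier C5)"
    by (auto simp: bij_betw_def inj_on_def carrier_integer_mod_group image_iff)
qed (auto simp: mult_D5)

lemma C5_pairs_mult:
  assumes "v \<in> {0..<5}" "v' \<in> {0..<5}"
  shows "((u, d), (u', d')) \<otimes>\<^bsub>D5 \<times>\<times> D5\<^esub> ((v, e), (v', e')) =
    (((if d then u - v else u + v) mod 5, d \<noteq> e), ((if d' then u' - v' else u' + v') mod 5, d' \<noteq> e'))"
  using assms by (simp add: mult_D5 del: split_paired_All)

lemma C5_pairs_cases:
  assumes "g \<in> C5_pairs S"
  obtains u d v e where "g = ((u, d), (v, e))" "u \<in> {0..<5}" "v \<in> {0..<5}" "S d e"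
  using assms unfolding C5_pairs_def by blast

lemma C5_graph_cases:
  assumes "g \<in> C5_graph k m S"
  obtains u d where "g = ((u, d), ((k * u + (if d then 2 * m else 0)) mod 5, d))" "u \<in> {0..<5}" "S d"
  using assms unfolding C5_graph_def by blast

lemma iso_pairs_all: "(D5 \<times>\<times> D5)\<lparr>carrier := C5_pairs (\<lambda>d e. True)\<rparr> \<cong> D5 \<times>\<times> D5"
proof (rule isoI[of _ "\<lambda>g. g"])
  show "bij_betw (\<lambda>g. g) (carrier ((D5 \<times>\<times> D5)\<lparr>carrier := C5_pairs (\<lambda>d e. True)\<rparr>)) (carrier (D5 \<times>\<times> D5))"
    by (auto simp: bij_betw_def C5_pairs_def carrier_D5)
qed simp

lemma iso_pairs_eq: "(D5 \<times>\<times> D5)\<lparr>carrier := C5_pairs (\<lambda>d e. d = e)\<rparr> \<cong> C5C5_C2"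
proof (rule isoI[of _ "\<lambda>((u, d::bool), (v, e::bool)). ((u, v), d)"])
  have "(\<lambda>((u, d::bool), (v, e::bool)). ((u, v), d)) ` C5_pairs (\<lambda>d e. d = e) = ({0..<5} \<times> {0..<5}) \<times> UNIV"
  proof (intro equalityI subsetI)
    fix p :: "(int \<times> int) \<times> bool" assume "p \<in> ({0..<5} \<times> {0..<5}) \<times> UNIV"
    then obtain u v d where "p = ((u, v), d)" "u \<in> {0..<5}" "v \<in> {0..<5}" by blast
    then show "p \<in> (\<lambda>((u, d::bool), (v, e::bool)). ((u, v), d)) ` C5_pairs (\<lambda>d e. d = e)"
      by (intro image_eqI[of _ _ "((u, d), (v, d))"]) (simp_all add: mem_C5_pairs)
  qed (auto elim!: C5_pairs_cases)
  moreover have "inj_on (\<lambda>((u, d::bool), (v, e::bool)). ((u, v), d)) (C5_pairs (\<lambda>d e. d = e))"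
    by (auto simp: inj_on_def C5_pairs_def)
  ultimately show "bij_betw (\<lambda>((u, d::bool), (v, e::bool)). ((u, v), d)) (carrier ((D5 \<times>\<times> D5)\<lparr>carrier := C5_pairs (\<lambda>d e. d = e)\<rparr>)) (carrier C5C5_C2)"
    by (simp add: bij_betw_def gen_dihedral_def carrier_integer_mod_group)
  fix g h
  assume "g \<in> carrier ((D5 \<times>\<times> D5)\<lparr>carrier := C5_pairs (\<lambda>d e. d = e)\<rparr>)" "h \<in> carrier ((D5 \<times>\<times> D5)\<lparr>carrier := C5_pairs (\<lambda>d e. d = e)\<rparr>)"
  then obtain u d v u' d' v' where gh: "g = ((u, d), (v, d))" "h = ((u', d'), (v', d'))" "u' \<in> {0..<5}" "v' \<in> {0..<5}"
    by (auto elim!: C5_pairs_cases)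
  have "inv\<^bsub>C5 \<times>\<times> C5\<^esub> (u', v') = ((- u') mod 5, (- v') mod 5)"
    using gh(3,4) by (subst inv_DirProd) (auto simp: carrier_integer_mod_group)
  then show "(\<lambda>((u, d::bool), (v, e::bool)). ((u, v), d)) (g \<otimes>\<^bsub>(D5 \<times>\<times> D5)\<lparr>carrier := C5_pairs (\<lambda>d e. d = e)\<rparr>\<^esub> h) =
     (\<lambda>((u, d::bool), (v, e::bool)). ((u, v), d)) g \<otimes>\<^bsub>C5C5_C2\<^esub> (\<lambda>((u, d::bool), (v, e::bool)). ((u, v), d)) h"
    unfolding gh(1,2) update_carrier_mult C5_pairs_mult[OF gh(3,4)]
    by (cases d) (simp_all add: gen_dihedral_def mod_simps)
qed

lemma iso_pairs_snd: "(D5 \<times>\<times> D5)\<lparr>carrier := C5_pairs (\<lambda>d e. \<not> e)\<rparr> \<cong> D5 \<times>\<times> C5"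
proof (rule isoI[of _ "\<lambda>(a, (v, e)). (a, v)"])
  have "(\<lambda>(a, (v, e)). (a, v)) ` C5_pairs (\<lambda>d e. \<not> e) = ({0..<5} \<times> UNIV) \<times> {0..<5}"
  proof (intro equalityI subsetI)
    fix p :: "(int \<times> bool) \<times> int" assume "p \<in> ({0..<5} \<times> UNIV) \<times> {0..<5}"
    then obtain u d v where "p = ((u, d), v)" "u \<in> {0..<5}" "v \<in> {0..<5}" by blast
    then show "p \<in> (\<lambda>(a, (v, e)). (a, v)) ` C5_pairs (\<lambda>d e. \<not> e)"
      by (intro image_eqI[of _ _ "((u, d), (v, False))"]) (simp_all add: mem_C5_pairs)
  qed (auto elim!: C5_pairs_cases)
  moreover have "inj_on (\<lambda>(a, (v, e)). (a, v)) (C5_pairs (\<lambda>d e. \<not> e))"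
    by (auto simp: inj_on_def C5_pairs_def)
  ultimately show "bij_betw (\<lambda>(a, (v, e)). (a, v)) (carrier ((D5 \<times>\<times> D5)\<lparr>carrier := C5_pairs (\<lambda>d e. \<not> e)\<rparr>)) (carrier (D5 \<times>\<times> C5))"
    by (simp add: bij_betw_def carrier_D5 carrier_integer_mod_group)
  fix g h
  assume "g \<in> carrier ((D5 \<times>\<times> D5)\<lparr>carrier := C5_pairs (\<lambda>d e. \<not> e)\<rparr>)" "h \<in> carrier ((D5 \<times>\<times> D5)\<lparr>carrier := C5_pairs (\<lambda>d e. \<not> e)\<rparr>)"
  then obtain u d v u' d' v' where gh: "g = ((u, d), (v, False))" "h = ((u', d'), (v', False))" "u' \<in> {0..<5}" "v' \<in> {0..<5}"
    by (auto elim!: C5_pairs_cases)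
  show "(case g \<otimes>\<^bsub>(D5 \<times>\<times> D5)\<lparr>carrier := C5_pairs (\<lambda>d e. \<not> e)\<rparr>\<^esub> h of (a, (v, e)) \<Rightarrow> (a, v)) =
     (case g of (a, (v, e)) \<Rightarrow> (a, v)) \<otimes>\<^bsub>D5 \<times>\<times> C5\<^esub> (case h of (a, (v, e)) \<Rightarrow> (a, v))"
    unfolding gh(1,2) update_carrier_mult C5_pairs_mult[OF gh(3,4)]
    using gh(3) by (simp add: mult_D5)
qed

lemma iso_pairs_rot: "(D5 \<times>\<times> D5)\<lparr>carrier := C5_pairs (\<lambda>d e. \<not> d \<and> \<not> e)\<rparr> \<cong> C5 \<times>\<times> C5"
proof (rule isoI[of _ "\<lambda>((u, d::bool), (v, e::bool)). (u, v)"])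
  have "(\<lambda>((u, d::bool), (v, e::bool)). (u, v)) ` C5_pairs (\<lambda>d e. \<not> d \<and> \<not> e) = {0..<5} \<times> {0..<5}"
  proof (intro equalityI subsetI)
    fix p :: "int \<times> int" assume "p \<in> {0..<5} \<times> {0..<5}"
    then obtain u v where "p = (u, v)" "u \<in> {0..<5}" "v \<in> {0..<5}" by blast
    then show "p \<in> (\<lambda>((u, d::bool), (v, e::bool)). (u, v)) ` C5_pairs (\<lambda>d e. \<not> d \<and> \<not> e)"
      by (intro image_eqI[of _ _ "((u, False), (v, False))"]) (simp_all add: mem_C5_pairs)
  qed (auto elim!: C5_pairs_cases)
  moreover have "inj_on (\<lambda>((u, d::bool), (v, e::bool)). (u, v)) (C5_pairs (\<lambda>d e. \<not> d \<and> \<not> e))"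
    by (auto simp: inj_on_def C5_pairs_def)
  ultimately show "bij_betw (\<lambda>((u, d::bool), (v, e::bool)). (u, v)) (carrier ((D5 \<times>\<times> D5)\<lparr>carrier := C5_pairs (\<lambda>d e. \<not> d \<and> \<not> e)\<rparr>)) (carrier (C5 \<times>\<times> C5))"
    by (simp add: bij_betw_def carrier_integer_mod_group)
  fix g h
  assume "g \<in> carrier ((D5 \<times>\<times> D5)\<lparr>carrier := C5_pairs (\<lambda>d e. \<not> d \<and> \<not> e)\<rparr>)" "h \<in> carrier ((D5 \<times>\<times> D5)\<lparr>carrier := C5_pairs (\<lambda>d e. \<not> d \<and> \<not> e)\<rparr>)"
  then obtain u v u' v' where gh: "g = ((u, False), (v, False))" "h = ((u', False), (v', False))" "u' \<in> {0..<5}" "v' \<in> {0..<5}"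
    by (auto elim!: C5_pairs_cases)
  show "(\<lambda>((u, d::bool), (v, e::bool)). (u, v)) (g \<otimes>\<^bsub>(D5 \<times>\<times> D5)\<lparr>carrier := C5_pairs (\<lambda>d e. \<not> d \<and> \<not> e)\<rparr>\<^esub> h) =
     (\<lambda>((u, d::bool), (v, e::bool)). (u, v)) g \<otimes>\<^bsub>C5 \<times>\<times> C5\<^esub> (\<lambda>((u, d::bool), (v, e::bool)). (u, v)) h"
    unfolding gh(1,2) update_carrier_mult C5_pairs_mult[OF gh(3,4)] by simp
qed

lemma C5_graph_image_fst: "fst ` C5_graph k m S = {0..<5} \<times> {d. S d}"
proof (intro equalityI subsetI)
  fix a :: "int \<times> bool" assume "a \<in> {0..<5} \<times> {d. S d}"
  then obtain u d where "a = (u, d)" "u \<in> {0..<5}" "S d" by blast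
  then show "a \<in> fst ` C5_graph k m S"
    by (intro image_eqI[of _ _ "((u, d), ((k * u + (if d then 2 * m else 0)) mod 5, d))"]) (simp_all add: mem_C5_graph)
qed (auto elim!: C5_graph_cases)

lemma inj_on_fst_C5_graph: "inj_on fst (C5_graph k m S)"
  by (rule inj_onI) (auto elim!: C5_graph_cases)

lemma iso_graph_all: "(D5 \<times>\<times> D5)\<lparr>carrier := C5_graph k m (\<lambda>d. True)\<rparr> \<cong> D5"
proof (rule isoI[of _ fst])
  show "bij_betw fst (carrier ((D5 \<times>\<times> D5)\<lparr>carrier := C5_graph k m (\<lambda>d. True)\<rparr>)) (carrier D5)"
    using C5_graph_image_fst[of k m "\<lambda>d. True"] inj_on_fst_C5_graph by (simp add: bij_betw_def carrier_D5)
qed (simp add: mult_DirProd')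

lemma iso_graph_rot: "(D5 \<times>\<times> D5)\<lparr>carrier := C5_graph k m (\<lambda>d. \<not> d)\<rparr> \<cong> C5"
proof (rule isoI[of _ "\<lambda>g. fst (fst g)"])
  have "(\<lambda>g. fst (fst g)) ` C5_graph k m (\<lambda>d. \<not> d) = fst ` fst ` C5_graph k m (\<lambda>d. \<not> d)"
    by (simp only: image_image)
  also have "\<dots> = {0..<5}" unfolding C5_graph_image_fst by force
  finally have "(\<lambda>g. fst (fst g)) ` C5_graph k m (\<lambda>d. \<not> d) = {0..<5}" .
  moreover have "inj_on (\<lambda>g. fst (fst g)) (C5_graph k m (\<lambda>d. \<not> d))"
    by (rule inj_onI) (auto elim!: C5_graph_cases)
  ultimately show "bij_betw (\<lambda>g. fst (fst g)) (carrier ((D5 \<times>\<times> D5)\<lparr>carrier := C5_graph k m (\<lambda>d. \<not> d)\<rparr>)) (carrier C5)"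
    by (simp add: bij_betw_def carrier_integer_mod_group)
  fix g h
  assume "g \<in> carrier ((D5 \<times>\<times> D5)\<lparr>carrier := C5_graph k m (\<lambda>d. \<not> d)\<rparr>)"
    "h \<in> carrier ((D5 \<times>\<times> D5)\<lparr>carrier := C5_graph k m (\<lambda>d. \<not> d)\<rparr>)"
  then obtain u b v b' where gh: "g = ((u, False), b)" "h = ((v, False), b')" "v \<in> {0..<5}"
    by (auto elim!: C5_graph_cases)
  show "fst (fst (g \<otimes>\<^bsub>(D5 \<times>\<times> D5)\<lparr>carrier := C5_graph k m (\<lambda>d. \<not> d)\<rparr>\<^esub> h)) = fst (fst g) \<otimes>\<^bsub>C5\<^esub> fst (fst h)"
    unfolding gh(1,2) update_carrier_mult using gh(3) by (simp add: mult_DirProd' mult_D5)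
qed

lemma C5_pairs_image:
  "fst ` C5_pairs S = {0..<5} \<times> {d. \<exists>e. S d e}" "snd ` C5_pairs S = {0..<5} \<times> {e. \<exists>d. S d e}"
proof -
  have z: "(0::int) \<in> {0..<5}" by simp
  show "fst ` C5_pairs S = {0..<5} \<times> {d. \<exists>e. S d e}"
  proof (intro equalityI subsetI)
    fix a :: "int \<times> bool" assume "a \<in> {0..<5} \<times> {d. \<exists>e. S d e}"
    then obtain u :: int and d e where "a = (u, d)" "u \<in> {0..<5}" "S d e" by auto
    then have "((u, d), (0, e)) \<in> C5_pairs S" "a = fst ((u, d), (0::int, e))" using z by (auto simp: C5_pairs_def)
    then show "a \<in> fst ` C5_pairs S" by (rule image_eqI[rotated])
  qed (auto simp: C5_pairs_def)
  show "snd ` C5_pairs S = {0..<5} \<times> {e. \<exists>d. S d e}"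
  proof (intro equalityI subsetI)
    fix a :: "int \<times> bool" assume "a \<in> {0..<5} \<times> {e. \<exists>d. S d e}"
    then obtain v :: int and d e where "a = (v, e)" "v \<in> {0..<5}" "S d e" by auto
    then have "((0, d), (v, e)) \<in> C5_pairs S" "a = snd ((0::int, d), (v, e))" using z by (auto simp: C5_pairs_def)
    then show "a \<in> snd ` C5_pairs S" by (rule image_eqI[rotated])
  qed (auto simp: C5_pairs_def)
qed

lemma C5_graph_inj_snd:
  assumes "k mod 5 \<noteq> 0"
  shows "inj_on snd (C5_graph k m S)"
proof (rule inj_onI)
  fix g h assume g: "g \<in> C5_graph k m S" and h: "h \<in> C5_graph k m S" and eq: "snd g = snd h"
  obtain u d where g: "g = ((u, d), ((k * u + (if d then 2 * m else 0)) mod 5, d))" "u \<in> {0..<5}"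
    using g by (rule C5_graph_cases)
  obtain v e where h: "h = ((v, e), ((k * v + (if e then 2 * m else 0)) mod 5, e))" "v \<in> {0..<5}"
    using h by (rule C5_graph_cases)
  have "d = e" using eq g h by simp
  then have "(k * u + (if d then 2 * m else 0)) mod 5 = (k * v + (if d then 2 * m else 0)) mod 5" using eq g h by simp
  then have "5 dvd k * (u - v)" by (simp add: mod_eq_dvd_iff algebra_simps)
  then have "(k * (u - v)) mod 5 = 0" by simp
  then have "u mod 5 = v mod 5" using assms by (simp add: mod_eq_0_iff_dvd dvd5_mult mod_eq_dvd_iff mod_eq_0_iff_dvd)
  then have "u = v" using g h by simp
  then show "g = h" using g h \<open>d = e\<close> by simp
qed

text \<open>Both projections are injective on the graph, so the image has the same size as the first
  projection, and an inclusion of finite sets of equal size is an equality.\<close>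

lemma C5_graph_image_snd:
  assumes "k mod 5 \<noteq> 0"
  shows "snd ` C5_graph k m S = {0..<5} \<times> {d. S d}"
proof (rule card_subset_eq)
  have fin: "finite ({0..<5::int} \<times> {d. S d})" by simp
  then show "finite ({0..<5::int} \<times> {d. S d})" .
  show "snd ` C5_graph k m S \<subseteq> {0..<5} \<times> {d. S d}" by (auto simp: C5_graph_def)
  have "card (snd ` C5_graph k m S) = card (C5_graph k m S)" by (rule card_image[OF C5_graph_inj_snd[OF assms]])
  also have "\<dots> = card (fst ` C5_graph k m S)" by (rule card_image[OF inj_on_fst_C5_graph, symmetric])
  finally show "card (snd ` C5_graph k m S) = card ({0..<5::int} \<times> {d. S d})" by (simp only: C5_graph_image_fst)
qed

section \<open>Orbits on the dihedral group\<close>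

text \<open>On \<open>D5\<close>, \<open>c = 1\<close> gives the identity, which belongs to the
  first resolvent; the second one leads to \<open>c = 3\<close>.\<close>

definition kap :: "int \<Rightarrow> int \<times> bool \<Rightarrow> int \<times> bool" where
  "kap c a = ((c * fst a) mod 5, snd a)"

lemma kap_carrier: "kap c a \<in> carrier D5"
  by (simp add: kap_def carrier_D5)

lemma kap_one: "kap c \<one>\<^bsub>D5\<^esub> = \<one>\<^bsub>D5\<^esub>"
  by (simp add: kap_def one_D5)

lemma kap_mult:
  assumes "b \<in> carrier D5"
  shows "kap c (a \<otimes>\<^bsub>D5\<^esub> b) = kap c a \<otimes>\<^bsub>D5\<^esub> kap c b"
proof -
  obtain u d v e where ab: "a = (u, d)" "b = (v, e)" "v \<in> {0..<5}" using assms by (cases a, cases b) (auto simp: carrier_D5)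
  have "c * v mod 5 \<in> {0..<5}" by simp
  then show ?thesis
    unfolding ab(1,2) mult_D5[OF ab(3)] kap_def fst_conv snd_conv
    by (subst mult_D5) (auto simp: mod_simps algebra_simps)
qed

definition act :: "int \<Rightarrow> (int \<times> bool) \<times> (int \<times> bool) \<Rightarrow> int \<times> bool \<Rightarrow> int \<times> bool" where
  "act c g h = snd g \<otimes>\<^bsub>D5\<^esub> h \<otimes>\<^bsub>D5\<^esub> inv\<^bsub>D5\<^esub> (kap c (fst g))"

definition orbs :: "int \<Rightarrow> ((int \<times> bool) \<times> (int \<times> bool)) set \<Rightarrow> (int \<times> bool) set set" where
  "orbs c \<Gamma> = (\<lambda>h. (\<lambda>g. act c g h) ` \<Gamma>) ` carrier D5"

lemma inv_D5:
  assumes "u \<in> {0..<5}"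
  shows "inv\<^bsub>D5\<^esub> (u, d) = (if d then u else (- u) mod 5, d)"
proof (rule D5.inv_equality)
  show "(if d then u else (- u) mod 5, d) \<otimes>\<^bsub>D5\<^esub> (u, d) = \<one>\<^bsub>D5\<^esub>"
    unfolding mult_D5[OF assms] by (auto simp: one_D5 mod_simps)
qed (use assms in \<open>auto simp: carrier_D5\<close>)

lemma act_formula:
  assumes "w \<in> {0..<5}"
  shows "act c ((u, d), (v, e)) (w, f) =
    ((v + (if e then - w else w) + (if (e \<noteq> f) \<noteq> d then c * u else - (c * u))) mod 5, (e \<noteq> f) \<noteq> d)"
proof -
  have m: "c * u mod 5 \<in> {0..<5}" "(- (c * u mod 5)) mod 5 \<in> {0..<5}" by simp_all
  show ?thesis
    unfolding act_def kap_def fst_conv snd_conv mult_D5[OF assms] inv_D5[OF m(1)]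
    by (cases d) (simp_all add: mult_D5 mod_simps algebra_simps)
qed

lemma dvd5_bound: "5 dvd u - v \<Longrightarrow> u \<in> {0..<5} \<Longrightarrow> v \<in> {0..<5} \<Longrightarrow> u = (v :: int)"
  by (metis atLeastLessThan_iff mod_eq_dvd_iff mod_pos_pos_trivial)

lemma affine_surj:
  fixes a b :: int
  assumes "\<not> 5 dvd a"
  shows "(\<lambda>u. (a * u + b) mod 5) ` {0..<5} = {0..<5}"
proof (rule endo_inj_surj)
  show "inj_on (\<lambda>u. (a * u + b) mod 5) {0..<5}"
  proof (rule inj_onI)
    fix u v :: int assume uv: "u \<in> {0..<5}" "v \<in> {0..<5}" "(a * u + b) mod 5 = (a * v + b) mod 5"
    then have "5 dvd a * (u - v)" by (simp add: mod_eq_dvd_iff algebra_simps)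
    then have "5 dvd u - v" using assms by (simp add: dvd5_mult)
    then show "u = v" using uv dvd5_bound by blast
  qed
qed auto

text \<open>The free rotation in the second component already reaches every position, so an orbit is
  determined by the flags that occur in it.\<close>

lemma orbit_pairs:
  assumes w: "w \<in> {0..<5}"
  shows "(\<lambda>g. act c g (w, f)) ` C5_pairs S = {0..<5} \<times> {f'. \<exists>d e. S d e \<and> f' = ((e \<noteq> f) \<noteq> d)}"
proof (intro equalityI subsetI)
  fix h assume "h \<in> (\<lambda>g. act c g (w, f)) ` C5_pairs S"
  then obtain g where g: "g \<in> C5_pairs S" "h = act c g (w, f)" by blast
  obtain u d v e where "g = ((u, d), (v, e))" and S: "S d e" using g(1) by (rule C5_pairs_cases)
  then obtain y where "h = (y mod 5, (e \<noteq> f) \<noteq> d)" using g(2) act_formula[OF w] by blast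
  moreover have "y mod 5 \<in> {0..<5}" by simp
  ultimately show "h \<in> {0..<5} \<times> {f'. \<exists>d e. S d e \<and> f' = ((e \<noteq> f) \<noteq> d)}" using S by blast
next
  fix h :: "int \<times> bool" assume "h \<in> {0..<5} \<times> {f'. \<exists>d e. S d e \<and> f' = ((e \<noteq> f) \<noteq> d)}"
  then obtain y d e where h: "h = (y, (e \<noteq> f) \<noteq> d)" "y \<in> {0..<5}" "S d e" by blast
  define v where "v = (y - (if e then - w else w)) mod 5"
  have "act c ((0, d), (v, e)) (w, f) = h"
    unfolding act_formula[OF w] h(1) v_def using h(2) by (simp add: mod_simps)
  moreover have "((0, d), (v, e)) \<in> C5_pairs S" using h by (auto simp: C5_pairs_def v_def)
  ultimately show "h \<in> (\<lambda>g. act c g (w, f)) ` C5_pairs S" by blast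
qed

lemma orbs_pairs:
  "orbs c (C5_pairs S) = (\<lambda>f. {0..<5} \<times> {f'. \<exists>d e. S d e \<and> f' = ((e \<noteq> f) \<noteq> d)}) ` UNIV"
proof -
  have "orbs c (C5_pairs S) = (\<lambda>(w, f). {0..<5} \<times> {f'. \<exists>d e. S d e \<and> f' = ((e \<noteq> f) \<noteq> d)}) ` ({0..<5::int} \<times> UNIV)"
    unfolding orbs_def carrier_D5
  proof (rule image_cong[OF refl])
    fix h :: "int \<times> bool" assume "h \<in> {0..<5} \<times> UNIV"
    then obtain w f where "h = (w, f)" "w \<in> {0..<5}" by blast
    then show "(\<lambda>g. act c g h) ` C5_pairs S =
      (\<lambda>(w, f). {0..<5} \<times> {f'. \<exists>d e. S d e \<and> f' = ((e \<noteq> f) \<noteq> d)}) h" by (simp only: orbit_pairs prod.case)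
  qed
  also have "\<dots> = (\<lambda>f. {0..<5} \<times> {f'. \<exists>d e. S d e \<and> f' = ((e \<noteq> f) \<noteq> d)}) ` UNIV"
  proof (intro equalityI subsetI)
    fix Y assume "Y \<in> (\<lambda>f. {0..<5::int} \<times> {f'. \<exists>d e. S d e \<and> f' = ((e \<noteq> f) \<noteq> d)}) ` UNIV"
    then obtain f where "Y = {0..<5} \<times> {f'. \<exists>d e. S d e \<and> f' = ((e \<noteq> f) \<noteq> d)}" by blast
    then show "Y \<in> (\<lambda>(w, f). {0..<5} \<times> {f'. \<exists>d e. S d e \<and> f' = ((e \<noteq> f) \<noteq> d)}) ` ({0..<5::int} \<times> UNIV)"
      by (intro image_eqI[of _ _ "(0, f)"]) auto
  qed auto
  finally show ?thesis .
qed

definition DT_of :: "(int \<times> bool) set set \<Rightarrow> nat multiset" where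
  "DT_of Y = image_mset card (mset_set Y)"

lemma card_slice: "card ({0..<5::int} \<times> {f}) = 5"
  by simp

lemma slice_ne: "{0..<5::int} \<times> {True} \<noteq> {0..<5} \<times> {False}"
proof
  assume eq: "{0..<5::int} \<times> {True} = {0..<5} \<times> {False}"
  have "(0::int, True) \<in> {0..<5} \<times> {True}" by simp
  then show False unfolding eq by simp
qed

lemma DT_slices: "DT_of {{0..<5} \<times> {True}, {0..<5} \<times> {False}} = {#5, 5#}"
proof -
  have "mset_set {{0..<5::int} \<times> {True}, {0..<5} \<times> {False}} = {#{0..<5} \<times> {True}, {0..<5} \<times> {False}#}"
    using slice_ne by simp
  then show ?thesis unfolding DT_of_def by (simp only: image_mset_add_mset image_mset_empty card_slice)
qed

lemma DT_whole: "DT_of {{0..<5} \<times> UNIV} = {#10#}"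
  by (simp add: DT_of_def)

lemma DT_pairs:
  "DT_of (orbs c (C5_pairs (\<lambda>d e. True))) = {#10#}"
  "DT_of (orbs c (C5_pairs (\<lambda>d e. \<not> e))) = {#10#}"
  "DT_of (orbs c (C5_pairs (\<lambda>d e. d = e))) = {#5, 5#}"
  "DT_of (orbs c (C5_pairs (\<lambda>d e. \<not> d \<and> \<not> e))) = {#5, 5#}"
proof -
  have 1: "{f'. \<exists>d e. True \<and> f' = ((e \<noteq> f) \<noteq> d)} = UNIV" for f :: bool by auto
  have 2: "{f'. \<exists>d e. \<not> e \<and> f' = ((e \<noteq> f) \<noteq> d)} = UNIV" for f :: bool by auto
  have 3: "{f'. \<exists>d e. d = e \<and> f' = ((e \<noteq> f) \<noteq> d)} = {f}" for f :: bool by auto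
  have 4: "{f'. \<exists>d e. (\<not> d \<and> \<not> e) \<and> f' = ((e \<noteq> f) \<noteq> d)} = {f}" for f :: bool by auto
  show "DT_of (orbs c (C5_pairs (\<lambda>d e. True))) = {#10#}" "DT_of (orbs c (C5_pairs (\<lambda>d e. \<not> e))) = {#10#}"
    unfolding orbs_pairs 1 2 using DT_whole by simp_all
  show "DT_of (orbs c (C5_pairs (\<lambda>d e. d = e))) = {#5, 5#}"
    "DT_of (orbs c (C5_pairs (\<lambda>d e. \<not> d \<and> \<not> e))) = {#5, 5#}"
    unfolding orbs_pairs 3 4 UNIV_bool using DT_slices by (simp_all add: insert_commute)
qed

text \<open>Both components have the same flag, so an orbit stays in the slice \<open>f\<close>. An
  element with rotation part \<open>u\<close> shifts there by \<open>u\<close> times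
  \<open>k + c\<close> or \<open>k - c\<close>, depending on \<open>f\<close>; whether 5 divides
  this factor decides whether the orbits are small.\<close>

lemma orbit_graph:
  assumes w: "w \<in> {0..<5}"
  shows "(\<lambda>g. act c g (w, f)) ` C5_graph k m S =
    {((k + (if f then c else - c)) * u + (if d then 2 * m - w else w)) mod 5 | u d. u \<in> {0..<5} \<and> S d} \<times> {f}"
    (is "?L = ?R")
proof -
  have act: "act c ((u, d), ((k * u + (if d then 2 * m else 0)) mod 5, d)) (w, f) =
    (((k + (if f then c else - c)) * u + (if d then 2 * m - w else w)) mod 5, f)" for u d
    unfolding act_formula[OF w] add.assoc mod_add_left_eq by (cases d; cases f) (simp_all add: algebra_simps)
  have "?L = {act c ((u, d), ((k * u + (if d then 2 * m else 0)) mod 5, d)) (w, f) | u d. u \<in> {0..<5} \<and> S d}"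
    unfolding C5_graph_def by blast
  also have "\<dots> = ?R" unfolding act by blast
  finally show ?thesis .
qed

section \<open>Orbit lengths on the two slices\<close>

definition slice_orbs :: "int \<Rightarrow> int \<Rightarrow> (bool \<Rightarrow> bool) \<Rightarrow> bool \<Rightarrow> (int \<times> bool) set set" where
  "slice_orbs a m S f = (\<lambda>w. {(a * u + (if d then 2 * m - w else w)) mod 5 | u d. u \<in> {0..<5} \<and> S d} \<times> {f}) ` {0..<5}"

lemma orbs_graph: "orbs c (C5_graph k m S) = slice_orbs (k + c) m S True \<union> slice_orbs (k - c) m S False"
proof -
  have "carrier D5 = (\<lambda>w. (w, True)) ` {0..<5} \<union> (\<lambda>w. (w, False)) ` {0..<5}"
    by (auto simp: carrier_D5 image_iff)
  then show ?thesis
    unfolding orbs_def slice_orbs_def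
    by (simp only: image_Un image_image) (intro arg_cong2[of _ _ _ _ "(\<union>)"] image_cong refl; simp add: orbit_graph)
qed

lemma slice_orbs_transitive:
  assumes "\<not> 5 dvd a" "S False"
  shows "slice_orbs a m S f = {{0..<5} \<times> {f}}"
proof -
  have "{(a * u + (if d then 2 * m - w else w)) mod 5 | u d. u \<in> {0..<5} \<and> S d} = {0..<5}" for w
  proof
    show "{(a * u + (if d then 2 * m - w else w)) mod 5 | u d. u \<in> {0..<5} \<and> S d} \<subseteq> {0..<5}" by auto
    have "{0..<5} = (\<lambda>u. (a * u + w) mod 5) ` {0..<5}" by (rule affine_surj[OF assms(1), symmetric])
    also have "\<dots> \<subseteq> {(a * u + (if d then 2 * m - w else w)) mod 5 | u d. u \<in> {0..<5} \<and> S d}"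
      using assms(2) by (auto intro!: exI[of _ False])
    finally show "{0..<5} \<subseteq> {(a * u + (if d then 2 * m - w else w)) mod 5 | u d. u \<in> {0..<5} \<and> S d}" .
  qed
  note eq = this
  have "slice_orbs a m S f = (\<lambda>w. {0..<5} \<times> {f}) ` {0..<5::int}" unfolding slice_orbs_def eq ..
  also have "\<dots> = {{0..<5} \<times> {f}}" by (rule image_constant[of 0]) simp
  finally show ?thesis .
qed

lemma slice_orbs_trivial:
  assumes "5 dvd a"
  shows "slice_orbs a m S f = (\<lambda>w. {(if d then 2 * m - w else w) mod 5 | d. S d} \<times> {f}) ` {0..<5}"
proof -
  have "(a * u + b) mod 5 = b mod 5" for u b
    using assms by (simp add: mod_eq_dvd_iff)
  note red = this
  have z: "(0::int) \<in> {0..<5}" by simp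
  have "{(a * u + (if d then 2 * m - w else w)) mod 5 | u d. u \<in> {0..<5::int} \<and> S d} =
    {(if d then 2 * m - w else w) mod 5 | d. S d}" for w
    unfolding red using z by blast
  then show ?thesis by (simp add: slice_orbs_def)
qed

lemma slice_orbs_rot:
  assumes "5 dvd a"
  shows "DT_of (slice_orbs a m (\<lambda>d. \<not> d) f) = {#1, 1, 1, 1, 1#}"
proof -
  have "{(if d then 2 * m - w else w) mod 5 | d. \<not> d} = {w mod 5}" for w by auto
  then have "slice_orbs a m (\<lambda>d. \<not> d) f = (\<lambda>w. {w mod 5} \<times> {f}) ` {0..<5}" unfolding slice_orbs_trivial[OF assms] by simp
  also have "\<dots> = {{(0, f)}, {(1, f)}, {(2, f)}, {(3, f)}, {(4, f)}}" by (simp add: atLeastLessThan5)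
  finally show ?thesis by (simp add: DT_of_def)
qed

text \<open>What acts is the reflection \<open>w \<mapsto> 2m - w\<close>, which fixes
  \<open>m\<close> and exchanges the other residues in two pairs; the pairs are listed for each
  \<open>m\<close> modulo 5.\<close>

lemma slice_orbs_refl:
  assumes "5 dvd a"
  shows "DT_of (slice_orbs a m (\<lambda>d. True) f) = {#1, 2, 2#}"
proof -
  have "{(if d then 2 * m - w else w) mod 5 | d. True} = {w mod 5, (2 * m - w) mod 5}" for w
    by (auto split: if_splits)
  then have eq: "slice_orbs a m (\<lambda>d. True) f = (\<lambda>w. {w mod 5, (2 * m - w) mod 5} \<times> {f}) ` {0..<5}"
    unfolding slice_orbs_trivial[OF assms] by simp
  have "(2 * m - w) mod 5 = (2 * (m mod 5) - w) mod 5" for w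
    using mod_diff_left_eq[of "2 * m" 5 w] mod_diff_left_eq[of "2 * (m mod 5)" 5 w] mod_mult_right_eq[of 2 m 5] by simp
  then have eq: "slice_orbs a m (\<lambda>d. True) f =
    {{0, (2 * (m mod 5)) mod 5} \<times> {f}, {1, (2 * (m mod 5) - 1) mod 5} \<times> {f}, {2, (2 * (m mod 5) - 2) mod 5} \<times> {f},
      {3, (2 * (m mod 5) - 3) mod 5} \<times> {f}, {4, (2 * (m mod 5) - 4) mod 5} \<times> {f}}"
    unfolding eq by (simp add: atLeastLessThan5)
  have three: "DT_of {{a} \<times> {f}, {b, c} \<times> {f}, {d, e} \<times> {f}} = {#1, 2, 2#}"
    if "distinct [a, b, c, d, e]" for a b c d e :: int
  proof -
    have ne: "{a} \<times> {f} \<noteq> {b, c} \<times> {f}" "{a} \<times> {f} \<noteq> {d, e} \<times> {f}" "{b, c} \<times> {f} \<noteq> {d, e} \<times> {f}"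
      using that by auto
    have card: "card ({a} \<times> {f}) = 1" "card ({b, c} \<times> {f}) = 2" "card ({d, e} \<times> {f}) = 2"
      using that by (simp_all add: card_cartesian_product)
    have "mset_set {{a} \<times> {f}, {b, c} \<times> {f}, {d, e} \<times> {f}} = {#{a} \<times> {f}, {b, c} \<times> {f}, {d, e} \<times> {f}#}"
      using ne by (simp del: insert_Times_insert)
    then show ?thesis unfolding DT_of_def by (simp only: image_mset_add_mset image_mset_empty card)
  qed
  show ?thesis
  proof (cases rule: mod5_cases[of m])
    case 1
    have "slice_orbs a m (\<lambda>d. True) f = {{0} \<times> {f}, {1, 4} \<times> {f}, {2, 3} \<times> {f}}" unfolding eq 1 by auto
    then show ?thesis using three[of 0 1 4 2 3] by simp
  next
    case 2
    have "slice_orbs a m (\<lambda>d. True) f = {{1} \<times> {f}, {0, 2} \<times> {f}, {3, 4} \<times> {f}}" unfolding eq 2 by auto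
    then show ?thesis using three[of 1 0 2 3 4] by simp
  next
    case 3
    have "slice_orbs a m (\<lambda>d. True) f = {{2} \<times> {f}, {0, 4} \<times> {f}, {1, 3} \<times> {f}}" unfolding eq 3 by auto
    then show ?thesis using three[of 2 0 4 1 3] by simp
  next
    case 4
    have "slice_orbs a m (\<lambda>d. True) f = {{3} \<times> {f}, {0, 1} \<times> {f}, {2, 4} \<times> {f}}" unfolding eq 4 by auto
    then show ?thesis using three[of 3 0 1 2 4] by simp
  next
    case 5
    have "slice_orbs a m (\<lambda>d. True) f = {{4} \<times> {f}, {0, 3} \<times> {f}, {1, 2} \<times> {f}}" unfolding eq 5 by auto
    then show ?thesis using three[of 4 0 3 1 2] by simp
  qed
qed

text \<open>Orbits are nonempty and lie in one slice, so none is counted for both values of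
  \<open>f\<close>.\<close>

lemma DT_graph:
  assumes "S False"
  shows "DT_of (orbs c (C5_graph k m S)) = DT_of (slice_orbs (k + c) m S True) + DT_of (slice_orbs (k - c) m S False)"
proof -
  have *: "Y \<noteq> {} \<and> Y \<subseteq> UNIV \<times> {f}" if "Y \<in> slice_orbs a m S f" for Y a f
    using that assms unfolding slice_orbs_def by (auto intro!: exI[of _ "0::int"])
  have "slice_orbs (k + c) m S True \<inter> slice_orbs (k - c) m S False = {}"
  proof (rule equals0I)
    fix Y assume "Y \<in> slice_orbs (k + c) m S True \<inter> slice_orbs (k - c) m S False"
    then have "Y \<noteq> {}" "Y \<subseteq> UNIV \<times> {True}" "Y \<subseteq> UNIV \<times> {False}" using * by blast+
    then show False by blast
  qed
  moreover have "finite (slice_orbs a m S f)" for a f by (simp add: slice_orbs_def)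
  ultimately show ?thesis unfolding orbs_graph DT_of_def by (simp add: mset_set_Union)
qed

lemma DT_graph_all:
  assumes "k mod 5 \<noteq> 0"
  shows "(DT_of (orbs 1 (C5_graph k m (\<lambda>d. True))), DT_of (orbs 3 (C5_graph k m (\<lambda>d. True)))) \<in>
      {({#5, 2, 2, 1#}, {#5, 5#}), ({#5, 5#}, {#5, 2, 2, 1#})}"
    and "(DT_of (orbs 1 (C5_graph k m (\<lambda>d. \<not> d))), DT_of (orbs 3 (C5_graph k m (\<lambda>d. \<not> d)))) \<in>
      {({#5, 1, 1, 1, 1, 1#}, {#5, 5#}), ({#5, 5#}, {#5, 1, 1, 1, 1, 1#})}"
proof -
  have one: "DT_of {{0..<5} \<times> {f}} = {#5#}" for f by (simp add: DT_of_def)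
  have trans: "DT_of (slice_orbs a m S f) = {#5#}" if "\<not> 5 dvd a" "S False" for a S f
    unfolding slice_orbs_transitive[of a S m f, OF that] by (rule one)
  have d: "5 dvd k + j \<longleftrightarrow> (k mod 5 + j) mod 5 = 0" "5 dvd k - j \<longleftrightarrow> (k mod 5 - j) mod 5 = 0" for j
    by (simp_all add: mod_eq_0_iff_dvd mod_simps flip: mod_eq_0_iff_dvd)
  have "(5 dvd k + 1 \<and> \<not> 5 dvd k - 1 \<and> \<not> 5 dvd k + 3 \<and> \<not> 5 dvd k - 3) \<or>
    (\<not> 5 dvd k + 1 \<and> 5 dvd k - 1 \<and> \<not> 5 dvd k + 3 \<and> \<not> 5 dvd k - 3) \<or>
    (\<not> 5 dvd k + 1 \<and> \<not> 5 dvd k - 1 \<and> 5 dvd k + 3 \<and> \<not> 5 dvd k - 3) \<or>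
    (\<not> 5 dvd k + 1 \<and> \<not> 5 dvd k - 1 \<and> \<not> 5 dvd k + 3 \<and> 5 dvd k - 3)"
    using assms unfolding d by (cases rule: mod5_cases[of k]) simp_all
  then show "(DT_of (orbs 1 (C5_graph k m (\<lambda>d. True))), DT_of (orbs 3 (C5_graph k m (\<lambda>d. True)))) \<in>
      {({#5, 2, 2, 1#}, {#5, 5#}), ({#5, 5#}, {#5, 2, 2, 1#})}"
    "(DT_of (orbs 1 (C5_graph k m (\<lambda>d. \<not> d))), DT_of (orbs 3 (C5_graph k m (\<lambda>d. \<not> d)))) \<in>
      {({#5, 1, 1, 1, 1, 1#}, {#5, 5#}), ({#5, 5#}, {#5, 1, 1, 1, 1, 1#})}"
    by (elim disjE; simp add: DT_graph trans slice_orbs_rot slice_orbs_refl)+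
qed

section \<open>The pentagon belonging to the second resolvent\<close>

text \<open>
  If \<open>x\<close> has the invariants \<open>s, t\<close>, then the following pentagon has the invariants
  \<open>(s + 5t)/t\<^sup>2, -1/t\<close> at which \<open>F\<^sup>1\<close> is evaluated in the definition of \<open>F\<^sup>2\<close>.
\<close>

definition twist :: "(int \<Rightarrow> 'f::field) \<Rightarrow> int \<Rightarrow> 'f" where
  "twist x i = x (2 * i) / (x (2 * i) - 1)"

lemma e4_as_inverses:
  fixes a b c d e :: "'f::field"
  assumes "a \<noteq> 0" "b \<noteq> 0" "c \<noteq> 0" "d \<noteq> 0" "e \<noteq> 0"
  shows "a * b * c * d + a * b * c * e + a * b * d * e + a * c * d * e + b * c * d * e =
    a * b * c * d * e * (inverse a + inverse b + inverse c + inverse d + inverse e)"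
  using assms by (simp add: field_simps)

context pentagon
begin

text \<open>On inverses the twist is an affine map, which gives its injectivity and makes
  \<open>pent_s\<close> of the twist easy to compute.\<close>

lemma twist_inverse: "inverse (twist x i) = 1 - inverse (x (2 * i))"
proof -
  have "x (2 * i) - 1 \<noteq> 0" by simp
  then show ?thesis by (simp add: twist_def field_simps)
qed

text \<open>Neighbours in the twisted sequence have distance 2 in the old one. When each factor
  \<open>x - 1\<close> is written as minus the product of the old neighbours, everything but
  \<open>1 / (b * d)\<close> cancels.\<close>

lemma pentagon_twist: "pentagon (twist x)"
proof
  show "twist x (i + 5) = twist x i" for i
  proof -
    have "x (2 * (i + 5)) = x (2 * i)" by (rule x_cong) (simp add: mod_eq_dvd_iff)
    then show ?thesis by (simp add: twist_def)
  qed
  show "twist x i \<noteq> 0" for i by (simp add: twist_def)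
  fix i
  define a b c d e where "a = x (2 * i - 2)" and "b = x (2 * i - 1)" and "c = x (2 * i)"
    and "d = x (2 * i + 1)" and "e = x (2 * i + 2)"
  have "x (2 * i - 3) = e" "x (2 * i + 3) = a" unfolding e_def a_def by (rule x_cong; simp add: mod_eq_dvd_iff)+
  moreover have "2 * i - 2 - 1 = 2 * i - 3" "2 * i - 2 + 1 = 2 * i - 1" "2 * i + 2 - 1 = 2 * i + 1" "2 * i + 2 + 1 = 2 * i + 3"
    by simp_all
  ultimately have 1: "e * b = 1 - a" and 2: "d * a = 1 - e" and 3: "b * d = 1 - c"
    using rel[of "2 * i - 2"] rel[of "2 * i + 2"] rel[of "2 * i"]
    by (simp_all only: a_def[symmetric] b_def[symmetric] c_def[symmetric] d_def[symmetric] e_def[symmetric])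
  have nz': "a \<noteq> 0" "b \<noteq> 0" "c \<noteq> 0" "d \<noteq> 0" "e \<noteq> 0" by (simp_all add: a_def b_def c_def d_def e_def)
  have 1: "a - 1 = - (e * b)" and 2: "e - 1 = - (d * a)" and 3: "c - 1 = - (b * d)"
    unfolding 1 2 3 by simp_all
  have "twist x (i - 1) * twist x (i + 1) = a / (a - 1) * (e / (e - 1))"
    by (simp add: twist_def a_def e_def algebra_simps)
  also have "\<dots> = 1 / (b * d)" unfolding 1 2 using nz' by (simp add: field_simps)
  also have "\<dots> = 1 - c / (c - 1)"
  proof -
    have "c - 1 \<noteq> 0" by (simp add: c_def)
    then have "1 - c / (c - 1) = - 1 / (c - 1)" by (simp add: field_simps)
    then show ?thesis unfolding 3 by simp
  qed
  finally show "twist x (i - 1) * twist x (i + 1) = 1 - twist x i" by (simp add: twist_def c_def)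
qed

lemma twist_values:
  "twist x 0 = x 0 / (x 0 - 1)" "twist x 1 = x 2 / (x 2 - 1)" "twist x 2 = x 4 / (x 4 - 1)"
  "twist x 3 = x 1 / (x 1 - 1)" "twist x 4 = x 3 / (x 3 - 1)"
proof -
  have "x 6 = x 1" "x 8 = x 3" by (rule x_cong; simp)+
  then show "twist x 0 = x 0 / (x 0 - 1)" "twist x 1 = x 2 / (x 2 - 1)" "twist x 2 = x 4 / (x 4 - 1)"
    "twist x 3 = x 1 / (x 1 - 1)" "twist x 4 = x 3 / (x 3 - 1)" by (simp_all add: twist_def)
qed

lemma x_minus_1:
  "x 0 - 1 = - (x 4 * x 1)" "x 1 - 1 = - (x 0 * x 2)" "x 2 - 1 = - (x 1 * x 3)" "x 3 - 1 = - (x 2 * x 4)"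
  "x 4 - 1 = - (x 3 * x 0)"
  unfolding rels by simp_all

lemma pent_t_twist: "pent_t (twist x) = - 1 / pent_t x"
  unfolding pent_t_def twist_values x_minus_1 by (simp add: field_simps)

text \<open>The invariant \<open>s\<close> is the fourth elementary symmetric function, that is, the
  product of the entries times the sum of their inverses. The twist turns this sum \<open>q\<close>
  into \<open>5 - q\<close>, which is the origin of the summand \<open>5t\<close>.\<close>

lemma pent_s_twist: "pent_s (twist x) = (pent_s x + 5 * pent_t x) / (pent_t x)\<^sup>2"
proof -
  interpret tw: pentagon "twist x" by (rule pentagon_twist)
  define t where "t = pent_t x"
  have t0: "t \<noteq> 0" by (simp add: t_def)
  define q where "q = inverse (x 0) + inverse (x 1) + inverse (x 2) + inverse (x 3) + inverse (x 4)"
  have "pent_s x = x 0 * x 1 * x 2 * x 3 * x 4 * q"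
    unfolding q_def elementary_symmetric(3)[symmetric] by (rule e4_as_inverses) simp_all
  then have s: "pent_s x = - t * q" by (simp add: t_def pent_t_def)
  have "x 6 = x 1" "x 8 = x 3" by (rule x_cong; simp)+
  then have iv: "inverse (twist x 0) = 1 - inverse (x 0)" "inverse (twist x 1) = 1 - inverse (x 2)"
    "inverse (twist x 2) = 1 - inverse (x 4)" "inverse (twist x 3) = 1 - inverse (x 1)"
    "inverse (twist x 4) = 1 - inverse (x 3)"
    using twist_inverse[of 0] twist_inverse[of 1] twist_inverse[of 2] twist_inverse[of 3] twist_inverse[of 4] by simp_all
  have "twist x 0 * twist x 1 * twist x 2 * twist x 3 * twist x 4 = - pent_t (twist x)" by (simp add: pent_t_def)
  also have "\<dots> = 1 / t" by (simp add: pent_t_twist t_def)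
  finally have P: "twist x 0 * twist x 1 * twist x 2 * twist x 3 * twist x 4 = 1 / t" .
  have "pent_s (twist x) = twist x 0 * twist x 1 * twist x 2 * twist x 3 * twist x 4 *
      (inverse (twist x 0) + inverse (twist x 1) + inverse (twist x 2) + inverse (twist x 3) + inverse (twist x 4))"
    unfolding tw.elementary_symmetric(3)[symmetric] by (rule e4_as_inverses) simp_all
  also have "\<dots> = 1 / t * (5 - q)" unfolding P iv q_def by (simp add: algebra_simps)
  also have "\<dots> = (- t * q + 5 * t) / t\<^sup>2" using t0 by (simp add: field_simps power2_eq_square)
  finally show ?thesis unfolding s t_def[symmetric] .
qed

text \<open>This serves to show that twisted entries are functions in \<open>W2\<close>: that ring
  is generated by entries and constants, and the only denominator left here is
  \<open>t\<^sup>2\<close>, a constant.\<close>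

lemma quotient_formula:
  "x 0 / (x 0 - 1) = - (x 0 * (x 0 * x 1 * x 2 * x 3) * (x 2 * x 3 * x 4 * x 0)) * (inverse (pent_t x) * inverse (pent_t x))"
  unfolding x_minus_1 pent_t_def by (simp add: field_simps)

end

context distinct_pentagon
begin

lemma inj_twist: "inj_on (twist x) {0..<5}"
proof (rule inj_onI)
  fix i j :: int assume ij: "i \<in> {0..<5}" "j \<in> {0..<5}" "twist x i = twist x j"
  then have "inverse (x (2 * i)) = inverse (x (2 * j))" using twist_inverse[of i] twist_inverse[of j] by simp
  then have "x (2 * i) = x (2 * j)" by simp
  then have "2 * i mod 5 = 2 * j mod 5" by (simp add: x_eq_iff)
  then have "5 dvd 2 * (i - j)" unfolding mod_eq_dvd_iff right_diff_distrib .
  then have "5 dvd (2::int) \<or> 5 dvd i - j" unfolding dvd5_mult .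
  then have "5 dvd i - j" by simp
  then show "i = j" using dvd5_bound ij by blast
qed

end

section \<open>Decomposition types from orbits\<close>

text \<open>If all five sums agreed, they would agree with any polynomial \<open>q\<close> of degree
  below 5 in place of the powers. A \<open>q\<close> vanishing at all entries of \<open>x'\<close>
  but one isolates a single term on each side, and as the \<open>z j\<close> are distinct,
  \<open>h\<close> and \<open>k\<close> send the same index to this entry. So transforming
  \<open>x'\<close> alone can separate the ten roots of the resolvent.\<close>

lemma tschirnhausen_separation:
  assumes z: "distinct_pentagon z" and x': "distinct_pentagon x'" and hk: "h \<in> carrier D5" "k \<in> carrier D5" "h \<noteq> k"
  shows "\<exists>i<5::nat. (\<Sum>j\<in>{0..<5}. z j * x' (aff h j) ^ i) \<noteq> (\<Sum>j\<in>{0..<5}. z j * x' (aff k j) ^ i)"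
proof (rule ccontr)
  interpret z: distinct_pentagon z by fact
  interpret x': distinct_pentagon x' by fact
  assume "\<not> ?thesis"
  then have eq: "(\<Sum>j\<in>{0..<5}. z j * x' (aff h j) ^ i) = (\<Sum>j\<in>{0..<5}. z j * x' (aff k j) ^ i)" if "i < 5" for i
    using that by blast
  have eq_poly: "(\<Sum>j\<in>{0..<5}. z j * poly q (x' (aff h j))) = (\<Sum>j\<in>{0..<5}. z j * poly q (x' (aff k j)))"
    if q: "Polynomial.degree q < 5" for q
  proof -
    have "(\<Sum>j\<in>{0..<5}. z j * poly q (x' (aff l j))) =
      (\<Sum>i\<le>Polynomial.degree q. Polynomial.coeff q i * (\<Sum>j\<in>{0..<5}. z j * x' (aff l j) ^ i))" for l
      unfolding poly_altdef sum_distrib_left by (subst sum.swap) (simp add: mult_ac)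
    then show ?thesis using eq q by simp
  qed
  have "aff h j0 mod 5 = aff k j0 mod 5" if j0: "j0 \<in> {0..<5}" for j0
  proof -
    define l where "l = aff h j0 mod 5"
    define q where "q = (\<Prod>i\<in>{0..<5} - {l}. [:- x' i, 1:])"
    have deg: "Polynomial.degree q < 5" unfolding q_def degree_prod_linear by (simp add: l_def)
    have q: "poly q (x' i) = 0 \<longleftrightarrow> i mod 5 \<noteq> l" for i
    proof -
      have "poly q (x' i) = poly q (x' (i mod 5))" by (simp add: x'.x_mod)
      also have "\<dots> = 0 \<longleftrightarrow> (\<exists>j\<in>{0..<5} - {l}. x' (i mod 5) = x' j)"
        by (simp add: q_def poly_prod prod_zero_iff)
      also have "\<dots> \<longleftrightarrow> i mod 5 \<noteq> l"
      proof -
        have "i mod 5 \<in> {0..<5}" by simp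
        moreover have "x' (i mod 5) = x' j \<longleftrightarrow> i mod 5 = j" if "j \<in> {0..<5}" for j
          using that by (simp add: x'.x_eq_iff)
        ultimately show ?thesis by blast
      qed
      finally show ?thesis .
    qed
    have aff_inj: "i = j" if "aff a i mod 5 = aff a j mod 5" "i \<in> {0..<5}" "j \<in> {0..<5}" for a i j
    proof -
      have "5 dvd aff a i - aff a j" using that(1) by (simp add: mod_eq_dvd_iff)
      then have "5 dvd i - j" by (cases "snd a") (auto simp: aff_def dvd_diff_commute)
      then show ?thesis using dvd5_bound that by blast
    qed
    have single: "(\<Sum>j\<in>{0..<5}. z j * poly q (x' (aff a j))) = z i * poly q (x' l)"
      if "i \<in> {0..<5}" "aff a i mod 5 = l" for a i
    proof -
      have "(\<Sum>j\<in>{0..<5} - {i}. z j * poly q (x' (aff a j))) = 0"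
      proof (intro sum.neutral ballI)
        fix j assume j: "j \<in> {0..<5} - {i}"
        then have "aff a j mod 5 \<noteq> l" using aff_inj[of a j i] that by (metis DiffE singletonI)
        then have "poly q (x' (aff a j)) = 0" unfolding q .
        then show "z j * poly q (x' (aff a j)) = 0" by simp
      qed
      moreover have "x' (aff a i) = x' l" using that(2) by (intro x'.x_cong) (simp add: l_def)
      ultimately show ?thesis using that(1) by (simp add: sum.remove[of _ i])
    qed
    \<comment> \<open>The index that \<open>k\<close> maps to \<open>l\<close>.\<close>
    define j1 where "j1 = aff (aff_inv k) l mod 5"
    have "aff k j1 mod 5 = aff k (aff (aff_inv k) l) mod 5"
      unfolding j1_def aff_def[of k] by (simp add: mod_simps)
    then have j1: "j1 \<in> {0..<5}" "aff k j1 mod 5 = l" by (simp_all add: j1_def l_def)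
    have "z j0 * poly q (x' l) = z j1 * poly q (x' l)"
      using eq_poly[OF deg] single[OF j0, of h] single[OF j1] by (simp add: l_def)
    moreover have "poly q (x' l) \<noteq> 0" by (simp add: q l_def)
    ultimately have "z j0 = z j1" by simp
    then have "j0 = j1" using j0 j1(1) by (simp add: z.x_eq_iff)
    then show ?thesis using j1(2) by (simp add: l_def)
  qed
  from this[of 0] this[of 1] show False using aff_eqI[OF hk(1,2)] hk(3) by simp
qed

context pentagon_pair
begin

text \<open>The first pentagon is a parameter \<open>z\<close>, since the second resolvent uses the
  twist of \<open>x\<close>, on which \<open>fst g\<close> acts through
  \<open>kap c\<close>.\<close>

lemma conjugate_family_rsum:
  fixes p p' :: "'m poly"
  assumes z: "pentagon z" and zW: "\<And>i. (\<lambda>g. z (aff (kap c (fst g)) i)) \<in> W2"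
  shows "conjugate_family (D5 \<times>\<times> D5) W2 \<theta>2 (carrier D5) (act c)
    (\<lambda>h g. rsum (poly (map_poly to_ac p)) (poly (map_poly to_ac p')) z x' (kap c (fst g)) (snd g \<otimes>\<^bsub>D5\<^esub> h))"
proof (unfold_locales)
  have car: "fst g \<in> carrier D5" "snd g \<in> carrier D5" if "g \<in> \<Gamma>" for g using Gamma_carrier[OF that] by (cases g, simp)+
  show "finite (carrier D5)" by (rule finite_D5)
  show "act c g h \<in> carrier D5" if "g \<in> \<Gamma>" "h \<in> carrier D5" for g h
    using car that kap_carrier by (simp add: act_def)
  show "act c \<one>\<^bsub>D5 \<times>\<times> D5\<^esub> h = h" if "h \<in> carrier D5" for h
    using that by (simp add: act_def kap_one)
  show "act c (g \<otimes>\<^bsub>D5 \<times>\<times> D5\<^esub> k) h = act c g (act c k h)" if "g \<in> \<Gamma>" "k \<in> \<Gamma>" "h \<in> carrier D5" for g k h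
    using car that kap_carrier
    by (simp add: act_def mult_DirProd' kap_mult D5.inv_mult_group D5.m_assoc)
  show "(\<lambda>g. rsum (poly (map_poly to_ac p)) (poly (map_poly to_ac p')) z x' (kap c (fst g)) (snd g \<otimes>\<^bsub>D5\<^esub> h)) \<in> W2"
    if h: "h \<in> carrier D5" for h
    unfolding rsum_def x'.x_aff_mult[OF h] by (intro sum_mem mult_mem poly_mem zW gen2)
  show "rsum (poly (map_poly to_ac p)) (poly (map_poly to_ac p')) z x' (kap c (fst g)) (snd g \<otimes>\<^bsub>D5\<^esub> h) =
    rsum (poly (map_poly to_ac p)) (poly (map_poly to_ac p')) z x' (kap c (fst \<one>\<^bsub>D5 \<times>\<times> D5\<^esub>)) (snd \<one>\<^bsub>D5 \<times>\<times> D5\<^esub> \<otimes>\<^bsub>D5\<^esub> act c g h)"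
    if "g \<in> \<Gamma>" "h \<in> carrier D5" for g h
  proof -
    have "act c g h \<in> carrier D5" using car that kap_carrier by (simp add: act_def)
    then show ?thesis
      using rsum_act[OF z x'.pentagon_axioms kap_carrier, of _ _ c "fst g" "snd g \<otimes>\<^bsub>D5\<^esub> h"]
      by (simp add: kap_one one_D5 act_def flip: one_D5)
  qed
qed

text \<open>For all transformations the resolvent is squarefree iff its ten roots are distinct, and
  then its irreducible degrees are the orbit lengths; so the description operator has only one
  candidate. A squarefree resolvent is found with \<open>X\<close> for the first transformation and
  a polynomial with coefficients \<open>1, e, e\<^sup>2, ...\<close> for the second.\<close>

lemma decomp_type_orbits:
  fixes R :: "'m poly \<Rightarrow> 'm poly \<Rightarrow> 'm poly"
  assumes z: "root_pentagon z b1 b2" and zW: "\<And>i. (\<lambda>g. z (aff (kap c (fst g)) i)) \<in> W2"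
    and R: "\<And>p p'. map_poly to_ac (R p p') =
      (\<Prod>h\<in>carrier D5. [:- rsum (poly (map_poly to_ac p)) (poly (map_poly to_ac p')) z x' (0, False) h, 1:])"
    and F: "F = R [:0, 1:] [:0, 1:]"
  shows "decomp_type F (fD5 b1 b2) (fD5 a1' a2') R = DT_of (orbs c \<Gamma>)"
proof -
  interpret z: root_pentagon z b1 b2 by fact
  have V1: "rsum G G' z x' (kap c (fst \<one>\<^bsub>D5 \<times>\<times> D5\<^esub>)) (snd \<one>\<^bsub>D5 \<times>\<times> D5\<^esub> \<otimes>\<^bsub>D5\<^esub> h) = rsum G G' z x' (0, False) h"
    if "h \<in> carrier D5" for G G' :: "'m alg_closure \<Rightarrow> 'm alg_closure" and h
    using that by (simp add: kap_one) (simp add: one_D5)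
  have main: "squarefree (R p p') \<longleftrightarrow> inj_on (rsum (poly (map_poly to_ac p)) (poly (map_poly to_ac p')) z x' (0, False)) (carrier D5)"
    "squarefree (R p p') \<Longrightarrow> irr_degrees (R p p') = DT_of (orbs c \<Gamma>)" for p p'
  proof -
    define V where "V = (\<lambda>h g. rsum (poly (map_poly to_ac p)) (poly (map_poly to_ac p')) z x' (kap c (fst g)) (snd g \<otimes>\<^bsub>D5\<^esub> h))"
    interpret C: conjugate_family "D5 \<times>\<times> D5" W2 \<theta>2 "carrier D5" "act c" V
      unfolding V_def by (rule conjugate_family_rsum[OF z.pentagon_axioms zW])
    have V: "V h \<one>\<^bsub>D5 \<times>\<times> D5\<^esub> = rsum (poly (map_poly to_ac p)) (poly (map_poly to_ac p')) z x' (0, False) h"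
      if "h \<in> carrier D5" for h unfolding V_def by (rule V1[OF that])
    have RV: "map_poly to_ac (R p p') = (\<Prod>h\<in>carrier D5. [:- V h \<one>\<^bsub>D5 \<times>\<times> D5\<^esub>, 1:])"
      unfolding R by (rule prod.cong[OF refl]) (simp only: V)
    have injV: "inj_on (\<lambda>h. V h \<one>\<^bsub>D5 \<times>\<times> D5\<^esub>) (carrier D5) \<longleftrightarrow>
        inj_on (rsum (poly (map_poly to_ac p)) (poly (map_poly to_ac p')) z x' (0, False)) (carrier D5)"
      by (rule inj_on_cong) (rule V)
    show "squarefree (R p p') \<longleftrightarrow> inj_on (rsum (poly (map_poly to_ac p)) (poly (map_poly to_ac p')) z x' (0, False)) (carrier D5)"
      using C.inj_if_squarefree[OF RV] C.squarefree_if_inj[OF RV] injV by blast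
    show "irr_degrees (R p p') = DT_of (orbs c \<Gamma>)" if "squarefree (R p p')"
      using C.irr_degrees_orbits[OF RV C.inj_if_squarefree[OF RV that]]
      by (simp add: DT_of_def orbs_def C.orb_def)
  qed
  show ?thesis
  proof (cases "squarefree F")
    case True
    then show ?thesis using main(2)[of "[:0, 1:]" "[:0, 1:]"] by (simp add: decomp_type_def F)
  next
    case False
    define f where "f = (\<lambda>(i::nat) h. \<Sum>j\<in>{0..<5}. z j * x' (aff h j) ^ i)"
    \<comment> \<open>The conditions on \<open>e\<close>: the first set makes the ten roots of the
      resolvent distinct, the second makes \<open>g'\<close> injective on the entries of
      \<open>x'\<close>.\<close>
    define S where "S = (\<lambda>(g, h). pencil 5 f g h) ` {(g, h). g \<in> carrier D5 \<and> h \<in> carrier D5 \<and> g \<noteq> h} \<union>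
      (\<lambda>(i, j). pencil 5 (\<lambda>n k. x' k ^ n) i j) ` {(i, j). i \<in> {0..<5} \<and> j \<in> {0..<5} \<and> i \<noteq> j}"
    have "finite {(g, h). g \<in> carrier D5 \<and> h \<in> carrier D5 \<and> g \<noteq> h}"
      by (rule finite_subset[of _ "carrier D5 \<times> carrier D5"]) (auto simp: finite_D5)
    moreover have "finite {(i, j). i \<in> {0..<5::int} \<and> j \<in> {0..<5} \<and> i \<noteq> j}"
      by (rule finite_subset[of _ "{0..<5} \<times> {0..<5}"]) auto
    ultimately have fin: "finite S" by (simp add: S_def)
    have "0 \<notin> S"
    proof
      assume "0 \<in> S"
      then show False unfolding S_def
      proof (elim UnE imageE CollectE)
        fix y assume "0 = (case y of (g, h) \<Rightarrow> pencil 5 f g h)" "case y of (g, h) \<Rightarrow> g \<in> carrier D5 \<and> h \<in> carrier D5 \<and> g \<noteq> h"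
        then obtain g h where 1: "g \<in> carrier D5" "h \<in> carrier D5" "g \<noteq> h" "pencil 5 f g h = 0"
          by (cases y) (simp only: prod.case, metis)
        obtain i where "i < 5" "f i g \<noteq> f i h"
          using tschirnhausen_separation[OF z.distinct_pentagon_axioms x'.distinct_pentagon_axioms 1(1-3)]
          unfolding f_def by blast
        with pencil_nz[of i 5 f g h] 1 show False by simp
      next
        fix y :: "int \<times> int" assume "0 = (case y of (i, j) \<Rightarrow> pencil 5 (\<lambda>n k. x' k ^ n) i j)"
          "case y of (i, j) \<Rightarrow> i \<in> {0..<5} \<and> j \<in> {0..<5} \<and> i \<noteq> j"
        then obtain i j where 2: "i \<in> {0..<5::int}" "j \<in> {0..<5}" "i \<noteq> j" "pencil 5 (\<lambda>n k. x' k ^ n) i j = 0"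
          by (cases y) (simp only: prod.case, metis)
        then have "x' i \<noteq> x' j" by (simp add: x'.x_eq_iff)
        with pencil_nz[of 1 5 "\<lambda>n k. x' k ^ n" i j] 2 show False by simp
      qed
    qed
    from avoid_roots[OF infinite_M fin this] obtain e :: 'm where e: "\<And>p. p \<in> S \<Longrightarrow> poly p (to_ac e) \<noteq> 0"
      by blast
    define g' where "g' = (\<Sum>i<5. Polynomial.monom (e ^ i) i)"
    have g': "poly (map_poly to_ac g') y = (\<Sum>i<5. to_ac e ^ i * y ^ i)" for y
    proof -
      have "map_poly to_ac g' = (\<Sum>i<5. Polynomial.monom (to_ac e ^ i) i)"
        by (rule poly_eqI) (simp add: g'_def coeff_sum to_ac.hom_sum if_distrib cong: if_cong)
      then show ?thesis by (simp add: poly_sum poly_monom)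
    qed
    have deg: "Polynomial.degree g' < 5"
    proof -
      have "Polynomial.degree g' \<le> 4" unfolding g'_def
        by (rule degree_sum_le) (auto intro: order.trans[OF degree_monom_le])
      then show ?thesis by simp
    qed
    have degp: "Polynomial.degree (fD5 b1 b2) = 5" "Polynomial.degree (fD5 a1' a2') = 5" by (simp_all add: fD5_def)
    have t1: "tschirnhausen (fD5 b1 b2) [:0, 1:]"
      unfolding tschirnhausen_def degp by (auto simp: inj_on_def)
    have t2: "tschirnhausen (fD5 a1' a2') g'"
      unfolding tschirnhausen_def degp x'.fD5_roots
    proof (intro conjI deg inj_onI)
      fix y y' assume "y \<in> range x'" "y' \<in> range x'" and eq: "poly (map_poly to_ac g') y = poly (map_poly to_ac g') y'"
      then obtain i j where ij: "y = x' (i mod 5)" "y' = x' (j mod 5)" by (auto simp: x'.x_mod)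
      show "y = y'"
      proof (rule ccontr)
        assume "y \<noteq> y'"
        then have "i mod 5 \<noteq> j mod 5" using ij by auto
        then have "(i mod 5, j mod 5) \<in> {(i, j). i \<in> {0..<5} \<and> j \<in> {0..<5} \<and> i \<noteq> j}" by simp
        then have "pencil 5 (\<lambda>n k. x' k ^ n) (i mod 5) (j mod 5) \<in> S" unfolding S_def by (intro UnI2 image_eqI[of _ _ "(i mod 5, j mod 5)"]) auto
        from e[OF this] eq show False by (simp add: poly_pencil g' ij)
      qed
    qed
    have rs: "rsum (poly (map_poly to_ac [:0, 1:])) (poly (map_poly to_ac g')) z x' (0, False) h = (\<Sum>i<5. to_ac e ^ i * f i h)" for h
    proof -
      have "rsum (poly (map_poly to_ac [:0, 1:])) (poly (map_poly to_ac g')) z x' (0, False) h =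
          (\<Sum>j\<in>{0..<5}. \<Sum>i<5. to_ac e ^ i * (z j * x' (aff h j) ^ i))"
        unfolding rsum_def g' by (simp add: sum_distrib_left mult_ac)
      also have "\<dots> = (\<Sum>i<5. to_ac e ^ i * f i h)" unfolding f_def sum_distrib_left by (rule sum.swap)
      finally show ?thesis .
    qed
    have "inj_on (rsum (poly (map_poly to_ac [:0, 1:])) (poly (map_poly to_ac g')) z x' (0, False)) (carrier D5)"
    proof (rule inj_onI, rule ccontr)
      fix g h assume gh: "g \<in> carrier D5" "h \<in> carrier D5" "g \<noteq> h"
        and eq: "rsum (poly (map_poly to_ac [:0, 1:])) (poly (map_poly to_ac g')) z x' (0, False) g =
          rsum (poly (map_poly to_ac [:0, 1:])) (poly (map_poly to_ac g')) z x' (0, False) h"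
      have "pencil 5 f g h \<in> S" unfolding S_def using gh by (intro UnI1 image_eqI[of _ _ "(g, h)"]) auto
      from e[OF this] eq show False by (simp only: rs poly_pencil) simp
    qed
    then have sq: "squarefree (R [:0, 1:] g')" unfolding main(1) .
    have "(THE m. \<exists>g g'. tschirnhausen (fD5 b1 b2) g \<and> tschirnhausen (fD5 a1' a2') g' \<and>
        squarefree (R g g') \<and> m = irr_degrees (R g g')) = DT_of (orbs c \<Gamma>)"
    proof (rule the_equality)
      show "\<exists>g g'. tschirnhausen (fD5 b1 b2) g \<and> tschirnhausen (fD5 a1' a2') g' \<and>
        squarefree (R g g') \<and> DT_of (orbs c \<Gamma>) = irr_degrees (R g g')"
        using t1 t2 sq main(2)[OF sq] by metis
    qed (auto simp: main(2))
    then show ?thesis using False by (simp add: decomp_type_def)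
  qed
qed

lemma a2_nz: "a2 \<noteq> 0" "a2' \<noteq> 0"
  using x.t_nz x'.t_nz x.t_eq x'.t_eq by auto

lemma DT_F1_orbits:
  assumes "field_morphism \<iota>"
  shows "DT_F1 \<iota> a1 a2 a1' a2' = DT_of (orbs 1 \<Gamma>)"
  unfolding DT_F1_def
proof (rule decomp_type_orbits[OF x.root_pentagon_axioms])
  interpret \<iota>: field_morphism \<iota> by fact
  have id: "field_morphism (id :: 'm \<Rightarrow> 'm)" by unfold_locales auto
  show R: "map_poly to_ac (specialize id a1 a2 a1' a2' (F1_tr p p')) =
    (\<Prod>h\<in>carrier D5. [:- rsum (poly (map_poly to_ac p)) (poly (map_poly to_ac p')) x x' (0, False) h, 1:])" for p p'
    using specialize_F1_tr[OF id x.pentagon_axioms x.s_eq x.t_eq x'.pentagon_axioms x'.s_eq x'.t_eq, of p p'] by simp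
  \<comment> \<open>The resolvent itself is defined over \<open>k\<close>, the transformed ones over
    \<open>M\<close>. For the polynomial \<open>X\<close>, with coefficients 0 and 1, both
    specialize to the same product.\<close>
  have "map_poly to_ac (specialize \<iota> a1 a2 a1' a2' F1) = map_poly to_ac (specialize id a1 a2 a1' a2' (F1_tr [:0, 1:] [:0, 1:]))"
    unfolding R F1_def
    unfolding specialize_F1_tr[OF assms x.pentagon_axioms x.s_eq x.t_eq x'.pentagon_axioms x'.s_eq x'.t_eq]
    by (simp add: map_poly_pCons)
  then show "specialize \<iota> a1 a2 a1' a2' F1 = specialize id a1 a2 a1' a2' (F1_tr [:0, 1:] [:0, 1:])" by simp
  fix i
  have "x (aff (kap 1 a) i) = x (aff a i)" for a using x.x_aff_mod[of a i] by (simp add: kap_def)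
  then show "(\<lambda>g. x (aff (kap 1 (fst g)) i)) \<in> W2" using gen2(2)[of i] by simp
qed

lemma DT_F2_orbits:
  assumes "field_morphism \<iota>"
  shows "DT_F2 \<iota> a1 a2 a1' a2' = DT_of (orbs 3 \<Gamma>)"
  unfolding DT_F2_def
proof (rule decomp_type_orbits[where z = "twist x"])
  interpret \<iota>: field_morphism \<iota> by fact
  have id: "field_morphism (id :: 'm \<Rightarrow> 'm)" by unfold_locales auto
  let ?b1 = "(a1 + 5 * a2) / a2\<^sup>2" and ?b2 = "- 1 / a2"
  have st: "pent_s (twist x) = to_ac ?b1" "pent_t (twist x) = to_ac ?b2"
    by (simp_all add: x.pent_s_twist x.pent_t_twist x.s_eq x.t_eq)
  interpret tw: pentagon "twist x" by (rule x.pentagon_twist)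
  show "root_pentagon (twist x) ?b1 ?b2" by unfold_locales (rule x.inj_twist st)+
  show R: "map_poly to_ac (specialize id a1 a2 a1' a2' (F2_tr p p')) =
    (\<Prod>h\<in>carrier D5. [:- rsum (poly (map_poly to_ac p)) (poly (map_poly to_ac p')) (twist x) x' (0, False) h, 1:])" for p p'
    unfolding specialize_F2_tr[OF id a2_nz]
    using specialize_F1_tr[OF id tw.pentagon_axioms st x'.pentagon_axioms x'.s_eq x'.t_eq, of p p'] by simp
  have "map_poly to_ac (specialize \<iota> a1 a2 a1' a2' F2) = map_poly to_ac (specialize id a1 a2 a1' a2' (F2_tr [:0, 1:] [:0, 1:]))"
    unfolding R F2_def specialize_F2_tr[OF assms a2_nz]
    unfolding specialize_F1_tr[OF assms tw.pentagon_axioms st x'.pentagon_axioms x'.s_eq x'.t_eq]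
    by (simp add: map_poly_pCons)
  then show "specialize \<iota> a1 a2 a1' a2' F2 = specialize id a1 a2 a1' a2' (F2_tr [:0, 1:] [:0, 1:])" by simp
  fix i
  \<comment> \<open>Since \<open>2 * 3\<close> is 1 modulo 5, moving the index of the twist by
    \<open>kap 3 a\<close> moves the index of \<open>x\<close> by \<open>a\<close>;
    \<open>quotient_formula\<close> then writes the entry through entries of \<open>x\<close> and a
    constant.\<close>
  have val: "twist x (aff (kap 3 a) i) = - (x (aff a (2 * i)) * (x (aff a (2 * i)) * x (aff a (2 * i + 1)) * x (aff a (2 * i + 2)) * x (aff a (2 * i + 3))) *
    (x (aff a (2 * i + 2)) * x (aff a (2 * i + 3)) * x (aff a (2 * i + 4)) * x (aff a (2 * i)))) * to_ac (inverse a2 * inverse a2)" for a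
  proof -
    interpret p: pentagon "\<lambda>j. x (aff a j)" by (rule x.pentagon_aff)
    interpret q: pentagon "\<lambda>j. x (aff a (2 * i + j))" using p.pentagon_aff[of "(2 * i, False)"] by simp
    have "pent_t (\<lambda>j. x (aff a (2 * i + j))) = to_ac a2"
      using p.pent_invariant(1)[of "(2 * i, False)"] by (simp add: x.pent_invariant x.t_eq)
    moreover have "x (2 * aff (kap 3 a) i) = x (aff a (2 * i))"
    proof (rule x.x_cong)
      have "2 * (3 * fst a mod 5) mod 5 = fst a mod 5"
        by (subst mod_mult_right_eq) (simp add: mod_eq_dvd_iff)
      then show "2 * aff (kap 3 a) i mod 5 = aff a (2 * i) mod 5"
        unfolding aff_def kap_def fst_conv snd_conv right_diff_distrib distrib_left
        by (auto intro: mod_diff_cong mod_add_cong)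
    qed
    ultimately show ?thesis using q.quotient_formula by (simp add: twist_def)
  qed
  show "(\<lambda>g. twist x (aff (kap 3 (fst g)) i)) \<in> W2"
    unfolding val by (intro mult_mem minus_mem gen2)
qed

end

text \<open>For \<open>t = 0\<close> the element 0 of \<open>M\<close> is a root, and every
  automorphism fixes it.\<close>

lemma fD5_nonzero:
  assumes "\<phi> \<in> carrier (Gal (fD5 s t))" "\<And>z. z \<in> ac_roots (fD5 s t) \<Longrightarrow> \<phi> z \<noteq> z"
  shows "t \<noteq> 0"
proof
  assume "t = 0"
  then have "to_ac 0 \<in> ac_roots (fD5 s t)" by (simp add: ac_roots_def fD5_def map_poly_pCons)
  with assms Gal_fixes show False by blast
qed

text \<open>The numbering \<open>r\<close> provides five distinct roots; the five entries of a
  pentagon exhaust the roots, so they are distinct too.\<close>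

lemma root_pentagon_exists:
  fixes s t :: "'m::field"
  assumes t: "t \<noteq> 0" and r: "bij_betw r {..<5::nat} (ac_roots (fD5 s t))"
  shows "\<exists>x. root_pentagon x s t"
proof -
  obtain x :: "int \<Rightarrow> 'm alg_closure" where x: "pentagon x" "pent_s x = to_ac s" "pent_t x = to_ac t"
    using pentagon_exists[of "to_ac t" "to_ac s"] t by auto
  interpret pentagon x by fact
  have "map_poly to_ac (fD5 s t) = fD5 (pent_s x) (pent_t x)"
    by (simp add: x fD5_def)
  then have "ac_roots (fD5 s t) = x ` {0..<5}"
    unfolding ac_roots_def fD5_eq_prod by (auto simp: poly_prod prod_zero_iff)
  then have "card (x ` {0..<5}) = card {0..<5::int}" using bij_betw_same_card[OF r] by simp
  then have "inj_on x {0..<5}" by (simp add: eq_card_imp_inj_on)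
  then have "root_pentagon x s t" using x by unfold_locales
  then show ?thesis by blast
qed

lemma subgroup_rotations: "subgroup ({0..<5} \<times> {False}) D5"
proof (rule D5.subgroupI)
  show "{0..<5} \<times> {False} \<subseteq> carrier D5" by (auto simp: carrier_D5)
  show "{0..<5::int} \<times> {False} \<noteq> {}" by auto
  show "inv\<^bsub>D5\<^esub> a \<in> {0..<5} \<times> {False}" if "a \<in> {0..<5} \<times> {False}" for a
    using that by (cases a) (simp add: inv_D5)
  show "a \<otimes>\<^bsub>D5\<^esub> b \<in> {0..<5} \<times> {False}" if "a \<in> {0..<5} \<times> {False}" "b \<in> {0..<5} \<times> {False}" for a b
    using that by (cases a, cases b) (simp add: mult_D5)
qed

lemma reflection_coset:
  assumes v: "\<And>g r. g \<in> carrier D5 \<Longrightarrow> r \<in> {0..<5} \<times> {False} \<Longrightarrow> v (g \<otimes>\<^bsub>D5\<^esub> r) = v g" and u: "u \<in> {0..<5}"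
  shows "v (u, d) = v (0, d)"
proof -
  define w where "w = (if d then (- u) mod 5 else u)"
  have w: "w \<in> {0..<5}" using u by (simp add: w_def)
  have "(0, d) \<otimes>\<^bsub>D5\<^esub> (w, False) = (u, d)"
    unfolding mult_D5[OF w] using u by (simp add: w_def mod_simps)
  then show ?thesis using v[of "(0, d)" "(w, False)"] w by (simp add: carrier_D5)
qed

section \<open>Intersection and equality of the splitting fields\<close>

context pentagon_pair
begin

lemma Spl1: "Spl (fD5 a1 a2) = (\<lambda>u. u (0, False)) ` x.W1" "Spl (fD5 a1' a2') = (\<lambda>u. u (0, False)) ` x'.W1"
  by (rule x.Spl1[OF gx.galois_algebra_axioms] x'.Spl1[OF gx'.galois_algebra_axioms])+

lemma one_pair: "\<one>\<^bsub>D5 \<times>\<times> D5\<^esub> = ((0, False), (0, False))"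
  by (simp add: one_D5)

text \<open>An element of both fields is given by a function of the first index map and by one of
  the second. At \<open>(a, \<one>)\<close> the second takes its value at the identity, so the first
  is constant on its Galois group.\<close>

lemma inter_trivial:
  assumes "\<And>a. a \<in> gx.\<Gamma> \<Longrightarrow> (a, (0, False)) \<in> \<Gamma>"
  shows "Spl (fD5 a1 a2) \<inter> Spl (fD5 a1' a2') = range to_ac"
proof (intro equalityI subsetI)
  fix z assume "z \<in> Spl (fD5 a1 a2) \<inter> Spl (fD5 a1' a2')"
  then obtain u v where u: "u \<in> x.W1" "z = u (0, False)" and v: "v \<in> x'.W1" "z = v (0, False)"
    unfolding Spl1 by blast
  have "u a = u \<one>\<^bsub>D5\<^esub>" if "a \<in> gx.\<Gamma>" for a
    using Gamma_eq[OF assms[OF that] W1_W2(1)[OF u(1)] W1_W2(2)[OF v(1)]] u(2) v(2) by (simp add: one_D5)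
  then show "z \<in> range to_ac"
    using gx.rational_on_Gamma u unfolding gx.rational_on_def one_D5 by blast
next
  fix z :: "'m alg_closure" assume "z \<in> range to_ac"
  then show "z \<in> Spl (fD5 a1 a2) \<inter> Spl (fD5 a1' a2')" using Spl_closed(1) by blast
qed

text \<open>If a projection is injective on \<open>\<Gamma>\<close>, then a primitive element of the
  corresponding field already separates \<open>\<Gamma>\<close>, and all functions in
  \<open>W2\<close> are interpolated by polynomials in it.\<close>

lemma Spl_subset:
  shows "inj_on fst \<Gamma> \<Longrightarrow> Spl (fD5 a1' a2') \<subseteq> Spl (fD5 a1 a2)"
    and "inj_on snd \<Gamma> \<Longrightarrow> Spl (fD5 a1 a2) \<subseteq> Spl (fD5 a1' a2')"
proof -
  assume inj: "inj_on fst \<Gamma>"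
  have "inj_on \<theta>1 (fst ` \<Gamma>)"
    unfolding Gamma_fst by (rule inj_on_subset[OF gx.theta_inj]) (auto intro: gx.Gamma_carrier)
  then have inj: "inj_on (\<lambda>g. \<theta>1 (fst g)) \<Gamma>" using comp_inj_on[OF inj] by (simp add: comp_def)
  show "Spl (fD5 a1' a2') \<subseteq> Spl (fD5 a1 a2)"
  proof
    fix z assume "z \<in> Spl (fD5 a1' a2')"
    then obtain v where v: "v \<in> x'.W1" "z = v (0, False)" unfolding Spl1 by blast
    obtain q where "\<forall>h\<in>\<Gamma>. poly (map_poly to_ac q) (\<theta>1 (fst h)) = v (snd h)"
      using interpolation[OF subgroup_Gamma rational_on_Gamma W1_W2(1)[OF gx.theta_mem] inj W1_W2(2)[OF v(1)]] by blast
    from bspec[OF this one_Gamma] have "z = poly (map_poly to_ac q) (\<theta>1 (0, False))" by (simp add: v one_D5)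
    then show "z \<in> Spl (fD5 a1 a2)" unfolding Spl1
      by (rule image_eqI[where x = "\<lambda>g. poly (map_poly to_ac q) (\<theta>1 g)"]) (rule gx.poly_mem[OF gx.theta_mem])
  qed
next
  assume inj: "inj_on snd \<Gamma>"
  have "inj_on \<theta>1' (snd ` \<Gamma>)"
    unfolding Gamma_snd by (rule inj_on_subset[OF gx'.theta_inj]) (auto intro: gx'.Gamma_carrier)
  then have inj: "inj_on (\<lambda>g. \<theta>1' (snd g)) \<Gamma>" using comp_inj_on[OF inj] by (simp add: comp_def)
  show "Spl (fD5 a1 a2) \<subseteq> Spl (fD5 a1' a2')"
  proof
    fix z assume "z \<in> Spl (fD5 a1 a2)"
    then obtain v where v: "v \<in> x.W1" "z = v (0, False)" unfolding Spl1 by blast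
    obtain q where "\<forall>h\<in>\<Gamma>. poly (map_poly to_ac q) (\<theta>1' (snd h)) = v (fst h)"
      using interpolation[OF subgroup_Gamma rational_on_Gamma W1_W2(2)[OF gx'.theta_mem] inj W1_W2(1)[OF v(1)]] by blast
    from bspec[OF this one_Gamma] have "z = poly (map_poly to_ac q) (\<theta>1' (0, False))" by (simp add: v one_D5)
    then show "z \<in> Spl (fD5 a1' a2')" unfolding Spl1
      by (rule image_eqI[where x = "\<lambda>g. poly (map_poly to_ac q) (\<theta>1' g)"]) (rule gx'.poly_mem[OF gx'.theta_mem])
  qed
qed

text \<open>This automorphism fixes the first field and moves \<open>x' 0\<close>.\<close>

lemma Spl_neq:
  assumes mem: "((0, False), (1, False)) \<in> \<Gamma>"
  shows "Spl (fD5 a1 a2) \<noteq> Spl (fD5 a1' a2')"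
proof
  assume eq: "Spl (fD5 a1 a2) = Spl (fD5 a1' a2')"
  have "x' 0 \<in> ac_roots (fD5 a1' a2')" unfolding x'.fD5_roots by simp
  then have "x' 0 \<in> Spl (fD5 a1 a2)" unfolding eq by (rule Spl_closed)
  then obtain u where u: "u \<in> x.W1" "x' 0 = u (0, False)" unfolding Spl1 by blast
  have "u (0, False) = x' (aff (1, False) 0)"
    using Gamma_eq[OF mem W1_W2(1)[OF u(1)] gen2(3)[of 0]] u(2) by (simp add: one_D5)
  then have "x' 0 = x' 1" using u(2) by (simp add: aff_def)
  then show False by (simp add: x'.x_eq_iff)
qed

text \<open>On this group both components have the same reflection flag. Functions \<open>v\<close>
  and \<open>v'\<close> that see only this flag exist for each field and are linear in each other
  over \<open>M\<close>, so \<open>\<delta>\<close> lies in the intersection. An element of the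
  intersection is a function of either component alone, hence of the common flag only, and
  \<open>1, \<delta>\<close> is a basis.\<close>

lemma ext_degree_2:
  assumes G: "\<Gamma> = C5_pairs (\<lambda>d e. d = e)"
  shows "ext_degree (Spl (fD5 a1 a2) \<inter> Spl (fD5 a1' a2')) = 2"
proof -
  let ?L = "Spl (fD5 a1 a2) \<inter> Spl (fD5 a1' a2')" and ?N = "{0..<5::int} \<times> {False}"
  have t: "(0, True) \<in> carrier D5" "(0, True) \<notin> ?N" by (simp_all add: carrier_D5)
  obtain v where v: "v \<in> x.W1" "\<And>g r. g \<in> carrier D5 \<Longrightarrow> r \<in> ?N \<Longrightarrow> v (g \<otimes>\<^bsub>D5\<^esub> r) = v g" "v (0, True) \<noteq> v \<one>\<^bsub>D5\<^esub>"
    using gx.coset_separating[OF subgroup_rotations t] by blast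
  obtain v' where v': "v' \<in> x'.W1" "\<And>g r. g \<in> carrier D5 \<Longrightarrow> r \<in> ?N \<Longrightarrow> v' (g \<otimes>\<^bsub>D5\<^esub> r) = v' g" "v' (0, True) \<noteq> v' \<one>\<^bsub>D5\<^esub>"
    using gx'.coset_separating[OF subgroup_rotations t] by blast
  define \<delta> where "\<delta> = v (0, False)"
  have vval: "v (fst g) = (if snd (fst g) then v (0, True) else \<delta>)" if g\<Gamma>: "g \<in> \<Gamma>" for g
  proof -
    obtain a d b where g: "g = ((a, d), (b, d))" "a \<in> {0..<5}" "b \<in> {0..<5}"
      using g\<Gamma> unfolding G by (elim C5_pairs_cases) blast
    show ?thesis using reflection_coset[of v a d, OF v(2) g(2)] by (cases d) (simp_all add: g(1) \<delta>_def)
  qed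
  have v'val: "v' (snd g) = (if snd (fst g) then v' (0, True) else v' (0, False))" if g\<Gamma>: "g \<in> \<Gamma>" for g
  proof -
    obtain a d b where g: "g = ((a, d), (b, d))" "a \<in> {0..<5}" "b \<in> {0..<5}"
      using g\<Gamma> unfolding G by (elim C5_pairs_cases) blast
    show ?thesis using reflection_coset[of v' b d, OF v'(2) g(3)] by (cases d) (simp_all add: g(1))
  qed
  let ?t = "((0, True), (0, True)) :: (int \<times> bool) \<times> (int \<times> bool)"
  have t\<Gamma>: "?t \<in> \<Gamma>" unfolding G mem_C5_pairs by simp
  have \<epsilon>: "snd (fst ?t)" "\<not> snd (fst \<one>\<^bsub>D5 \<times>\<times> D5\<^esub>)" by (simp_all add: one_D5)
  have \<epsilon>_mult: "snd (fst (g \<otimes>\<^bsub>D5 \<times>\<times> D5\<^esub> ?t)) \<longleftrightarrow> \<not> snd (fst g)" if "g \<in> \<Gamma>" for g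
    using that unfolding G by (elim C5_pairs_cases) (simp add: mult_D5)
  have \<delta>_nonrational: "\<delta> \<notin> range to_ac"
  proof
    assume "\<delta> \<in> range to_ac"
    then obtain c where "\<delta> = to_ac c" by blast
    then have "v (0, True) = to_ac c" using Gamma_eq[OF t\<Gamma> W1_W2(1)[OF v(1)] const_mem[of c]] by (simp add: \<delta>_def one_D5)
    then show False using v(3) \<open>\<delta> = to_ac c\<close> by (simp add: \<delta>_def one_D5)
  qed
  have "\<exists>c0 c1. v (fst \<one>\<^bsub>D5 \<times>\<times> D5\<^esub>) = to_ac c0 + to_ac c1 * v' (0, False)"
  proof (rule quadratic_values[where v = "\<lambda>g. v' (snd g)" and u = "\<lambda>g. v (fst g)" and \<epsilon> = "\<lambda>g. snd (fst g)" and t = ?t])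
    show "v (fst g) = (if snd (fst g) then v (fst ?t) else v (fst \<one>\<^bsub>D5 \<times>\<times> D5\<^esub>))" if "g \<in> \<Gamma>" for g
      using vval[OF that] by (simp add: \<delta>_def one_D5)
    show "v' (0, False) \<noteq> v' (0, True)" using v'(3) by (simp add: one_D5)
  qed (use v'val t\<Gamma> \<epsilon> \<epsilon>_mult W1_W2 v(1) v'(1) in blast)+
  then obtain c0 c1 where "\<delta> = to_ac c0 + to_ac c1 * v' (0, False)" by (auto simp: \<delta>_def one_D5)
  moreover have "v' (0, False) \<in> Spl (fD5 a1' a2')" "\<delta> \<in> Spl (fD5 a1 a2)" unfolding Spl1 \<delta>_def using v(1) v'(1) by blast+
  ultimately have \<delta>_mem: "\<delta> \<in> ?L" by (simp add: Spl_closed)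
  have repr: "\<exists>c0 c1. z = to_ac c0 + to_ac c1 * \<delta>" if z: "z \<in> ?L" for z
  proof -
    obtain u w where u: "u \<in> x.W1" "z = u (0, False)" and w: "w \<in> x'.W1" "z = w (0, False)"
      using z unfolding Spl1 by blast
    have uw: "u (fst g) = w (snd g)" if "g \<in> \<Gamma>" for g
      using Gamma_eq[OF that W1_W2(1)[OF u(1)] W1_W2(2)[OF w(1)]] u(2) w(2) by (simp add: one_D5)
    \<comment> \<open>Both \<open>(a, d)\<close> and \<open>(0, d)\<close> are paired with
      \<open>(0, d)\<close> in \<open>\<Gamma>\<close>, and \<open>w\<close> sees only the second
      component.\<close>
    have u0: "u (a, d) = u (0, d)" if "a \<in> {0..<5}" for a d
    proof -
      have "((a, d), (0, d)) \<in> \<Gamma>" "((0, d), (0, d)) \<in> \<Gamma>" using that unfolding G mem_C5_pairs by simp_all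
      then show ?thesis using uw[of "((a, d), (0, d))"] uw[of "((0, d), (0, d))"] by simp
    qed
    have "\<exists>c0 c1. u (fst \<one>\<^bsub>D5 \<times>\<times> D5\<^esub>) = to_ac c0 + to_ac c1 * \<delta>"
    proof (rule quadratic_values[where v = "\<lambda>g. v (fst g)" and u = "\<lambda>g. u (fst g)" and \<epsilon> = "\<lambda>g. snd (fst g)" and t = ?t])
      show "u (fst g) = (if snd (fst g) then u (fst ?t) else u (fst \<one>\<^bsub>D5 \<times>\<times> D5\<^esub>))" if g\<Gamma>: "g \<in> \<Gamma>" for g
      proof -
        obtain a d b where g: "g = ((a, d), (b, d))" "a \<in> {0..<5}"
          using g\<Gamma> unfolding G by (elim C5_pairs_cases) blast
        show ?thesis using u0[OF g(2), of d] by (cases d) (simp_all add: g(1) one_D5)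
      qed
      show "\<delta> \<noteq> v (0, True)" using v(3) by (simp add: one_D5 \<delta>_def)
    qed (use vval t\<Gamma> \<epsilon> \<epsilon>_mult W1_W2 v(1) u(1) in blast)+
    then show ?thesis using u(2) by (simp add: one_D5)
  qed
  interpret vs: vector_space "\<lambda>(c::'m) v. to_ac c * v"
    by unfold_locales (simp_all add: algebra_simps)
  have "1 \<notin> vs.span {}" by (simp add: vs.span_empty)
  then have "vs.independent {1}" by (simp add: vs.independent_insert)
  moreover have "\<delta> \<notin> vs.span {1}" using \<delta>_nonrational by (auto simp: vs.span_singleton)
  moreover have "\<delta> \<noteq> 1" using \<delta>_nonrational to_ac_1 by (metis rangeI)
  ultimately have "vs.independent {\<delta>, 1}" by (simp add: vs.independent_insert)
  moreover have "{\<delta>, 1} \<subseteq> ?L" using \<delta>_mem Spl_closed(1)[of 1 "fD5 a1 a2"] Spl_closed(1)[of 1 "fD5 a1' a2'"] by simp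
  moreover have "?L \<subseteq> vs.span {\<delta>, 1}"
  proof
    fix z assume "z \<in> ?L"
    from repr[OF this] obtain c0 c1 where z: "z = to_ac c0 * 1 + to_ac c1 * \<delta>" unfolding mult_1_right by blast
    show "z \<in> vs.span {\<delta>, 1}" unfolding z by (intro vs.span_add vs.span_scale vs.span_base) simp_all
  qed
  moreover have "card {\<delta>, 1} = 2" using \<open>\<delta> \<noteq> 1\<close> by simp
  ultimately show ?thesis unfolding ext_degree_def by (intro vs.dim_unique)
qed

lemma Gal_isos:
  "Gal (fD5 a1 a2) \<cong> D5\<lparr>carrier := fst ` \<Gamma>\<rparr>" "Gal (fD5 a1' a2') \<cong> D5\<lparr>carrier := snd ` \<Gamma>\<rparr>"
  "Gal (fD5 a1 a2 * fD5 a1' a2') \<cong> (D5 \<times>\<times> D5)\<lparr>carrier := \<Gamma>\<rparr>"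
proof -
  have "Spl (fD5 a1 a2) = (\<lambda>u. u \<one>\<^bsub>D5\<^esub>) ` x.W1" unfolding Spl1 one_D5 ..
  from gx.Gal_iso[OF this] have "D5\<lparr>carrier := gx.\<Gamma>\<rparr> \<cong> Gal (fD5 a1 a2)" unfolding is_iso_def by blast
  then show "Gal (fD5 a1 a2) \<cong> D5\<lparr>carrier := fst ` \<Gamma>\<rparr>" unfolding Gamma_fst
    by (rule group.iso_sym[OF gx.subgroup_imp_group[OF gx.subgroup_Gamma]])
  have "Spl (fD5 a1' a2') = (\<lambda>u. u \<one>\<^bsub>D5\<^esub>) ` x'.W1" unfolding Spl1 one_D5 ..
  from gx'.Gal_iso[OF this] have "D5\<lparr>carrier := gx'.\<Gamma>\<rparr> \<cong> Gal (fD5 a1' a2')" unfolding is_iso_def by blast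
  then show "Gal (fD5 a1' a2') \<cong> D5\<lparr>carrier := snd ` \<Gamma>\<rparr>" unfolding Gamma_snd
    by (rule group.iso_sym[OF gx.subgroup_imp_group[OF gx'.subgroup_Gamma]])
  have "Spl (fD5 a1 a2 * fD5 a1' a2') = (\<lambda>u. u \<one>\<^bsub>D5 \<times>\<times> D5\<^esub>) ` W2" unfolding Spl2 one_pair ..
  from Gal_iso[OF this] have "(D5 \<times>\<times> D5)\<lparr>carrier := \<Gamma>\<rparr> \<cong> Gal (fD5 a1 a2 * fD5 a1' a2')" unfolding is_iso_def by blast
  then show "Gal (fD5 a1 a2 * fD5 a1' a2') \<cong> (D5 \<times>\<times> D5)\<lparr>carrier := \<Gamma>\<rparr>"
    by (rule group.iso_sym[OF subgroup_imp_group[OF subgroup_Gamma]])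
qed

text \<open>An element without fixed roots is a nontrivial rotation, and \<open>gal_ge\<close>
  provides one for the first pentagon too. An element that fixes one root and moves another is a
  reflection, so a reflection in the second group yields one in the first. These are the hypotheses
  of \<open>subgroup_classification\<close>.\<close>

lemma Gamma_classification:
  assumes ge: "gal_ge (fD5 a1 a2) (fD5 a1' a2')" and C5: "gal_ge_C5 (fD5 a1' a2')"
  shows "\<Gamma> = C5_pairs (\<lambda>d e. True) \<or> \<Gamma> = C5_pairs (\<lambda>d e. d = e) \<or> \<Gamma> = C5_pairs (\<lambda>d e. \<not> e) \<or>
    \<Gamma> = C5_pairs (\<lambda>d e. \<not> d \<and> \<not> e) \<or>
    (\<exists>k m. k mod 5 \<noteq> 0 \<and> \<Gamma> = C5_graph k m (\<lambda>d. True)) \<or>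
    (\<exists>k. k mod 5 \<noteq> 0 \<and> \<Gamma> = C5_graph k 0 (\<lambda>d. \<not> d))"
proof -
  obtain h' where h': "h' \<in> gx'.\<Gamma>" "\<not> (\<exists>j. x' (aff h' j) = x' j)" using gal_ge_C5_rotation[OF C5] by blast
  from gal_ge_transfer[OF ge h'(1)] h'(2) obtain h where h: "h \<in> gx.\<Gamma>" "\<not> (\<exists>j. x (aff h j) = x j)" by blast
  obtain u v where uv: "h = (u, False)" "u \<noteq> 0" "h' = (v, False)" "v \<noteq> 0"
    using h(2) h'(2) unfolding x.fixed_points(1) x'.fixed_points(1)
    by (cases h, cases h') (simp, metis mod_0)
  obtain \<beta> where \<beta>: "((u, False), \<beta>) \<in> \<Gamma>" using h(1) unfolding uv Gamma_fst[symmetric] by force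
  obtain \<alpha> where \<alpha>: "(\<alpha>, (v, False)) \<in> \<Gamma>" using h'(1) unfolding uv Gamma_snd[symmetric] by force
  have refl: "\<exists>u \<beta>. ((u, True), \<beta>) \<in> \<Gamma>" if "(\<alpha>, (w, True)) \<in> \<Gamma>" for \<alpha> w
  proof -
    have "(w, True) \<in> gx'.\<Gamma>" unfolding Gamma_snd[symmetric] using that by force
    from gal_ge_transfer[OF ge this] obtain g where g: "g \<in> gx.\<Gamma>" "\<exists>j. x (aff g j) = x j" "\<exists>j. x (aff g j) \<noteq> x j"
      unfolding x'.fixed_points by auto
    then have "snd g" unfolding x.fixed_points by (cases "snd g") simp_all
    then have "(fst g, True) \<in> fst ` \<Gamma>" using g(1) unfolding Gamma_fst by (metis prod.collapse)
    then show ?thesis by force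
  qed
  show ?thesis by (rule subgroup_classification[OF subgroup_Gamma \<beta> uv(2) \<alpha> uv(4) refl])
qed

text \<open>The row is read off from the form of \<open>\<Gamma>\<close>: its projections give
  \<open>G\<close> and \<open>G'\<close>, the group itself gives \<open>H\<close>, and its orbits
  under \<open>act 1\<close> and \<open>act 3\<close> give the decomposition types.\<close>

lemma table:
  assumes "gal_ge (fD5 a1 a2) (fD5 a1' a2')" "gal_ge_C5 (fD5 a1' a2')" "field_morphism \<iota>"
  defines "L \<equiv> Spl (fD5 a1 a2)" and "L' \<equiv> Spl (fD5 a1' a2')"
    and "G \<equiv> Gal (fD5 a1 a2)" and "G' \<equiv> Gal (fD5 a1' a2')"
    and "H \<equiv> Gal (fD5 a1 a2 * fD5 a1' a2')"
    and "DT1 \<equiv> DT_F1 \<iota> a1 a2 a1' a2'" and "DT2 \<equiv> DT_F2 \<iota> a1 a2 a1' a2'"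
  shows "(G \<cong> D5 \<and> G' \<cong> D5 \<and> H \<cong> D5 \<times>\<times> D5 \<and> L \<inter> L' = range to_ac \<and> DT1 = {#10#} \<and> DT2 = {#10#}) \<or>
    (G \<cong> D5 \<and> G' \<cong> D5 \<and> H \<cong> C5C5_C2 \<and> ext_degree (L \<inter> L') = 2 \<and> DT1 = {#5, 5#} \<and> DT2 = {#5, 5#}) \<or>
    (G \<cong> D5 \<and> G' \<cong> D5 \<and> H \<cong> D5 \<and> L = L' \<and>
      ((DT1, DT2) = ({#5, 2, 2, 1#}, {#5, 5#}) \<or> (DT1, DT2) = ({#5, 5#}, {#5, 2, 2, 1#}))) \<or>
    (G \<cong> D5 \<and> G' \<cong> C5 \<and> H \<cong> D5 \<times>\<times> C5 \<and> L \<inter> L' = range to_ac \<and> DT1 = {#10#} \<and> DT2 = {#10#}) \<or>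
    (G \<cong> C5 \<and> G' \<cong> C5 \<and> H \<cong> C5 \<times>\<times> C5 \<and> L \<noteq> L' \<and> DT1 = {#5, 5#} \<and> DT2 = {#5, 5#}) \<or>
    (G \<cong> C5 \<and> G' \<cong> C5 \<and> H \<cong> C5 \<and> L = L' \<and>
      ((DT1, DT2) = ({#5, 1, 1, 1, 1, 1#}, {#5, 5#}) \<or> (DT1, DT2) = ({#5, 5#}, {#5, 1, 1, 1, 1, 1#})))"
    (is "?A \<or> ?B \<or> ?C \<or> ?D \<or> ?E \<or> ?F")
proof -
  have DT: "DT1 = DT_of (orbs 1 \<Gamma>)" "DT2 = DT_of (orbs 3 \<Gamma>)"
    unfolding DT1_def DT2_def by (rule DT_F1_orbits[OF assms(3)] DT_F2_orbits[OF assms(3)])+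
  have "D5\<lparr>carrier := {0..<5} \<times> UNIV\<rparr> = D5" unfolding carrier_D5[symmetric] by simp
  then have G_D5: "G \<cong> D5" if "fst ` \<Gamma> = {0..<5} \<times> UNIV"
    using Gal_isos(1) that unfolding G_def by simp
  have G'_D5: "G' \<cong> D5" if "snd ` \<Gamma> = {0..<5} \<times> UNIV"
    using Gal_isos(2) that \<open>D5\<lparr>carrier := {0..<5} \<times> UNIV\<rparr> = D5\<close> unfolding G'_def by simp
  have G_C5: "G \<cong> C5" if "fst ` \<Gamma> = {0..<5} \<times> {False}"
    using iso_trans[OF Gal_isos(1)[unfolded that] D5_rotations_iso] unfolding G_def .
  have G'_C5: "G' \<cong> C5" if "snd ` \<Gamma> = {0..<5} \<times> {False}"
    using iso_trans[OF Gal_isos(2)[unfolded that] D5_rotations_iso] unfolding G'_def .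
  have trivial: "L \<inter> L' = range to_ac" if "\<And>a. a \<in> fst ` \<Gamma> \<Longrightarrow> (a, (0, False)) \<in> \<Gamma>"
    unfolding L_def L'_def by (rule inter_trivial) (rule that, simp only: Gamma_fst)
  have L_eq: "L = L'" if "\<Gamma> = C5_graph k m S" "k mod 5 \<noteq> 0" for k m S
    unfolding L_def L'_def
    using Spl_subset(1)[unfolded that(1), OF inj_on_fst_C5_graph] Spl_subset(2)[unfolded that(1), OF C5_graph_inj_snd[OF that(2)]]
    by (rule equalityI[rotated])
  from Gamma_classification[OF assms(1,2)] consider
    (1) "\<Gamma> = C5_pairs (\<lambda>d e. True)" | (2) "\<Gamma> = C5_pairs (\<lambda>d e. d = e)" | (3) "\<Gamma> = C5_pairs (\<lambda>d e. \<not> e)"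
    | (4) "\<Gamma> = C5_pairs (\<lambda>d e. \<not> d \<and> \<not> e)"
    | (5) k m where "k mod 5 \<noteq> 0" "\<Gamma> = C5_graph k m (\<lambda>d. True)" | (6) k where "k mod 5 \<noteq> 0" "\<Gamma> = C5_graph k 0 (\<lambda>d. \<not> d)"
    by blast
  then show ?thesis
  proof cases
    case 1
    have im: "fst ` \<Gamma> = {0..<5} \<times> UNIV" "snd ` \<Gamma> = {0..<5} \<times> UNIV" unfolding 1 C5_pairs_image by simp_all
    have "H \<cong> D5 \<times>\<times> D5" unfolding H_def by (rule iso_trans[OF Gal_isos(3)[unfolded 1] iso_pairs_all])
    moreover have "(a, (0, False)) \<in> \<Gamma>" if "a \<in> fst ` \<Gamma>" for a
      using that unfolding im unfolding 1 by (cases a) (simp add: mem_C5_pairs)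
    then have "L \<inter> L' = range to_ac" by (rule trivial)
    ultimately have ?A using G_D5[OF im(1)] G'_D5[OF im(2)] DT DT_pairs(1)[of 1] DT_pairs(1)[of 3] 1 by simp
    then show ?thesis by blast
  next
    case 2
    have im: "fst ` \<Gamma> = {0..<5} \<times> UNIV" "snd ` \<Gamma> = {0..<5} \<times> UNIV" unfolding 2 C5_pairs_image by simp_all
    have "H \<cong> C5C5_C2" unfolding H_def by (rule iso_trans[OF Gal_isos(3)[unfolded 2] iso_pairs_eq])
    moreover have "ext_degree (L \<inter> L') = 2" unfolding L_def L'_def by (rule ext_degree_2[OF 2])
    ultimately have ?B using G_D5[OF im(1)] G'_D5[OF im(2)] DT DT_pairs(3)[of 1] DT_pairs(3)[of 3] 2 by simp
    then show ?thesis by blast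
  next
    case 3
    have im: "fst ` \<Gamma> = {0..<5} \<times> UNIV" "snd ` \<Gamma> = {0..<5} \<times> {False}" unfolding 3 C5_pairs_image by auto
    have "H \<cong> D5 \<times>\<times> C5" unfolding H_def by (rule iso_trans[OF Gal_isos(3)[unfolded 3] iso_pairs_snd])
    moreover have "(a, (0, False)) \<in> \<Gamma>" if "a \<in> fst ` \<Gamma>" for a
      using that unfolding im unfolding 3 by (cases a) (simp add: mem_C5_pairs)
    then have "L \<inter> L' = range to_ac" by (rule trivial)
    ultimately have ?D using G_D5[OF im(1)] G'_C5[OF im(2)] DT DT_pairs(2)[of 1] DT_pairs(2)[of 3] 3 by simp
    then show ?thesis by blast
  next
    case 4
    have im: "fst ` \<Gamma> = {0..<5} \<times> {False}" "snd ` \<Gamma> = {0..<5} \<times> {False}" unfolding 4 C5_pairs_image by auto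
    have "H \<cong> C5 \<times>\<times> C5" unfolding H_def by (rule iso_trans[OF Gal_isos(3)[unfolded 4] iso_pairs_rot])
    moreover have "L \<noteq> L'" unfolding L_def L'_def by (rule Spl_neq) (simp add: 4 mem_C5_pairs)
    ultimately have ?E using G_C5[OF im(1)] G'_C5[OF im(2)] DT DT_pairs(4)[of 1] DT_pairs(4)[of 3] 4 by simp
    then show ?thesis by blast
  next
    case 5
    have im: "fst ` \<Gamma> = {0..<5} \<times> UNIV" "snd ` \<Gamma> = {0..<5} \<times> UNIV"
      unfolding 5(2) C5_graph_image_fst C5_graph_image_snd[OF 5(1)] by simp_all
    have "H \<cong> D5" unfolding H_def by (rule iso_trans[OF Gal_isos(3)[unfolded 5(2)] iso_graph_all])
    moreover have "(DT1, DT2) = ({#5, 2, 2, 1#}, {#5, 5#}) \<or> (DT1, DT2) = ({#5, 5#}, {#5, 2, 2, 1#})"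
      using DT_graph_all(1)[OF 5(1), of m] unfolding DT 5(2) by (simp only: insert_iff empty_iff simp_thms)
    ultimately have ?C using G_D5[OF im(1)] G'_D5[OF im(2)] L_eq[OF 5(2,1)] by blast
    then show ?thesis by blast
  next
    case 6
    have im: "fst ` \<Gamma> = {0..<5} \<times> {False}" "snd ` \<Gamma> = {0..<5} \<times> {False}"
      unfolding 6(2) C5_graph_image_fst C5_graph_image_snd[OF 6(1)] by auto
    have "H \<cong> C5" unfolding H_def by (rule iso_trans[OF Gal_isos(3)[unfolded 6(2)] iso_graph_rot])
    moreover have "(DT1, DT2) = ({#5, 1, 1, 1, 1, 1#}, {#5, 5#}) \<or> (DT1, DT2) = ({#5, 5#}, {#5, 1, 1, 1, 1, 1#})"
      using DT_graph_all(2)[OF 6(1), of 0] unfolding DT 6(2) by (simp only: insert_iff empty_iff simp_thms)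
    ultimately have ?F using G_C5[OF im(1)] G'_C5[OF im(2)] L_eq[OF 6(2,1)] by blast
    then show ?thesis by blast
  qed
qed

end

text \<open>Isomorphic groups have equal orders, so these numbers serve to tell the rows of the
  table apart.\<close>

lemma card_carriers:
  "card (carrier C5) = 5" "card (carrier D5) = 10" "card (carrier C5C5_C2) = 50"
  "card (carrier (D5 \<times>\<times> D5)) = 100" "card (carrier (D5 \<times>\<times> C5)) = 50" "card (carrier (C5 \<times>\<times> C5)) = 25"
proof -
  have C5: "carrier C5 = {0..<5}" by (simp add: carrier_integer_mod_group)
  show "card (carrier C5) = 5" "card (carrier D5) = 10" "card (carrier C5C5_C2) = 50"
  "card (carrier (D5 \<times>\<times> D5)) = 100" "card (carrier (D5 \<times>\<times> C5)) = 50" "card (carrier (C5 \<times>\<times> C5)) = 25"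
    by (simp_all add: C5 gen_dihedral_def card_cartesian_product)
qed

lemma nth_of_six:
  assumes "a \<or> b \<or> c \<or> d \<or> e \<or> f"
  shows "\<exists>i. i < 6 \<and> [a, b, c, d, e, f] ! i"
proof -
  have "True \<in> set [a, b, c, d, e, f]" using assms by simp
  then show ?thesis unfolding in_set_conv_nth by (simp add: numeral_eq_Suc)
qed

theorem theorem7p13:
  fixes \<iota> :: "'k::field \<Rightarrow> 'm::field" and a1 a2 a1' a2' :: 'm
  assumes "\<iota> 1 = 1"
    and "\<And>c d. \<iota> (c + d) = \<iota> c + \<iota> d"
    and "\<And>c d. \<iota> (c * d) = \<iota> c * \<iota> d"
    and "infinite (UNIV :: 'm set)"
    and "gal_ge (fD5 a1 a2) (fD5 a1' a2')"
    and "gal_ge_C5 (fD5 a1' a2')"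
  defines "L \<equiv> Spl (fD5 a1 a2)" and "L' \<equiv> Spl (fD5 a1' a2')"
    and "G \<equiv> Gal (fD5 a1 a2)" and "G' \<equiv> Gal (fD5 a1' a2')"
    and "H \<equiv> Gal (fD5 a1 a2 * fD5 a1' a2')"
    and "DT1 \<equiv> DT_F1 \<iota> a1 a2 a1' a2'" and "DT2 \<equiv> DT_F2 \<iota> a1 a2 a1' a2'"
  shows "\<exists>!i. i < 6 \<and>
    [ \<comment> \<open>II-1\<close>
      G \<cong> D5 \<and> G' \<cong> D5 \<and> H \<cong> D5 \<times>\<times> D5 \<and> L \<inter> L' = range to_ac \<and>
        DT1 = {#10#} \<and> DT2 = {#10#},
      \<comment> \<open>II-2\<close>
      G \<cong> D5 \<and> G' \<cong> D5 \<and> H \<cong> C5C5_C2 \<and> ext_degree (L \<inter> L') = 2 \<and>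
        DT1 = {#5, 5#} \<and> DT2 = {#5, 5#},
      \<comment> \<open>II-3\<close>
      G \<cong> D5 \<and> G' \<cong> D5 \<and> H \<cong> D5 \<and> L = L' \<and>
        ((DT1, DT2) = ({#5, 2, 2, 1#}, {#5, 5#}) \<or> (DT1, DT2) = ({#5, 5#}, {#5, 2, 2, 1#})),
      \<comment> \<open>II-4\<close>
      G \<cong> D5 \<and> G' \<cong> C5 \<and> H \<cong> D5 \<times>\<times> C5 \<and> L \<inter> L' = range to_ac \<and>
        DT1 = {#10#} \<and> DT2 = {#10#},
      \<comment> \<open>III-1\<close>
      G \<cong> C5 \<and> G' \<cong> C5 \<and> H \<cong> C5 \<times>\<times> C5 \<and> L \<noteq> L' \<and>
        DT1 = {#5, 5#} \<and> DT2 = {#5, 5#},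
      \<comment> \<open>III-2\<close>
      G \<cong> C5 \<and> G' \<cong> C5 \<and> H \<cong> C5 \<and> L = L' \<and>
        ((DT1, DT2) = ({#5, 1, 1, 1, 1, 1#}, {#5, 5#}) \<or>
         (DT1, DT2) = ({#5, 5#}, {#5, 1, 1, 1, 1, 1#}))
    ] ! i"
    (is "\<exists>!i. i < 6 \<and> ?rows ! i")
proof -
  interpret \<iota>: field_morphism \<iota> by unfold_locales (use assms(1-3) in auto)
  \<comment> \<open>An automorphism that moves every root, and its counterpart for the first
    polynomial, show that \<open>a2'\<close> and \<open>a2\<close> are nonzero, as the pentagons
    require.\<close>
  obtain \<phi>' where \<phi>': "\<phi>' \<in> carrier (Gal (fD5 a1' a2'))" "\<And>z. z \<in> ac_roots (fD5 a1' a2') \<Longrightarrow> \<phi>' z \<noteq> z"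
    using gal_ge_C5_moves[OF assms(6)] by blast
  then obtain \<phi> where \<phi>: "\<phi> \<in> carrier (Gal (fD5 a1 a2))" "\<And>z. z \<in> ac_roots (fD5 a1 a2) \<Longrightarrow> \<phi> z \<noteq> z"
    using gal_ge_fixed_roots[OF assms(5) \<phi>'(1)] by blast
  obtain r r' where r: "bij_betw r {..<5::nat} (ac_roots (fD5 a1 a2))" and r': "bij_betw r' {..<5::nat} (ac_roots (fD5 a1' a2'))"
    using assms(5) unfolding gal_ge_def by blast
  obtain x where x: "root_pentagon x a1 a2" using root_pentagon_exists[OF fD5_nonzero[OF \<phi>] r] by blast
  obtain x' where x': "root_pentagon x' a1' a2'" using root_pentagon_exists[OF fD5_nonzero[OF \<phi>'] r'] by blast
  interpret xx: two_pentagons x x' a1 a2 a1' a2'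
    using x x' assms(4) by (intro two_pentagons.intro two_pentagons_axioms.intro)
  obtain \<theta>1 where t1: "galois_algebra D5 xx.x.W1 \<theta>1" using xx.x.galois1[OF assms(4)] by blast
  obtain \<theta>1' where t1': "galois_algebra D5 xx.x'.W1 \<theta>1'" using xx.x'.galois1[OF assms(4)] by blast
  obtain \<theta>2 where t2: "galois_algebra (D5 \<times>\<times> D5) xx.W2 \<theta>2" using xx.galois2 by blast
  interpret pp: pentagon_pair x x' a1 a2 a1' a2' \<theta>1 \<theta>1' \<theta>2
    using xx.two_pentagons_axioms t1 t1' t2 by (rule pentagon_pair.intro)
  note table = pp.table[OF assms(5,6) \<iota>.field_morphism_axioms,
    folded L_def L'_def G_def G'_def H_def DT1_def DT2_def]
  \<comment> \<open>The orders of \<open>G\<close>, \<open>G'\<close> and \<open>H\<close> in the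
    six rows; the triples are pairwise distinct, which gives uniqueness of the row.\<close>
  let ?cards = "[(10, 10, 100), (10, 10, 50), (10, 10, 10), (10, 5, 50), (5, 5, 25), (5, 5, 5)] :: (nat \<times> nat \<times> nat) list"
  have cards: "(card (carrier G), card (carrier G'), card (carrier H)) = ?cards ! i" if "i < 6 \<and> ?rows ! i" for i
  proof -
    have "i \<in> {0, 1, 2, 3, 4, 5}" using that by auto
    then show ?thesis using that
      by (elim insertE emptyE) (auto dest!: iso_same_card simp: card_carriers simp del: carrier_DirProd)
  qed
  have inj: "j = i" if "i < 6" "j < 6" "?cards ! j = ?cards ! i" for i j
  proof -
    have "distinct ?cards" by simp
    from nth_eq_iff_index_eq[OF this, of j i] that show ?thesis by (simp del: nth_Cons_numeral)
  qed
  obtain i where i: "i < 6 \<and> ?rows ! i" using nth_of_six[OF table] by (rule exE)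
  show ?thesis
  proof (rule ex1I, rule i)
    fix j assume j: "j < 6 \<and> ?rows ! j"
    show "j = i" by (rule inj[OF conjunct1[OF i] conjunct1[OF j] trans[OF cards[OF j, symmetric] cards[OF i]]])
  qed
qed

end
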